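(* Suppose $\eta(n)\sim\beta\kappa(n)$ as $n\to\infty$ for some $\beta>0$. Then the weak limit $B:=\lim_{t\to\infty}(Z^{(1)}_t)^{1/\alpha}/\xi(Z^{(1)}_t)$ exists and is strictly positive almost surely, and as $t\to\infty$, $$\frac{u(t,Z^{(1)}_t)}{u(t,-Z^{(1)}_t)}\Rightarrow \exp\{\sqrt{2\beta}\,\sigma B N\},$$ where $\Rightarrow$ denotes convergence in law, $N$ is a standard normal random variable independent of $B$, and $\sigma>0$ is given by $\sigma^2=\frac{\alpha}{(\alpha-2)(\alpha-1)^2}$ if $\alpha>2$ and $\sigma^2=1$ if $\alpha=2$.
   Context: Fix $\alpha\ge 2$. Let $(\xi_0(z))_{z\in\mathbb Z}$ be i.i.d. Pareto random variables with parameter $\alpha$, i.e. $\mathrm{Prob}(\xi_0(z)>x)=x^{-\alpha}$ for $x\ge 1$. Let $p:\mathbb N\to[0,1]$ be eventually nondecreasing with $p(n)\to 1$, and $q=1-p$. Define the potential $\xi:\mathbb Z\to[1,\infty)$ by $\xi(n)=\xi_0(n)$ for $n\ge 0$ and, independently for each $n\ge1$ (and independently of $\xi_0$), $\xi(-n)=\xi_0(n)$ with probability $p(n)$ and $\xi(-n)=\xi_0(-n)$ with probability $q(n)$. Let $u$ be the solution of $\partial_t u=\Delta u+\xi u$ on $(0,\infty)\times\mathbb Z$, $u(0,\cdot)=\mathbf 1_{\{0\}}$, with $(\Delta f)(z)=\sum_{|y-z|=1}(f(y)-f(z))$, given by $u(t,z)=\mathbb E[\exp\{\int_0^t\xi(X_s)ds\}\mathbf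 1\{X_t=z\}]$ with $(X_s)$ the continuous-time random walk with generator $\Delta$ started at $0$. Let $D=\{z\in\mathbb N_0:\xi(z)=\xi(-z)\}$, $\Psi_t(z)=\xi(z)-\frac{|z|}{t}\log\xi(z)$, and $Z^{(1)}_t$ a maximiser of $\Psi_t$ over $D$. Let $\eta(n)=\sum_{z=1}^n q(z)$ and $\kappa(n)=n^{2/\alpha}$ if $\alpha>2$, $\kappa(n)=n/\log n$ if $\alpha=2$. *)

theory Defs
  imports "HOL-Probability.Probability" "HOL-Library.Landau_Symbols"
begin

section \<open>Continuous-time simple random walk on Z (generator Delta, rate 1 per neighbour)\<close>

definition walk_step :: "(real \<times> int) measure" where
  "walk_step = density lborel (exponential_density 2) \<Otimes>\<^sub>M measure_pmf (pmf_of_set {-1, 1})"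

definition walk :: "(nat \<Rightarrow> real \<times> int) measure" where
  "walk = (\<Pi>\<^sub>M k\<in>UNIV. walk_step)"

definition jump_time :: "(nat \<Rightarrow> real \<times> int) \<Rightarrow> nat \<Rightarrow> real" where
  "jump_time w k = (\<Sum>j<k. fst (w j))"

definition walk_pos :: "(nat \<Rightarrow> real \<times> int) \<Rightarrow> real \<Rightarrow> int" where
  "walk_pos w s = (\<Sum>j\<in>{j. jump_time w (Suc j) \<le> s}. snd (w j))"

text \<open>Feynman-Kac solution u(t,z) of the parabolic Anderson model with potential xi,
  u(0,.) = indicator of 0.\<close>
definition pam_u :: "(int \<Rightarrow> real) \<Rightarrow> real \<Rightarrow> int \<Rightarrow> real" where
  "pam_u xi t z =
     (\<integral>w. exp (set_lebesgue_integral lborel {0..t} (\<lambda>s. xi (walk_pos w s)))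
            * indicator {w. walk_pos w t = z} w \<partial>walk)"

definition potential :: "(int \<Rightarrow> 'a \<Rightarrow> real) \<Rightarrow> (nat \<Rightarrow> 'a \<Rightarrow> bool) \<Rightarrow> 'a \<Rightarrow> int \<Rightarrow> real" where
  "potential xi0 coin \<omega> z =
     (if 0 \<le> z then xi0 z \<omega>
      else if coin (nat (- z)) \<omega> then xi0 (- z) \<omega> else xi0 z \<omega>)"

definition Dset :: "(int \<Rightarrow> real) \<Rightarrow> nat set" where
  "Dset xi = {z. xi (int z) = xi (- int z)}"

definition Psi :: "(int \<Rightarrow> real) \<Rightarrow> real \<Rightarrow> nat \<Rightarrow> real" where
  "Psi xi t z = xi (int z) - real z / t * ln (xi (int z))"

definition eta :: "(nat \<Rightarrow> real) \<Rightarrow> nat \<Rightarrow> real" where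
  "eta p n = (\<Sum>z=1..n. 1 - p z)"

definition kappa :: "real \<Rightarrow> nat \<Rightarrow> real" where
  "kappa \<alpha> n = (if \<alpha> > 2 then real n powr (2 / \<alpha>) else real n / ln (real n))"

definition sigma :: "real \<Rightarrow> real" where
  "sigma \<alpha> = sqrt (if \<alpha> > 2 then \<alpha> / ((\<alpha> - 2) * (\<alpha> - 1)\<^sup>2) else 1)"

definition weak_conv_at_top :: "(real \<Rightarrow> real measure) \<Rightarrow> real measure \<Rightarrow> bool" where
  "weak_conv_at_top \<mu> \<nu> \<longleftrightarrow>
     (\<forall>f :: real \<Rightarrow> real. continuous_on UNIV f \<and> bounded (range f) \<longrightarrow>
        ((\<lambda>t. \<integral>x. f x \<partial>\<mu> t) \<longlongrightarrow> (\<integral>x. f x \<partial>\<nu>)) at_top)"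

end

theory Submission
  imports Defs "HOL-Real_Asymp.Real_Asymp"
begin

text \<open>Conditionally on the coins at and near \<open>N\<close> having succeeded and on the peak \<open>\<xi> N = x\<close> being well separated from
  all other sites, the mass near \<open>\<plusminus>N\<close> is that of a principal eigenfunction whose consecutive ratios are
  continued fractions; hence \<open>u(t, N) / u(t, -N)\<close> is, up to \<open>o(1)\<close> in the exponent,
  \<open>\<Prod>k<N. (x - \<xi> (- k)) / (x - \<xi> k)\<close>, and only failed coins contribute. The logarithm of this product is a sum of independent
  symmetric terms with characteristic function \<open>\<Prod>k. 1 - q k * w\<close>, where \<open>x\<^sup>2 w\<close> is of order one (of order \<open>ln x\<close> at \<open>\<alpha> = 2\<close>), which with
  \<open>\<eta> \<sim> \<beta> \<kappa>\<close> gives a Gaussian limit with variance \<open>2 \<beta> \<sigma>\<^sup>2 b\<^sup>2\<close> at \<open>b = N\<^sup>1\<^sup>/\<^sup>\<alpha> / x\<close>.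
  The position and height of the peak need only a lower bound: on the event that \<open>n\<close> is the strict maximiser of \<open>\<Psi>\<close>, resample the
  value at \<open>n\<close>, rescale to \<open>n = r s\<close>, \<open>x = a y\<close>, and apply Fatou's lemma. The limiting density in \<open>(s, y)\<close> has total mass one, so
  the lower bounds for \<open>g\<close> and \<open>C - g\<close> together force convergence.\<close>

section \<open>Feynman--Kac expansion in the number of jumps\<close>

text \<open>The obstacle is the factor \<open>exp (s * t)\<close>: it cancels in the ratio only if
  the principal eigenvalues at the two peaks agree up to o(1/t), although the environments around
  them differ. What happens further than \<open>d\<close> sites from a peak with gap
  \<open>g\<close> moves the eigenvalue by about \<open>(2 / g) ^ (2 * d + 1)\<close>. Since
  \<open>g\<close> is of order \<open>scale_a\<close>, a window of radius
  \<open>nat \<lceil>\<alpha>\<rceil>\<close> with successful coins makes \<open>t\<close> times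
  this negligible, and one number \<open>s\<close> serves both peaks. The number of factors is of
  order \<open>g powr \<alpha>\<close>, at least g^2, so an error of order g^-2 in each one is too
  large; the two sides are therefore compared by differences, and the error is bounded by the total
  asymmetry. Different sites give disjoint winning events, so lower bounds for single sites add up,
  and a bad environment may simply be dropped from the integrand. Failed coins feed the asymmetry
  while successful ones supply the rivals; the two decouple except for rivals at failed coins, whose
  probability vanishes because \<open>q\<close> tends to 0.\<close>

lemma continuous_on_atLeastI:
  fixes f :: "real \<Rightarrow> 'b::topological_space"
  assumes "\<And>T. a < T \<Longrightarrow> continuous_on {a..T} f"
  shows "continuous_on {a..} f"
  unfolding continuous_on_eq_continuous_within
proof
  fix t assume "t \<in> {a..}"
  then have "continuous (at t within {a..t+1}) f"
    using assms[of "t+1"] by (auto simp: continuous_on_eq_continuous_within)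
  moreover have "at t within {a..t+1} = at t within {a..}"
    using \<open>t \<in> {a..}\<close> by (intro at_within_nhd[where S="{..<t+1}"]) auto
  ultimately show "continuous (at t within {a..}) f" by simp
qed

text \<open>The contribution to \<open>u(t, z)\<close>, started at \<open>x\<close>, of the paths with exactly \<open>k\<close> jumps that stay in \<open>B\<close>;
  \<open>c\<close> is \<open>\<xi> - 2\<close>, the jump rate being absorbed.\<close>
primrec pathw :: "int set \<Rightarrow> (int \<Rightarrow> real) \<Rightarrow> int \<Rightarrow> nat \<Rightarrow> real \<Rightarrow> int \<Rightarrow> real" where
  "pathw B c z 0 t x = (if x \<in> B \<and> x = z then exp (c x * t) else 0)"
| "pathw B c z (Suc k) t x = (if x \<in> B then exp (c x * t) *
     integral {0..t} (\<lambda>s. exp (- c x * s) * (pathw B c z k s (x + 1) + pathw B c z k s (x - 1))) else 0)"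

text \<open>Both claims run in one induction: the next integrand has to be continuous to be
  integrable, and nonnegative for its integral to be so.\<close>

lemma pathw_props:
  shows "continuous_on {0..} (\<lambda>t. pathw B c z k t x) \<and> (\<forall>t\<ge>0. 0 \<le> pathw B c z k t x)"
proof (induction k arbitrary: x)
  case 0
  have "continuous_on {0..} (\<lambda>t. (if x \<in> B \<and> x = z then 1 else 0) * exp (c x * t))"
    by (intro continuous_intros)
  moreover have "(\<lambda>t. (if x \<in> B \<and> x = z then 1 else 0) * exp (c x * t)) = (\<lambda>t. pathw B c z 0 t x)"
    by auto
  ultimately have "continuous_on {0..} (\<lambda>t. pathw B c z 0 t x)" by (simp only:)
  then show ?case by (simp del: pathw.simps) simp
next
  case (Suc k)
  let ?g = "\<lambda>s. exp (- c x * s) * (pathw B c z k s (x + 1) + pathw B c z k s (x - 1))"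
  have c: "continuous_on {0..} ?g"
    by (intro continuous_intros conjunct1[OF Suc])
  have i: "?g integrable_on {0..t}" for t
    by (intro integrable_continuous_interval continuous_on_subset[OF c]) auto
  have "continuous_on {0..} (\<lambda>t. integral {0..t} ?g)"
    by (intro continuous_on_atLeastI indefinite_integral_continuous_1 i)
  then have "continuous_on {0..} (\<lambda>t. exp (c x * t) * integral {0..t} ?g)"
    by (intro continuous_intros)
  moreover have "0 \<le> integral {0..t} ?g" for t
    using Suc by (intro integral_nonneg i) auto
  ultimately show ?case by (cases "x \<in> B") auto
qed

lemmas pathw_cont = pathw_props[THEN conjunct1]
lemma pathw_nonneg [simp]: "0 \<le> t \<Longrightarrow> 0 \<le> pathw B c z k t x"
  using pathw_props by blast

lemma pathw_outside [simp]: "x \<notin> B \<Longrightarrow> pathw B c z k t x = 0"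
  by (cases k) auto

lemma pathw_deriv_0: "((\<lambda>t. pathw B c z 0 t x) has_real_derivative c x * pathw B c z 0 t x) (at t)"
  by (auto intro!: derivative_eq_intros)

text \<open>Duhamel's formula differentiated. Summed over \<open>k\<close> it is the parabolic
  equation, the term -2u of the Laplacian being part of \<open>c\<close>. The two-sided derivative
  is taken at positive times, as the integral runs over \<open>{0..t}\<close>.\<close>

lemma pathw_deriv_Suc:
  assumes "x \<in> B" "0 < t"
  shows "((\<lambda>t. pathw B c z (Suc k) t x) has_real_derivative
     c x * pathw B c z (Suc k) t x + pathw B c z k t (x + 1) + pathw B c z k t (x - 1)) (at t)"
proof -
  let ?g = "\<lambda>s. exp (- c x * s) * (pathw B c z k s (x + 1) + pathw B c z k s (x - 1))"
  have c: "continuous_on {0..t+1} ?g"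
    by (intro continuous_intros continuous_on_subset[OF pathw_cont]) auto
  have "((\<lambda>t. integral {0..t} ?g) has_real_derivative ?g t) (at t within {0..t+1})"
    using assms by (intro integral_has_real_derivative[OF c]) auto
  moreover have "at t within {0..t+1} = at t"
    using assms by (intro at_within_interior) auto
  ultimately have d: "((\<lambda>t. integral {0..t} ?g) has_real_derivative ?g t) (at t)" by simp
  have "((\<lambda>t. exp (c x * t) * integral {0..t} ?g) has_real_derivative
      exp (c x * t) * ?g t + (exp (c x * t) * c x) * integral {0..t} ?g) (at t)"
    by (rule derivative_eq_intros d refl)+ (simp add: algebra_simps)
  moreover have "exp (c x * t) * ?g t = pathw B c z k t (x + 1) + pathw B c z k t (x - 1)"
    by (simp add: mult.assoc[symmetric] exp_minus)
  then have "exp (c x * t) * ?g t + (exp (c x * t) * c x) * integral {0..t} ?g =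
     c x * pathw B c z (Suc k) t x + pathw B c z k t (x + 1) + pathw B c z k t (x - 1)"
    using assms(1) by simp
  ultimately have "((\<lambda>t. exp (c x * t) * integral {0..t} ?g) has_real_derivative
     c x * pathw B c z (Suc k) t x + pathw B c z k t (x + 1) + pathw B c z k t (x - 1)) (at t)"
    by (simp only:)
  then show ?thesis using assms(1) by simp
qed

lemma pathw_at_0: "pathw B c z k 0 x = (if k = 0 \<and> x \<in> B \<and> x = z then 1 else 0)"
  by (cases k) auto

section \<open>Law of the walk and decomposition at the first jump\<close>

definition walk_site :: "(nat \<Rightarrow> real \<times> int) \<Rightarrow> nat \<Rightarrow> int" where
  "walk_site w k = (\<Sum>j<k. snd (w j))"

text \<open>The Feynman-Kac integrand on the event that the walk started at \<open>x\<close> makes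
  exactly \<open>k\<close> jumps up to time \<open>t\<close> and ends at \<open>z\<close>. It is
  written through the jump chain, so the time integral is already a finite sum.\<close>

definition jump_weight :: "(int \<Rightarrow> real) \<Rightarrow> int \<Rightarrow> nat \<Rightarrow> real \<Rightarrow> int \<Rightarrow> (nat \<Rightarrow> real \<times> int) \<Rightarrow> real" where
  "jump_weight \<xi> z k t x w =
     exp ((\<Sum>j<k. fst (w j) * \<xi> (x + walk_site w j)) + (t - jump_time w k) * \<xi> (x + walk_site w k)) *
     (if x + walk_site w k = z \<and> jump_time w k \<le> t \<and> t < jump_time w (Suc k) then 1 else 0)"

lemma walk_site_case_nat: "walk_site (case_nat (a, e) w) (Suc k) = e + walk_site w k"
  and jump_time_case_nat: "jump_time (case_nat (a, e) w) (Suc k) = a + jump_time w k"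
  by (simp_all add: walk_site_def jump_time_def sum.lessThan_Suc_shift del: sum.lessThan_Suc)

lemma jump_weight_Suc:
  "jump_weight \<xi> z (Suc k) t x (case_nat (a, e) w) = exp (a * \<xi> x) * jump_weight \<xi> z k (t - a) (x + e) w"
proof -
  have "(\<Sum>j<Suc k. fst ((case_nat (a, e) w :: nat \<Rightarrow> real \<times> int) j) * \<xi> (x + walk_site (case_nat (a, e) w) j))
     = a * \<xi> x + (\<Sum>j<k. fst (w j) * \<xi> (x + e + walk_site w j))"
    by (simp add: sum.lessThan_Suc_shift walk_site_case_nat add.assoc del: sum.lessThan_Suc)
       (simp add: walk_site_def)
  then show ?thesis
    unfolding jump_weight_def walk_site_case_nat jump_time_case_nat
    by (auto simp: exp_add[symmetric] algebra_simps)
qed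

lemma jump_weight_0: "jump_weight \<xi> z 0 t x (case_nat (a, e) w) = (if x = z \<and> 0 \<le> t \<and> t < a then exp (t * \<xi> x) else 0)"
  by (auto simp: jump_weight_def walk_site_def jump_time_def)

lemma sets_walk_step [measurable_cong]: "sets walk_step = sets (borel \<Otimes>\<^sub>M count_space UNIV)"
  unfolding walk_step_def by (intro sets_pair_measure_cong) auto

lemma prob_space_walk_step: "prob_space walk_step"
proof -
  interpret A: prob_space "density lborel (exponential_density 2)"
    by (rule prob_space_exponential_density) simp
  interpret pair_prob_space "density lborel (exponential_density 2)" "measure_pmf (pmf_of_set {-1, 1::int})" ..
  show ?thesis unfolding walk_step_def by unfold_locales
qed

lemma prob_space_walk: "prob_space walk"
  unfolding walk_def by (intro prob_space_PiM prob_space_walk_step)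

interpretation walk_step: prob_space walk_step by (rule prob_space_walk_step)
interpretation walk: prob_space walk by (rule prob_space_walk)

lemma sets_walk [measurable_cong]: "sets walk = sets (PiM UNIV (\<lambda>_. borel \<Otimes>\<^sub>M count_space UNIV))"
  unfolding walk_def by (intro sets_PiM_cong) (auto simp: sets_walk_step)

text \<open>A fresh step in front of an independent walk is again a walk: the renewal property
  behind every recursion over the number of jumps.\<close>

lemma walk_iter: "distr (walk_step \<Otimes>\<^sub>M walk) walk (\<lambda>(s, w). case_nat s w) = walk"
proof -
  interpret sequence_space walk_step by unfold_locales
  show ?thesis unfolding walk_def by (rule PiM_iter)
qed

lemma measurable_walk_coord [measurable]:
  "(\<lambda>w. fst (w j)) \<in> borel_measurable (PiM UNIV (\<lambda>_. borel \<Otimes>\<^sub>M count_space UNIV :: (real \<times> int) measure))"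
  "(\<lambda>w. snd (w j)) \<in> measurable (PiM UNIV (\<lambda>_. borel \<Otimes>\<^sub>M count_space UNIV :: (real \<times> int) measure)) (count_space UNIV)"
  by measurable

lemma measurable_jump_time [measurable]: "(\<lambda>w. jump_time w k) \<in> borel_measurable walk"
  unfolding jump_time_def by measurable

lemma measurable_sum_int [measurable (raw)]:
  fixes f :: "'i \<Rightarrow> 'b \<Rightarrow> int"
  assumes "\<And>i. i \<in> I \<Longrightarrow> f i \<in> measurable M (count_space UNIV)"
  shows "(\<lambda>x. \<Sum>i\<in>I. f i x) \<in> measurable M (count_space UNIV)"
  using assms by (induction I rule: infinite_finite_induct) simp_all

lemma measurable_walk_site [measurable]: "(\<lambda>w. walk_site w k) \<in> measurable walk (count_space UNIV)"
  unfolding walk_site_def by measurable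

lemma measurable_jump_weight [measurable]: "(\<lambda>w. jump_weight \<xi> z k t x w) \<in> borel_measurable walk"
  unfolding jump_weight_def by measurable

lemma measurable_jump_weight2 [measurable]:
  "(\<lambda>(t, w). jump_weight \<xi> z k t x w) \<in> borel_measurable (borel \<Otimes>\<^sub>M walk)"
  unfolding jump_weight_def by measurable

text \<open>The first holding time and the first direction are integrated out; the division by 2 is
  the uniform choice between the two neighbours.\<close>

lemma nn_integral_walk:
  assumes [measurable]: "f \<in> borel_measurable walk"
  shows "(\<integral>\<^sup>+w. f w \<partial>walk) = (\<integral>\<^sup>+a. ennreal (exponential_density 2 a) *
      (\<integral>\<^sup>+w. f (case_nat (a, 1) w) + f (case_nat (a, -1) w) \<partial>walk) / 2 \<partial>lborel)"
proof -
  have [measurable]: "(\<lambda>(s, w). case_nat s w) \<in> measurable (walk_step \<Otimes>\<^sub>M walk) walk"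
    unfolding walk_def by measurable
  have *: "(\<lambda>(s, w). f (case_nat s w)) \<in> borel_measurable (walk_step \<Otimes>\<^sub>M walk)"
    by measurable
  have space_walk_step: "space walk_step = UNIV"
    by (simp add: walk_step_def space_pair_measure)
  have "(\<integral>\<^sup>+w. f w \<partial>walk) = (\<integral>\<^sup>+(s, w). f (case_nat s w) \<partial>(walk_step \<Otimes>\<^sub>M walk))"
    by (subst walk_iter[symmetric], subst nn_integral_distr) (auto simp: split_beta')
  also have "\<dots> = (\<integral>\<^sup>+s. \<integral>\<^sup>+w. f (case_nat s w) \<partial>walk \<partial>walk_step)"
    by (subst walk.nn_integral_fst[symmetric]) (auto simp: split_beta')
  also have "\<dots> = (\<integral>\<^sup>+a. \<integral>\<^sup>+e. \<integral>\<^sup>+w. f (case_nat (a, e) w) \<partial>walk \<partial>measure_pmf (pmf_of_set {-1,1}) \<partial>density lborel (exponential_density 2))"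
  proof -
    have "(\<lambda>s. \<integral>\<^sup>+w. f (case_nat s w) \<partial>walk) \<in> borel_measurable walk_step"
      by measurable
    then show ?thesis unfolding walk_step_def
      by (subst measure_pmf.nn_integral_fst[symmetric]) auto
  qed
  also have "\<dots> = (\<integral>\<^sup>+a. ennreal (exponential_density 2 a) *
      (\<integral>\<^sup>+w. f (case_nat (a, 1) w) + f (case_nat (a, -1) w) \<partial>walk) / 2 \<partial>lborel)"
  proof -
    have [measurable]: "(\<lambda>a. \<integral>\<^sup>+w. f (case_nat (a, e) w) \<partial>walk) \<in> borel_measurable borel" for e
    proof -
      have "(\<lambda>a. (a, e)) \<in> borel \<rightarrow>\<^sub>M walk_step" by measurable
      from measurable_compose[OF this, of "\<lambda>s. \<integral>\<^sup>+w. f (case_nat s w) \<partial>walk"] show ?thesis by simp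
    qed
    have [measurable]: "(\<lambda>w. f (case_nat (a, e) w)) \<in> borel_measurable walk" for a e
      using measurable_compose[OF measurable_Pair1'[of "(a, e)" walk_step walk] *[unfolded split_beta']]
      by (auto simp: space_walk_step)
    show ?thesis
      by (subst nn_integral_density)
         (auto simp: nn_integral_pmf_of_set nn_integral_add add.commute ennreal_times_divide intro!: nn_integral_cong)
  qed
  finally show ?thesis .
qed

lemma ennreal_mult_half: "0 \<le> u \<Longrightarrow> 0 \<le> v \<Longrightarrow> ennreal u * ennreal v / 2 = ennreal (u * v / 2)"
  using divide_ennreal[of "u * v" 2] by (simp add: ennreal_mult)

text \<open>Induction by the first jump. Holding rate 2 times direction probability 1/2 gives rate 1
  per neighbour, and the factor \<open>exp (- 2 * a)\<close> of the density turns
  \<open>\<xi>\<close> into \<open>\<xi> - 2\<close>. Negative \<open>t\<close> is included because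
  the remaining time \<open>t - a\<close> can be negative in the induction step.\<close>

lemma nn_integral_jump_weight:
  "(\<integral>\<^sup>+w. jump_weight \<xi> z k t x w \<partial>walk) = (if 0 \<le> t then pathw UNIV (\<lambda>y. \<xi> y - 2) z k t x else 0)"
proof (induction k arbitrary: t x)
  case 0
  have "(\<integral>\<^sup>+w. jump_weight \<xi> z 0 t x w \<partial>walk) = (\<integral>\<^sup>+a. ennreal (exponential_density 2 a) *
      (if x = z \<and> 0 \<le> t \<and> t < a then ennreal (exp (t * \<xi> x)) else 0) \<partial>lborel)"
  proof (subst nn_integral_walk, simp, intro nn_integral_cong)
    fix a :: real
    have "u * (2 * v) / 2 = u * (v::ennreal)" for u v
      using mult_divide_eq_ennreal[of 2 "u * v"] by (simp add: ac_simps)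
    then show "ennreal (exponential_density 2 a) * (\<integral>\<^sup>+w. ennreal (jump_weight \<xi> z 0 t x (case_nat (a, 1) w)) +
        ennreal (jump_weight \<xi> z 0 t x (case_nat (a, - 1) w)) \<partial>walk) / 2 =
      ennreal (exponential_density 2 a) * (if x = z \<and> 0 \<le> t \<and> t < a then ennreal (exp (t * \<xi> x)) else 0)"
      by (simp add: jump_weight_0 walk.emeasure_space_1 mult_2[symmetric])
  qed
  also have "\<dots> = (if x = z \<and> 0 \<le> t then ennreal (exp (t * \<xi> x)) * (\<integral>\<^sup>+a. ennreal (exponential_density 2 a) * indicator {t<..} a \<partial>lborel) else 0)"
    by (auto simp: nn_integral_cmult[symmetric] indicator_def mult.commute intro!: nn_integral_cong)
  finally have *: "(\<integral>\<^sup>+w. jump_weight \<xi> z 0 t x w \<partial>walk) = (if x = z \<and> 0 \<le> t then ennreal (exp (t * \<xi> x)) * (\<integral>\<^sup>+a. ennreal (exponential_density 2 a) * indicator {t<..} a \<partial>lborel) else 0)" .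
  have "(\<integral>\<^sup>+a. ennreal (exponential_density 2 a) * indicator {t<..} a \<partial>lborel) = ennreal (exp (- 2 * t))" if "0 \<le> t"
  proof -
    interpret A: prob_space "density lborel (exponential_density 2)"
      by (rule prob_space_exponential_density) simp
    have "distributed (density lborel (exponential_density 2)) lborel (\<lambda>x. x) (exponential_density 2)"
      by (simp add: distributed_def distr_id2)
    from A.exponential_distributedD_gt[OF this that]
    have "measure (density lborel (exponential_density 2)) {t<..} = exp (- t * 2)"
      by (simp add: greaterThan_def)
    then have "emeasure (density lborel (exponential_density 2)) {t<..} = ennreal (exp (- t * 2))"
      by (simp add: A.emeasure_eq_measure)
    then show ?thesis by (simp add: emeasure_density mult.commute)
  qed
  then show ?case unfolding * by (auto simp: ennreal_mult[symmetric] exp_add[symmetric] algebra_simps)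
next
  case (Suc k)
  let ?c = "\<lambda>y. \<xi> y - 2"
  let ?P = "\<lambda>t x. if 0 \<le> t then pathw UNIV ?c z k t x else 0"
  have [measurable]: "(\<lambda>w. jump_weight \<xi> z k t' y w) \<in> borel_measurable walk" for t' y
    by measurable
  have Pm [measurable]: "(\<lambda>t. ?P t y) \<in> borel_measurable borel" for y
    using borel_measurable_continuous_on_indicator[OF _ pathw_cont[of UNIV ?c z k y]]
    by (rule measurable_cong[THEN iffD1, rotated]) (auto simp: indicator_def)
  have "(\<integral>\<^sup>+w. jump_weight \<xi> z (Suc k) t x w \<partial>walk) = (\<integral>\<^sup>+a. ennreal (exponential_density 2 a) *
      (ennreal (exp (a * \<xi> x)) * ennreal (?P (t - a) (x + 1) + ?P (t - a) (x - 1))) / 2 \<partial>lborel)"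
  proof (subst nn_integral_walk, simp, intro nn_integral_cong)
    fix a :: real
    show "ennreal (exponential_density 2 a) * (\<integral>\<^sup>+w. ennreal (jump_weight \<xi> z (Suc k) t x (case_nat (a, 1) w)) +
        ennreal (jump_weight \<xi> z (Suc k) t x (case_nat (a, - 1) w)) \<partial>walk) / 2 =
      ennreal (exponential_density 2 a) * (ennreal (exp (a * \<xi> x)) * ennreal (?P (t - a) (x + 1) + ?P (t - a) (x - 1))) / 2"
    proof -
      have "(\<integral>\<^sup>+w. ennreal (jump_weight \<xi> z (Suc k) t x (case_nat (a, 1) w)) +
          ennreal (jump_weight \<xi> z (Suc k) t x (case_nat (a, - 1) w)) \<partial>walk) =
        (\<integral>\<^sup>+w. ennreal (exp (a * \<xi> x)) * (ennreal (jump_weight \<xi> z k (t - a) (x + 1) w)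
           + ennreal (jump_weight \<xi> z k (t - a) (x - 1) w)) \<partial>walk)"
        by (simp add: jump_weight_Suc ennreal_mult' distrib_left)
      also have "\<dots> = ennreal (exp (a * \<xi> x)) * (ennreal (?P (t - a) (x + 1)) + ennreal (?P (t - a) (x - 1)))"
        by (subst nn_integral_cmult, simp, subst nn_integral_add) (simp_all only: Suc measurable_compose[OF _ measurable_ennreal] measurable_jump_weight)
      also have "ennreal (?P (t - a) (x + 1)) + ennreal (?P (t - a) (x - 1)) = ennreal (?P (t - a) (x + 1) + ?P (t - a) (x - 1))"
        by (intro ennreal_plus[symmetric]) auto
      finally show ?thesis by simp
    qed
  qed
  also have "\<dots> = (\<integral>\<^sup>+a. ennreal (exp (?c x * a) * (?P (t - a) (x + 1) + ?P (t - a) (x - 1)) * indicator {0..} a) \<partial>lborel)"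
  proof (intro nn_integral_cong)
    fix a :: real
    let ?Q = "?P (t - a) (x + 1) + ?P (t - a) (x - 1)"
    have Q: "0 \<le> ?Q" by auto
    have "ennreal (exponential_density 2 a) * (ennreal (exp (a * \<xi> x)) * ennreal ?Q) / 2 = ennreal (exponential_density 2 a * (exp (a * \<xi> x) * ?Q) / 2)"
      unfolding ennreal_mult[OF exp_ge_zero Q, symmetric]
      using Q by (intro ennreal_mult_half) (auto simp: exponential_density_def)
    also have "exponential_density 2 a * (exp (a * \<xi> x) * ?Q) / 2 = exp (?c x * a) * ?Q * indicator {0..} a"
    proof -
      have "exp (?c x * a) = exp (a * \<xi> x) * exp (- (a * 2))"
        by (simp add: exp_add[symmetric] algebra_simps)
      then show ?thesis by (simp add: exponential_density_def)
    qed
    finally show "ennreal (exponential_density 2 a) * (ennreal (exp (a * \<xi> x)) * ennreal ?Q) / 2 = ennreal (exp (?c x * a) * ?Q * indicator {0..} a)" .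
  qed
  \<comment> \<open>Reflection \<open>s = t - a\<close>: the integral now runs over the time left
    after the first jump, as in \<open>pathw\<close>.\<close>
  also have "\<dots> = (\<integral>\<^sup>+s. ennreal (exp (?c x * (t - s)) * (?P s (x + 1) + ?P s (x - 1)) * indicator {0..} (t - s)) \<partial>lborel)"
  proof -
    have "(\<lambda>a. ?P (t - a) y) \<in> borel_measurable borel" for y
      by (rule measurable_compose[OF _ Pm]) measurable
    then have "(\<lambda>a. ennreal (exp (?c x * a) * (?P (t - a) (x + 1) + ?P (t - a) (x - 1)) * indicator {0..} a)) \<in> borel_measurable borel"
      by (intro measurable_compose[OF _ measurable_ennreal] borel_measurable_times borel_measurable_add) auto
    from nn_integral_real_affine[OF this, of "-1" t] show ?thesis by (simp cong: if_cong)
  qed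
  also have "\<dots> = (\<integral>\<^sup>+s. ennreal (exp (?c x * t) * (exp (- ?c x * s) * (pathw UNIV ?c z k s (x + 1) + pathw UNIV ?c z k s (x - 1)))) * indicator {0..t} s \<partial>lborel)"
  proof (intro nn_integral_cong)
    fix s :: real
    have "exp (?c x * (t - s)) = exp (?c x * t) * exp (- ?c x * s)"
      by (simp add: exp_add[symmetric] algebra_simps)
    then show "ennreal (exp (?c x * (t - s)) * (?P s (x + 1) + ?P s (x - 1)) * indicator {0..} (t - s)) =
      ennreal (exp (?c x * t) * (exp (- ?c x * s) * (pathw UNIV ?c z k s (x + 1) + pathw UNIV ?c z k s (x - 1)))) * indicator {0..t} s"
      by (cases "s \<in> {0..t}") (auto simp: mult.assoc)
  qed
  also have "\<dots> = (if 0 \<le> t then pathw UNIV ?c z (Suc k) t x else 0)"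
  proof cases
    assume t: "0 \<le> t"
    have "(\<lambda>s. exp (- ?c x * s) * (pathw UNIV ?c z k s (x + 1) + pathw UNIV ?c z k s (x - 1))) integrable_on {0..t}"
      by (intro integrable_continuous_interval continuous_intros continuous_on_subset[OF pathw_cont]) auto
    from nn_integral_has_integral_lebesgue'[OF _ has_integral_mult_right[OF integrable_integral[OF this], of "exp (?c x * t)"]] t
    show ?thesis by auto
  next
    assume "\<not> 0 \<le> t"
    then have "{0..t} = {}" by auto
    then show ?thesis using \<open>\<not> 0 \<le> t\<close> by simp
  qed
  finally show ?case .
qed

text \<open>2/3 is the Laplace transform at 1 of one exponential holding time of rate 2. The bound
  rules out explosion.\<close>

lemma nn_integral_exp_jump_time: "(\<integral>\<^sup>+w. ennreal (exp (- jump_time w k)) \<partial>walk) \<le> ennreal ((2/3)^k)"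
proof (induction k)
  case 0 then show ?case by (simp add: jump_time_def walk.emeasure_space_1)
next
  case (Suc k)
  have "(\<integral>\<^sup>+w. ennreal (exp (- jump_time w (Suc k))) \<partial>walk) \<le>
      (\<integral>\<^sup>+a. ennreal (2 * exp (- 3 * a)) * indicator {0..} a * ennreal ((2/3)^k) \<partial>lborel)"
  proof (subst nn_integral_walk, simp, intro nn_integral_mono)
    fix a :: real
    have "(\<integral>\<^sup>+w. ennreal (exp (- jump_time (case_nat (a, 1) w) (Suc k))) + ennreal (exp (- jump_time (case_nat (a, - 1) w) (Suc k))) \<partial>walk)
       = 2 * (ennreal (exp (-a)) * (\<integral>\<^sup>+w. ennreal (exp (- jump_time w k)) \<partial>walk))"
      unfolding jump_time_case_nat mult_2[symmetric] minus_add_distrib exp_add ennreal_mult'[OF exp_ge_zero]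
      by (simp add: nn_integral_cmult)
    also have "\<dots> \<le> 2 * (ennreal (exp (-a)) * ennreal ((2/3)^k))"
      by (intro mult_left_mono Suc) auto
    finally have "ennreal (exponential_density 2 a) * (\<integral>\<^sup>+w. ennreal (exp (- jump_time (case_nat (a, 1) w) (Suc k))) + ennreal (exp (- jump_time (case_nat (a, - 1) w) (Suc k))) \<partial>walk) / 2
      \<le> ennreal (exponential_density 2 a) * (2 * (ennreal (exp (-a)) * ennreal ((2/3)^k))) / 2"
      by (intro divide_right_mono_ennreal mult_left_mono) auto
    also have "\<dots> = ennreal (exponential_density 2 a * (2 * (exp (-a) * (2/3)^k)) / 2)"
    proof -
      have "2 * (ennreal (exp (-a)) * ennreal ((2/3)^k)) = ennreal (2 * (exp (-a) * (2/3)^k))"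
        by (simp add: ennreal_mult)
      then show ?thesis by (simp only:, intro ennreal_mult_half) (auto simp: exponential_density_def)
    qed
    also have "exponential_density 2 a * (2 * (exp (-a) * (2/3)^k)) / 2 = 2 * exp (- 3 * a) * indicator {0..} a * (2/3)^k"
    proof -
      have "exp (- 3 * a) = exp (- a) * exp (- (a * 2))"
        by (simp add: exp_add[symmetric])
      then show ?thesis by (simp add: exponential_density_def)
    qed
    also have "ennreal \<dots> = ennreal (2 * exp (- 3 * a)) * indicator {0..} a * ennreal ((2/3)^k)"
      by (cases "0 \<le> a") (auto simp: ennreal_mult)
    finally show "ennreal (exponential_density 2 a) * (\<integral>\<^sup>+w. ennreal (exp (- jump_time (case_nat (a, 1) w) (Suc k))) + ennreal (exp (- jump_time (case_nat (a, - 1) w) (Suc k))) \<partial>walk) / 2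
      \<le> ennreal (2 * exp (- 3 * a)) * indicator {0..} a * ennreal ((2/3)^k)" .
  qed
  also have "\<dots> = (\<integral>\<^sup>+a. ennreal (2 * exp (- 3 * a)) * indicator {0..} a \<partial>lborel) * ennreal ((2/3)^k)"
    by (rule nn_integral_multc) measurable
  also have "(\<integral>\<^sup>+a. ennreal (2 * exp (- 3 * a)) * indicator {0..} a \<partial>lborel) = ennreal (0 - (- (2/3) * exp (- 3 * 0)))"
  proof (rule nn_integral_FTC_atLeast)
    show "((\<lambda>a. - (2/3) * exp (- 3 * a)) \<longlongrightarrow> (0::real)) at_top" by real_asymp
  qed (auto intro!: derivative_eq_intros)
  also have "\<dots> * ennreal ((2/3)^k) = ennreal ((2/3)^Suc k)"
    by (simp add: ennreal_mult[symmetric])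
  finally show ?case .
qed

lemma AE_walk_regular: "AE w in walk. (\<forall>j. 0 < fst (w j)) \<and> (\<forall>K. \<exists>k. K < jump_time w k)"
proof -
  have "AE w in walk. \<forall>j. 0 < fst (w j)"
  proof (subst AE_all_countable, intro allI)
    fix j :: nat
    have "AE a in density lborel (exponential_density 2). 0 < a"
    proof (subst AE_density)
      show "AE x in lborel. 0 < ennreal (exponential_density 2 x) \<longrightarrow> 0 < x"
        using AE_lborel_singleton[of 0] by eventually_elim (auto simp: exponential_density_def not_less)
    qed auto
    then have "AE s in walk_step. 0 < fst s"
    proof -
      interpret A: prob_space "density lborel (exponential_density 2)"
        by (rule prob_space_exponential_density) simp
      interpret pair_prob_space "density lborel (exponential_density 2)" "measure_pmf (pmf_of_set {-1, 1::int})" ..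
      assume "AE a in density lborel (exponential_density 2). 0 < a"
      then show ?thesis unfolding walk_step_def by (intro AE_pair_measure) auto
    qed
    then show "AE w in walk. 0 < fst (w j)"
      unfolding walk_def by (intro AE_PiM_component) (auto intro: prob_space_walk_step)
  qed
  moreover have "AE w in walk. \<forall>K. \<exists>k. K < jump_time w k"
  proof -
    \<comment> \<open>Bounded jump times would keep this infimum positive, while its integral is at
      most every power of 2/3.\<close>
    have "AE w in walk. (INF k. ennreal (exp (- jump_time w k))) = 0"
    proof (subst nn_integral_0_iff_AE[symmetric])
      have "(\<integral>\<^sup>+w. (INF k. ennreal (exp (- jump_time w k))) \<partial>walk) \<le> ennreal ((2/3)^k)" for k
        by (rule order_trans[OF nn_integral_mono nn_integral_exp_jump_time]) (auto intro: INF_lower)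
      note le = this
      have "(\<integral>\<^sup>+w. (INF k. ennreal (exp (- jump_time w k))) \<partial>walk) \<le> 0"
      proof (rule LIMSEQ_le_const[rotated], intro exI allI impI, rule le)
        show "(\<lambda>k. ennreal ((2/3)^k)) \<longlonglongrightarrow> 0"
          using tendsto_ennrealI[OF LIMSEQ_realpow_zero[of "2/3"]] by simp
      qed
      then show "(\<integral>\<^sup>+w. (INF k. ennreal (exp (- jump_time w k))) \<partial>walk) = 0" by simp
    qed measurable
    then show ?thesis
    proof eventually_elim
      fix w assume *: "(INF k. ennreal (exp (- jump_time w k))) = 0"
      show "\<forall>K. \<exists>k. K < jump_time w k"
      proof
        fix K
        have "(INF k. ennreal (exp (- jump_time w k))) < ennreal (exp (- K))" unfolding * by simp
        then obtain k where "ennreal (exp (- jump_time w k)) < ennreal (exp (- K))"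
          by (auto simp: INF_less_iff)
        then show "\<exists>k. K < jump_time w k" by (auto simp: ennreal_less_iff)
      qed
    qed
  qed
  ultimately show ?thesis by eventually_elim simp
qed

text \<open>\<open>walk_pos\<close> sums over a random set of jumps. The least \<open>N\<close> such
  that all jumps from index \<open>N\<close> on come after \<open>s\<close> turns it into a finite
  sum; if there is none, the index set is infinite and the sum is 0 by convention, so measurability
  holds on the whole space.\<close>

lemma walk_pos_measurable: "(\<lambda>(w, s). walk_pos w s) \<in> measurable (walk \<Otimes>\<^sub>M borel) (count_space UNIV)"
proof -
  define P where "P N x \<longleftrightarrow> (\<forall>j\<ge>N. snd x < jump_time (fst x) (Suc j))" for N :: nat and x :: "(nat \<Rightarrow> real \<times> int) \<times> real"
  define g where "g N x = (\<Sum>j<N. if jump_time (fst x) (Suc j) \<le> snd x then snd (fst x j) else 0)" for N :: nat and x :: "(nat \<Rightarrow> real \<times> int) \<times> real"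
  have [measurable]: "Measurable.pred (walk \<Otimes>\<^sub>M borel) (P N)" for N
    unfolding P_def by measurable
  have [measurable]: "g N \<in> measurable (walk \<Otimes>\<^sub>M borel) (count_space UNIV)" for N
    unfolding g_def by measurable
  have "(\<lambda>x. g (LEAST N. P N x) x) \<in> measurable (walk \<Otimes>\<^sub>M borel) (count_space UNIV)"
    by (rule measurable_compose_countable) measurable
  then have "(\<lambda>x. if \<exists>N. P N x then g (LEAST N. P N x) x else 0) \<in> measurable (walk \<Otimes>\<^sub>M borel) (count_space UNIV)"
    by measurable
  moreover have "walk_pos w s = (if \<exists>N. P N (w, s) then g (LEAST N. P N (w, s)) (w, s) else 0)" for w s
  proof (cases "\<exists>N. P N (w, s)")
    case True
    define N where "N = (LEAST N. P N (w, s))"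
    have N: "P N (w, s)" unfolding N_def by (rule LeastI_ex[OF True])
    then have "{j. jump_time w (Suc j) \<le> s} = {..<N} \<inter> {j. jump_time w (Suc j) \<le> s}"
      unfolding P_def by (auto simp: not_le[symmetric])
    then have "walk_pos w s = (\<Sum>j\<in>{..<N} \<inter> {j. jump_time w (Suc j) \<le> s}. snd (w j))"
      unfolding walk_pos_def by simp
    also have "\<dots> = g N (w, s)"
      by (simp add: g_def sum.inter_restrict cong: if_cong)
    finally show ?thesis using True by (simp add: N_def)
  next
    case False
    have "infinite {j. jump_time w (Suc j) \<le> s}"
    proof
      assume "finite {j. jump_time w (Suc j) \<le> s}"
      then obtain N where "\<forall>j\<in>{j. jump_time w (Suc j) \<le> s}. j < N"
        using finite_nat_set_iff_bounded by blast
      then have "P N (w, s)" unfolding P_def by (auto simp: not_le[symmetric])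
      then show False using False by blast
    qed
    then show ?thesis using False by (simp add: walk_pos_def)
  qed
  ultimately show ?thesis by (simp add: split_beta')
qed

lemma walk_regular:
  assumes pos: "\<And>j. 0 < fst (w j)" and unb: "\<And>K. \<exists>k. K < jump_time w k" and t: "0 \<le> t"
  obtains k where "jump_time w k \<le> t" "t < jump_time w (Suc k)"
    and "\<And>l. jump_time w l \<le> t \<Longrightarrow> t < jump_time w (Suc l) \<Longrightarrow> l = k"
    and "walk_pos w t = walk_site w k"
proof -
  have mono: "strict_mono (jump_time w)"
    by (intro strict_mono_Suc_iff[THEN iffD2]) (simp add: jump_time_def pos)
  define k where "k = (LEAST k. t < jump_time w (Suc k))"
  have ex: "\<exists>k. t < jump_time w (Suc k)"
  proof -
    obtain k where "t < jump_time w k" using unb by blast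
    with t show ?thesis by (cases k) (auto simp: jump_time_def)
  qed
  have k: "t < jump_time w (Suc k)" unfolding k_def by (rule LeastI_ex[OF ex])
  have k': "jump_time w k \<le> t"
  proof (cases k)
    case 0 then show ?thesis using t by (simp add: jump_time_def)
  next
    case (Suc l) then show ?thesis using not_less_Least[of l "\<lambda>k. t < jump_time w (Suc k)"] by (auto simp: k_def)
  qed
  have iff: "jump_time w (Suc j) \<le> t \<longleftrightarrow> j < k" for j
    using k k' mono by (meson Suc_leI leD leI less_Suc_eq_le order.strict_trans2 order_trans strict_mono_less_eq)
  have "l = k" if "jump_time w l \<le> t" "t < jump_time w (Suc l)" for l
  proof -
    have "\<not> l < k" using iff[of l] that by linarith
    moreover have "l \<le> k"
    proof (cases l)
      case (Suc i) then show ?thesis using iff[of i] that by simp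
    qed simp
    ultimately show ?thesis by simp
  qed
  moreover have "walk_pos w t = walk_site w k"
    unfolding walk_pos_def iff walk_site_def by (simp add: lessThan_def)
  ultimately show ?thesis using that k k' by blast
qed

text \<open>On a non-exploding path the position is constant between jumps, so the time integral is
  a finite sum; the series has a single nonzero term, at the number of jumps up to time
  \<open>t\<close>.\<close>

lemma pam_integrand_eq:
  assumes pos: "\<And>j. 0 < fst (w j)" and unb: "\<And>K. \<exists>k. K < jump_time w k" and t: "0 \<le> t"
  shows "ennreal (exp (set_lebesgue_integral lborel {0..t} (\<lambda>s. \<xi> (walk_pos w s))) * indicator {w. walk_pos w t = z} w)
    = (\<Sum>k. ennreal (jump_weight \<xi> z k t 0 w))"
proof -
  obtain k where k: "jump_time w k \<le> t" "t < jump_time w (Suc k)"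
    and ku: "\<And>l. jump_time w l \<le> t \<Longrightarrow> t < jump_time w (Suc l) \<Longrightarrow> l = k"
    and kp: "walk_pos w t = walk_site w k"
    using walk_regular[OF pos unb t] by blast
  have mono: "strict_mono (jump_time w)"
    by (intro strict_mono_Suc_iff[THEN iffD2]) (simp add: jump_time_def pos)
  have eq: "indicator {0..t} s *\<^sub>R \<xi> (walk_pos w s) =
     (\<Sum>j<k. indicator {jump_time w j..<jump_time w (Suc j)} s * \<xi> (walk_site w j)) + indicator {jump_time w k..t} s * \<xi> (walk_site w k)" for s
  proof (cases "s \<in> {0..t}")
    case True
    obtain m where m: "jump_time w m \<le> s" "s < jump_time w (Suc m)"
      and mu: "\<And>l. jump_time w l \<le> s \<Longrightarrow> s < jump_time w (Suc l) \<Longrightarrow> l = m"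
      and mp: "walk_pos w s = walk_site w m"
      using walk_regular[OF pos unb, of s] True by (metis atLeastAtMost_iff)
    have "jump_time w m < jump_time w (Suc k)" using m k True by auto
    then have mk: "m \<le> k" using mono by (simp add: strict_mono_less)
    have "(indicator {jump_time w j..<jump_time w (Suc j)} s :: real) = (if j = m then 1 else 0)" for j
      using mu[of j] m by (cases "j = m") (auto simp: indicator_def)
    then have 1: "(\<Sum>j<k. indicator {jump_time w j..<jump_time w (Suc j)} s * \<xi> (walk_site w j)) =
        (if m < k then \<xi> (walk_site w m) else 0)"
      by (simp add: if_distrib[of "\<lambda>u. u * _"] cong: if_cong)
    have 2: "jump_time w k \<le> s \<longleftrightarrow> m = k"
      using m(1) k(2) True mu[of k] by auto
    show ?thesis unfolding 1 using True mk 2 by (auto simp: mp indicator_def)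
  next
    case False
    then have st: "s < 0 \<or> t < s" by auto
    have nn: "0 \<le> jump_time w j" for j using pos by (simp add: jump_time_def sum_nonneg less_imp_le)
    have le: "jump_time w (Suc j) \<le> t" if "j < k" for j
      using k(1) mono that by (meson Suc_leI order_trans strict_mono_less_eq)
    have "(indicator {jump_time w j..<jump_time w (Suc j)} s :: real) = 0" if "j < k" for j
      using st nn[of j] le[OF that] by (auto simp: indicator_def)
    moreover have "s \<notin> {jump_time w k..t}"
      using st nn[of k] by auto
    ultimately show ?thesis using False by simp
  qed
  have "set_lebesgue_integral lborel {0..t} (\<lambda>s. \<xi> (walk_pos w s)) =
     (\<integral>s. (\<Sum>j<k. indicator {jump_time w j..<jump_time w (Suc j)} s * \<xi> (walk_site w j)) + indicator {jump_time w k..t} s * \<xi> (walk_site w k) \<partial>lborel)"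
    unfolding set_lebesgue_integral_def eq ..
  also have "\<dots> = (\<Sum>j<k. fst (w j) * \<xi> (walk_site w j)) + (t - jump_time w k) * \<xi> (walk_site w k)"
  proof -
    have "jump_time w (Suc j) - jump_time w j = fst (w j)" "jump_time w j \<le> jump_time w (Suc j)" for j
      using pos[of j] by (auto simp: jump_time_def)
    then have "(\<integral>s. indicator {jump_time w j..<jump_time w (Suc j)} s * \<xi> (walk_site w j) \<partial>lborel) = fst (w j) * \<xi> (walk_site w j)"
        "integrable lborel (\<lambda>s. indicator {jump_time w j..<jump_time w (Suc j)} s * \<xi> (walk_site w j))" for j
      by simp_all
    moreover have "(\<integral>s. indicator {jump_time w k..t} s * \<xi> (walk_site w k) \<partial>lborel) = (t - jump_time w k) * \<xi> (walk_site w k)"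
        "integrable lborel (\<lambda>s. indicator {jump_time w k..t} s * \<xi> (walk_site w k))"
      using k by simp_all
    ultimately show ?thesis
      by (simp only: Bochner_Integration.integral_add Bochner_Integration.integral_sum Bochner_Integration.integrable_sum)
  qed
  finally have I: "exp (set_lebesgue_integral lborel {0..t} (\<lambda>s. \<xi> (walk_pos w s))) * indicator {w. walk_pos w t = z} w = jump_weight \<xi> z k t 0 w"
    using k by (simp add: jump_weight_def kp indicator_def)
  have "(\<Sum>l. ennreal (jump_weight \<xi> z l t 0 w)) = (\<Sum>l\<in>{k}. ennreal (jump_weight \<xi> z l t 0 w))"
    using ku by (intro suminf_finite) (auto simp: jump_weight_def)
  then show ?thesis unfolding I by simp
qed

text \<open>An identity that covers infinite expectations as well: then the Bochner integral and
  \<open>enn2real \<infinity>\<close> are both 0. Finiteness has to be established on good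
  environments only.\<close>

theorem pam_u_eq:
  assumes t: "0 \<le> t"
  shows "pam_u \<xi> t z = enn2real (\<Sum>k. ennreal (pathw UNIV (\<lambda>y. \<xi> y - 2) z k t 0))"
proof -
  have [measurable]: "(\<lambda>(w, s). walk_pos w s) \<in> measurable (walk \<Otimes>\<^sub>M borel) (count_space UNIV)"
    by (rule walk_pos_measurable)
  have wp: "(\<lambda>w. walk_pos w t) \<in> measurable walk (count_space UNIV)"
    using measurable_compose[OF measurable_Pair1' walk_pos_measurable] by measurable
  have m: "(\<lambda>w. exp (set_lebesgue_integral lborel {0..t} (\<lambda>s. \<xi> (walk_pos w s))) * indicator {w. walk_pos w t = z} w) \<in> borel_measurable walk"
    unfolding set_lebesgue_integral_def using wp by measurable
  have "pam_u \<xi> t z = enn2real (\<integral>\<^sup>+w. ennreal (exp (set_lebesgue_integral lborel {0..t} (\<lambda>s. \<xi> (walk_pos w s))) * indicator {w. walk_pos w t = z} w) \<partial>walk)"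
    unfolding pam_u_def by (intro integral_eq_nn_integral m) auto
  also have "(\<integral>\<^sup>+w. ennreal (exp (set_lebesgue_integral lborel {0..t} (\<lambda>s. \<xi> (walk_pos w s))) * indicator {w. walk_pos w t = z} w) \<partial>walk) =
     (\<integral>\<^sup>+w. (\<Sum>k. ennreal (jump_weight \<xi> z k t 0 w)) \<partial>walk)"
    by (intro nn_integral_cong_AE, rule eventually_mono[OF AE_walk_regular], rule pam_integrand_eq) (auto simp: t)
  also have "\<dots> = (\<Sum>k. \<integral>\<^sup>+w. ennreal (jump_weight \<xi> z k t 0 w) \<partial>walk)"
    by (rule nn_integral_suminf) measurable
  finally show ?thesis using t by (simp add: nn_integral_jump_weight)
qed

text \<open>Integrating factor: \<open>exp (- c * s) * f s\<close> is nondecreasing. Every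
  comparison below is an induction over the number of jumps with this as its inductive step.\<close>

lemma deriv_ge_linear_nonneg:
  fixes f :: "real \<Rightarrow> real"
  assumes "0 \<le> t" and c: "continuous_on {0..t} f" and f0: "0 \<le> f 0"
    and d: "\<And>s. 0 < s \<Longrightarrow> s < t \<Longrightarrow> \<exists>d. (f has_real_derivative d) (at s) \<and> c * f s \<le> d"
  shows "0 \<le> f t"
proof -
  have "exp (- c * 0) * f 0 \<le> exp (- c * t) * f t"
  proof (rule DERIV_nonneg_imp_increasing_open[OF \<open>0 \<le> t\<close>])
    fix s assume s: "0 < s" "s < t"
    obtain d' where d': "(f has_real_derivative d') (at s)" "c * f s \<le> d'" using d[OF s] by blast
    have "((\<lambda>s. exp (- c * s) * f s) has_real_derivative exp (- c * s) * (d' - c * f s)) (at s)"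
      by (rule derivative_eq_intros d' refl)+ (simp add: algebra_simps)
    then show "\<exists>y. ((\<lambda>s. exp (- c * s) * f s) has_real_derivative y) (at s) \<and> 0 \<le> y"
      using d'(2) by (intro exI conjI) auto
  qed (intro continuous_intros c)
  then have "0 \<le> exp (- c * t) * f t" using f0 by simp
  then show ?thesis by (simp add: zero_le_mult_iff)
qed

section \<open>Comparison with super- and subsolutions\<close>

abbreviation pathsum :: "int set \<Rightarrow> (int \<Rightarrow> real) \<Rightarrow> int \<Rightarrow> nat \<Rightarrow> real \<Rightarrow> int \<Rightarrow> real" where
  "pathsum B c z k t x \<equiv> \<Sum>j\<le>k. pathw B c z j t x"

lemma pathsum_cont: "continuous_on {0..T} (\<lambda>t. pathsum B c z k t x)"
  by (intro continuous_intros continuous_on_subset[OF pathw_cont]) auto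

lemma pathsum_nonneg: "0 \<le> t \<Longrightarrow> 0 \<le> pathsum B c z k t x"
  by (simp add: sum_nonneg)

lemma pathsum_at_0: "pathsum B c z k 0 x = (if x \<in> B \<and> x = z then 1 else 0)"
  by (cases "x \<in> B \<and> x = z") (auto simp: pathw_at_0 cong: if_cong)

lemma pathsum_deriv_Suc:
  assumes "x \<in> B" "0 < t"
  shows "((\<lambda>t. pathsum B c z (Suc k) t x) has_real_derivative
     c x * pathsum B c z (Suc k) t x + pathsum B c z k t (x + 1) + pathsum B c z k t (x - 1)) (at t)"
proof -
  have "((\<lambda>t. pathw B c z 0 t x + (\<Sum>j\<le>k. pathw B c z (Suc j) t x)) has_real_derivative
    c x * pathw B c z 0 t x + (\<Sum>j\<le>k. c x * pathw B c z (Suc j) t x + pathw B c z j t (x + 1) + pathw B c z j t (x - 1))) (at t)"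
    by (intro DERIV_add pathw_deriv_0 DERIV_sum pathw_deriv_Suc assms)
  then show ?thesis
    by (simp add: sum.atMost_Suc_shift sum.distrib sum_distrib_left distrib_left add.assoc del: sum.atMost_Suc pathw.simps)
qed

text \<open>\<open>exp (\<mu> * t) * \<phi>\<close> is a supersolution on \<open>B\<close>. The
  induction over the number of jumps takes the place of a maximum principle and so works for
  infinite \<open>B\<close> and unbounded \<open>c\<close>.\<close>

theorem pathsum_le_supersolution:
  assumes nn: "\<And>x. 0 \<le> \<phi> x" and z: "1 \<le> \<phi> z"
    and sup: "\<And>x. x \<in> B \<Longrightarrow> \<phi> (x + 1) + \<phi> (x - 1) \<le> (\<mu> - c x) * \<phi> x" and t: "0 \<le> t"
  shows "pathsum B c z k t x \<le> exp (\<mu> * t) * \<phi> x"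
  using t
proof (induction k arbitrary: t x)
  case 0
  show ?case
  proof (cases "x \<in> B \<and> x = z")
    case True
    \<comment> \<open>Nonnegative neighbours and \<open>\<phi> z \<ge> 1\<close> force
      \<open>c z \<le> \<mu>\<close>, which settles the path without jumps.\<close>
    have "0 \<le> \<phi> (z + 1) + \<phi> (z - 1)" using nn by simp
    also have "\<dots> \<le> (\<mu> - c z) * \<phi> z" using sup[of z] True by blast
    finally have "c z \<le> \<mu>" using z by (simp add: zero_le_mult_iff)
    then have "exp (c z * t) * 1 \<le> exp (\<mu> * t) * \<phi> z"
      using z 0 by (intro mult_mono) (auto intro: mult_right_mono)
    then show ?thesis using True nn[of z] by simp
  next
    case False
    then show ?thesis using nn by auto
  qed
next
  case (Suc k)
  show ?case
  proof (cases "x \<in> B")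
    case True
    have "0 \<le> exp (\<mu> * t) * \<phi> x - pathsum B c z (Suc k) t x"
    proof (rule deriv_ge_linear_nonneg[where c="c x", OF Suc.prems])
      show "continuous_on {0..t} (\<lambda>t. exp (\<mu> * t) * \<phi> x - pathsum B c z (Suc k) t x)"
        by (intro continuous_intros pathsum_cont)
      show "0 \<le> exp (\<mu> * 0) * \<phi> x - pathsum B c z (Suc k) 0 x"
        using nn[of x] z by (auto simp: pathsum_at_0 simp del: sum.atMost_Suc pathw.simps)
      fix s :: real assume s: "0 < s" "s < t"
      have "((\<lambda>t. exp (\<mu> * t) * \<phi> x - pathsum B c z (Suc k) t x) has_real_derivative
          exp (\<mu> * s) * \<mu> * \<phi> x - (c x * pathsum B c z (Suc k) s x + pathsum B c z k s (x + 1) + pathsum B c z k s (x - 1))) (at s)"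
        by (rule DERIV_diff pathsum_deriv_Suc[OF True s(1)] derivative_eq_intros refl | simp)+
      moreover have "pathsum B c z k s (x + 1) + pathsum B c z k s (x - 1) \<le> exp (\<mu> * s) * ((\<mu> - c x) * \<phi> x)"
      proof -
        have "pathsum B c z k s (x + 1) + pathsum B c z k s (x - 1) \<le> exp (\<mu> * s) * (\<phi> (x + 1) + \<phi> (x - 1))"
          using Suc.IH[of s "x + 1"] Suc.IH[of s "x - 1"] s by (simp add: distrib_left)
        also have "\<dots> \<le> exp (\<mu> * s) * ((\<mu> - c x) * \<phi> x)"
          using sup[OF True] by simp
        finally show ?thesis .
      qed
      ultimately show "\<exists>d. ((\<lambda>t. exp (\<mu> * t) * \<phi> x - pathsum B c z (Suc k) t x) has_real_derivative d) (at s) \<and>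
          c x * (exp (\<mu> * s) * \<phi> x - pathsum B c z (Suc k) s x) \<le> d"
        by - (rule exI, rule conjI, assumption, simp add: algebra_simps del: sum.atMost_Suc)
    qed
    then show ?thesis by (simp del: sum.atMost_Suc)
  next
    case False
    then show ?thesis using nn by simp
  qed
qed

text \<open>These weights solve the recursion of \<open>pathw\<close> with \<open>c\<close> replaced
  by the constant \<open>C\<close>; being the same at both neighbours, they enter with the factor
  2.\<close>

lemma poisson_weight_deriv:
  fixes M C t :: real
  shows "((\<lambda>t. M * exp (C * t) * (2 * t) ^ Suc k / fact (Suc k)) has_real_derivative
    C * (M * exp (C * t) * (2 * t) ^ Suc k / fact (Suc k)) + 2 * (M * exp (C * t) * (2 * t) ^ k / fact k)) (at t)"
proof -
  have "((\<lambda>t::real. (2 * t) ^ Suc k / fact (Suc k)) has_real_derivative (real (Suc k) * (2 * t) ^ k * 2) / fact (Suc k)) (at t)"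
    by (rule derivative_eq_intros refl | simp)+
  moreover have "(real (Suc k) * (2 * t) ^ k * 2) / fact (Suc k) = 2 * ((2 * t) ^ k / fact k)"
  proof -
    have "real (Suc k) * A / (real (Suc k) * B) = A / B" for A B :: real by (simp del: of_nat_Suc)
    from this[of "(2 * t) ^ k * 2" "fact k"] show ?thesis by (simp add: fact_Suc mult.assoc del: of_nat_Suc)
  qed
  ultimately have "((\<lambda>t::real. (2 * t) ^ Suc k / fact (Suc k)) has_real_derivative 2 * ((2 * t) ^ k / fact k)) (at t)"
    by (simp only:)
  moreover have "((\<lambda>t. M * exp (C * t)) has_real_derivative M * (exp (C * t) * C)) (at t)"
    by (rule derivative_eq_intros refl | simp)+
  ultimately have "((\<lambda>t. (M * exp (C * t)) * ((2 * t) ^ Suc k / fact (Suc k))) has_real_derivative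
     M * (exp (C * t) * C) * ((2 * t) ^ Suc k / fact (Suc k)) + 2 * ((2 * t) ^ k / fact k) * (M * exp (C * t))) (at t)"
    by (rule DERIV_mult[rotated])
  then show ?thesis by (simp add: mult_ac)
qed

text \<open>The excess of a subsolution over the terms up to \<open>k + 1\<close> is driven only by
  its excess over the terms up to \<open>k\<close>, so by induction it is at most the weight
  \<open>G k\<close>, which tends to 0 like \<open>(2 * T) ^ k / fact k\<close>. Stated for a common
  bound \<open>U\<close> of the partial sums, the result can be applied before the series is known
  to converge.\<close>

theorem subsolution_le_pathsum_limit:
  fixes L L' :: "real \<Rightarrow> int \<Rightarrow> real"
  assumes zB: "z \<in> B" and Lc: "\<And>x. continuous_on {0..T} (\<lambda>t. L t x)"
    and Ld: "\<And>x t. x \<in> B \<Longrightarrow> 0 < t \<Longrightarrow> t < T \<Longrightarrow> ((\<lambda>t. L t x) has_real_derivative L' t x) (at t)"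
    and sub: "\<And>x t. x \<in> B \<Longrightarrow> 0 < t \<Longrightarrow> t < T \<Longrightarrow> L' t x \<le> c x * L t x + L t (x + 1) + L t (x - 1)"
    and out: "\<And>x t. x \<notin> B \<Longrightarrow> L t x \<le> 0"
    and L0: "\<And>x. L 0 x \<le> (if x = z then 1 else 0)"
    and M: "0 \<le> M" "\<And>x t. 0 \<le> t \<Longrightarrow> t \<le> T \<Longrightarrow> L t x \<le> M"
    and C: "0 \<le> C" "\<And>x. x \<in> B \<Longrightarrow> c x \<le> C"
    and U: "\<And>k. pathsum B c z k T x \<le> U" and T: "0 \<le> T"
  shows "L T x \<le> U"
proof -
  define G where "G k t = M * exp (C * t) * (2 * t) ^ k / fact k" for k :: nat and t :: real
  have G: "0 \<le> G k t" if "0 \<le> t" for k t using that M by (simp add: G_def)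
  have Gd: "(G (Suc k) has_real_derivative C * G (Suc k) t + 2 * G k t) (at t)" for k t
    unfolding G_def by (rule poisson_weight_deriv)
  have main: "L t x - pathsum B c z k t x \<le> G k t" if "0 \<le> t" "t \<le> T" for k t x
    using that
  proof (induction k arbitrary: t x)
    case 0
    have "L t x \<le> M" using M 0 by simp
    moreover have "M * 1 \<le> M * exp (C * t)" using M 0 C by (intro mult_left_mono) auto
    moreover have "0 \<le> pathsum B c z 0 t x" using 0 by (intro pathsum_nonneg)
    ultimately show ?case by (simp add: G_def)
  next
    case (Suc k)
    show ?case
    proof (cases "x \<in> B")
      case True
      have "0 \<le> G (Suc k) t - (L t x - pathsum B c z (Suc k) t x)"
      proof (rule deriv_ge_linear_nonneg[where c="c x", OF Suc.prems(1)])
        show "continuous_on {0..t} (\<lambda>t. G (Suc k) t - (L t x - pathsum B c z (Suc k) t x))"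
          using Suc.prems by (intro continuous_intros pathsum_cont continuous_on_subset[OF Lc])
            (auto simp: G_def intro!: continuous_intros)
        show "0 \<le> G (Suc k) 0 - (L 0 x - pathsum B c z (Suc k) 0 x)"
          using L0[of x] zB by (auto simp: pathsum_at_0 G_def simp del: sum.atMost_Suc split: if_splits)
        fix s assume s: "0 < s" "s < t"
        have "((\<lambda>t. G (Suc k) t - (L t x - pathsum B c z (Suc k) t x)) has_real_derivative
           (C * G (Suc k) s + 2 * G k s) - (L' s x - (c x * pathsum B c z (Suc k) s x + pathsum B c z k s (x + 1) + pathsum B c z k s (x - 1)))) (at s)"
          using s Suc.prems by (intro DERIV_diff Gd Ld pathsum_deriv_Suc True) auto
        moreover have "L' s x \<le> c x * L s x + L s (x + 1) + L s (x - 1)"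
          using sub[OF True] s Suc.prems by simp
        moreover have "c x * G (Suc k) s \<le> C * G (Suc k) s"
          using C(2)[OF True] s G by (intro mult_right_mono) auto
        moreover have "L s (x + 1) - pathsum B c z k s (x + 1) \<le> G k s" "L s (x - 1) - pathsum B c z k s (x - 1) \<le> G k s"
          using Suc.IH s Suc.prems by auto
        ultimately show "\<exists>d. ((\<lambda>t. G (Suc k) t - (L t x - pathsum B c z (Suc k) t x)) has_real_derivative d) (at s) \<and>
            c x * (G (Suc k) s - (L s x - pathsum B c z (Suc k) s x)) \<le> d"
          by - (rule exI, rule conjI, assumption, simp add: algebra_simps del: sum.atMost_Suc)
      qed
      then show ?thesis by simp
    next
      case False
      then show ?thesis using out[OF False, of t] G[of t "Suc k"] Suc.prems by simp
    qed
  qed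
  have "L T x - U \<le> G k T" for k
    using main[OF T order_refl, of x k] U[of k] by linarith
  moreover have "(\<lambda>k. G k T) \<longlonglongrightarrow> 0"
  proof -
    have "(\<lambda>k. M * exp (C * T) * (inverse (fact k) * (2 * T) ^ k)) \<longlonglongrightarrow> M * exp (C * T) * 0"
      by (intro tendsto_intros summable_LIMSEQ_zero summable_exp)
    then show ?thesis unfolding G_def by (simp add: divide_inverse mult_ac)
  qed
  ultimately have "L T x - U \<le> 0" by (intro LIMSEQ_le_const) auto
  then show ?thesis by simp
qed

lemma pathw_mono:
  assumes "B \<subseteq> B'" "0 \<le> t"
  shows "pathw B c z k t x \<le> pathw B' c z k t x"
  using assms(2)
proof (induction k arbitrary: t x)
  case 0
  then show ?case using assms(1) by auto
next
  case (Suc k)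
  have i: "(\<lambda>s. exp (- c x * s) * (pathw A c z k s (x + 1) + pathw A c z k s (x - 1))) integrable_on {0..t}" for A
    by (intro integrable_continuous_interval continuous_intros continuous_on_subset[OF pathw_cont]) auto
  show ?case
  proof (cases "x \<in> B")
    case True
    then have "x \<in> B'" using assms by auto
    have "integral {0..t} (\<lambda>s. exp (- c x * s) * (pathw B c z k s (x + 1) + pathw B c z k s (x - 1)))
       \<le> integral {0..t} (\<lambda>s. exp (- c x * s) * (pathw B' c z k s (x + 1) + pathw B' c z k s (x - 1)))"
      by (intro integral_le i mult_left_mono add_mono Suc.IH) auto
    then show ?thesis using True \<open>x \<in> B'\<close> by simp
  next
    case False
    then show ?thesis using Suc.prems pathw_nonneg[of t B' c z "Suc k" x] by simp
  qed
qed

text \<open>Replacing \<open>c\<close> by its bound \<open>m\<close> leaves the volume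
  \<open>t ^ k / fact k\<close> of the jump times and a factor 2 for the direction of each
  jump.\<close>

lemma pathw_le_poisson:
  assumes m: "\<And>y. y \<in> B \<Longrightarrow> c y \<le> m" and t: "0 \<le> t"
  shows "pathw B c z k t x \<le> exp (m * t) * (2 * t) ^ k / fact k"
  using t
proof (induction k arbitrary: t x)
  case 0
  then show ?case using m by (auto simp: mult_right_mono)
next
  case (Suc k)
  define G where "G k t = exp (m * t) * (2 * t) ^ k / fact k" for k :: nat and t :: real
  have Gd: "(G (Suc k) has_real_derivative m * G (Suc k) t + 2 * G k t) (at t)" for k t
    using poisson_weight_deriv[of 1 m k t] unfolding G_def by simp
  show ?case
  proof (cases "x \<in> B")
    case True
    have "0 \<le> G (Suc k) t - pathw B c z (Suc k) t x"
    proof (rule deriv_ge_linear_nonneg[where c="c x", OF Suc.prems])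
      show "continuous_on {0..t} (\<lambda>t. G (Suc k) t - pathw B c z (Suc k) t x)"
        by (intro continuous_intros continuous_on_subset[OF pathw_cont]) (auto simp: G_def intro!: continuous_intros)
      show "0 \<le> G (Suc k) 0 - pathw B c z (Suc k) 0 x" by (simp add: G_def)
      fix s assume s: "0 < s" "s < t"
      have "((\<lambda>t. G (Suc k) t - pathw B c z (Suc k) t x) has_real_derivative
        (m * G (Suc k) s + 2 * G k s) - (c x * pathw B c z (Suc k) s x + pathw B c z k s (x + 1) + pathw B c z k s (x - 1))) (at s)"
        by (intro DERIV_diff Gd pathw_deriv_Suc True s)
      moreover have "c x * G (Suc k) s \<le> m * G (Suc k) s"
        using m[OF True] s by (intro mult_right_mono) (auto simp: G_def)
      moreover have "pathw B c z k s (x + 1) \<le> G k s" "pathw B c z k s (x - 1) \<le> G k s"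
        unfolding G_def using s by (intro Suc.IH; simp)+
      ultimately show "\<exists>d. ((\<lambda>t. G (Suc k) t - pathw B c z (Suc k) t x) has_real_derivative d) (at s) \<and>
            c x * (G (Suc k) s - pathw B c z (Suc k) s x) \<le> d"
        by - (rule exI, rule conjI, assumption, simp add: algebra_simps del: pathw.simps)
    qed
    then show ?thesis by (simp add: G_def del: pathw.simps)
  next
    case False
    then show ?thesis using Suc.prems by simp
  qed
qed

text \<open>A path from \<open>x\<close> to \<open>z\<close> through \<open>y\<close> makes at least
  \<open>\<bar>x - y\<bar> + \<bar>y - z\<bar>\<close> jumps, so paths with \<open>k\<close> jumps
  cannot visit \<open>B - B'\<close>.\<close>

lemma pathw_eq_if_unreachable:
  assumes "B' \<subseteq> B" "\<And>y. y \<in> B - B' \<Longrightarrow> int k < \<bar>x - y\<bar> + \<bar>y - z\<bar>" "0 \<le> t"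
  shows "pathw B c z k t x = pathw B' c z k t x"
  using assms(2,3)
proof (induction k arbitrary: t x)
  case 0
  then show ?case using assms(1) by fastforce
next
  case (Suc k)
  have zero: "pathw A c z k t x = 0" if "int k < \<bar>x - z\<bar>" for A k x t
    using that
  proof (induction k arbitrary: t x)
    case (Suc k)
    then have "pathw A c z k s (x + 1) = 0" "pathw A c z k s (x - 1) = 0" for s
      by (intro Suc.IH; simp)+
    then show ?case by simp
  qed auto
  show ?case
  proof (cases "x \<in> B")
    case True
    show ?thesis
    proof (cases "x \<in> B'")
      case True
      have "pathw B c z k s (x + 1) = pathw B' c z k s (x + 1)" "pathw B c z k s (x - 1) = pathw B' c z k s (x - 1)" if "0 \<le> s" for s
        using Suc.prems(1) that by (intro Suc.IH; fastforce)+
      then show ?thesis using True \<open>x \<in> B\<close>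
        by (auto intro!: arg_cong[where f="\<lambda>u. exp _ * u"] integral_cong)
    next
      case False
      \<comment> \<open>The hypothesis at \<open>y = x\<close>: a path that starts in the removed
        set cannot even reach \<open>z\<close>.\<close>
      then have "int (Suc k) < \<bar>x - z\<bar>" using Suc.prems(1)[of x] True by simp
      from zero[OF this] show ?thesis by metis
    qed
  next
    case False
    then show ?thesis using assms(1) by auto
  qed
qed

section \<open>Eigenfunctions from continued fractions\<close>

text \<open>Quotients of consecutive values of a solution of \<open>h (k + 1) + h (k - 1) = (\<lambda> - c k) h k\<close> obey this recursion.\<close>
primrec cfrac :: "real \<Rightarrow> (nat \<Rightarrow> real) \<Rightarrow> nat \<Rightarrow> real" where
  "cfrac b e 0 = b"
| "cfrac b e (Suc k) = 1 / (e k - cfrac b e k)"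

text \<open>The interval from 0 to \<open>2 / g\<close> is invariant under one step: for
  \<open>g \<ge> 4\<close> the denominator is at least \<open>g - 2 / g \<ge> g / 2\<close>.\<close>

lemma cfrac_bounds:
  assumes g: "4 \<le> g" and e: "\<And>j. j < k \<Longrightarrow> g \<le> e j" and b: "0 \<le> b" "b \<le> 2 / g"
  shows "0 \<le> cfrac b e k" "cfrac b e k \<le> 2 / g"
proof -
  have "0 \<le> cfrac b e k \<and> cfrac b e k \<le> 2 / g" using e
  proof (induction k)
    case 0 then show ?case using b by simp
  next
    case (Suc k)
    have "2 / g \<le> g / 2" using g by (simp add: divide_simps mult_mono[of 2 g 2 g, simplified])
    then have "g / 2 \<le> e k - cfrac b e k" using Suc.IH Suc.prems(1)[of k] Suc.prems by force
    then show ?case using g by (auto simp: field_simps)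
  qed
  then show "0 \<le> cfrac b e k" "cfrac b e k \<le> 2 / g" by auto
qed

lemma cfrac_denominator:
  assumes g: "4 \<le> g" and e: "\<And>j. j \<le> k \<Longrightarrow> g \<le> e j" and b: "0 \<le> b" "b \<le> 2 / g"
  shows "g / 2 \<le> e k - cfrac b e k"
proof -
  have "2 / g \<le> g / 2" using g by (simp add: divide_simps mult_mono[of 2 g 2 g, simplified])
  then show ?thesis using cfrac_bounds[OF g, of k e b] e b by fastforce
qed

lemma cfrac_pos:
  assumes g: "4 \<le> g" and e: "\<And>j. j \<le> k \<Longrightarrow> g \<le> e j" and b: "0 \<le> b" "b \<le> 2 / g"
  shows "0 < cfrac b e (Suc k)"
proof -
  have "g / 2 \<le> e k - cfrac b e k" by (rule cfrac_denominator[OF g e b])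
  then show ?thesis using g by simp
qed

lemma cfrac_mono:
  assumes g: "4 \<le> g" and e: "\<And>j. j < k \<Longrightarrow> g \<le> e' j" "\<And>j. j < k \<Longrightarrow> e' j \<le> e j" and b: "0 \<le> b" "b \<le> b'" "b' \<le> 2 / g"
  shows "cfrac b e k \<le> cfrac b' e' k"
  using e
proof (induction k)
  case (Suc k)
  have "cfrac b e k \<le> cfrac b' e' k" using Suc by auto
  moreover have "g / 2 \<le> e' k - cfrac b' e' k"
    using Suc.prems b by (intro cfrac_denominator g) auto
  moreover have "e' k \<le> e k" using Suc.prems by simp
  ultimately show ?case using g by (auto intro!: divide_left_mono mult_pos_pos)
qed (use b in simp)

text \<open>The difference of two reciprocals is the product of the reciprocals times the difference
  of the denominators. A perturbation thus passes one step with a factor of at most 4 / g^2.\<close>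

lemma cfrac_diff:
  assumes g: "4 \<le> g" and e: "\<And>j. j \<le> k \<Longrightarrow> g \<le> e j" "\<And>j. j \<le> k \<Longrightarrow> g \<le> e' j"
    and b: "0 \<le> b" "b \<le> 2 / g" "0 \<le> b'" "b' \<le> 2 / g"
  shows "cfrac b e (Suc k) - cfrac b' e' (Suc k) =
    cfrac b e (Suc k) * cfrac b' e' (Suc k) * ((e' k - e k) + (cfrac b e k - cfrac b' e' k))"
  using cfrac_denominator[of g k e b] cfrac_denominator[of g k e' b'] assms by (simp add: divide_simps)

text \<open>Each step multiplies the difference by a product of two ratios, hence by at most 4 /
  g^2. For this reason the ratio at the peak hardly feels anything more than a few sites
  away.\<close>

lemma cfrac_contraction:
  assumes g: "4 \<le> g" and e: "\<And>j. j < k \<Longrightarrow> g \<le> e j" and b: "0 \<le> b" "b \<le> b'" "b' \<le> 2 / g"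
  shows "cfrac b' e k - cfrac b e k \<le> (4 / g\<^sup>2) ^ k * (b' - b)"
  using e
proof (induction k)
  case (Suc k)
  have mono: "cfrac b e k \<le> cfrac b' e k" by (rule cfrac_mono[OF g]) (use Suc.prems b in auto)
  have "cfrac b' e (Suc k) - cfrac b e (Suc k) = (cfrac b' e (Suc k) * cfrac b e (Suc k)) * (cfrac b' e k - cfrac b e k)"
    using cfrac_diff[OF g, of k e e b' b] Suc.prems b by simp
  also have "\<dots> \<le> (2 / g * (2 / g)) * ((4 / g\<^sup>2) ^ k * (b' - b))"
  proof (rule mult_mono)
    show "cfrac b' e (Suc k) * cfrac b e (Suc k) \<le> 2 / g * (2 / g)"
      using Suc.prems b g by (intro mult_mono cfrac_bounds[OF g]) auto
    show "cfrac b' e k - cfrac b e k \<le> (4 / g\<^sup>2) ^ k * (b' - b)" using Suc by auto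
  qed (use mono g in auto)
  finally show ?case by (simp add: power2_eq_square)
qed simp

text \<open>The last steps, those nearest to the peak, form a fraction of their own, started from
  the value reached so far; contraction is applied to these alone.\<close>

lemma cfrac_shift: "cfrac b e (m + k) = cfrac (cfrac b e m) (\<lambda>j. e (m + j)) k"
  by (induction k) auto

lemma cfrac_cong: "(\<And>j. j < k \<Longrightarrow> e j = e' j) \<Longrightarrow> cfrac b e k = cfrac b e' k"
  by (induction k) auto

lemma cfrac_continuous:
  assumes g: "4 \<le> g" and e: "\<And>j s. j < k \<Longrightarrow> s \<in> S \<Longrightarrow> g \<le> s - p j" and b: "0 \<le> b" "b \<le> 2 / g"
  shows "continuous_on S (\<lambda>s. cfrac b (\<lambda>j. s - p j) k)"
  using e
proof (induction k)
  case (Suc k)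
  have "s - p k - cfrac b (\<lambda>j. s - p j) k \<noteq> 0" if "s \<in> S" for s
    using cfrac_denominator[OF g, of k "\<lambda>j. s - p j" b] Suc.prems that b g by force
  then show ?case using Suc by (auto intro!: continuous_intros)
qed simp

text \<open>For an eigenfunction equal to 1 at the peak, the equation there says that
  \<open>s - C\<close> is the sum of the two neighbouring values, each a continued fraction started
  from the Dirichlet value 0. Both lie between 0 and \<open>2 / g\<close>, so the intermediate value
  theorem applies between \<open>C\<close> and \<open>C + 4 / g\<close>.\<close>

lemma window_eigenvalue:
  assumes g: "4 \<le> g" and p: "\<And>j. j < d \<Longrightarrow> p j \<le> C - g" and q: "\<And>j. j < d \<Longrightarrow> q j \<le> C - g"
  obtains s where "C \<le> s" "s \<le> C + 4 / g"
    "s - C = cfrac 0 (\<lambda>j. s - p j) d + cfrac 0 (\<lambda>j. s - q j) d"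
proof -
  let ?F = "\<lambda>s. s - C - (cfrac 0 (\<lambda>j. s - p j) d + cfrac 0 (\<lambda>j. s - q j) d)"
  have b: "0 \<le> cfrac 0 (\<lambda>j. s - p j) d" "cfrac 0 (\<lambda>j. s - p j) d \<le> 2 / g"
     "0 \<le> cfrac 0 (\<lambda>j. s - q j) d" "cfrac 0 (\<lambda>j. s - q j) d \<le> 2 / g" if "C \<le> s" for s
    using p q g that by (intro cfrac_bounds[OF g]; fastforce)+
  have "continuous_on {C..C + 4 / g} ?F"
    using p q g by (intro continuous_intros cfrac_continuous[OF g]) fastforce+
  moreover have "?F C \<le> 0" using b[of C] by simp
  moreover have "0 \<le> ?F (C + 4 / g)" using b[of "C + 4 / g"] g by (simp add: field_simps)
  moreover have "C \<le> C + 4 / g" using g by simp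
  ultimately obtain s where "C \<le> s" "s \<le> C + 4 / g" "?F s = 0" using IVT'[of ?F C 0 "C + 4 / g"] by auto
  then show ?thesis using that by auto
qed

text \<open>Value at distance \<open>j\<close> from the peak, where it equals 1, of the solution
  with ratio \<open>b\<close> at distance \<open>K\<close>. Beyond \<open>K\<close> the truncated
  subtraction stays at 0 and the function continues with ratio \<open>b\<close>: it vanishes for
  \<open>b = 0\<close>, a Dirichlet condition, and decays geometrically for
  \<open>b = 2 / g\<close>.\<close>

definition hprod :: "real \<Rightarrow> (nat \<Rightarrow> real) \<Rightarrow> nat \<Rightarrow> nat \<Rightarrow> real" where
  "hprod b e K j = (\<Prod>i<j. cfrac b e (K - i))"

lemma hprod_0 [simp]: "hprod b e K 0 = 1" by (simp add: hprod_def)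
lemma hprod_1: "hprod b e K (Suc 0) = cfrac b e K" by (simp add: hprod_def)
lemma hprod_Suc: "hprod b e K (Suc j) = hprod b e K j * cfrac b e (K - j)" by (simp add: hprod_def)

lemma hprod_full: "hprod b e K K = (\<Prod>k<K. cfrac b e (Suc k))"
  unfolding hprod_def by (rule prod.reindex_bij_witness[of _ "\<lambda>k. K - Suc k" "\<lambda>k. K - Suc k"]) (auto simp: Suc_diff_Suc)

context
  fixes g b :: real and e :: "nat \<Rightarrow> real" and K :: nat
  assumes g: "4 \<le> g" and e: "\<And>j. j < K \<Longrightarrow> g \<le> e j" and b: "0 \<le> b" "b \<le> 2 / g"
begin

lemma hprod_nonneg: "0 \<le> hprod b e K j"
  unfolding hprod_def using e by (intro prod_nonneg cfrac_bounds[OF g _ b]) fastforce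

lemma hprod_step: "hprod b e K (Suc j) \<le> 2 / g * hprod b e K j"
proof -
  have "cfrac b e (K - j) \<le> 2 / g" using e by (intro cfrac_bounds[OF g _ b]) fastforce
  from mult_left_mono[OF this hprod_nonneg[of j]] show ?thesis by (simp add: hprod_Suc mult.commute)
qed

lemma hprod_recurrence:
  assumes "j < K"
  shows "hprod b e K j + hprod b e K (Suc (Suc j)) = e (K - Suc j) * hprod b e K (Suc j)"
proof -
  obtain i where i: "K - j = Suc i" "K - Suc j = i" using assms by (metis Suc_diff_Suc)
  have d: "g / 2 \<le> e i - cfrac b e i"
    using e i by (intro cfrac_denominator[OF g _ b]) auto
  have "hprod b e K (Suc j) * (e i - cfrac b e i) = hprod b e K j"
    using d g by (simp add: hprod_Suc i)
  then show ?thesis by (simp add: hprod_Suc[of _ _ _ "Suc j"] i algebra_simps)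
qed

lemma hprod_tail:
  assumes "K \<le> j" "0 < b"
  shows "hprod b e K j + hprod b e K (Suc (Suc j)) = (1 / b + b) * hprod b e K (Suc j)"
  using assms by (simp add: hprod_Suc field_simps)

lemma hprod_zero: "b = 0 \<Longrightarrow> K < j \<Longrightarrow> hprod b e K j = 0"
  unfolding hprod_def by (rule prod_zero) (auto intro!: bexI[of _ K])

lemma hprod_le_1: "hprod b e K j \<le> 1"
proof (induction j)
  case (Suc j)
  have "hprod b e K (Suc j) \<le> 2 / g * hprod b e K j" by (rule hprod_step)
  also have "\<dots> \<le> 1 * 1" using Suc g hprod_nonneg by (intro mult_mono) auto
  finally show ?case by simp
qed simp

end

section \<open>Super- and subsolutions around a peak\<close>

lemma two_sided_cases:
  fixes x n :: int
  obtains "x = n" | j where "x = n - int (Suc j)" | j where "x = n + int (Suc j)"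
proof -
  consider "x = n" | "x < n" | "n < x" by linarith
  then show ?thesis
  proof cases
    case 2 then show ?thesis using that(2)[of "nat (n - x) - 1"] by simp
  next
    case 3 then show ?thesis using that(3)[of "nat (x - n) - 1"] by simp
  qed (use that in auto)
qed

definition two_sided :: "(nat \<Rightarrow> real) \<Rightarrow> (nat \<Rightarrow> real) \<Rightarrow> int \<Rightarrow> int \<Rightarrow> real" where
  "two_sided u v n x = (if x \<le> n then u (nat (n - x)) else v (nat (x - n)))"

lemma two_sided_at:
  "two_sided u v n n = u 0"
  "two_sided u v n (n - int (Suc j)) = u (Suc j)"
  "two_sided u v n (n + int (Suc j)) = v (Suc j)"
  "two_sided u v n (n + 1) = v 1" "two_sided u v n (n - 1) = u 1"
  "u 0 = v 0 \<Longrightarrow> two_sided u v n (n - int (Suc j) + 1) = u j"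
  "two_sided u v n (n - int (Suc j) - 1) = u (Suc (Suc j))"
  "u 0 = v 0 \<Longrightarrow> two_sided u v n (n + int (Suc j) - 1) = v j"
  "two_sided u v n (n + int (Suc j) + 1) = v (Suc (Suc j))"
  unfolding two_sided_def
  by (auto simp: nat_add_distrib Suc_nat_eq_nat_zadd1 intro!: arg_cong[where f=u] arg_cong[where f=v])

text \<open>The supersolution is the two-sided product with end ratio \<open>b = 2 / g\<close>.
  Inside the box the equation is exact off the peak; beyond the box the product solves it with
  \<open>1 / b + b\<close> in place of \<open>s - c x\<close>, and \<open>1 / b + b \<le> g\<close>
  is covered by the gap; at \<open>n\<close> the inequality is \<open>eig\<close>.\<close>

theorem pathsum_upper:
  fixes c :: "int \<Rightarrow> real"
  assumes g: "4 \<le> g" and gap: "\<And>x. x \<in> B \<Longrightarrow> x \<noteq> n \<Longrightarrow> g \<le> s - c x" and box: "{n - int K..n + int d} \<subseteq> B"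
    and eig: "cfrac (2 / g) (\<lambda>k. s - c (n - int K + int k)) K + cfrac (2 / g) (\<lambda>k. s - c (n + int d - int k)) d \<le> s - c n"
    and t: "0 \<le> t"
  shows "pathsum B c n k t (n - int K) \<le> exp (s * t) * (\<Prod>k<K. cfrac (2 / g) (\<lambda>k. s - c (n - int K + int k)) (Suc k))"
proof -
  define b where "b = 2 / g"
  define eL where "eL = (\<lambda>k. s - c (n - int K + int k))"
  define eR where "eR = (\<lambda>k. s - c (n + int d - int k))"
  define \<phi> where "\<phi> = two_sided (hprod b eL K) (hprod b eR d) n"
  have b: "0 < b" "0 \<le> b" "b \<le> 2 / g" using g by (auto simp: b_def)
  have eL: "g \<le> eL j" if "j < K" for j unfolding eL_def using that box by (intro gap) auto
  have eR: "g \<le> eR j" if "j < d" for j unfolding eR_def using that box by (intro gap) auto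
  note L = eL b(2,3) and R = eR b(2,3)
  have nnL: "0 \<le> hprod b eL K i" and nnR: "0 \<le> hprod b eR d i" for i
    by (rule hprod_nonneg[OF g L], assumption) (rule hprod_nonneg[OF g R])
  have bg: "1 / b + b \<le> g"
  proof -
    have "2 / g \<le> g / 2" using g by (simp add: divide_simps mult_mono[of 2 g 2 g, simplified])
    then show ?thesis by (simp add: b_def)
  qed
  have "pathsum B c n k t (n - int K) \<le> exp (s * t) * \<phi> (n - int K)"
  proof (rule pathsum_le_supersolution[OF _ _ _ t])
    show "0 \<le> \<phi> x" for x
      using nnL nnR by (simp add: \<phi>_def two_sided_def)
    show "1 \<le> \<phi> n" by (simp add: \<phi>_def two_sided_at)
    fix x assume x: "x \<in> B"
    show "\<phi> (x + 1) + \<phi> (x - 1) \<le> (s - c x) * \<phi> x"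
    proof (cases x n rule: two_sided_cases)
      case 1
      have "\<phi> (n + 1) = cfrac b eR d" "\<phi> (n - 1) = cfrac b eL K" "\<phi> n = 1"
        unfolding \<phi>_def two_sided_at by (simp_all add: hprod_1)
      then show ?thesis using eig[folded eL_def eR_def b_def] 1 by simp
    next
      case (2 j)
      have "\<phi> (x + 1) + \<phi> (x - 1) = hprod b eL K j + hprod b eL K (Suc (Suc j))"
        unfolding \<phi>_def 2 by (simp add: two_sided_at[where u="hprod b eL K" and v="hprod b eR d", simplified])
      also have "\<dots> \<le> (s - c x) * hprod b eL K (Suc j)"
      proof (cases "j < K")
        case True
        then have "eL (K - Suc j) = s - c x" unfolding eL_def 2 by (simp add: of_nat_diff algebra_simps)
        then show ?thesis using hprod_recurrence[OF g L True] by simp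
      next
        case False
        have "(1 / b + b) * hprod b eL K (Suc j) \<le> (s - c x) * hprod b eL K (Suc j)"
          using nnL[of "Suc j"] gap[OF x] 2 bg by (intro mult_right_mono) auto
        moreover have "hprod b eL K j + hprod b eL K (Suc (Suc j)) = (1 / b + b) * hprod b eL K (Suc j)"
          by (rule hprod_tail[OF g L _ b(1)]) (use False in auto)
        ultimately show ?thesis by simp
      qed
      finally show ?thesis unfolding \<phi>_def 2 by (simp only: two_sided_at)
    next
      case (3 j)
      have "\<phi> (x + 1) + \<phi> (x - 1) = hprod b eR d j + hprod b eR d (Suc (Suc j))"
        unfolding \<phi>_def 3 by (simp add: two_sided_at[where u="hprod b eL K" and v="hprod b eR d", simplified])
      also have "\<dots> \<le> (s - c x) * hprod b eR d (Suc j)"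
      proof (cases "j < d")
        case True
        then have "eR (d - Suc j) = s - c x" unfolding eR_def 3 by (simp add: of_nat_diff algebra_simps)
        then show ?thesis using hprod_recurrence[OF g R True] by simp
      next
        case False
        have "(1 / b + b) * hprod b eR d (Suc j) \<le> (s - c x) * hprod b eR d (Suc j)"
          using nnR[of "Suc j"] gap[OF x] 3 bg by (intro mult_right_mono) auto
        moreover have "hprod b eR d j + hprod b eR d (Suc (Suc j)) = (1 / b + b) * hprod b eR d (Suc j)"
          by (rule hprod_tail[OF g R _ b(1)]) (use False in auto)
        ultimately show ?thesis by simp
      qed
      finally show ?thesis unfolding \<phi>_def 3 by (simp only: two_sided_at)
    qed
  qed
  also have "\<phi> (n - int K) = hprod b eL K K" by (simp add: \<phi>_def two_sided_def)
  finally show ?thesis by (simp only: hprod_full eL_def b_def)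
qed

text \<open>The Dirichlet eigenfunction \<open>\<phi>\<close> lies above the initial condition away
  from \<open>n\<close>. Subtracting \<open>exp (- \<theta> * t) * \<zeta>\<close> repairs this:
  \<open>\<zeta>\<close> is 0 at \<open>n\<close> and at least \<open>\<phi>\<close> elsewhere, and
  it decays relative to \<open>exp (s * t)\<close> because it lives where the potential is at least
  \<open>g\<close> below \<open>s\<close>. The part of it that flows into the peak lowers the
  amplitude \<open>A\<close> from 1 to no less than \<open>1 - \<kappa>\<close>. At the starting
  site, at distance \<open>K\<close>, the correction is the term with \<open>2 ^ K\<close>.\<close>

theorem pathsum_lower:
  fixes c :: "int \<Rightarrow> real"
  assumes g: "8 \<le> g" and gap: "\<And>x. n - int K \<le> x \<Longrightarrow> x \<le> n + int d \<Longrightarrow> x \<noteq> n \<Longrightarrow> g \<le> s - c x" and K: "0 < K"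
    and eig: "s - c n \<le> cfrac 0 (\<lambda>k. s - c (n - int K + int k)) K + cfrac 0 (\<lambda>k. s - c (n + int d - int k)) d"
    and cs: "c n \<le> s"
    and t: "0 \<le> t" and U: "\<And>k. pathsum {n - int K..n + int d} c n k t (n - int K) \<le> U"
  shows "exp (s * t) * (\<Prod>k<K. cfrac 0 (\<lambda>k. s - c (n - int K + int k)) (Suc k)) * (1 - 64 / g\<^sup>2 - 2 ^ K * exp (- (g * t / 8))) \<le> U"
proof -
  define B where "B = {n - int K..n + int d}"
  define eL where "eL = (\<lambda>k. s - c (n - int K + int k))"
  define eR where "eR = (\<lambda>k. s - c (n + int d - int k))"
  define u where "u = hprod 0 eL K"
  define v where "v = hprod 0 eR d"
  define \<phi> where "\<phi> = two_sided u v n"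
  \<comment> \<open>The rate \<open>g / 8\<close> and the weights \<open>2 ^ j\<close> below are
    matched in \<open>weighted\<close>: neighbouring values shrink by
    \<open>2 / g \<le> 1 / 4\<close>, which leaves room for both.\<close>
  define \<theta> where "\<theta> = g / 8"
  define u' where "u' j = (if j = 0 then 0 else 2 ^ j * u j)" for j :: nat
  define v' where "v' j = (if j = 0 then 0 else 2 ^ j * v j)" for j :: nat
  define \<zeta> where "\<zeta> = two_sided u' v' n"
  define \<kappa> where "\<kappa> = (\<zeta> (n + 1) + \<zeta> (n - 1)) / \<theta>"
  define A where "A t = 1 - \<kappa> * (1 - exp (- \<theta> * t))" for t
  define L where "L t x = exp (s * t) * (A t * \<phi> x - exp (- \<theta> * t) * \<zeta> x)" for t x
  define L' where "L' t x = s * L t x + exp (s * t) * (- \<kappa> * \<theta> * exp (- \<theta> * t) * \<phi> x + \<theta> * exp (- \<theta> * t) * \<zeta> x)" for t x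
  have g4: "4 \<le> g" using g by simp
  have b: "(0::real) \<le> 0" "0 \<le> 2 / g" using g by auto
  have eL: "g \<le> eL j" if "j < K" for j unfolding eL_def using that by (intro gap) auto
  have eR: "g \<le> eR j" if "j < d" for j unfolding eR_def using that by (intro gap) auto
  note HL = g4 eL b and HR = g4 eR b
  have \<theta>: "0 < \<theta>" using g by (simp add: \<theta>_def)
  have u0: "u 0 = 1" "v 0 = 1" "u' 0 = 0" "v' 0 = 0" by (auto simp: u_def v_def u'_def v'_def)
  have uvnn: "0 \<le> u j" "0 \<le> v j" "u j \<le> 1" "v j \<le> 1" for j
    using hprod_nonneg[OF HL] hprod_nonneg[OF HR] hprod_le_1[OF HL] hprod_le_1[OF HR] by (auto simp: u_def v_def)
  have uv'nn: "0 \<le> u' j" "0 \<le> v' j" for j using uvnn by (auto simp: u'_def v'_def)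
  have nn: "0 \<le> \<phi> x" "0 \<le> \<zeta> x" "\<phi> x \<le> 1" for x
    using uvnn uv'nn by (auto simp: \<phi>_def \<zeta>_def two_sided_def)
  have step: "u (Suc j) \<le> 2 / g * u j" "v (Suc j) \<le> 2 / g * v j" for j
    using hprod_step[OF HL] hprod_step[OF HR] by (auto simp: u_def v_def)
  have zero: "K < j \<Longrightarrow> u j = 0" "d < j \<Longrightarrow> v j = 0" for j
    using hprod_zero[OF HL] hprod_zero[OF HR] by (auto simp: u_def v_def)
  have out: "\<phi> x = 0" "\<zeta> x = 0" if "x \<notin> B" for x
  proof -
    have "x < n - int K \<or> n + int d < x" using that by (auto simp: B_def)
    then have "x \<le> n \<and> K < nat (n - x) \<or> \<not> x \<le> n \<and> d < nat (x - n)" by linarith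
    then show "\<phi> x = 0" "\<zeta> x = 0"
      unfolding \<phi>_def \<zeta>_def two_sided_def u'_def v'_def using zero by auto
  qed
  have \<kappa>0: "0 \<le> \<kappa>" using nn \<theta> by (simp add: \<kappa>_def)
  have \<kappa>: "\<kappa> \<le> 64 / g\<^sup>2"
  proof -
    have "\<zeta> (n + 1) + \<zeta> (n - 1) \<le> 8 / g"
      using step(1)[of 0] step(2)[of 0] by (simp add: \<zeta>_def two_sided_at u0 u'_def v'_def)
    then have "\<kappa> \<le> (8 / g) / (g / 8)" unfolding \<kappa>_def \<theta>_def using g by (intro divide_right_mono) auto
    then show ?thesis by (simp add: power2_eq_square)
  qed
  have \<kappa>1: "\<kappa> \<le> 1"
  proof -
    have "8 * 8 \<le> g * g" using g by (intro mult_mono) auto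
    then have "64 / g\<^sup>2 \<le> 1" using g by (simp add: power2_eq_square)
    then show ?thesis using \<kappa> by simp
  qed
  have A: "1 - \<kappa> \<le> A t" "0 \<le> A t" "A t \<le> 1" if "0 \<le> t" for t
  proof -
    have "0 \<le> 1 - exp (- \<theta> * t)" "1 - exp (- \<theta> * t) \<le> 1" using that \<theta> by auto
    then have "\<kappa> * (1 - exp (- \<theta> * t)) \<le> \<kappa> * 1" "0 \<le> \<kappa> * (1 - exp (- \<theta> * t))"
      using \<kappa>0 by (intro mult_left_mono mult_nonneg_nonneg; simp)+
    then show "1 - \<kappa> \<le> A t" "0 \<le> A t" "A t \<le> 1" using \<kappa>1 by (auto simp: A_def)
  qed
  have weighted: "w' j + w' (Suc (Suc j)) \<le> (a - \<theta>) * w' (Suc j)"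
    if "w j + w (Suc (Suc j)) = a * w (Suc j)" "w (Suc j) \<le> 2 / g * w j" "w (Suc (Suc j)) \<le> 2 / g * w (Suc j)"
       "0 \<le> w j" "0 \<le> w (Suc j)" "w' = (\<lambda>j. if j = 0 then 0 else 2 ^ j * w j)" for a w w' j
  proof -
    have q: "2 / g * y \<le> 1 / 4 * y" if "0 \<le> y" for y
      using g that by (intro mult_right_mono) (auto simp: field_simps)
    have "w (Suc (Suc j)) \<le> (1/4) * w (Suc j)" "w (Suc j) \<le> (1/4) * w j"
      using q[of "w (Suc j)"] q[of "w j"] that(2-5) by linarith+
    moreover have "\<theta> * w (Suc j) \<le> (1/4) * w j"
      using that(2) g mult_left_mono[OF that(2), of \<theta>] by (simp add: \<theta>_def)
    ultimately have "2 ^ j * (w j + 4 * w (Suc (Suc j))) \<le> 2 ^ j * (2 * (a - \<theta>) * w (Suc j))"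
      using that by (intro mult_left_mono) (auto simp: algebra_simps)
    moreover have "w' j \<le> 2 ^ j * w j" using that by auto
    ultimately show ?thesis using that(6) by (simp add: algebra_simps)
  qed
  have inner: "\<phi> (x + 1) + \<phi> (x - 1) = (s - c x) * \<phi> x \<and> \<zeta> (x + 1) + \<zeta> (x - 1) \<le> (s - c x - \<theta>) * \<zeta> x"
    if x: "x \<in> B" "x \<noteq> n" for x
  proof (cases x n rule: two_sided_cases)
    case 1 then show ?thesis using x by simp
  next
    case (2 j)
    then have j: "j < K" using x by (auto simp: B_def)
    have e: "eL (K - Suc j) = s - c x" unfolding eL_def 2 using j by (simp add: of_nat_diff algebra_simps)
    have r: "u j + u (Suc (Suc j)) = (s - c x) * u (Suc j)"
      using hprod_recurrence[OF HL j] e by (simp add: u_def)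
    moreover have "u' j + u' (Suc (Suc j)) \<le> (s - c x - \<theta>) * u' (Suc j)"
      using r step uvnn by (intro weighted[where w=u]) (auto simp: u'_def)
    ultimately show ?thesis unfolding \<phi>_def \<zeta>_def 2 by (simp only: two_sided_at u0)
  next
    case (3 j)
    then have j: "j < d" using x by (auto simp: B_def)
    have e: "eR (d - Suc j) = s - c x" unfolding eR_def 3 using j by (simp add: of_nat_diff algebra_simps)
    have r: "v j + v (Suc (Suc j)) = (s - c x) * v (Suc j)"
      using hprod_recurrence[OF HR j] e by (simp add: v_def)
    moreover have "v' j + v' (Suc (Suc j)) \<le> (s - c x - \<theta>) * v' (Suc j)"
      using r step uvnn by (intro weighted[where w=v]) (auto simp: v'_def)
    ultimately show ?thesis unfolding \<phi>_def \<zeta>_def 3 by (simp only: two_sided_at u0) (simp only: add.commute)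
  qed
  have Ld: "((\<lambda>t. L t x) has_real_derivative L' t x) (at t)" for t x
    unfolding L_def L'_def A_def by (rule derivative_eq_intros refl | simp add: algebra_simps)+
  have "L t (n - int K) \<le> U"
  proof (rule subsolution_le_pathsum_limit[where L=L and T=t and L'=L' and B=B and z=n and c=c and M="exp (\<bar>s\<bar> * t)" and C="\<bar>s\<bar>"])
    show "n \<in> B" by (simp add: B_def)
    show "continuous_on {0..t} (\<lambda>t. L t x)" for x
      using Ld by (auto intro!: DERIV_continuous_on intro: has_field_derivative_at_within)
    show "((\<lambda>t. L t x) has_real_derivative L' r x) (at r)" for x r by (rule Ld)
    show "L r x \<le> 0" if "x \<notin> B" for r x using out[OF that] by (simp add: L_def)
    show "L 0 x \<le> (if x = n then 1 else 0)" for x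
    proof (cases x n rule: two_sided_cases)
      case (2 j)
      have "u (Suc j) * 1 \<le> u (Suc j) * 2 ^ Suc j" using uvnn by (intro mult_left_mono one_le_power) auto
      moreover have "\<phi> x = u (Suc j)" "\<zeta> x = 2 ^ Suc j * u (Suc j)" "x \<noteq> n"
        unfolding \<phi>_def \<zeta>_def 2 two_sided_at by (simp_all add: u'_def)
      ultimately show ?thesis unfolding L_def A_def by (simp add: mult.commute)
    next
      case (3 j)
      have "v (Suc j) * 1 \<le> v (Suc j) * 2 ^ Suc j" using uvnn by (intro mult_left_mono one_le_power) auto
      moreover have "\<phi> x = v (Suc j)" "\<zeta> x = 2 ^ Suc j * v (Suc j)" "x \<noteq> n"
        unfolding \<phi>_def \<zeta>_def 3 two_sided_at by (simp_all add: v'_def)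
      ultimately show ?thesis unfolding L_def A_def by (simp add: mult.commute)
    qed (simp add: L_def A_def \<phi>_def \<zeta>_def two_sided_at u0)
    show "L r x \<le> exp (\<bar>s\<bar> * t)" if "0 \<le> r" "r \<le> t" for r x
    proof -
      have "A r * \<phi> x - exp (- \<theta> * r) * \<zeta> x \<le> 1 * 1 - 0"
        using A[OF that(1)] nn by (intro diff_mono mult_mono) auto
      then have "L r x \<le> exp (s * r) * 1" unfolding L_def by (intro mult_left_mono) auto
      also have "s * r \<le> \<bar>s\<bar> * t" using that by (intro order_trans[OF mult_right_mono[of s "\<bar>s\<bar>"] mult_left_mono]) auto
      finally show ?thesis by simp
    qed
    show "c x \<le> \<bar>s\<bar>" if "x \<in> B" for x
      using gap[of x] that cs g by (cases "x = n") (auto simp: B_def)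
    show "pathsum B c n k t (n - int K) \<le> U" for k using U by (simp add: B_def)
    fix x r assume x: "x \<in> B" and r: "0 < r" "r < t"
    define E where "E = exp (- \<theta> * r)"
    have E: "0 \<le> E" by (simp add: E_def)
    have "s * (A r * \<phi> x - E * \<zeta> x) + (- \<kappa> * \<theta> * E * \<phi> x + \<theta> * E * \<zeta> x)
      \<le> c x * (A r * \<phi> x - E * \<zeta> x) + (A r * \<phi> (x + 1) - E * \<zeta> (x + 1)) + (A r * \<phi> (x - 1) - E * \<zeta> (x - 1))"
    proof (cases "x = n")
      case False
      have 1: "A r * (\<phi> (x + 1) + \<phi> (x - 1)) = A r * ((s - c x) * \<phi> x)"
        using inner[OF x False] by simp
      have 2: "E * (\<zeta> (x + 1) + \<zeta> (x - 1)) \<le> E * ((s - c x - \<theta>) * \<zeta> x)"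
        using inner[OF x False] E by (intro mult_left_mono) auto
      have "0 \<le> \<kappa> * \<theta> * E * \<phi> x" using \<kappa>0 \<theta> E nn by simp
      then show ?thesis using 1 2 by (simp add: algebra_simps)
    next
      case True
      have \<phi>n: "\<phi> n = 1" "\<zeta> n = 0" by (auto simp: \<phi>_def \<zeta>_def two_sided_at u0)
      have "s - c n \<le> \<phi> (n + 1) + \<phi> (n - 1)"
        using eig[folded eL_def eR_def] unfolding \<phi>_def two_sided_at u_def v_def by (simp add: hprod_1)
      then have "A r * (s - c n) \<le> A r * (\<phi> (n + 1) + \<phi> (n - 1))"
        using A r by (intro mult_left_mono) auto
      \<comment> \<open>Origin of \<open>\<kappa>\<close>: the decrease of \<open>A\<close> pays
        exactly for the flow of \<open>\<zeta>\<close> into the peak.\<close>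
      moreover have "\<kappa> * \<theta> = \<zeta> (n + 1) + \<zeta> (n - 1)" using \<theta> by (simp add: \<kappa>_def)
      then have "\<kappa> * \<theta> * E = E * (\<zeta> (n + 1) + \<zeta> (n - 1))" by simp
      ultimately show ?thesis unfolding True \<phi>n by (simp add: algebra_simps)
    qed
    from mult_left_mono[OF this, of "exp (s * r)"] show "L' r x \<le> c x * L r x + L r (x + 1) + L r (x - 1)"
      by (simp add: L_def L'_def E_def algebra_simps)
  qed (use t in auto)
  moreover have "exp (s * t) * u K * (1 - 64 / g\<^sup>2 - 2 ^ K * exp (- (g * t / 8))) \<le> L t (n - int K)"
  proof -
    have "\<phi> (n - int K) = u K" "\<zeta> (n - int K) = 2 ^ K * u K"
      using K by (auto simp: \<phi>_def \<zeta>_def two_sided_def u'_def)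
    moreover have "u K * (1 - 64 / g\<^sup>2) \<le> u K * A t"
      using A[OF t] \<kappa> uvnn by (intro mult_left_mono) auto
    ultimately have "u K * (1 - 64 / g\<^sup>2 - 2 ^ K * exp (- (g * t / 8))) \<le> A t * \<phi> (n - int K) - exp (- \<theta> * t) * \<zeta> (n - int K)"
      by (simp add: \<theta>_def algebra_simps)
    from mult_left_mono[OF this, of "exp (s * t)"] show ?thesis by (simp add: L_def mult.assoc)
  qed
  ultimately have "exp (s * t) * u K * (1 - 64 / g\<^sup>2 - 2 ^ K * exp (- (g * t / 8))) \<le> U" by simp
  then show ?thesis by (simp only: u_def hprod_full eL_def)
qed

text \<open>The starting ratio changes the factors by relative amounts at most \<open>q\<close>,
  \<open>q ^ 2\<close> and so on, with q = 4 / g^2 at most 1/4. Their sum is at most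
  \<open>2 * q\<close>, so the error does not grow with \<open>K\<close>.\<close>

lemma cfrac_prod_perturb:
  assumes g: "4 \<le> g" and e: "\<And>j. j < K \<Longrightarrow> g \<le> e j"
  shows "(\<Prod>k<K. cfrac (2 / g) e (Suc k)) \<le> (\<Prod>k<K. cfrac 0 e (Suc k)) * exp (8 / g\<^sup>2)"
proof -
  define q where "q = 4 / g\<^sup>2"
  have "4 * 4 \<le> g * g" using g by (intro mult_mono) auto
  then have q: "0 \<le> q" "q \<le> 1/4" using g by (auto simp: q_def power2_eq_square field_simps)
  have b: "(0::real) \<le> 0" "0 \<le> 2 / g" "0 \<le> 2 / g" "2 / g \<le> 2 / g" using g by auto
  have "(\<Prod>k<K. cfrac (2 / g) e (Suc k)) \<le> (\<Prod>k<K. cfrac 0 e (Suc k) * exp (q ^ Suc k))"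
  proof (rule prod_mono)
    fix k assume "k \<in> {..<K}"
    then have k: "k < K" by simp
    have ek: "g \<le> e j" if "j \<le> k" for j using that k e by auto
    have c1: "0 \<le> cfrac (2 / g) e (Suc k)" "cfrac (2 / g) e (Suc k) \<le> 2 / g" "0 \<le> cfrac 0 e (Suc k)"
      using ek by (intro cfrac_bounds[OF g _ b(3,4)] cfrac_bounds[OF g _ b(1,2)]; simp)+
    have con: "cfrac (2 / g) e k - cfrac 0 e k \<le> q ^ k * (2 / g)"
      using cfrac_contraction[OF g, of k e 0 "2 / g"] ek b by (simp add: q_def)
    have "cfrac (2 / g) e (Suc k) - cfrac 0 e (Suc k) =
        cfrac (2 / g) e (Suc k) * cfrac 0 e (Suc k) * (cfrac (2 / g) e k - cfrac 0 e k)"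
      using cfrac_diff[OF g, of k e e "2 / g" 0] ek b by simp
    also have "\<dots> \<le> (2 / g) * cfrac 0 e (Suc k) * (q ^ k * (2 / g))"
    proof (intro mult_mono con mult_right_mono c1)
      show "0 \<le> cfrac (2 / g) e k - cfrac 0 e k"
        using cfrac_mono[OF g, of k e e 0 "2 / g"] ek b by simp
    qed (use g c1 in auto)
    also have "\<dots> = cfrac 0 e (Suc k) * q ^ Suc k" by (simp add: q_def power2_eq_square)
    finally have "cfrac (2 / g) e (Suc k) \<le> cfrac 0 e (Suc k) * (1 + q ^ Suc k)" by (simp add: algebra_simps del: cfrac.simps)
    also have "\<dots> \<le> cfrac 0 e (Suc k) * exp (q ^ Suc k)"
      using c1 exp_ge_add_one_self[of "q ^ Suc k"] by (intro mult_left_mono) auto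
    finally show "0 \<le> cfrac (2 / g) e (Suc k) \<and> cfrac (2 / g) e (Suc k) \<le> cfrac 0 e (Suc k) * exp (q ^ Suc k)"
      using c1 by simp
  qed
  also have "\<dots> = (\<Prod>k<K. cfrac 0 e (Suc k)) * exp (\<Sum>k<K. q ^ Suc k)"
    by (simp add: prod.distrib exp_sum del: cfrac.simps power_Suc)
  finally have main: "(\<Prod>k<K. cfrac (2 / g) e (Suc k)) \<le> (\<Prod>k<K. cfrac 0 e (Suc k)) * exp (\<Sum>k<K. q ^ Suc k)" .
  have "(\<Sum>k<K. q ^ Suc k) \<le> 8 / g\<^sup>2"
  proof -
    have "(\<Sum>k<K. q ^ Suc k) \<le> q * 2"
    proof -
      have "(1 - q) * (\<Sum>k<K. q ^ k) = 1 - q ^ K" using one_diff_power_eq[of q K] by simp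
      then have "(1 - q) * (\<Sum>k<K. q ^ k) \<le> 1" using q by simp
      moreover have "(1/2) * (\<Sum>k<K. q ^ k) \<le> (1 - q) * (\<Sum>k<K. q ^ k)"
        using q by (intro mult_right_mono sum_nonneg) auto
      ultimately have "(\<Sum>k<K. q ^ k) \<le> 2" by linarith
      then show ?thesis using q by (simp add: sum_distrib_left[symmetric] mult_left_mono)
    qed
    then show ?thesis by (simp add: q_def)
  qed
  moreover have "0 \<le> (\<Prod>k<K. cfrac 0 e (Suc k))"
    by (intro prod_nonneg ballI cfrac_bounds(1)[OF g _ b(1,2)]) (use e in auto)
  ultimately have "(\<Prod>k<K. cfrac 0 e (Suc k)) * exp (\<Sum>k<K. q ^ Suc k) \<le> (\<Prod>k<K. cfrac 0 e (Suc k)) * exp (8 / g\<^sup>2)"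
    by (intro mult_left_mono) auto
  then show ?thesis using main by linarith
qed

text \<open>The same \<open>s\<close>, the eigenvalue of the window of radius \<open>d\<close>,
  appears in both bounds. Extending the left side from \<open>d\<close> to \<open>N\<close> sites
  only raises the ratio at the peak, so \<open>s\<close> remains admissible for the subsolution. For
  the supersolution, closing with ratio \<open>2 / g\<close> overestimates each side by at most
  \<open>(2 / g) ^ (2 * d + 1)\<close>; raising \<open>s\<close> by twice this amount makes up for
  it.\<close>

theorem pathsum_sandwich:
  fixes c :: "int \<Rightarrow> real" and N d :: nat
  defines "n \<equiv> int N"
  defines "eL \<equiv> \<lambda>s k. s - c (int k)"
  defines "H \<equiv> \<lambda>s. \<Prod>k<N. cfrac 0 (eL s) (Suc k)"
  assumes g: "8 \<le> g" and gap: "\<And>x. x \<in> B \<Longrightarrow> x \<noteq> n \<Longrightarrow> c x \<le> c n - g" and box: "{0..n + int d} \<subseteq> B"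
    and N: "0 < N" "d \<le> N" and s: "c n \<le> s" and t: "0 \<le> t"
    and eig: "s - c n = cfrac 0 (\<lambda>k. s - c (n - int d + int k)) d + cfrac 0 (\<lambda>k. s - c (n + int d - int k)) d"
  shows "(\<And>k. pathsum UNIV c n k t 0 \<le> U) \<Longrightarrow> exp (s * t) * H s * (1 - 64 / g\<^sup>2 - 2 ^ N * exp (- (g * t / 8))) \<le> U"
    and "pathsum B c n k t 0 \<le> exp (s * t) * H s * exp (8 / g\<^sup>2 + 2 * (2 / g) ^ (2 * d + 1) * t)"
proof -
  have g4: "4 \<le> g" using g by simp
  have b: "(0::real) \<le> 0" "0 \<le> 2 / g" "2 / g \<le> 2 / g" using g by auto
  define m where "m = N - d"
  have Nm: "N = m + d" using N by (simp add: m_def)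
  define wL where "wL = (\<lambda>k. s - c (n - int d + int k))"
  define wR where "wR = (\<lambda>k. s - c (n + int d - int k))"
  have sh: "(\<lambda>j. eL s (m + j)) = wL" by (auto simp: eL_def wL_def n_def Nm)
  have gL: "g \<le> eL s k" if "k < N" for k
  proof -
    have "c (int k) \<le> c n - g" by (rule gap) (use that box in \<open>auto simp: n_def\<close>)
    then show ?thesis using s by (simp add: eL_def)
  qed
  have gw: "g \<le> wL k" "g \<le> wR k" if "k < d" for k
  proof -
    have "c (n - int d + int k) \<le> c n - g" "c (n + int d - int k) \<le> c n - g"
      by (rule gap; use that box N in \<open>auto simp: n_def\<close>)+
    then show "g \<le> wL k" "g \<le> wR k" using s by (simp_all add: wL_def wR_def)
  qed
  have L: "cfrac b' (eL s) N = cfrac (cfrac b' (eL s) m) wL d" for b'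
    unfolding Nm cfrac_shift sh ..
  have bm: "0 \<le> cfrac b' (eL s) m" "cfrac b' (eL s) m \<le> 2 / g" if "0 \<le> b'" "b' \<le> 2 / g" for b'
    using gL that by (intro cfrac_bounds[OF g4]; simp add: Nm)+
  have eig': "s - c n = cfrac 0 wL d + cfrac 0 wR d" using eig by (simp add: wL_def wR_def)
  { assume U: "\<And>k. pathsum UNIV c n k t 0 \<le> U"
    have "pathsum {0..n + int d} c n k t 0 \<le> U" for k
      using U[of k] sum_mono[of "{..k}" "\<lambda>j. pathw {0..n + int d} c n j t 0" "\<lambda>j. pathw UNIV c n j t 0"] t
      by (force intro: pathw_mono)
    moreover have "cfrac 0 wL d \<le> cfrac 0 (eL s) N"
      unfolding L using gw bm[of 0] b by (intro cfrac_mono[OF g4]) auto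
    ultimately show "exp (s * t) * H s * (1 - 64 / g\<^sup>2 - 2 ^ N * exp (- (g * t / 8))) \<le> U"
      using pathsum_lower[OF g, of n N d s c t U] gap box s t N eig'
      by (fastforce simp: H_def eL_def n_def wR_def) }
  define \<epsilon> where "\<epsilon> = 2 * (2 / g) ^ (2 * d + 1)"
  have \<epsilon>: "0 \<le> \<epsilon>" using g by (simp add: \<epsilon>_def)
  have \<epsilon>': "(4 / g\<^sup>2) ^ d * (2 / g) = (2 / g) ^ (2 * d + 1)"
  proof -
    have "(2 / g) ^ (2 * d + 1) = ((2 / g)\<^sup>2) ^ d * (2 / g)" by (simp only: power_add power_mult power_one_right)
    then show ?thesis by (simp add: power_divide)
  qed
  have \<epsilon>_eq: "\<epsilon> = 2 * (2 / g) ^ (2 * d + 1)" by (simp only: \<epsilon>_def)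
  define eR' where "eR' = (\<lambda>k. s + \<epsilon> - c (n + int d - int k))"
  have u1: "cfrac (2 / g) (eL (s + \<epsilon>)) k \<le> cfrac (2 / g) (eL s) k" if "k \<le> N" for k
    using gL \<epsilon> b that by (intro cfrac_mono[OF g4]) (auto simp: eL_def)
  have u2: "cfrac (2 / g) eR' d \<le> cfrac (2 / g) wR d"
    using gw \<epsilon> b by (intro cfrac_mono[OF g4]) (auto simp: eR'_def wR_def)
  have "cfrac (2 / g) wR d - cfrac 0 wR d \<le> (4 / g\<^sup>2) ^ d * (2 / g - 0)"
    using gw b by (intro cfrac_contraction[OF g4]) auto
  moreover have "cfrac (2 / g) (eL s) N - cfrac 0 wL d \<le> (4 / g\<^sup>2) ^ d * (cfrac (2 / g) (eL s) m - 0)"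
    unfolding L using gw bm[of "2 / g"] b by (intro cfrac_contraction[OF g4]) auto
  moreover have "(4 / g\<^sup>2) ^ d * (cfrac (2 / g) (eL s) m - 0) \<le> (4 / g\<^sup>2) ^ d * (2 / g)"
    using bm[of "2 / g"] b by (intro mult_left_mono) auto
  ultimately have eigU: "cfrac (2 / g) (eL (s + \<epsilon>)) N + cfrac (2 / g) eR' d \<le> s + \<epsilon> - c n"
    unfolding diff_0_right \<epsilon>' using u1[of N] u2 eig' \<epsilon>_eq by linarith
  have "pathsum B c n k t 0 \<le> exp ((s + \<epsilon>) * t) * (\<Prod>k<N. cfrac (2 / g) (eL (s + \<epsilon>)) (Suc k))"
    using pathsum_upper[OF g4, of B n "s + \<epsilon>" c N d t k] gap box s t eigU \<epsilon>
    by (fastforce simp: eL_def n_def eR'_def)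
  also have "\<dots> \<le> exp ((s + \<epsilon>) * t) * ((\<Prod>k<N. cfrac 0 (eL s) (Suc k)) * exp (8 / g\<^sup>2))"
  proof (intro mult_left_mono order_trans[OF prod_mono cfrac_prod_perturb[OF g4]])
    fix k assume "k \<in> {..<N}"
    moreover have "0 \<le> cfrac (2 / g) (eL (s + \<epsilon>)) (Suc k)" if "k < N"
    proof (intro cfrac_bounds[OF g4])
      fix j assume "j < Suc k"
      then show "g \<le> eL (s + \<epsilon>) j" using gL[of j] \<epsilon> that by (simp add: eL_def)
    qed (use b in auto)
    ultimately show "0 \<le> cfrac (2 / g) (eL (s + \<epsilon>)) (Suc k) \<and> cfrac (2 / g) (eL (s + \<epsilon>)) (Suc k) \<le> cfrac (2 / g) (eL s) (Suc k)"
      using u1[of "Suc k"] by simp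
  qed (use gL in auto)
  also have "\<dots> = exp (s * t) * H s * exp (8 / g\<^sup>2 + 2 * (2 / g) ^ (2 * d + 1) * t)"
    by (simp add: H_def \<epsilon>_def exp_add[symmetric] algebra_simps)
  finally show "pathsum B c n k t 0 \<le> exp (s * t) * H s * exp (8 / g\<^sup>2 + 2 * (2 / g) ^ (2 * d + 1) * t)" .
qed

text \<open>A factor is \<open>1 / (v k + \<tau> - h k)\<close>, with logarithm
  \<open>- ln (v k)\<close> up to a correction of order g^-2. Only the differences of the
  corrections between the two sides are estimated: they involve \<open>v k - v' k\<close> and
  \<open>h k - h' k\<close>, and the latter are controlled by the former through contraction. The
  result is proportional to the total asymmetry with a factor of order g^-3.\<close>

lemma ln_cfrac_ratio:
  fixes x :: real and v v' :: "nat \<Rightarrow> real"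
  assumes g: "8 \<le> g" and v: "\<And>k. k < N \<Longrightarrow> g \<le> v k" "\<And>k. k < N \<Longrightarrow> g \<le> v' k" and \<tau>: "0 \<le> \<tau>" "\<tau> \<le> 4 / g"
  defines "h \<equiv> cfrac 0 (\<lambda>k. v k + \<tau>)" and "h' \<equiv> cfrac 0 (\<lambda>k. v' k + \<tau>)"
  shows "\<bar>(\<Sum>k<N. ln (h (Suc k)) - ln (h' (Suc k))) - (\<Sum>k<N. ln (v' k) - ln (v k))\<bar> \<le> 24 / g ^ 3 * (\<Sum>k<N. \<bar>v k - v' k\<bar>)"
proof -
  have g4: "4 \<le> g" using g by simp
  have b: "(0::real) \<le> 0" "0 \<le> 2 / g" using g by auto
  have e: "g \<le> v k + \<tau>" "g \<le> v' k + \<tau>" if "k < N" for k using v[OF that] \<tau> by auto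
  have gg: "64 \<le> g\<^sup>2" using g by (simp add: power2_eq_square mult_mono[of 8 g 8 g, simplified])
  have hb: "0 \<le> h k" "h k \<le> 2 / g" "0 \<le> h' k" "h' k \<le> 2 / g" if "k \<le> N" for k
    unfolding h_def h'_def using e that b by (intro cfrac_bounds[OF g4]; simp)+
  have step: "\<bar>h (Suc k) - h' (Suc k)\<bar> \<le> 4 / g\<^sup>2 * (\<bar>v k - v' k\<bar> + \<bar>h k - h' k\<bar>)" if "k < N" for k
  proof -
    have "h (Suc k) - h' (Suc k) = h (Suc k) * h' (Suc k) * ((v' k - v k) + (h k - h' k))"
      using cfrac_diff[OF g4, of k "\<lambda>k. v k + \<tau>" "\<lambda>k. v' k + \<tau>" 0 0] e that b by (simp add: h_def h'_def)
    then have "\<bar>h (Suc k) - h' (Suc k)\<bar> = h (Suc k) * h' (Suc k) * \<bar>(v' k - v k) + (h k - h' k)\<bar>"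
      using hb[of "Suc k"] that by (simp add: abs_mult)
    also have "\<dots> \<le> (2 / g * (2 / g)) * (\<bar>v k - v' k\<bar> + \<bar>h k - h' k\<bar>)"
      using hb[of "Suc k"] that g by (intro mult_mono) auto
    finally show ?thesis by (simp add: power2_eq_square)
  qed
  have tot: "(\<Sum>k<m. \<bar>h k - h' k\<bar>) \<le> 8 / g\<^sup>2 * (\<Sum>k<m. \<bar>v k - v' k\<bar>)" if "m \<le> N" for m
  proof (cases m)
    case 0 then show ?thesis by simp
  next
    case (Suc l)
    have "(\<Sum>k<Suc l. \<bar>h k - h' k\<bar>) = (\<Sum>k<l. \<bar>h (Suc k) - h' (Suc k)\<bar>)"
      by (simp add: sum.lessThan_Suc_shift h_def h'_def del: sum.lessThan_Suc)
    also have "\<dots> \<le> (\<Sum>k<l. 4 / g\<^sup>2 * (\<bar>v k - v' k\<bar> + \<bar>h k - h' k\<bar>))"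
      using that Suc by (intro sum_mono step) auto
    also have "\<dots> \<le> (\<Sum>k<Suc l. 4 / g\<^sup>2 * (\<bar>v k - v' k\<bar> + \<bar>h k - h' k\<bar>))"
      by (intro sum_mono2) auto
    also have "\<dots> = 4 / g\<^sup>2 * (\<Sum>k<Suc l. \<bar>v k - v' k\<bar>) + 4 / g\<^sup>2 * (\<Sum>k<Suc l. \<bar>h k - h' k\<bar>)"
      by (simp add: sum_distrib_left sum.distrib distrib_left del: sum.lessThan_Suc)
    finally have "(\<Sum>k<m. \<bar>h k - h' k\<bar>) \<le> 4 / g\<^sup>2 * (\<Sum>k<m. \<bar>v k - v' k\<bar>) + 4 / g\<^sup>2 * (\<Sum>k<m. \<bar>h k - h' k\<bar>)"
      by (simp add: Suc del: sum.lessThan_Suc)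
    \<comment> \<open>The total occurs on both sides; the contraction makes its coefficient on the
      right at most 1/2, so it can be absorbed.\<close>
    moreover have "4 / g\<^sup>2 * (\<Sum>k<m. \<bar>h k - h' k\<bar>) \<le> 1/2 * (\<Sum>k<m. \<bar>h k - h' k\<bar>)"
    proof (intro mult_right_mono sum_nonneg)
      show "4 / g\<^sup>2 \<le> 1 / 2" using gg by (intro divide_le_eq[THEN iffD2]) auto
    qed auto
    ultimately show ?thesis by simp
  qed
  have each: "\<bar>(ln (h (Suc k)) - ln (h' (Suc k))) - (ln (v' k) - ln (v k))\<bar> \<le> 2 / g * \<bar>h k - h' k\<bar> + 8 / g ^ 3 * \<bar>v k - v' k\<bar>"
    if k: "k < N" for k
  proof -
    define \<omega> where "\<omega> = \<tau> - h k"
    define \<omega>' where "\<omega>' = \<tau> - h' k"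
    have vk: "g \<le> v k" "g \<le> v' k" using v k by auto
    have w: "\<bar>\<omega>\<bar> \<le> 4 / g" "\<bar>\<omega>'\<bar> \<le> 4 / g"
    proof -
      have "0 \<le> 2 / g" "4 / g = 2 * (2 / g)" using g by auto
      then show "\<bar>\<omega>\<bar> \<le> 4 / g" "\<bar>\<omega>'\<bar> \<le> 4 / g"
        unfolding \<omega>_def \<omega>'_def abs_le_iff using hb[of k] k \<tau> by linarith+
    qed
    have g2: "4 / g \<le> g / 2" using gg g by (simp add: field_simps power2_eq_square)
    have small: "\<bar>\<omega> / v k\<bar> \<le> 1/2" "\<bar>\<omega>' / v' k\<bar> \<le> 1/2"
    proof -
      have "\<bar>\<omega>\<bar> \<le> v k / 2" "\<bar>\<omega>'\<bar> \<le> v' k / 2" using w g2 vk by linarith+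
      then show "\<bar>\<omega> / v k\<bar> \<le> 1/2" "\<bar>\<omega>' / v' k\<bar> \<le> 1/2" using vk g by (simp_all add: field_simps)
    qed
    have h1: "ln (h (Suc k)) = - (ln (v k) + ln (1 + \<omega> / v k))"
    proof -
      have p: "0 < v k" "0 < 1 + \<omega> / v k" using vk g small(1) unfolding abs_le_iff by linarith+
      have "v k * (1 + \<omega> / v k) = v k + \<omega>" using p by (simp add: distrib_left)
      then have "h (Suc k) = inverse (v k * (1 + \<omega> / v k))"
        by (simp add: h_def \<omega>_def inverse_eq_divide algebra_simps)
      then show ?thesis using p by (simp only: ln_inverse mult_pos_pos ln_mult_pos)
    qed
    have h2: "ln (h' (Suc k)) = - (ln (v' k) + ln (1 + \<omega>' / v' k))"
    proof -
      have p: "0 < v' k" "0 < 1 + \<omega>' / v' k" using vk g small(2) unfolding abs_le_iff by linarith+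
      have "v' k * (1 + \<omega>' / v' k) = v' k + \<omega>'" using p by (simp add: distrib_left)
      then have "h' (Suc k) = inverse (v' k * (1 + \<omega>' / v' k))"
        by (simp add: h'_def \<omega>'_def inverse_eq_divide algebra_simps)
      then show ?thesis using p by (simp only: ln_inverse mult_pos_pos ln_mult_pos)
    qed
    have lip: "\<bar>ln (1 + y) - ln (1 + z)\<bar> \<le> 2 * \<bar>y - z\<bar>" if "\<bar>y\<bar> \<le> 1/2" "\<bar>z\<bar> \<le> 1/2" for y z :: real
    proof -
      have *: "ln (1 + y) - ln (1 + z) \<le> 2 * \<bar>y - z\<bar>" if "\<bar>y\<bar> \<le> 1/2" "\<bar>z\<bar> \<le> 1/2" for y z :: real
      proof -
        have p: "0 < 1 + y" "0 < 1 + z" "1 / 2 \<le> 1 + z" using that unfolding abs_le_iff by linarith+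
        have "ln (1 + y) - ln (1 + z) = ln ((1 + y) / (1 + z))" using p by (simp add: ln_div)
        also have "\<dots> \<le> (1 + y) / (1 + z) - 1" using p by (intro ln_le_minus_one divide_pos_pos)
        also have "\<dots> = (y - z) / (1 + z)" using p by (simp add: diff_divide_distrib[symmetric] field_simps)
        also have "\<dots> \<le> \<bar>y - z\<bar> / (1/2)" using p by (intro frac_le) auto
        finally show ?thesis by simp
      qed
      from *[OF that] *[OF that(2,1)] show ?thesis by (simp add: abs_le_iff abs_minus_commute)
    qed
    have "\<bar>(ln (h (Suc k)) - ln (h' (Suc k))) - (ln (v' k) - ln (v k))\<bar> = \<bar>ln (1 + \<omega>' / v' k) - ln (1 + \<omega> / v k)\<bar>"
      unfolding h1 h2 by simp
    also have "\<dots> \<le> 2 * \<bar>\<omega>' / v' k - \<omega> / v k\<bar>" by (rule lip[OF small(2,1)])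
    also have "\<omega>' / v' k - \<omega> / v k = (\<omega>' - \<omega>) / v' k + \<omega> * (v k - v' k) / (v k * v' k)"
      using vk g by (simp add: field_simps)
    also have "\<bar>\<dots>\<bar> \<le> \<bar>h k - h' k\<bar> / g + (4 / g) * \<bar>v k - v' k\<bar> / (g * g)"
    proof (intro order_trans[OF abs_triangle_ineq] add_mono)
      show "\<bar>(\<omega>' - \<omega>) / v' k\<bar> \<le> \<bar>h k - h' k\<bar> / g"
        using vk g by (simp add: \<omega>_def \<omega>'_def abs_divide) (intro divide_left_mono mult_pos_pos; simp)
      show "\<bar>\<omega> * (v k - v' k) / (v k * v' k)\<bar> \<le> (4 / g) * \<bar>v k - v' k\<bar> / (g * g)"
        unfolding abs_divide abs_mult using vk g w by (intro frac_le mult_mono) auto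
    qed
    finally show ?thesis by (simp add: field_simps power3_eq_cube)
  qed
  have "\<bar>(\<Sum>k<N. ln (h (Suc k)) - ln (h' (Suc k))) - (\<Sum>k<N. ln (v' k) - ln (v k))\<bar>
    \<le> (\<Sum>k<N. \<bar>(ln (h (Suc k)) - ln (h' (Suc k))) - (ln (v' k) - ln (v k))\<bar>)"
    unfolding sum_subtractf[symmetric] by (rule sum_abs)
  also have "\<dots> \<le> (\<Sum>k<N. 2 / g * \<bar>h k - h' k\<bar> + 8 / g ^ 3 * \<bar>v k - v' k\<bar>)"
    by (intro sum_mono each) auto
  also have "\<dots> = 2 / g * (\<Sum>k<N. \<bar>h k - h' k\<bar>) + 8 / g ^ 3 * (\<Sum>k<N. \<bar>v k - v' k\<bar>)"
    by (simp add: sum.distrib sum_distrib_left)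
  also have "\<dots> \<le> 2 / g * (8 / g\<^sup>2 * (\<Sum>k<N. \<bar>v k - v' k\<bar>)) + 8 / g ^ 3 * (\<Sum>k<N. \<bar>v k - v' k\<bar>)"
    using g by (intro add_mono mult_left_mono tot) auto
  also have "\<dots> = 24 / g ^ 3 * (\<Sum>k<N. \<bar>v k - v' k\<bar>)"
    by (simp add: field_simps power2_eq_square power3_eq_cube)
  finally show ?thesis .
qed

section \<open>Solutions with a single high peak\<close>

text \<open>Chernoff's bound: with \<open>q = 2 * t / s \<le> 1\<close>,
  \<open>(2 * t) ^ j \<le> q ^ s * s ^ j\<close> for \<open>j \<ge> s\<close>, and the remaining
  exponential series is at most \<open>exp s\<close>.\<close>

lemma poisson_tail:
  assumes t: "0 < t" "2 * t \<le> real s" "0 < s" and A: "finite A" "\<And>j. j \<in> A \<Longrightarrow> s \<le> j"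
  shows "(\<Sum>j\<in>A. (2 * t) ^ j / fact j) \<le> exp (- (real s * ln (real s / (2 * exp 1 * t))))"
proof -
  define q where "q = 2 * t / real s"
  have q: "0 < q" "q \<le> 1" using t by (auto simp: q_def)
  have "(\<Sum>j\<in>A. (2 * t) ^ j / fact j) \<le> (\<Sum>j\<in>A. q ^ s * (real s ^ j / fact j))"
  proof (rule sum_mono)
    fix j assume "j \<in> A"
    have "(2 * t) ^ j = q ^ j * real s ^ j" using t by (simp add: q_def power_divide)
    also have "\<dots> \<le> q ^ s * real s ^ j"
      using q A(2)[OF \<open>j \<in> A\<close>] by (intro mult_right_mono power_decreasing) auto
    finally show "(2 * t) ^ j / fact j \<le> q ^ s * (real s ^ j / fact j)" by (simp add: divide_right_mono)
  qed
  also have "\<dots> = q ^ s * (\<Sum>j\<in>A. real s ^ j / fact j)" by (simp add: sum_distrib_left)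
  also have "\<dots> \<le> q ^ s * exp (real s)"
  proof (intro mult_left_mono)
    have "(\<Sum>j\<in>A. real s ^ j / fact j) \<le> (\<Sum>j. real s ^ j / fact j)"
      using summable_exp[of "real s"] A(1) by (intro sum_le_suminf) (auto simp: field_simps)
    then show "(\<Sum>j\<in>A. real s ^ j / fact j) \<le> exp (real s)" by (simp add: exp_def field_simps)
  qed (use q in auto)
  also have "\<dots> = exp (- (real s * ln (real s / (2 * exp 1 * t))))"
  proof -
    have "q ^ s = exp (real s * ln q)" using q by (simp add: exp_of_nat_mult)
    moreover have "ln (real s / (2 * exp 1 * t)) = - 1 - ln q"
      using t by (simp add: q_def ln_div ln_mult)
    then have "- (real s * ln (real s / (2 * exp 1 * t))) = real s * ln q + real s"
      by (simp only:) (simp add: algebra_simps)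
    ultimately show ?thesis by (simp only: exp_add)
  qed
  finally show ?thesis .
qed

text \<open>Boxes \<open>{- r..r}\<close> are enlarged one site on each side at a time. A path that
  touches \<open>\<plusminus>r\<close> before ending at \<open>N\<close> makes at least
  \<open>2 * r - N\<close> jumps, and one that visits \<open>- N\<close> makes at least
  \<open>3 * N\<close>; the Poisson cost of so many jumps outweighs the maximum of the potential in
  the box. The number \<open>s\<close> of jumps that is charged is left open because the cost is
  estimated differently for different heights. The errors form a geometric series.\<close>

lemma pathsum_far_bound:
  fixes c :: "int \<Rightarrow> real" and N m :: nat and mr :: "nat \<Rightarrow> real"
  assumes N: "0 < N" and m: "0 < m" and t: "0 < t" "2 * t \<le> real N"
    and mr: "\<And>r x. \<bar>x\<bar> \<le> int r \<Longrightarrow> c x \<le> mr r"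
    and b0: "mr (N + m - 1) * t - real (3 * N) * ln (real (3 * N) / (2 * exp 1 * t)) \<le> w - real N"
    and br: "\<And>r. N + m \<le> r \<Longrightarrow> \<exists>s\<ge>N. s \<le> 2 * r - N \<and> mr r * t - real s * ln (real s / (2 * exp 1 * t)) \<le> w - real r"
  shows "pathsum UNIV c (int N) k t 0 \<le> pathsum {- int N<..<int N + int m} c (int N) k t 0 + 3 * exp (w - real N)"
proof -
  define M where "M = N + m"
  define box where "box r = {- int r..int r}" for r
  define P where "P A j = pathw A c (int N) j t 0" for A j
  \<comment> \<open>Open at \<open>- N\<close>, where the mirrored peak of equal height will sit;
    paths reaching it are charged \<open>3 * N\<close> jumps.\<close>
  define B where "B = {- int N<..<int N + int m}"
  have t0: "0 \<le> t" using t by simp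
  have cost: "(\<Sum>j\<in>A. P (box r) j) \<le> exp (mr r * t - real s * ln (real s / (2 * exp 1 * t)))"
    if "finite A" "\<And>j. j \<in> A \<Longrightarrow> s \<le> j" "N \<le> s" for A r s
  proof -
    have "(\<Sum>j\<in>A. P (box r) j) \<le> (\<Sum>j\<in>A. exp (mr r * t) * ((2 * t) ^ j / fact j))"
    proof (rule sum_mono)
      fix j
      have "P (box r) j \<le> exp (mr r * t) * (2 * t) ^ j / fact j"
        unfolding P_def by (rule pathw_le_poisson) (use mr t0 in \<open>auto simp: box_def\<close>)
      then show "P (box r) j \<le> exp (mr r * t) * ((2 * t) ^ j / fact j)" by simp
    qed
    also have "\<dots> = exp (mr r * t) * (\<Sum>j\<in>A. (2 * t) ^ j / fact j)" by (simp add: sum_distrib_left)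
    also have "\<dots> \<le> exp (mr r * t) * exp (- (real s * ln (real s / (2 * exp 1 * t))))"
      using that N t by (intro mult_left_mono poisson_tail) auto
    finally show ?thesis by (simp add: exp_add[symmetric])
  qed
  have Pnn: "0 \<le> P A j" for A j using t0 by (simp add: P_def)
  have base: "(\<Sum>j\<le>k. P (box (M - 1)) j) \<le> (\<Sum>j\<le>k. P B j) + exp (w - real N)"
  proof -
    have sub: "B \<subseteq> box (M - 1)" using N m by (auto simp: B_def box_def M_def)
    have eq: "P (box (M - 1)) j = P B j" if "j < 3 * N" for j
      unfolding P_def using that sub t0
      by (intro pathw_eq_if_unreachable) (auto simp: B_def box_def M_def of_nat_diff)
    have "(\<Sum>j\<le>k. P (box (M - 1)) j) \<le> (\<Sum>j\<le>k. P B j + (if 3 * N \<le> j then P (box (M - 1)) j else 0))"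
      using eq Pnn by (intro sum_mono) (auto simp: not_le)
    also have "\<dots> = (\<Sum>j\<le>k. P B j) + (\<Sum>j\<in>{j\<in>{..k}. 3 * N \<le> j}. P (box (M - 1)) j)"
      by (simp add: sum.distrib sum.If_cases Int_def)
    also have "(\<Sum>j\<in>{j\<in>{..k}. 3 * N \<le> j}. P (box (M - 1)) j) \<le> exp (mr (M - 1) * t - real (3 * N) * ln (real (3 * N) / (2 * exp 1 * t)))"
      by (rule cost) auto
    also have "\<dots> \<le> exp (w - real N)" using b0 by (simp add: M_def)
    finally show ?thesis by simp
  qed
  have step: "(\<Sum>j\<le>k. P (box (M - 1 + i)) j) \<le> (\<Sum>j\<le>k. P B j) + exp (w - real N) + (\<Sum>r=M..<M + i. exp (w - real r))" for i
  proof (induction i)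
    case 0 then show ?case using base by simp
  next
    case (Suc i)
    define r where "r = M + i"
    have r: "M - 1 + Suc i = r" "M - 1 + i = r - 1" "N + m \<le> r" using N by (auto simp: r_def M_def)
    obtain s where s: "N \<le> s" "s \<le> 2 * r - N" "mr r * t - real s * ln (real s / (2 * exp 1 * t)) \<le> w - real r"
      using br[OF r(3)] by blast
    have sub: "box (r - 1) \<subseteq> box r" by (auto simp: box_def)
    have eq: "P (box r) j = P (box (r - 1)) j" if "j < s" for j
    proof -
      have "int j < \<bar>0 - z\<bar> + \<bar>z - int N\<bar>" if "z \<in> box r - box (r - 1)" for z
      proof -
        have "z = int r \<or> z = - int r" using that r N by (auto simp: box_def of_nat_diff)
        moreover have "int j < 2 * int r - int N" using \<open>j < s\<close> s r by linarith
        ultimately show ?thesis using r by auto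
      qed
      then show ?thesis unfolding P_def by (intro pathw_eq_if_unreachable sub t0) auto
    qed
    have "(\<Sum>j\<le>k. P (box r) j) \<le> (\<Sum>j\<le>k. P (box (r - 1)) j + (if s \<le> j then P (box r) j else 0))"
      using eq Pnn by (intro sum_mono) (auto simp: not_le)
    also have "\<dots> = (\<Sum>j\<le>k. P (box (r - 1)) j) + (\<Sum>j\<in>{j\<in>{..k}. s \<le> j}. P (box r) j)"
      by (simp add: sum.distrib sum.If_cases Int_def)
    also have "(\<Sum>j\<in>{j\<in>{..k}. s \<le> j}. P (box r) j) \<le> exp (mr r * t - real s * ln (real s / (2 * exp 1 * t)))"
      by (rule cost) (use s in auto)
    also have "\<dots> \<le> exp (w - real r)" using s by simp
    finally show ?case using Suc unfolding r(1,2) by (simp add: r_def)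
  qed
  have "(\<Sum>j\<le>k. P UNIV j) = (\<Sum>j\<le>k. P (box (M - 1 + (k + 1))) j)"
    unfolding P_def by (intro sum.cong refl pathw_eq_if_unreachable) (auto simp: box_def t0 M_def)
  also have "\<dots> \<le> (\<Sum>j\<le>k. P B j) + exp (w - real N) + (\<Sum>r=M..<M + (k + 1). exp (w - real r))" by (rule step)
  also have "(\<Sum>r=M..<M + (k + 1). exp (w - real r)) \<le> 2 * exp (w - real N)"
  proof -
    have h: "exp (- 1 :: real) \<le> 1 / 2" using exp_ge_add_one_self[of 1] by (simp add: exp_minus field_simps)
    have "(\<Sum>r=M..<M + (k + 1). exp (w - real r)) \<le> 2 * exp (w - real M) - 2 * exp (w - real (M + (k + 1)))" for k
    proof (induction k)
      case 0
      have "exp (w - real (M + 1)) = exp (w - real M) * exp (- 1)" by (simp add: exp_add[symmetric])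
      then show ?case using h mult_left_mono[OF h, of "exp (w - real M)"] by simp
    next
      case (Suc k)
      have "exp (w - real (M + (Suc k + 1))) = exp (w - real (M + (k + 1))) * exp (- 1)" by (simp add: exp_add[symmetric])
      moreover have "exp (w - real (M + (k + 1))) * exp (- 1) \<le> exp (w - real (M + (k + 1))) * (1 / 2)"
        by (intro mult_left_mono h) simp
      moreover have "(\<Sum>r=M..<M + (Suc k + 1). exp (w - real r)) = (\<Sum>r=M..<M + (k + 1). exp (w - real r)) + exp (w - real (M + (k + 1)))"
        by simp
      ultimately show ?case using Suc by argo
    qed
    from this[of k] have "(\<Sum>r=M..<M + (k + 1). exp (w - real r)) \<le> 2 * exp (w - real M)"
      by (smt (verit) exp_gt_zero)
    also have "\<dots> \<le> 2 * exp (w - real N)" by (simp add: M_def)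
    finally show ?thesis .
  qed
  finally show ?thesis by (simp add: P_def B_def)
qed

text \<open>The sandwich inside \<open>B\<close> together with the cost of leaving it.
  \<open>E3\<close> concerns paths through the mirrored peak; \<open>E4\<close> boxes without a
  value above \<open>x\<close>, charged \<open>2 * r - N\<close> jumps; \<open>E5\<close> boxes with
  a higher value, which must pay through \<open>psi\<close> and are charged \<open>r\<close> jumps;
  \<open>E6\<close> boxes beyond \<open>R\<close>, where only linear growth of the potential is
  known.\<close>

theorem pam_sandwich:
  fixes \<xi> :: "int \<Rightarrow> real" and N d m :: nat and t x g D E R s :: real
  defines "H \<equiv> \<lambda>s. \<Prod>k<N. cfrac 0 (\<lambda>k. s - (\<xi> (int k) - 2)) (Suc k)"
  assumes \<xi>: "\<And>z. 1 \<le> \<xi> z" "\<xi> (int N) = x" "\<xi> (- int N) = x"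
    and gap: "\<And>z. \<bar>z\<bar> < int (N + m) \<Longrightarrow> \<bar>z\<bar> \<noteq> int N \<Longrightarrow> \<xi> z \<le> x - g"
    and psi: "\<And>z. \<bar>z\<bar> \<noteq> int N \<Longrightarrow> t * \<xi> z - \<bar>z\<bar> * ln (\<xi> z) \<le> t * x - N * ln x - D"
    and far: "\<And>z. \<xi> z \<le> E * max \<bar>z\<bar> R"
    and num: "8 \<le> g" "0 < N" "d \<le> N" "d < m" "0 < t" "2 * t \<le> real N"
    and E3: "N * ln x - real (3 * N) * ln (real (3 * N) / (2 * exp 1 * t)) \<le> - real N"
    and E4: "\<And>r::nat. N + m \<le> r \<Longrightarrow> r \<le> R \<Longrightarrow> N * ln x - real (2 * r - N) * ln (real (2 * r - N) / (2 * exp 1 * t)) \<le> - real r"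
    and E5: "\<And>r::nat. N + m \<le> r \<Longrightarrow> r \<le> R \<Longrightarrow> - D + r * ln (E * R) - r * ln (r / (2 * exp 1 * t)) \<le> - real r"
    and E6: "\<And>r::nat. N + m \<le> r \<Longrightarrow> R < r \<Longrightarrow> N * ln x + t * E * r - r * ln (r / (2 * exp 1 * t)) \<le> - real r"
    and s: "x - 2 \<le> s" "s \<le> x - 2 + 4 / g"
    and eig: "s - (x - 2) = cfrac 0 (\<lambda>k. s - (\<xi> (int N - int d + int k) - 2)) d + cfrac 0 (\<lambda>k. s - (\<xi> (int N + int d - int k) - 2)) d"
  shows "exp (s * t) * H s * (1 - 64 / g\<^sup>2 - 2 ^ N * exp (- (g * t / 8))) \<le> pam_u \<xi> t (int N)"
    and "pam_u \<xi> t (int N) \<le> exp (s * t) * H s * (exp (8 / g\<^sup>2 + 2 * (2 / g) ^ (2 * d + 1) * t) + 3 * exp (- real N))"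
    and "0 < H s"
proof -
  define c where "c = (\<lambda>z. \<xi> z - 2)"
  define B where "B = {- int N<..<int N + int m}"
  define W where "W = exp (s * t) * H s"
  define mr where "mr r = Max (\<xi> ` {- int r..int r})" for r :: nat
  have cN: "c (int N) = x - 2" by (simp add: c_def \<xi>)
  have x1: "1 \<le> x" using \<xi>(1)[of "int N"] \<xi>(2) by simp
  have Hc: "H s = (\<Prod>k<N. cfrac 0 (\<lambda>k. s - c (int k)) (Suc k))" by (simp add: H_def c_def)
  have gapB: "c z \<le> c (int N) - g" if "z \<in> B" "z \<noteq> int N" for z
    using gap[of z] that unfolding cN by (auto simp: B_def c_def)
  have box: "{0..int N + int d} \<subseteq> B" using num by (auto simp: B_def)
  have eig': "s - c (int N) = cfrac 0 (\<lambda>k. s - c (int N - int d + int k)) d + cfrac 0 (\<lambda>k. s - c (int N + int d - int k)) d"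
    using eig by (simp add: c_def \<xi>)
  note sw = pathsum_sandwich[where c=c and N=N and d=d and g=g and B=B and s=s and t=t, OF num(1) gapB box num(2,3) _ _ eig', folded Hc]
  \<comment> \<open>Lower bound for the main term: every denominator is at most \<open>x\<close>, so
    every ratio is at least \<open>1 / x\<close>. All errors are measured against the resulting
    exponent \<open>w\<close>.\<close>
  have HW: "exp ((x - 2) * t - N * ln x) \<le> W" "0 < H s"
  proof -
    have g4: "4 \<le> g" using num by simp
    have each: "1 / x \<le> cfrac 0 (\<lambda>k. s - c (int k)) (Suc k)" if "k < N" for k
    proof -
      have gk: "g \<le> s - c (int j)" if "j \<le> k" for j
        using gapB[of "int j"] that \<open>k < N\<close> s cN by (auto simp: B_def)
      have d: "g / 2 \<le> s - c (int k) - cfrac 0 (\<lambda>k. s - c (int k)) k"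
        using gk num by (intro cfrac_denominator[OF g4]) auto
      have nn: "0 \<le> cfrac 0 (\<lambda>k. s - c (int k)) k"
        using gk num by (intro cfrac_bounds(1)[OF g4]) auto
      have "4 / g \<le> 1" using num by simp
      then have "s - c (int k) - cfrac 0 (\<lambda>k. s - c (int k)) k \<le> x"
        using s \<xi>(1)[of "int k"] nn by (simp add: c_def)
      then show ?thesis using d num x1 by (auto intro!: divide_left_mono mult_pos_pos)
    qed
    have "(\<Prod>k<N. 1 / x) \<le> H s" unfolding Hc using each x1 by (intro prod_mono) auto
    then have h: "exp (- (N * ln x)) \<le> H s"
      using x1 by (simp add: exp_minus exp_of_nat_mult power_one_over inverse_eq_divide)
    then show "0 < H s" by (rule less_le_trans[rotated]) simp
    have "exp ((x - 2) * t) * exp (- (N * ln x)) \<le> exp (s * t) * H s"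
      using h s num by (intro mult_mono) auto
    then show "exp ((x - 2) * t - N * ln x) \<le> W" by (simp add: W_def exp_add[symmetric])
  qed
  show "0 < H s" by (rule HW)
  have Wp: "0 < W" using HW by (simp add: W_def)
  define w where "w = (x - 2) * t - N * ln x"
  have mr: "\<xi> z \<le> mr r" if "\<bar>z\<bar> \<le> int r" for z r
    unfolding mr_def using that by (intro Max_ge imageI) auto
  have mr_ex: "\<exists>z. \<bar>z\<bar> \<le> int r \<and> mr r = \<xi> z" for r
  proof -
    have "mr r \<in> \<xi> ` {- int r..int r}" unfolding mr_def by (intro Max_in) auto
    then obtain z where "z \<in> {- int r..int r}" "mr r = \<xi> z" by auto
    then show ?thesis by (intro exI[of _ z]) auto
  qed
  have far_bound: "pathsum UNIV c (int N) k t 0 \<le> pathsum B c (int N) k t 0 + 3 * exp (w - real N)" for k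
    unfolding B_def
  proof (rule pathsum_far_bound[where mr="\<lambda>r. mr r - 2" and w=w and t=t and c=c and N=N and m=m and k=k])
    show "c z \<le> mr r - 2" if "\<bar>z\<bar> \<le> int r" for r z using mr[OF that] by (simp add: c_def)
    have "mr (N + m - 1) \<le> x"
    proof -
      obtain z where z: "\<bar>z\<bar> \<le> int (N + m - 1)" "mr (N + m - 1) = \<xi> z" using mr_ex by blast
      show ?thesis
      proof (cases "\<bar>z\<bar> = int N")
        case True
        then have "z = int N \<or> z = - int N" by linarith
        then show ?thesis using z \<xi> by auto
      next
        case False
        then show ?thesis using gap[of z] z num by (auto simp: of_nat_diff)
      qed
    qed
    then have "(mr (N + m - 1) - 2) * t \<le> (x - 2) * t" using num by (intro mult_right_mono) auto
    then show "(mr (N + m - 1) - 2) * t - real (3 * N) * ln (real (3 * N) / (2 * exp 1 * t)) \<le> w - real N"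
      using E3 by (simp add: w_def)
    fix r assume r: "N + m \<le> r"
    obtain z where z: "\<bar>z\<bar> \<le> int r" "mr r = \<xi> z" using mr_ex by blast
    have zr: "\<bar>real_of_int z\<bar> \<le> real r"
    proof -
      have "real_of_int \<bar>z\<bar> \<le> real_of_int (int r)" using z(1) by (simp only: of_int_le_iff)
      then show ?thesis by simp
    qed
    show "\<exists>s\<ge>N. s \<le> 2 * r - N \<and> (mr r - 2) * t - real s * ln (real s / (2 * exp 1 * t)) \<le> w - real r"
    proof (cases "R < r")
      case True
      have "max \<bar>real_of_int z\<bar> R \<le> r" using zr True by simp
      have E0: "0 \<le> E"
      proof (rule ccontr)
        assume "\<not> 0 \<le> E"
        then have "E * max \<bar>real_of_int (int r)\<bar> R \<le> 0" by (intro mult_nonpos_nonneg) auto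
        then show False using far[of "int r"] \<xi>(1)[of "int r"] by simp
      qed
      have "mr r \<le> E * r"
        using far[of z] mult_left_mono[OF \<open>max \<bar>real_of_int z\<bar> R \<le> r\<close> E0] z by simp
      then have "mr r * t \<le> t * E * r" using num by (simp add: mult.commute mult_left_mono mult.left_commute)
      moreover have "0 \<le> x * t" using x1 num by simp
      ultimately have "(mr r - 2) * t - real r * ln (real r / (2 * exp 1 * t)) \<le> w - real r"
        using E6[OF r True] by (simp add: w_def algebra_simps)
      then show ?thesis using r by (intro exI[of _ r]) auto
    next
      case False
      then have rR: "r \<le> R" by simp
      show ?thesis
      proof (cases "mr r \<le> x")
        case True
        then have "(mr r - 2) * t \<le> (x - 2) * t" using num by (intro mult_right_mono) auto
        then show ?thesis using E4[OF r rR] r by (intro exI[of _ "2 * r - N"]) (auto simp: w_def)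
      next
        \<comment> \<open>A site higher than the peak is limited only through \<open>psi\<close>;
          the margin \<open>D\<close> makes up for the crude bounds \<open>r\<close> on its distance
          and \<open>E * R\<close> on its height.\<close>
        case False
        have zN: "\<bar>z\<bar> \<noteq> int N"
        proof
          assume "\<bar>z\<bar> = int N"
          then have "z = int N \<or> z = - int N" by linarith
          then show False using False z \<xi>(2,3) by auto
        qed
        have "mr r \<le> E * R" using far[of z] z(2) zr rR by (simp add: max_absorb2)
        then have "ln (mr r) \<le> ln (E * R)" using \<xi>(1)[of z] z by simp
        then have "\<bar>real_of_int z\<bar> * ln (\<xi> z) \<le> r * ln (E * R)"
          using zr z \<xi>(1)[of z] by (intro mult_mono) auto
        then have "t * mr r \<le> t * x - N * ln x - D + r * ln (E * R)"
          using psi[OF zN] z by simp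
        then have "(mr r - 2) * t - real r * ln (real r / (2 * exp 1 * t)) \<le> w - real r"
          using E5[OF r rR] by (simp add: w_def algebra_simps)
        then show ?thesis using r by (intro exI[of _ r]) auto
      qed
    qed
  qed (use num in auto)
  define hi where "hi = exp (8 / g\<^sup>2 + 2 * (2 / g) ^ (2 * d + 1) * t) + 3 * exp (- real N)"
  have up: "pathsum UNIV c (int N) k t 0 \<le> W * hi" for k
  proof -
    have "exp (w - real N) = exp w * exp (- real N)" by (simp add: exp_add[symmetric])
    also have "\<dots> \<le> W * exp (- real N)" using HW by (simp add: w_def mult_right_mono)
    finally have "3 * exp (w - real N) \<le> W * (3 * exp (- real N))" by simp
    moreover have "pathsum B c (int N) k t 0 \<le> W * exp (8 / g\<^sup>2 + 2 * (2 / g) ^ (2 * d + 1) * t)"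
      unfolding W_def using s cN num by (intro sw(2)) auto
    ultimately show ?thesis using far_bound[of k] unfolding hi_def by (simp add: distrib_left)
  qed
  have summ: "summable (\<lambda>k. pathw UNIV c (int N) k t 0)"
  proof (rule summableI_nonneg_bounded[of _ "W * hi"])
    show "0 \<le> pathw UNIV c (int N) k t 0" for k using num by simp
    show "(\<Sum>k<k'. pathw UNIV c (int N) k t 0) \<le> W * hi" for k'
    proof (cases k')
      case 0
      have "0 \<le> hi" by (simp add: hi_def)
      then show ?thesis using Wp 0 by simp
    next
      case (Suc k)
      show ?thesis using up[of k] unfolding Suc lessThan_Suc_atMost .
    qed
  qed
  have u: "pam_u \<xi> t (int N) = (\<Sum>k. pathw UNIV c (int N) k t 0)"
  proof -
    have "(\<Sum>k. ennreal (pathw UNIV c (int N) k t 0)) = ennreal (\<Sum>k. pathw UNIV c (int N) k t 0)"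
      using num by (intro suminf_ennreal2 summ) auto
    moreover have "pam_u \<xi> t (int N) = enn2real (\<Sum>k. ennreal (pathw UNIV c (int N) k t 0))"
      unfolding c_def using num by (intro pam_u_eq) simp
    moreover have "0 \<le> (\<Sum>k. pathw UNIV c (int N) k t 0)"
      using num by (intro suminf_nonneg summ) simp
    ultimately show ?thesis by (simp only: enn2real_ennreal)
  qed
  have "pathsum UNIV c (int N) k t 0 \<le> pam_u \<xi> t (int N)" for k
    unfolding u using num by (intro sum_le_suminf summ ballI pathw_nonneg) simp_all
  then show "exp (s * t) * H s * (1 - 64 / g\<^sup>2 - 2 ^ N * exp (- (g * t / 8))) \<le> pam_u \<xi> t (int N)"
    using s cN num by (intro sw(1)) auto
  have "pam_u \<xi> t (int N) \<le> W * hi"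
    unfolding u by (rule LIMSEQ_le_const2[OF summable_LIMSEQ'[OF summ]]) (use up in auto)
  then show "pam_u \<xi> t (int N) \<le> exp (s * t) * H s * (exp (8 / g\<^sup>2 + 2 * (2 / g) ^ (2 * d + 1) * t) + 3 * exp (- real N))"
    by (simp add: W_def hi_def)
qed

text \<open>Scale of the potential at the maximiser of \<open>\<Psi>\<close>; the corresponding spatial scale is \<open>scale_r\<close>, with \<open>scale_r = scale_a powr \<alpha>\<close>.\<close>
definition scale_a :: "real \<Rightarrow> real \<Rightarrow> real" where "scale_a \<alpha> t = (t / ln t) powr (1 / (\<alpha> - 1))"

text \<open>Reflection in the origin turns the solution at \<open>- N\<close> into that at
  \<open>N\<close> for the reflected potential, so all estimates are made on one side.\<close>

lemma pathw_reflect: "pathw UNIV c z k t x = pathw UNIV (\<lambda>y. c (- y)) (- z) k t (- x)"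
proof (induction k arbitrary: t x)
  case 0 then show ?case by auto
next
  case (Suc k)
  have "pathw UNIV c z k s (x + 1) = pathw UNIV (\<lambda>y. c (- y)) (- z) k s (- x - 1)"
       "pathw UNIV c z k s (x - 1) = pathw UNIV (\<lambda>y. c (- y)) (- z) k s (- x + 1)" for s
  proof -
    have e: "- (x + 1) = - x - 1" "- (x - 1) = - x + 1" by simp_all
    show "pathw UNIV c z k s (x + 1) = pathw UNIV (\<lambda>y. c (- y)) (- z) k s (- x - 1)"
       "pathw UNIV c z k s (x - 1) = pathw UNIV (\<lambda>y. c (- y)) (- z) k s (- x + 1)"
      using Suc[of s "x + 1"] Suc[of s "x - 1"] unfolding e by auto
  qed
  then show ?case by (simp add: add.commute)
qed

lemma pam_u_reflect: "0 \<le> t \<Longrightarrow> pam_u \<xi> t (- z) = pam_u (\<lambda>y. \<xi> (- y)) t z"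
  by (simp add: pam_u_eq pathw_reflect[of "\<lambda>y. \<xi> y - 2" "- z" _ _ 0])

text \<open>The sandwich is applied to \<open>\<xi>\<close> and to its reflection. Within the window
  the two agree, so both satisfy the eigenvalue equation with the same \<open>s\<close>, and
  \<open>exp (s * t)\<close> cancels in the quotient.\<close>

theorem pam_ratio:
  fixes \<xi> :: "int \<Rightarrow> real" and N d m :: nat and t x g D E R :: real
  assumes \<xi>: "\<And>z. 1 \<le> \<xi> z" "\<xi> (int N) = x" "\<xi> (- int N) = x"
    and gap: "\<And>z. \<bar>z\<bar> < int (N + m) \<Longrightarrow> \<bar>z\<bar> \<noteq> int N \<Longrightarrow> \<xi> z \<le> x - g"
    and psi: "\<And>z. \<bar>z\<bar> \<noteq> int N \<Longrightarrow> t * \<xi> z - \<bar>z\<bar> * ln (\<xi> z) \<le> t * x - N * ln x - D"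
    and far: "\<And>z. \<xi> z \<le> E * max \<bar>z\<bar> R"
    and win: "\<And>j. 1 \<le> j \<Longrightarrow> j \<le> int d \<Longrightarrow> \<xi> (int N - j) = \<xi> (- (int N - j)) \<and> \<xi> (int N + j) = \<xi> (- (int N + j))"
    and num: "8 \<le> g" "0 < N" "d \<le> N" "d < m" "0 < t" "2 * t \<le> real N"
    and E3: "N * ln x - real (3 * N) * ln (real (3 * N) / (2 * exp 1 * t)) \<le> - real N"
    and E4: "\<And>r::nat. N + m \<le> r \<Longrightarrow> r \<le> R \<Longrightarrow> N * ln x - real (2 * r - N) * ln (real (2 * r - N) / (2 * exp 1 * t)) \<le> - real r"
    and E5: "\<And>r::nat. N + m \<le> r \<Longrightarrow> r \<le> R \<Longrightarrow> - D + r * ln (E * R) - r * ln (r / (2 * exp 1 * t)) \<le> - real r"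
    and E6: "\<And>r::nat. N + m \<le> r \<Longrightarrow> R < r \<Longrightarrow> N * ln x + t * E * r - r * ln (r / (2 * exp 1 * t)) \<le> - real r"
    and lo: "lo = 1 - 64 / g\<^sup>2 - 2 ^ N * exp (- (g * t / 8))" "0 < lo"
    and hi: "hi = exp (8 / g\<^sup>2 + 2 * (2 / g) ^ (2 * d + 1) * t) + 3 * exp (- real N)"
  shows "0 < pam_u \<xi> t (int N)" "0 < pam_u \<xi> t (- int N)"
    and "\<bar>ln (pam_u \<xi> t (int N) / pam_u \<xi> t (- int N)) - (\<Sum>k<N. ln (x - \<xi> (- int k)) - ln (x - \<xi> (int k)))\<bar>
      \<le> ln hi - ln lo + 24 / g ^ 3 * (\<Sum>k<N. \<bar>\<xi> (int k) - \<xi> (- int k)\<bar>)"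
proof -
  define \<zeta> where "\<zeta> = (\<lambda>y. \<xi> (- y))"
  have g4: "4 \<le> g" using num by simp
  have wg: "\<xi> (int N - int d + int j) \<le> x - g \<and> \<xi> (int N + int d - int j) \<le> x - g" if "j < d" for j
    using that num by (intro conjI gap) auto
  obtain s where s: "x - 2 \<le> s" "s \<le> x - 2 + 4 / g"
    "s - (x - 2) = cfrac 0 (\<lambda>k. s - (\<xi> (int N - int d + int k) - 2)) d + cfrac 0 (\<lambda>k. s - (\<xi> (int N + int d - int k) - 2)) d"
    by (rule window_eigenvalue[OF g4, of d "\<lambda>k. \<xi> (int N - int d + int k) - 2" "x - 2" "\<lambda>k. \<xi> (int N + int d - int k) - 2"])
       (use wg in auto)
  have eq: "\<zeta> (int N - int d + int j) = \<xi> (int N - int d + int j)" "\<zeta> (int N + int d - int j) = \<xi> (int N + int d - int j)" if "j < d" for j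
    using win[of "int d - int j"] that by (auto simp: \<zeta>_def algebra_simps)
  have s': "s - (x - 2) = cfrac 0 (\<lambda>k. s - (\<zeta> (int N - int d + int k) - 2)) d + cfrac 0 (\<lambda>k. s - (\<zeta> (int N + int d - int k) - 2)) d"
    using s(3) eq by (simp cong: cfrac_cong)
  have \<zeta>: "\<And>z. 1 \<le> \<zeta> z" "\<zeta> (int N) = x" "\<zeta> (- int N) = x"
    "\<And>z. \<bar>z\<bar> < int (N + m) \<Longrightarrow> \<bar>z\<bar> \<noteq> int N \<Longrightarrow> \<zeta> z \<le> x - g"
    "\<And>z. \<bar>z\<bar> \<noteq> int N \<Longrightarrow> t * \<zeta> z - \<bar>z\<bar> * ln (\<zeta> z) \<le> t * x - N * ln x - D"
    "\<And>z. \<zeta> z \<le> E * max \<bar>z\<bar> R"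
    using \<xi> gap[of "- _"] psi[of "- _"] far[of "- _"] by (auto simp: \<zeta>_def)
  define h where "h = cfrac 0 (\<lambda>k. s - (\<xi> (int k) - 2))"
  define h' where "h' = cfrac 0 (\<lambda>k. s - (\<zeta> (int k) - 2))"
  define H where "H = (\<Prod>k<N. h (Suc k))"
  define H' where "H' = (\<Prod>k<N. h' (Suc k))"
  note A = pam_sandwich[where m=m, OF \<xi> gap psi far num E3 E4 E5 E6 s, folded h_def H_def lo(1) hi]
  note A' = pam_sandwich[where m=m, OF \<zeta> num E3 E4 E5 E6 s(1,2) s', folded h'_def H'_def lo(1) hi]
  have u': "pam_u \<xi> t (- int N) = pam_u \<zeta> t (int N)"
    using num by (simp add: pam_u_reflect \<zeta>_def)
  have Hp: "0 < H" "0 < H'" using A(3) A'(3) by auto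
  have hip: "0 < hi" unfolding hi by (intro add_pos_pos) auto
  have lowp: "0 < exp (s * t) * H * lo" "0 < exp (s * t) * H' * lo" using Hp lo by auto
  show up: "0 < pam_u \<xi> t (int N)" "0 < pam_u \<xi> t (- int N)"
    unfolding u' using less_le_trans[OF lowp(1) A(1)] less_le_trans[OF lowp(2) A'(1)] by auto
  have l1: "s * t + ln H + ln lo \<le> ln (pam_u \<xi> t (int N))" "ln (pam_u \<xi> t (int N)) \<le> s * t + ln H + ln hi"
    using ln_mono[OF A(1) lowp(1)] ln_mono[OF A(2) up(1)] Hp lo(2) hip by (simp_all add: ln_mult_pos)
  have l2: "s * t + ln H' + ln lo \<le> ln (pam_u \<xi> t (- int N))" "ln (pam_u \<xi> t (- int N)) \<le> s * t + ln H' + ln hi"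
    using ln_mono[OF A'(1) lowp(2)] ln_mono[OF A'(2)] up(2) Hp lo(2) hip unfolding u' by (simp_all add: ln_mult_pos)
  have gk: "g \<le> x - \<xi> (int k)" "g \<le> x - \<zeta> (int k)" if "k < N" for k
    using gap[of "int k"] gap[of "- int k"] that by (auto simp: \<zeta>_def)
  have hpos: "0 < h (Suc k)" "0 < h' (Suc k)" if "k < N" for k
  proof -
    have "g \<le> s - (\<xi> (int j) - 2)" "g \<le> s - (\<zeta> (int j) - 2)" if "j \<le> k" for j
      using gk[of j] that \<open>k < N\<close> s(1) by auto
    then show "0 < h (Suc k)" "0 < h' (Suc k)"
      unfolding h_def h'_def using num(1) by (intro cfrac_pos[OF g4]; simp)+
  qed
  have lnH: "ln H - ln H' = (\<Sum>k<N. ln (h (Suc k)) - ln (h' (Suc k)))"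
  proof -
    have "ln H = (\<Sum>k<N. ln (h (Suc k)))" "ln H' = (\<Sum>k<N. ln (h' (Suc k)))"
      unfolding H_def H'_def by (rule ln_prod; use hpos in \<open>force dest: less_imp_neq\<close>)+
    then show ?thesis by (simp add: sum_subtractf)
  qed
  have e1: "\<bar>(\<Sum>k<N. ln (h (Suc k)) - ln (h' (Suc k))) - (\<Sum>k<N. ln (x - \<zeta> (int k)) - ln (x - \<xi> (int k)))\<bar>
     \<le> 24 / g ^ 3 * (\<Sum>k<N. \<bar>(x - \<xi> (int k)) - (x - \<zeta> (int k))\<bar>)"
    using ln_cfrac_ratio[OF num(1), of N "\<lambda>k. x - \<xi> (int k)" "\<lambda>k. x - \<zeta> (int k)" "s - (x - 2)"] gk s
    by (simp add: h_def h'_def algebra_simps)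
  have e2: "(\<Sum>k<N. \<bar>(x - \<xi> (int k)) - (x - \<zeta> (int k))\<bar>) = (\<Sum>k<N. \<bar>\<xi> (int k) - \<xi> (- int k)\<bar>)"
    by (intro sum.cong) (auto simp: \<zeta>_def)
  have e3: "ln (pam_u \<xi> t (int N) / pam_u \<xi> t (- int N)) = ln (pam_u \<xi> t (int N)) - ln (pam_u \<xi> t (- int N))"
    using up by (simp add: ln_div)
  show "\<bar>ln (pam_u \<xi> t (int N) / pam_u \<xi> t (- int N)) - (\<Sum>k<N. ln (x - \<xi> (- int k)) - ln (x - \<xi> (int k)))\<bar>
      \<le> ln hi - ln lo + 24 / g ^ 3 * (\<Sum>k<N. \<bar>\<xi> (int k) - \<xi> (- int k)\<bar>)"
    using l1 l2 lnH e1[unfolded e2] e3 unfolding \<zeta>_def by linarith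
qed

section \<open>Regular environments and the asymptotics of the ratio on them\<close>

definition scale_r :: "real \<Rightarrow> real \<Rightarrow> real" where "scale_r \<alpha> t = t / ln t * scale_a \<alpha> t"

abbreviation peak_site :: "real \<Rightarrow> real \<Rightarrow> real \<Rightarrow> nat" where
  "peak_site \<alpha> s t \<equiv> nat \<lfloor>scale_r \<alpha> t * s\<rfloor>"

text \<open>A peak of height \<open>x\<close> at \<open>\<plusminus>N\<close> with gap \<open>D\<close> (in units of \<open>t \<Psi>\<close>), mirrored within distance \<open>d\<close> of the peak, of growth rate at most \<open>E\<close>
  beyond \<open>R\<close>, and of total asymmetry at most \<open>K\<close> between the peaks.\<close>
definition regular_env :: "real \<Rightarrow> real \<Rightarrow> nat \<Rightarrow> nat \<Rightarrow> real \<Rightarrow> real \<Rightarrow> real \<Rightarrow> real \<Rightarrow> (int \<Rightarrow> real) \<Rightarrow> bool" where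
  "regular_env t x N d D E R K \<xi> \<longleftrightarrow> (\<forall>z. 1 \<le> \<xi> z) \<and> \<xi> (int N) = x \<and> \<xi> (- int N) = x \<and>
     (\<forall>z. \<bar>z\<bar> \<noteq> int N \<longrightarrow> t * \<xi> z - \<bar>z\<bar> * ln (\<xi> z) \<le> t * x - N * ln x - D) \<and>
     (\<forall>j. 1 \<le> j \<longrightarrow> j \<le> int d \<longrightarrow> \<xi> (int N - j) = \<xi> (- (int N - j)) \<and> \<xi> (int N + j) = \<xi> (- (int N + j))) \<and>
     (\<forall>z. \<xi> z \<le> E * max \<bar>z\<bar> R) \<and> (\<Sum>k<N. \<bar>\<xi> (int k) - \<xi> (- int k)\<bar>) \<le> K"

text \<open>The derivative of \<open>v - k * ln v\<close> is \<open>1 - k / v\<close>, nonnegative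
  for \<open>v \<ge> k\<close>. This turns a bound on \<open>\<Psi>\<close> at a site into a bound
  on the height there.\<close>

lemma linear_minus_log_mono:
  fixes k v w :: real
  assumes "0 < w" "w \<le> v" "k \<le> w" "0 \<le> k"
  shows "w - k * ln w \<le> v - k * ln v"
proof -
  have "k * (ln v - ln w) = k * ln (v / w)" using assms by (simp add: ln_div)
  also have "\<dots> \<le> k * (v / w - 1)" using assms by (intro mult_left_mono ln_le_minus_one) auto
  also have "\<dots> = k / w * (v - w)" using assms by (simp add: field_simps)
  also have "\<dots> \<le> 1 * (v - w)" using assms by (intro mult_right_mono) auto
  finally show ?thesis by (simp add: algebra_simps)
qed

text \<open>What depends on the environment is separated from what depends on \<open>t\<close>
  alone: \<open>e2\<close> to \<open>e10\<close> are scalar inequalities valid for large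
  \<open>t\<close>. The gap \<open>A * \<delta> / 2\<close> uses half of the margin in
  \<open>\<Psi>\<close>; the other half pays for the logarithmic cost of the \<open>m\<close> sites
  beyond \<open>N\<close>.\<close>

lemma regular_env_ratio:
  fixes t A l r y s \<delta> \<gamma> C :: real and N m d :: nat
  assumes reg: "regular_env t (A * y) N d (\<delta> * A * t) (\<gamma> / 4 * l / t) (sqrt l * r) (A\<^sup>2 * sqrt A) \<xi>"
    and def: "l = ln t" "r = t / l * A" "N = nat \<lfloor>r * s\<rfloor>" "m = nat \<lfloor>r * (\<delta> / 4)\<rfloor>" "g = A * \<delta> / 2" "\<Lambda> = ln (A * s / (4 * exp 1 * l))"
    and pos: "0 < \<delta>" "\<delta> < y" "0 < s" "1 < l" "1 \<le> t" "0 < A" "0 < \<gamma>"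
    and e2: "8 \<le> A * \<delta> / 2"
    and e3: "2 \<le> r * s" "2 * t \<le> r * s / 2" "real d + 1 \<le> r * s / 2"
    and e4: "real d + 2 \<le> r * (\<delta> / 8)"
    and e5: "ln (A * y) + 1 \<le> 3 * \<Lambda>"
    and e6: "s * (ln (A * y) - \<Lambda> + 1) \<le> \<delta> / 8 * (2 * \<Lambda> - 1)" "0 \<le> ln (A * y) - \<Lambda> + 1" "1 \<le> \<Lambda>"
    and e7: "sqrt l * (ln (\<gamma> / 4 * sqrt l * A) + 1 - \<Lambda>) \<le> \<delta> * l" "0 \<le> ln (\<gamma> / 4 * sqrt l * A) + 1 - \<Lambda>"
    and e8: "s * ln (A * y) \<le> sqrt l * (\<Lambda> - 1 - \<gamma> / 4 * l)" "0 \<le> \<Lambda> - 1 - \<gamma> / 4 * l" "0 \<le> ln (A * y)"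
    and e9: "(s + \<delta> / 4) / l \<le> y - \<delta> / 2" "1 \<le> A * (y - \<delta> / 2)" "ln (A * y) < 2 * l"
    and e10: "lo = 1 - 64 / g\<^sup>2 - exp (r * s - \<delta> * A * t / 16)" "0 < lo"
       "hi = exp (8 / g\<^sup>2 + 2 * (C * t)) + 3 * exp (- (r * s / 2))" "(2 / g) ^ (2 * d + 1) \<le> C"
       "ln hi - ln lo + 24 / g ^ 3 * (A\<^sup>2 * sqrt A) \<le> \<epsilon>"
  shows "0 < pam_u \<xi> t (int N)" "0 < pam_u \<xi> t (- int N)"
    "\<bar>ln (pam_u \<xi> t (int N) / pam_u \<xi> t (- int N)) - (\<Sum>k<N. ln (A * y - \<xi> (- int k)) - ln (A * y - \<xi> (int k)))\<bar> \<le> \<epsilon>"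
    "\<And>z. \<bar>z\<bar> < int N \<Longrightarrow> \<xi> z \<le> A * (y - \<delta> / 2)"
proof -
  define x where "x = A * y"
  have rpos: "0 < r" unfolding def(2) using pos by (intro mult_pos_pos divide_pos_pos) auto
  have Nb: "real N \<le> r * s" "r * s / 2 \<le> real N" using e3(1) rpos pos by (auto simp: def(3)) linarith+
  have mb: "real m \<le> r * (\<delta> / 4)" "r * (\<delta> / 8) \<le> real m" using e4 rpos pos by (auto simp: def(4)) linarith+
  have num: "8 \<le> g" "0 < N" "d \<le> N" "d < m" "0 < t" "2 * t \<le> real N"
    using e2 e3 e4 Nb mb pos def(5) by auto
  have At: "A * t = r * l" using pos def(2) by simp
  have gt0: "0 < g" using num by simp
  have xg: "x - g = A * (y - \<delta> / 2)" by (simp add: x_def def(5) algebra_simps)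
  have x0: "0 < x" using pos by (simp add: x_def)
  obtain R1: "\<forall>z. 1 \<le> \<xi> z" and R2: "\<xi> (int N) = x" "\<xi> (- int N) = x"
    and R3: "\<forall>z. \<bar>z\<bar> \<noteq> int N \<longrightarrow> t * \<xi> z - \<bar>z\<bar> * ln (\<xi> z) \<le> t * x - N * ln x - \<delta> * A * t"
    and R4: "\<forall>j. 1 \<le> j \<longrightarrow> j \<le> int d \<longrightarrow> \<xi> (int N - j) = \<xi> (- (int N - j)) \<and> \<xi> (int N + j) = \<xi> (- (int N + j))"
    and R5: "\<forall>z. \<xi> z \<le> \<gamma> / 4 * l / t * max \<bar>z\<bar> (sqrt l * r)"
    and K: "(\<Sum>k<N. \<bar>\<xi> (int k) - \<xi> (- int k)\<bar>) \<le> A\<^sup>2 * sqrt A"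
    using reg[unfolded regular_env_def of_int_abs, folded x_def] by (elim conjE)
  note \<xi> = R1[rule_format] R2 and psi = R3[rule_format] and win = R4[rule_format] and far = R5[rule_format]
  have gap: "\<xi> z \<le> x - g" if z: "\<bar>z\<bar> < int (N + m)" "\<bar>z\<bar> \<noteq> int N" for z
  proof (rule ccontr)
    assume "\<not> \<xi> z \<le> x - g"
    then have zg: "x - g \<le> \<xi> z" by simp
    have "real_of_int \<bar>z\<bar> \<le> real_of_int (int (N + m))" using z(1) by (simp only: of_int_le_iff)
    then have zb: "\<bar>real_of_int z\<bar> \<le> N + m" by simp
    \<comment> \<open>\<open>t * \<Psi>\<close> at \<open>z\<close> is
      \<open>t * (\<xi> z - k * ln (\<xi> z))\<close>, and \<open>e9\<close> puts \<open>k\<close>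
      below \<open>x - g\<close>, from where on this increases with the height.\<close>
    define k where "k = \<bar>real_of_int z\<bar> / t"
    have "k \<le> (r * s + r * (\<delta> / 4)) / t"
      unfolding k_def using zb Nb(1) mb(1) pos by (intro divide_right_mono) auto
    also have "\<dots> = A * ((s + \<delta> / 4) / l)" using pos by (simp add: def(2) field_simps)
    also have "\<dots> \<le> x - g" unfolding xg using pos e9(1) by (intro mult_left_mono) auto
    finally have k: "k \<le> x - g" "0 \<le> k" using pos by (auto simp: k_def)
    have "x - g - k * ln (x - g) \<le> \<xi> z - k * ln (\<xi> z)"
      using zg k e9(2) by (intro linear_minus_log_mono) (auto simp: xg)
    then have "t * (x - g - k * ln (x - g)) \<le> t * (\<xi> z - k * ln (\<xi> z))" using pos by (intro mult_left_mono) auto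
    also have "\<dots> = t * \<xi> z - \<bar>z\<bar> * ln (\<xi> z)" using pos by (simp add: k_def algebra_simps)
    also have "\<dots> \<le> t * x - N * ln x - \<delta> * A * t" using psi[OF z(2)] by simp
    finally have 1: "\<delta> * A * t + N * ln x \<le> t * g + \<bar>z\<bar> * ln (x - g)" using pos by (simp add: k_def algebra_simps)
    have "\<bar>z\<bar> * ln (x - g) \<le> (N + m) * ln x"
      using zb e9(2) gt0 x0 by (intro mult_mono) (auto simp flip: xg)
    also have "\<dots> = N * ln x + m * ln x" by (simp add: distrib_right)
    finally have "\<delta> * A * t \<le> t * g + m * ln x" using 1 by simp
    moreover have "m * ln x \<le> r * (\<delta> / 4) * ln x" using mb(1) e8(3) by (intro mult_right_mono) (auto simp: x_def)
    moreover have "r * (\<delta> / 4) * ln x < r * (\<delta> / 4) * (2 * l)"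
      using e9(3) rpos pos by (intro mult_strict_left_mono) (auto simp: x_def)
    moreover have "r * (\<delta> / 4) * (2 * l) = \<delta> * (r * l) / 2" by simp
    moreover have "t * g = \<delta> * (r * l) / 2" unfolding At[symmetric] def(5) by simp
    moreover have "\<delta> * A * t = \<delta> * (r * l)" unfolding At[symmetric] by simp
    ultimately show False by linarith
  qed
  show "\<xi> z \<le> A * (y - \<delta> / 2)" if "\<bar>z\<bar> < int N" for z
    using gap[of z] that unfolding xg by simp
  \<comment> \<open>Lower bound for the cost per jump once at least \<open>N\<close> jumps are
    charged, from \<open>N \<ge> r * s / 2\<close>. For large \<open>t\<close> it is asymptotically
    equal to \<open>ln (A * y)\<close>.\<close>
  have \<Lambda>: "\<Lambda> \<le> ln (real q / (2 * exp 1 * t))" if "N \<le> q" for q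
  proof -
    have "A * s / (4 * exp 1 * l) = (r * s / 2) / (2 * exp 1 * t)" using pos by (simp add: def(2) field_simps)
    also have "\<dots> \<le> real q / (2 * exp 1 * t)" using that Nb(2) pos by (intro divide_right_mono) auto
    finally show ?thesis unfolding def(6) using pos by (intro ln_mono) auto
  qed
  have \<Lambda>0: "0 \<le> \<Lambda>" using e6(3) by simp
  have E3: "N * ln x - real (3 * N) * ln (real (3 * N) / (2 * exp 1 * t)) \<le> - real N"
  proof -
    have "real (3 * N) * \<Lambda> \<le> real (3 * N) * ln (real (3 * N) / (2 * exp 1 * t))" by (intro mult_left_mono \<Lambda>) auto
    moreover have "N * (ln x + 1) \<le> N * (3 * \<Lambda>)" using e5 by (intro mult_left_mono) (auto simp: x_def)
    ultimately show ?thesis by (simp add: algebra_simps)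
  qed
  have E4: "N * ln x - real (2 * q - N) * ln (real (2 * q - N) / (2 * exp 1 * t)) \<le> - real q" if q: "N + m \<le> q" "real q \<le> sqrt l * r" for q
  proof -
    have 1: "real (2 * q - N) * \<Lambda> \<le> real (2 * q - N) * ln (real (2 * q - N) / (2 * exp 1 * t))"
      using q by (intro mult_left_mono \<Lambda>) auto
    have 2: "real (2 * q - N) = 2 * real q - N" using q by (simp add: of_nat_diff)
    have "N * (ln x - \<Lambda> + 1) \<le> r * s * (ln x - \<Lambda> + 1)" using Nb(1) e6(2) by (intro mult_right_mono) (auto simp: x_def)
    moreover have "r * (s * (ln x - \<Lambda> + 1)) \<le> r * (\<delta> / 8 * (2 * \<Lambda> - 1))" using e6(1) rpos by (intro mult_left_mono) (auto simp: x_def)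
    moreover have "r * (\<delta> / 8) * (2 * \<Lambda> - 1) \<le> m * (2 * \<Lambda> - 1)" using mb(2) e6(3) by (intro mult_right_mono) auto
    ultimately have "N * (ln x - \<Lambda> + 1) \<le> m * (2 * \<Lambda> - 1)" by (simp only: mult.assoc)
    moreover have "(real N + m) * (2 * \<Lambda> - 1) \<le> real q * (2 * \<Lambda> - 1)" using q e6(3) by (intro mult_right_mono) auto
    ultimately have "N * ln x + q \<le> (2 * real q - N) * \<Lambda>" by (simp add: algebra_simps)
    then show ?thesis using 1 unfolding 2 by linarith
  qed
  have ER: "\<gamma> / 4 * l / t * (sqrt l * r) = \<gamma> / 4 * sqrt l * A" using pos by (simp add: def(2))
  have E5: "- (\<delta> * A * t) + q * ln (\<gamma> / 4 * l / t * (sqrt l * r)) - q * ln (q / (2 * exp 1 * t)) \<le> - real q"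
    if q: "N + m \<le> q" "real q \<le> sqrt l * r" for q :: nat
  proof -
    define b where "b = ln (\<gamma> / 4 * sqrt l * A) + 1 - \<Lambda>"
    have "real q * \<Lambda> \<le> real q * ln (q / (2 * exp 1 * t))" using q by (intro mult_left_mono \<Lambda>) auto
    moreover have "real q * b \<le> (sqrt l * r) * b" using q e7(2) by (intro mult_right_mono) (auto simp: b_def)
    moreover have "r * (sqrt l * b) \<le> r * (\<delta> * l)" using e7(1) rpos by (intro mult_left_mono) (auto simp: b_def)
    moreover have "\<delta> * A * t = r * (\<delta> * l)" unfolding mult.assoc At by simp
    moreover have "(sqrt l * r) * b = r * (sqrt l * b)" by simp
    ultimately have "real q * b \<le> \<delta> * A * t" by linarith
    then show ?thesis unfolding ER using \<open>real q * \<Lambda> \<le> _\<close> by (simp add: b_def algebra_simps)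
  qed
  have E6: "N * ln x + t * (\<gamma> / 4 * l / t) * q - q * ln (q / (2 * exp 1 * t)) \<le> - real q"
    if q: "N + m \<le> q" "sqrt l * r < real q" for q :: nat
  proof -
    define b where "b = \<Lambda> - 1 - \<gamma> / 4 * l"
    have "real q * \<Lambda> \<le> real q * ln (q / (2 * exp 1 * t))" using q by (intro mult_left_mono \<Lambda>) auto
    moreover have "N * ln x \<le> r * s * ln x" using Nb(1) e8(3) by (intro mult_right_mono) (auto simp: x_def)
    moreover have "r * (s * ln x) \<le> r * (sqrt l * b)" using e8(1) rpos by (intro mult_left_mono) (auto simp: x_def b_def)
    moreover have "(sqrt l * r) * b \<le> real q * b" using q e8(2) by (intro mult_right_mono) (auto simp: b_def)
    moreover have "t * (\<gamma> / 4 * l / t) * q = \<gamma> / 4 * l * q" using pos by simp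
    moreover have "(sqrt l * r) * b = r * (sqrt l * b)" "r * s * ln x = r * (s * ln x)" by simp_all
    ultimately have "N * ln x \<le> real q * b" by linarith
    then have "N * ln x + \<gamma> / 4 * l * q + q \<le> real q * \<Lambda>" by (simp add: b_def algebra_simps)
    then show ?thesis using \<open>real q * \<Lambda> \<le> _\<close> \<open>t * (\<gamma> / 4 * l / t) * q = _\<close> by linarith
  qed
  define lo' where "lo' = 1 - 64 / g\<^sup>2 - 2 ^ N * exp (- (g * t / 8))"
  define hi' where "hi' = exp (8 / g\<^sup>2 + 2 * (2 / g) ^ (2 * d + 1) * t) + 3 * exp (- real N)"
  have lo': "lo \<le> lo'"
  proof -
    have "(2::real) ^ N \<le> exp 1 ^ N" using exp_ge_add_one_self[of 1] by (intro power_mono) auto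
    also have "\<dots> = exp (real N)" by (simp add: exp_of_nat_mult[symmetric])
    also have "\<dots> \<le> exp (r * s)" using Nb by simp
    finally have "2 ^ N * exp (- (g * t / 8)) \<le> exp (r * s) * exp (- (g * t / 8))" by (intro mult_right_mono) auto
    also have "\<dots> = exp (r * s - \<delta> * A * t / 16)" by (simp add: exp_add[symmetric] def(5) algebra_simps)
    finally show ?thesis by (simp add: lo'_def e10(1))
  qed
  have hi': "hi' \<le> hi"
    unfolding hi'_def e10(3) using Nb(2) mult_right_mono[OF e10(4), of t] pos
    by (intro add_mono) auto
  have hi'p: "0 < hi'" unfolding hi'_def by (intro add_pos_pos) auto
  have lo'p: "0 < lo'" using lo' e10(2) by simp
  note P = pam_ratio[where \<xi>=\<xi> and N=N and d=d and m=m and g=g, OF \<xi> gap psi far win num E3 E4 E5 E6 lo'_def lo'p hi'_def]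
  show "0 < pam_u \<xi> t (int N)" "0 < pam_u \<xi> t (- int N)" using P(1,2) by auto
  have "ln hi' \<le> ln hi" "ln lo \<le> ln lo'" using hi' lo' hi'p e10(2) by (auto intro!: ln_mono)
  moreover have "24 / g ^ 3 * (\<Sum>k<N. \<bar>\<xi> (int k) - \<xi> (- int k)\<bar>) \<le> 24 / g ^ 3 * (A\<^sup>2 * sqrt A)"
    using K gt0 by (intro mult_left_mono) auto
  ultimately show "\<bar>ln (pam_u \<xi> t (int N) / pam_u \<xi> t (- int N)) - (\<Sum>k<N. ln (A * y - \<xi> (- int k)) - ln (A * y - \<xi> (int k)))\<bar> \<le> \<epsilon>"
    using P(3) e10(5) unfolding x_def by linarith
qed

text \<open>The cost per jump and \<open>ln (scale_a \<alpha> t)\<close> are both asymptotic to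
  \<open>ln t / (\<alpha> - 1)\<close>; a quarter of this is therefore a harmless growth rate beyond
  \<open>R\<close>. Up to \<open>R\<close>, the factor \<open>sqrt (ln t)\<close> multiplies a
  difference of logarithms of order \<open>ln (ln t)\<close>, which stays below the margin
  \<open>\<delta> * ln t\<close>. The bound on the asymmetry, \<open>scale_a\<close> to the power
  5/2, lies between its mean, at most of order 2 in \<open>scale_a\<close>, and the order 3 that the
  error term tolerates.\<close>

theorem pam_ratio_asymptotic:
  fixes \<alpha> s y \<delta> \<epsilon> :: real
  assumes \<alpha>: "2 \<le> \<alpha>" and s: "0 < s" and \<delta>: "0 < \<delta>" "\<delta> < y" and \<epsilon>: "0 < \<epsilon>"
  shows "eventually (\<lambda>t. \<forall>\<xi>. regular_env t (scale_a \<alpha> t * y) (peak_site \<alpha> s t) (nat \<lceil>\<alpha>\<rceil>) (\<delta> * scale_a \<alpha> t * t)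
        (1 / (\<alpha> - 1) / 4 * ln t / t) (sqrt (ln t) * scale_r \<alpha> t) ((scale_a \<alpha> t)\<^sup>2 * sqrt (scale_a \<alpha> t)) \<xi> \<longrightarrow>
      0 < pam_u \<xi> t (int (peak_site \<alpha> s t)) \<and> 0 < pam_u \<xi> t (- int (peak_site \<alpha> s t)) \<and>
      \<bar>ln (pam_u \<xi> t (int (peak_site \<alpha> s t)) / pam_u \<xi> t (- int (peak_site \<alpha> s t)))
        - (\<Sum>k<peak_site \<alpha> s t. ln (scale_a \<alpha> t * y - \<xi> (- int k)) - ln (scale_a \<alpha> t * y - \<xi> (int k)))\<bar> \<le> \<epsilon> \<and>
      (\<forall>z. \<bar>z\<bar> < int (peak_site \<alpha> s t) \<longrightarrow> \<xi> z \<le> scale_a \<alpha> t * (y - \<delta> / 2))) at_top"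
proof -
  define \<gamma> where "\<gamma> = 1 / (\<alpha> - 1)"
  have \<gamma>: "0 < \<gamma>" "\<gamma> \<le> 1" using \<alpha> by (auto simp: \<gamma>_def)
  have y: "0 < y" "\<delta> / 2 < y" using \<delta> by auto
  define d where "d = nat \<lceil>\<alpha>\<rceil>"
  \<comment> \<open>\<open>A powr (2 / \<gamma>)\<close> is \<open>(t / ln t) powr 2\<close>, and
    \<open>2 / \<gamma> \<le> 2 * d + 1\<close> by the choice of the window radius. So
    \<open>t\<close> times the eigenvalue error is at most a constant times
    \<open>t * (t / ln t) powr (- 2)\<close> and vanishes.\<close>
  define C0 where "C0 = (4 / \<delta>) powr (2 / \<gamma>)"
  have C0: "0 < C0" using \<delta> by (simp add: C0_def)
  define A where "A = (\<lambda>t. (t / ln t) powr \<gamma>)"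
  define r where "r = (\<lambda>t. t / ln t * A t)"
  define \<Lambda> where "\<Lambda> = (\<lambda>t. ln (A t * s / (4 * exp 1 * ln t)))"
  define g where "g = (\<lambda>t. A t * \<delta> / 2)"
  define lo where "lo = (\<lambda>t. 1 - 64 / (g t)\<^sup>2 - exp (r t * s - \<delta> * A t * t / 16))"
  define hi where "hi = (\<lambda>t. exp (8 / (g t)\<^sup>2 + 2 * (C0 * (t / ln t) powr (- 2) * t)) + 3 * exp (- (r t * s / 2)))"
  note defs = A_def r_def \<Lambda>_def g_def lo_def hi_def
  note pos = \<gamma> s \<delta> y C0 \<epsilon>
  have v0: "eventually (\<lambda>t::real. 1 < ln t) at_top" unfolding defs using pos by real_asymp
  have v1: "eventually (\<lambda>t::real. 1 \<le> t) at_top" unfolding defs using pos by real_asymp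
  have v2: "eventually (\<lambda>t. 0 < A t) at_top" unfolding defs using pos by real_asymp
  have v3: "eventually (\<lambda>t. 8 \<le> A t * \<delta> / 2) at_top" unfolding defs using pos by real_asymp
  have v4: "eventually (\<lambda>t. 2 \<le> r t * s) at_top" unfolding defs using pos by real_asymp
  have v5: "eventually (\<lambda>t. 2 * t \<le> r t * s / 2) at_top" unfolding defs using pos by real_asymp
  have v6: "eventually (\<lambda>t. real d + 1 \<le> r t * s / 2) at_top" unfolding defs using pos by real_asymp
  have v7: "eventually (\<lambda>t. real d + 2 \<le> r t * (\<delta> / 8)) at_top" unfolding defs using pos by real_asymp
  have v8: "eventually (\<lambda>t. ln (A t * y) + 1 \<le> 3 * \<Lambda> t) at_top" unfolding defs using pos by real_asymp
  have v9: "eventually (\<lambda>t. s * (ln (A t * y) - \<Lambda> t + 1) \<le> \<delta> / 8 * (2 * \<Lambda> t - 1)) at_top" unfolding defs using pos by real_asymp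
  have v10: "eventually (\<lambda>t. 0 \<le> ln (A t * y) - \<Lambda> t + 1) at_top" unfolding defs using pos by real_asymp
  have v11: "eventually (\<lambda>t. 1 \<le> \<Lambda> t) at_top" unfolding defs using pos by real_asymp
  have v12: "eventually (\<lambda>t. sqrt (ln t) * (ln (\<gamma> / 4 * sqrt (ln t) * A t) + 1 - \<Lambda> t) \<le> \<delta> * ln t) at_top" unfolding defs using pos by real_asymp
  have v13: "eventually (\<lambda>t. 0 \<le> ln (\<gamma> / 4 * sqrt (ln t) * A t) + 1 - \<Lambda> t) at_top" unfolding defs using pos by real_asymp
  have v14: "eventually (\<lambda>t. s * ln (A t * y) \<le> sqrt (ln t) * (\<Lambda> t - 1 - \<gamma> / 4 * ln t)) at_top" unfolding defs using pos by real_asymp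
  have v15: "eventually (\<lambda>t. 0 \<le> \<Lambda> t - 1 - \<gamma> / 4 * ln t) at_top" unfolding defs using pos by real_asymp
  have v16: "eventually (\<lambda>t. 0 \<le> ln (A t * y)) at_top" unfolding defs using pos by real_asymp
  have v17: "eventually (\<lambda>t. (s + \<delta> / 4) / ln t \<le> y - \<delta> / 2) at_top" unfolding defs using pos by real_asymp
  have v18: "eventually (\<lambda>t. 1 \<le> A t * (y - \<delta> / 2)) at_top" unfolding defs using pos by real_asymp
  have v19: "eventually (\<lambda>t. ln (A t * y) < 2 * ln t) at_top" unfolding defs using pos by real_asymp
  have v20: "eventually (\<lambda>t. 0 < lo t) at_top" unfolding defs using pos by real_asymp
  have u1: "((\<lambda>t. 8 / (g t)\<^sup>2) \<longlongrightarrow> 0) at_top" unfolding defs using pos by real_asymp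
  have u2: "((\<lambda>t. 2 * (C0 * (t / ln t) powr (- 2) * t)) \<longlongrightarrow> 0) at_top" unfolding defs using pos by real_asymp
  have u3: "((\<lambda>t. 3 * exp (- (r t * s / 2))) \<longlongrightarrow> 0) at_top" unfolding defs using pos by real_asymp
  have u4: "(lo \<longlongrightarrow> 1) at_top" unfolding defs using pos by real_asymp
  have u5: "((\<lambda>t. 24 / g t ^ 3 * ((A t)\<^sup>2 * sqrt (A t))) \<longlongrightarrow> 0) at_top" unfolding defs using pos by real_asymp
  have u6: "(hi \<longlongrightarrow> exp (0 + 0) + 0) at_top" unfolding hi_def by (intro tendsto_intros u1 u2 u3)
  have v21: "((\<lambda>t. ln (hi t) - ln (lo t) + 24 / g t ^ 3 * ((A t)\<^sup>2 * sqrt (A t))) \<longlongrightarrow> ln (exp (0 + 0) + 0) - ln 1 + 0) at_top"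
    by (intro tendsto_intros u4 u5 u6) auto
  then have v22: "((\<lambda>t. ln (hi t) - ln (lo t) + 24 / g t ^ 3 * ((A t)\<^sup>2 * sqrt (A t))) \<longlongrightarrow> 0) at_top" by simp
  have ev11: "eventually (\<lambda>t. ln (hi t) - ln (lo t) + 24 / g t ^ 3 * ((A t)\<^sup>2 * sqrt (A t)) \<le> \<epsilon>) at_top"
    using order_tendstoD(2)[OF v22 \<epsilon>] by eventually_elim simp
  have sc: "scale_a \<alpha> = A" "scale_r \<alpha> = r" "1 / (\<alpha> - 1) = \<gamma>"
    by (auto simp: scale_a_def scale_r_def A_def r_def \<gamma>_def fun_eq_iff)
  show ?thesis
    unfolding sc d_def[symmetric]
    using v0 v1 v2 v3 v4 v5 v6 v7 v8 v9 v10 v11 v12 v13 v14 v15 v16 v17 v18 v19 v20 ev11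
  proof eventually_elim
    case (elim t)
    have "(2 / g t) ^ (2 * d + 1) = (2 / g t) powr real (2 * d + 1)"
      using elim by (subst powr_realpow) (auto simp: g_def)
    also have "\<dots> \<le> (2 / g t) powr (2 / \<gamma>)"
    proof (rule powr_mono')
      have "\<alpha> \<le> real d" unfolding d_def by (rule real_nat_ceiling_ge)
      then show "2 / \<gamma> \<le> real (2 * d + 1)" by (simp add: \<gamma>_def)
    qed (use elim in \<open>auto simp: g_def\<close>)
    also have "\<dots> = (4 / \<delta> * inverse (A t)) powr (2 / \<gamma>)" using elim \<delta> by (simp add: g_def field_simps)
    also have "\<dots> = C0 * (t / ln t) powr (- 2)"
      using elim \<delta> \<gamma> by (subst powr_mult) (auto simp: C0_def A_def powr_minus[symmetric] powr_powr)
    finally have C: "(2 / g t) ^ (2 * d + 1) \<le> C0 * (t / ln t) powr (- 2)" .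
    show ?case
    proof (rule allI, rule impI)
    fix \<xi>
    assume reg: "regular_env t (A t * y) (nat \<lfloor>r t * s\<rfloor>) d (\<delta> * A t * t) (\<gamma> / 4 * ln t / t) (sqrt (ln t) * r t) ((A t)\<^sup>2 * sqrt (A t)) \<xi>"
    have eqs: "r t = t / ln t * A t" "g t = A t * \<delta> / 2" "\<Lambda> t = ln (A t * s / (4 * exp 1 * ln t))"
      "lo t = 1 - 64 / (g t)\<^sup>2 - exp (r t * s - \<delta> * A t * t / 16)"
      "hi t = exp (8 / (g t)\<^sup>2 + 2 * (C0 * (t / ln t) powr (- 2) * t)) + 3 * exp (- (r t * s / 2))"
      by (simp_all only: r_def g_def \<Lambda>_def lo_def hi_def)
    note R = regular_env_ratio[OF reg refl eqs(1) refl refl eqs(2,3) \<delta> s elim(1-3) \<gamma>(1) elim(4-20) eqs(4) elim(21) eqs(5) C elim(22)]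
    show "0 < pam_u \<xi> t (int (nat \<lfloor>r t * s\<rfloor>)) \<and> 0 < pam_u \<xi> t (- int (nat \<lfloor>r t * s\<rfloor>)) \<and>
      \<bar>ln (pam_u \<xi> t (int (nat \<lfloor>r t * s\<rfloor>)) / pam_u \<xi> t (- int (nat \<lfloor>r t * s\<rfloor>)))
        - (\<Sum>k<nat \<lfloor>r t * s\<rfloor>. ln (A t * y - \<xi> (- int k)) - ln (A t * y - \<xi> (int k)))\<bar> \<le> \<epsilon> \<and>
      (\<forall>z. \<bar>z\<bar> < int (nat \<lfloor>r t * s\<rfloor>) \<longrightarrow> \<xi> z \<le> A t * (y - \<delta> / 2))"
      using R by blast
    qed
  qed
qed

section \<open>The environment as a product measure\<close>

text \<open>Coordinate \<open>Inl z\<close> carries \<open>\<xi>\<^sub>0 z\<close>, coordinate \<open>Inr n\<close> the coin at \<open>n\<close>, with success encoded as the value 1.\<close>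
locale pareto_env =
  fixes \<alpha> \<beta> :: real and p :: "nat \<Rightarrow> real" and \<mu> :: "int + nat \<Rightarrow> real measure"
  assumes \<alpha>: "2 \<le> \<alpha>" and prob: "\<And>i. prob_space (\<mu> i)" and sets_\<mu> [measurable_cong, simp]: "\<And>i. sets (\<mu> i) = sets borel"
    and pareto: "\<And>z x. 1 \<le> x \<Longrightarrow> measure (\<mu> (Inl z)) {x<..} = x powr (- \<alpha>)"
    and coin1: "\<And>n. 1 \<le> n \<Longrightarrow> measure (\<mu> (Inr n)) {1} = p n"
    and p_range: "\<And>n. 0 \<le> p n" "\<And>n. p n \<le> 1"
    and p_lim: "p \<longlonglongrightarrow> 1" and eta_asymp: "(\<lambda>n. eta p n) \<sim>[at_top] (\<lambda>n. \<beta> * kappa \<alpha> n)" and \<beta>: "0 < \<beta>"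
begin

text \<open>There is no coin at 0, the origin being its own mirror image.\<close>

definition I :: "(int + nat) set" where "I = range Inl \<union> Inr ` {1..}"
definition P :: "(int + nat \<Rightarrow> real) measure" where "P = PiM I \<mu>"

sublocale \<mu>: prob_space "\<mu> i" for i by (rule prob)
sublocale P: prob_space P unfolding P_def by (intro prob_space_PiM prob)

lemma I_mem [simp]: "Inl z \<in> I" "1 \<le> n \<Longrightarrow> Inr n \<in> I" "Inr (Suc n) \<in> I"
  by (auto simp: I_def)

lemma space_\<mu> [simp]: "space (\<mu> i) = UNIV"
  using sets_eq_imp_space_eq[OF sets_\<mu>] by simp

lemma sets_P [measurable_cong]: "sets P = sets (PiM I (\<lambda>_. borel))"
  unfolding P_def by (intro sets_PiM_cong) auto

lemma space_P: "space P = extensional I"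
  by (simp add: P_def space_PiM PiE_def)

lemma measurable_coord [measurable (raw)]: "i \<in> I \<Longrightarrow> (\<lambda>v. v i) \<in> borel_measurable P"
  using measurable_component_singleton[of i I \<mu>] by (simp add: P_def cong: measurable_cong_sets)

lemma measurable_update [measurable (raw)]:
  assumes "i \<in> I" "f \<in> measurable N P" "g \<in> borel_measurable N"
  shows "(\<lambda>w. (f w)(i := g w)) \<in> measurable N P"
proof -
  have "(\<lambda>w. (f w)(i := g w)) \<in> measurable N (PiM I \<mu>)"
    using assms by (intro measurable_fun_upd[where J=I]) (auto simp: P_def cong: measurable_cong_sets)
  then show ?thesis by (simp add: P_def)
qed

lemma distr_coord: "i \<in> I \<Longrightarrow> distr P (\<mu> i) (\<lambda>v. v i) = \<mu> i"
  unfolding P_def by (intro distr_PiM_component prob)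

lemma distr_coord_borel: "i \<in> I \<Longrightarrow> distr P borel (\<lambda>v. v i) = \<mu> i"
  using distr_coord[of i] by (metis distr_cong sets_\<mu>)

lemma prob_coord:
  assumes i: "i \<in> I" and [measurable]: "A \<in> sets borel"
  shows "measure P {v\<in>space P. v i \<in> A} = measure (\<mu> i) A"
proof -
  have "measure (distr P borel (\<lambda>v. v i)) A = measure P ((\<lambda>v. v i) -` A \<inter> space P)"
    using i by (intro measure_distr) measurable
  then show ?thesis using i by (simp add: distr_coord_borel vimage_def Int_def conj_commute)
qed

lemma indep_coord: "P.indep_vars (\<lambda>_. borel) (\<lambda>i v. v i) I"
proof (subst P.indep_vars_iff_distr_eq_PiM')
  show "I \<noteq> {}" by (auto simp: I_def)
  show "P.random_variable borel (\<lambda>v. v i)" if "i \<in> I" for i using that by measurable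
  have "distr P (PiM I (\<lambda>_. borel)) (\<lambda>v. \<lambda>i\<in>I. v i) = distr P P (\<lambda>v. v)"
    by (intro distr_cong) (auto simp: space_P sets_P extensional_restrict)
  also have "\<dots> = PiM I \<mu>" by (simp add: P_def distr_id)
  also have "\<dots> = PiM I (\<lambda>i. distr P borel (\<lambda>v. v i))"
    by (intro PiM_cong) (auto simp: distr_coord_borel)
  finally show "distr P (PiM I (\<lambda>_. borel)) (\<lambda>v. \<lambda>i\<in>I. v i) = PiM I (\<lambda>i. distr P borel (\<lambda>v. v i))" .
qed

text \<open>One coordinate may be replaced by an independent copy. The two orders serve different
  ends: the first fixes a value and averages over the environment, the second fixes the environment
  and averages over one value.\<close>

lemma resample:
  assumes i: "i \<in> I" and [measurable]: "f \<in> borel_measurable P"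
  shows "(\<integral>\<^sup>+v. f v \<partial>P) = (\<integral>\<^sup>+x. \<integral>\<^sup>+v. f (v(i := x)) \<partial>P \<partial>\<mu> i)"
    and "(\<integral>\<^sup>+v. f v \<partial>P) = (\<integral>\<^sup>+v. \<integral>\<^sup>+x. f (v(i := x)) \<partial>\<mu> i \<partial>P)"
proof -
  have I: "insert i I = I" using i by auto
  have "P = distr (\<mu> i \<Otimes>\<^sub>M P) P (\<lambda>(x, v). v(i := x))"
    using distr_pair_PiM_eq_PiM[of I \<mu> i, OF prob prob] unfolding I P_def by simp
  then have "(\<integral>\<^sup>+v. f v \<partial>P) = (\<integral>\<^sup>+v. f v \<partial>distr (\<mu> i \<Otimes>\<^sub>M P) P (\<lambda>(x, v). v(i := x)))" by simp
  also have "\<dots> = (\<integral>\<^sup>+(x, v). f (v(i := x)) \<partial>(\<mu> i \<Otimes>\<^sub>M P))"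
    using i by (subst nn_integral_distr) (auto simp: split_beta')
  finally have 1: "(\<integral>\<^sup>+v. f v \<partial>P) = (\<integral>\<^sup>+(x, v). f (v(i := x)) \<partial>(\<mu> i \<Otimes>\<^sub>M P))" .
  have m [measurable]: "(\<lambda>(x, v). f (v(i := x))) \<in> borel_measurable (\<mu> i \<Otimes>\<^sub>M P)"
    using i by measurable
  show "(\<integral>\<^sup>+v. f v \<partial>P) = (\<integral>\<^sup>+x. \<integral>\<^sup>+v. f (v(i := x)) \<partial>P \<partial>\<mu> i)"
    unfolding 1 by (subst P.nn_integral_fst[symmetric]) (auto simp: split_beta')
  interpret pair_sigma_finite "\<mu> i" P ..
  show "(\<integral>\<^sup>+v. f v \<partial>P) = (\<integral>\<^sup>+v. \<integral>\<^sup>+x. f (v(i := x)) \<partial>\<mu> i \<partial>P)"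
    unfolding 1 by (subst nn_integral_snd[symmetric]) (auto simp: split_beta')
qed

text \<open>Coins decide whether the value at \<open>Inl z\<close> enters \<open>F\<close> or the event at \<open>z\<close>, never both;
  so conditioning on the events costs at most the product of their probabilities.\<close>
lemma site_events_lower_bound:
  fixes F :: "(int + nat \<Rightarrow> real) \<Rightarrow> ennreal" and J :: "nat set" and bad :: "nat \<Rightarrow> real set"
  assumes J: "finite J" and [measurable]: "F \<in> borel_measurable P" "\<And>z. bad z \<in> sets borel"
    and F: "\<And>v z x. z \<in> J \<Longrightarrow> z = 0 \<or> v (Inr z) = 1 \<Longrightarrow> F (v(Inl (int z) := x)) = F v"
  shows "(\<Prod>z\<in>J. 1 - measure (\<mu> (Inl (int z))) (bad z)) * (\<integral>\<^sup>+v. F v \<partial>P)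
    \<le> (\<integral>\<^sup>+v. F v * indicator {v. \<forall>z\<in>J. z = 0 \<or> v (Inr z) = 1 \<longrightarrow> v (Inl (int z)) \<notin> bad z} v \<partial>P)"
  using J F
proof (induction J)
  case empty then show ?case by simp
next
  case (insert j J)
  define E where "E v \<longleftrightarrow> (\<forall>z\<in>J. z = 0 \<or> v (Inr z) = 1 \<longrightarrow> v (Inl (int z)) \<notin> bad z)" for v :: "int + nat \<Rightarrow> real"
  define C where "C v \<longleftrightarrow> j = 0 \<or> v (Inr j) = 1" for v :: "int + nat \<Rightarrow> real"
  define b where "b = 1 - measure (\<mu> (Inl (int j))) (bad j)"
  have b: "0 \<le> b" "b \<le> 1" by (auto simp: b_def)
  have coin [measurable]: "Measurable.pred P (\<lambda>v. z = 0 \<or> v (Inr z) = 1)" for z :: nat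
    by (cases z) measurable
  have [measurable]: "Measurable.pred P E" unfolding E_def by (intro pred_intros_finite insert) measurable
  have [measurable]: "Measurable.pred P C" unfolding C_def by (rule coin)
  have mb: "(\<integral>\<^sup>+x. indicator {x. x \<notin> bad j} x \<partial>\<mu> (Inl (int j))) = b"
  proof -
    have "{x. x \<notin> bad j} = space (\<mu> (Inl (int j))) - bad j" by auto
    then show ?thesis using \<mu>.prob_compl[of "bad j" "Inl (int j)"] by (simp add: \<mu>.emeasure_eq_measure b_def)
  qed
  have E_upd: "E (v(Inl (int j) := x)) = E v" "C (v(Inl (int j) := x)) = C v" for v x
  proof -
    have "z \<noteq> j" if "z \<in> J" for z using insert.hyps that by auto
    then show "E (v(Inl (int j) := x)) = E v" "C (v(Inl (int j) := x)) = C v"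
      unfolding E_def C_def by simp_all
  qed
  have "(\<Prod>z\<in>insert j J. 1 - measure (\<mu> (Inl (int z))) (bad z)) * (\<integral>\<^sup>+v. F v \<partial>P) =
      ennreal b * (ennreal (\<Prod>z\<in>J. 1 - measure (\<mu> (Inl (int z))) (bad z)) * (\<integral>\<^sup>+v. F v \<partial>P))"
  proof -
    have "(\<Prod>z\<in>insert j J. 1 - measure (\<mu> (Inl (int z))) (bad z)) = b * (\<Prod>z\<in>J. 1 - measure (\<mu> (Inl (int z))) (bad z))"
      using insert.hyps by (simp add: b_def)
    then show ?thesis using b by (simp only: ennreal_mult'[OF b(1)] mult.assoc)
  qed
  also have "\<dots> \<le> ennreal b * (\<integral>\<^sup>+v. F v * indicator {v. E v} v \<partial>P)"
    unfolding E_def using insert by (intro mult_left_mono) auto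
  also have "\<dots> = ennreal b * (\<integral>\<^sup>+v. \<integral>\<^sup>+x. F (v(Inl (int j) := x)) * indicator {v. E v} v \<partial>\<mu> (Inl (int j)) \<partial>P)"
    by (subst resample(2)[of "Inl (int j)"]) (auto simp: E_upd indicator_def)
  also have "\<dots> = (\<integral>\<^sup>+v. ennreal b * (\<integral>\<^sup>+x. F (v(Inl (int j) := x)) * indicator {v. E v} v \<partial>\<mu> (Inl (int j))) \<partial>P)"
    by (rule nn_integral_cmult[symmetric]) measurable
  \<comment> \<open>If the coin lets the event apply, \<open>F\<close> does not see the value and
    the factor \<open>b\<close> is exact; otherwise the event is vacuous and
    \<open>b \<le> 1\<close> is enough.\<close>
  also have "\<dots> \<le> (\<integral>\<^sup>+v. \<integral>\<^sup>+x. F (v(Inl (int j) := x)) * indicator {v. E v \<and> (C v \<longrightarrow> v (Inl (int j)) \<notin> bad j)} (v(Inl (int j) := x)) \<partial>\<mu> (Inl (int j)) \<partial>P)"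
  proof (rule nn_integral_mono)
    fix v assume v: "v \<in> space P"
    have [measurable]: "(\<lambda>x. F (v(Inl (int j) := x))) \<in> borel_measurable (\<mu> (Inl (int j)))"
      by (rule measurable_compose[of _ _ P]) (use v in measurable)
    show "ennreal b * (\<integral>\<^sup>+x. F (v(Inl (int j) := x)) * indicator {v. E v} v \<partial>\<mu> (Inl (int j)))
      \<le> (\<integral>\<^sup>+x. F (v(Inl (int j) := x)) * indicator {v. E v \<and> (C v \<longrightarrow> v (Inl (int j)) \<notin> bad j)} (v(Inl (int j) := x)) \<partial>\<mu> (Inl (int j)))"
    proof (cases "C v")
      case True
      have Fv: "F (v(Inl (int j) := x)) = F v" for x by (rule insert.prems) (use True in \<open>auto simp: C_def\<close>)
      have "(\<integral>\<^sup>+x. F (v(Inl (int j) := x)) * indicator {v. E v} v \<partial>\<mu> (Inl (int j))) = F v * indicator {v. E v} v"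
        and "(\<integral>\<^sup>+x. F (v(Inl (int j) := x)) * indicator {v. E v \<and> (C v \<longrightarrow> v (Inl (int j)) \<notin> bad j)} (v(Inl (int j) := x)) \<partial>\<mu> (Inl (int j)))
          = F v * indicator {v. E v} v * (\<integral>\<^sup>+x. indicator {x. x \<notin> bad j} x \<partial>\<mu> (Inl (int j)))"
        using True by (auto simp: Fv \<mu>.emeasure_space_1[simplified] nn_integral_cmult[symmetric] E_upd indicator_def intro!: nn_integral_cong)
      then show ?thesis by (simp add: mb mult.commute)
    next
      case False
      have "ennreal b * (\<integral>\<^sup>+x. F (v(Inl (int j) := x)) * indicator {v. E v} v \<partial>\<mu> (Inl (int j))) \<le> 1 * (\<integral>\<^sup>+x. F (v(Inl (int j) := x)) * indicator {v. E v} v \<partial>\<mu> (Inl (int j)))"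
        using b by (intro mult_right_mono) (auto simp: ennreal_le_1)
      then show ?thesis using False by (simp add: E_upd indicator_def)
    qed
  qed
  also have "\<dots> = (\<integral>\<^sup>+v. F v * indicator {v. E v \<and> (C v \<longrightarrow> v (Inl (int j)) \<notin> bad j)} v \<partial>P)"
    by (rule resample(2)[symmetric]) auto
  also have "{v. E v \<and> (C v \<longrightarrow> v (Inl (int j)) \<notin> bad j)} = {v. \<forall>z\<in>insert j J. z = 0 \<or> v (Inr z) = 1 \<longrightarrow> v (Inl (int z)) \<notin> bad z}"
    by (auto simp: E_def C_def)
  finally show ?case .
qed

text \<open>The finite events decrease to the infinite one; dominated convergence with
  \<open>F\<close> itself as majorant carries the inequality over.\<close>

lemma site_events_lower_bound_all:
  fixes F :: "(int + nat \<Rightarrow> real) \<Rightarrow> ennreal" and J :: "nat set" and bad :: "nat \<Rightarrow> real set"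
  assumes [measurable]: "F \<in> borel_measurable P" "\<And>z. bad z \<in> sets borel"
    and F: "\<And>v z x. z \<in> J \<Longrightarrow> z = 0 \<or> v (Inr z) = 1 \<Longrightarrow> F (v(Inl (int z) := x)) = F v"
    and fin: "(\<integral>\<^sup>+v. F v \<partial>P) < \<infinity>"
    and q: "\<And>M. q \<le> (\<Prod>z\<in>J \<inter> {..<M}. 1 - measure (\<mu> (Inl (int z))) (bad z))"
  shows "ennreal q * (\<integral>\<^sup>+v. F v \<partial>P)
    \<le> (\<integral>\<^sup>+v. F v * indicator {v. \<forall>z\<in>J. z = 0 \<or> v (Inr z) = 1 \<longrightarrow> v (Inl (int z)) \<notin> bad z} v \<partial>P)"
proof -
  define E where "E M = {v. \<forall>z\<in>J \<inter> {..<M}. z = 0 \<or> v (Inr z) = 1 \<longrightarrow> v (Inl (int z)) \<notin> bad z}" for M :: nat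
  have coin [measurable]: "Measurable.pred P (\<lambda>v. z = 0 \<or> v (Inr z) = 1)" for z :: nat
    by (cases z) measurable
  have E_eq: "(\<Inter>M. E M) = {v. \<forall>z\<in>J. z = 0 \<or> v (Inr z) = 1 \<longrightarrow> v (Inl (int z)) \<notin> bad z}"
    by (auto simp: E_def)
  have [measurable]: "Measurable.pred P (\<lambda>v. v \<in> E M)" for M
    unfolding E_def mem_Collect_eq by (rule pred_intros_finite) (simp, measurable)
  have lim: "(\<lambda>M. \<integral>\<^sup>+v. F v * indicator (E M) v \<partial>P) \<longlonglongrightarrow> (\<integral>\<^sup>+v. F v * indicator (\<Inter>M. E M) v \<partial>P)"
  proof (rule nn_integral_dominated_convergence[where w=F])
    show "AE v in P. (\<lambda>M. F v * indicator (E M) v) \<longlonglongrightarrow> F v * indicator (\<Inter>M. E M) v"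
    proof (rule AE_I2)
      fix v
      show "(\<lambda>M. F v * indicator (E M) v) \<longlonglongrightarrow> F v * indicator (\<Inter>M. E M) v"
      proof (cases "v \<in> (\<Inter>M. E M)")
        case True then show ?thesis by (simp add: indicator_def)
      next
        case False
        then obtain M where M: "v \<notin> E M" by auto
        have "eventually (\<lambda>m. F v * indicator (E m) v = 0) sequentially"
          using eventually_ge_at_top[of M] by eventually_elim (use M in \<open>auto simp: E_def indicator_def\<close>)
        then show ?thesis using False by (simp add: indicator_def tendsto_eventually)
      qed
    qed
  qed (use fin in \<open>auto simp: indicator_def\<close>)
  have "ennreal q * (\<integral>\<^sup>+v. F v \<partial>P) \<le> (\<integral>\<^sup>+v. F v * indicator (E M) v \<partial>P)" for M
  proof -
    have "ennreal q * (\<integral>\<^sup>+v. F v \<partial>P) \<le> (\<Prod>z\<in>J \<inter> {..<M}. 1 - measure (\<mu> (Inl (int z))) (bad z)) * (\<integral>\<^sup>+v. F v \<partial>P)"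
      using q[of M] by (intro mult_right_mono ennreal_leI) auto
    also have "\<dots> \<le> (\<integral>\<^sup>+v. F v * indicator (E M) v \<partial>P)"
      unfolding E_def using F by (intro site_events_lower_bound) auto
    finally show ?thesis .
  qed
  then show ?thesis unfolding E_eq[symmetric] by (intro LIMSEQ_le_const[OF lim]) auto
qed

end

text \<open>Comparison with the integral of \<open>u powr (- \<alpha>)\<close>: by the mean value
  theorem every term after the first is at most a difference of the antiderivative, and these
  telescope.\<close>

lemma sum_powr_affine_le:
  fixes \<alpha> b c :: real
  assumes "1 < \<alpha>" "0 < b" "0 < c"
  shows "(\<Sum>z<M. (b + c * real z) powr (- \<alpha>)) \<le> b powr (- \<alpha>) + b powr (1 - \<alpha>) / (c * (\<alpha> - 1))"
proof -
  define f where "f u = u powr (1 - \<alpha>) / (\<alpha> - 1)" for u :: real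
  have step: "c * (u + c) powr (- \<alpha>) \<le> f u - f (u + c)" if "0 < u" for u
  proof -
    have "\<exists>z. u < z \<and> z < u + c \<and> f (u + c) - f u = (u + c - u) * (- (z powr (- \<alpha>)))"
    proof (rule MVT2)
      fix w assume "u \<le> w" "w \<le> u + c"
      then have "0 < w" using that by simp
      then show "(f has_real_derivative - (w powr (- \<alpha>))) (at w)"
      proof -
        have "((\<lambda>u. u powr (1 - \<alpha>) / (\<alpha> - 1)) has_real_derivative ((1 - \<alpha>) * w powr (1 - \<alpha> - 1)) / (\<alpha> - 1)) (at w)"
          by (intro DERIV_cdivide has_real_derivative_powr \<open>0 < w\<close>)
        moreover have "((1 - \<alpha>) * w powr (1 - \<alpha> - 1)) / (\<alpha> - 1) = - (w powr (- \<alpha>))"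
          using assms by (simp add: field_simps)
        ultimately show ?thesis unfolding f_def by simp
      qed
    qed (use assms in simp)
    then obtain z where z: "u < z" "z < u + c" "f (u + c) - f u = c * (- (z powr (- \<alpha>)))" by auto
    have "(u + c) powr (- \<alpha>) \<le> z powr (- \<alpha>)" using z that assms by (intro powr_mono2') auto
    then have "c * (u + c) powr (- \<alpha>) \<le> c * z powr (- \<alpha>)" using assms by (intro mult_left_mono) auto
    then show ?thesis using z(3) by linarith
  qed
  have fnn: "0 \<le> f u" for u using assms by (simp add: f_def)
  have "(\<Sum>z<Suc m. (b + c * real z) powr (- \<alpha>)) \<le> b powr (- \<alpha>) + (f b - f (b + c * real m)) / c" for m
  proof (induction m)
    case (Suc m)
    have "c * (b + c * real (Suc m)) powr (- \<alpha>) \<le> f (b + c * real m) - f (b + c * real (Suc m))"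
      using step[of "b + c * real m"] assms by (simp add: algebra_simps add_pos_nonneg)
    then have "(b + c * real (Suc m)) powr (- \<alpha>) \<le> (f (b + c * real m) - f (b + c * real (Suc m))) / c"
      using assms by (simp add: field_simps)
    then show ?case using Suc by (simp add: diff_divide_distrib)
  qed simp
  moreover have "(f b - f (b + c * real m)) / c \<le> b powr (1 - \<alpha>) / (c * (\<alpha> - 1))" for m
  proof -
    have "(f b - f (b + c * real m)) / c \<le> f b / c" using fnn assms by (intro divide_right_mono) auto
    then show ?thesis by (simp add: f_def mult.commute)
  qed
  ultimately have *: "(\<Sum>z<Suc m. (b + c * real z) powr (- \<alpha>)) \<le> b powr (- \<alpha>) + b powr (1 - \<alpha>) / (c * (\<alpha> - 1))" for m
    by (meson add_left_mono order_trans)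
  show ?thesis
  proof (cases M)
    case 0 then show ?thesis using assms by simp
  next
    case (Suc m) then show ?thesis using *[of m] by simp
  qed
qed

text \<open>Converse to \<open>1 - u \<le> exp (- u)\<close>. The loss \<open>1 + 2 * \<rho>\<close>
  tends to 1 as the largest single probability tends to 0, so products of survival probabilities are
  asymptotically exponentials.\<close>

lemma one_minus_ge_exp:
  fixes u \<rho> :: real assumes "0 \<le> u" "u \<le> \<rho>" "\<rho> \<le> 1 / 2"
  shows "exp (- ((1 + 2 * \<rho>) * u)) \<le> 1 - u"
proof -
  have "- ln (1 - u) = ln (1 / (1 - u))" using assms by (simp add: ln_div)
  also have "\<dots> \<le> 1 / (1 - u) - 1" using assms by (intro ln_le_minus_one) auto
  also have "\<dots> = u / (1 - u)" using assms by (simp add: field_simps)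
  also have "\<dots> \<le> (1 + 2 * \<rho>) * u"
  proof -
    have "1 \<le> (1 + 2 * u) * (1 - u)" using assms mult_left_mono[of u "1/2" u] by (simp add: algebra_simps)
    then have "u * 1 \<le> u * ((1 + 2 * u) * (1 - u))" using assms by (intro mult_left_mono) auto
    then have "u / (1 - u) \<le> (1 + 2 * u) * u" using assms by (simp add: divide_le_eq mult_ac)
    also have "\<dots> \<le> (1 + 2 * \<rho>) * u" using assms by (intro mult_right_mono) auto
    finally show ?thesis .
  qed
  finally have "- ((1 + 2 * \<rho>) * u) \<le> ln (1 - u)" by simp
  then have "exp (- ((1 + 2 * \<rho>) * u)) \<le> exp (ln (1 - u))" by simp
  also have "exp (ln (1 - u)) = 1 - u" using assms by (intro exp_ln) simp
  finally show ?thesis .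
qed

section \<open>The Pareto law and its tails\<close>

context pareto_env begin

lemma AE_pareto: "AE u in \<mu> (Inl z). 1 < u"
proof -
  have "\<mu>.prob (Inl z) {1<..} = 1" using pareto[of 1 z] by simp
  then show ?thesis using \<mu>.prob_eq_1[of "{1<..}" "Inl z"] by simp
qed

definition pareto_density :: "real \<Rightarrow> real" where
  "pareto_density u = (if 1 < u then \<alpha> * u powr (- \<alpha> - 1) else 0)"

lemma pareto_density_nonneg [simp]: "0 \<le> pareto_density u" using \<alpha> by (simp add: pareto_density_def)

lemma pareto_density_measurable [measurable]: "pareto_density \<in> borel_measurable borel"
  unfolding pareto_density_def by measurable

lemma nn_integral_pareto_density:
  assumes "1 \<le> x"
  shows "(\<integral>\<^sup>+u. ennreal (pareto_density u) * indicator {x<..} u \<partial>lborel) = ennreal (x powr (- \<alpha>))"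
proof -
  have "(\<integral>\<^sup>+u. ennreal (pareto_density u) * indicator {x<..} u \<partial>lborel) = (\<integral>\<^sup>+u. ennreal (\<alpha> * u powr (- \<alpha> - 1)) * indicator {x..} u \<partial>lborel)"
    by (intro nn_integral_cong_AE eventually_mono[OF AE_lborel_singleton[of x]])
       (use assms in \<open>auto simp: pareto_density_def indicator_def\<close>)
  also have "\<dots> = ennreal (0 - (- (x powr (- \<alpha>))))"
  proof (rule nn_integral_FTC_atLeast)
    show "((\<lambda>u. - (u powr (- \<alpha>))) has_real_derivative \<alpha> * u powr (- \<alpha> - 1)) (at u)" if "x \<le> u" for u
      using that assms by (auto intro!: derivative_eq_intros)
    show "((\<lambda>u. - (u powr (- \<alpha>))) \<longlongrightarrow> 0) at_top" using \<alpha> by real_asymp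
  qed (use \<alpha> in auto)
  finally show ?thesis by simp
qed

text \<open>The tail determines the distribution function and hence the measure. The explicit
  density is what the later change of variables in the height of the peak acts on.\<close>

lemma distr_pareto: "\<mu> (Inl z) = density lborel pareto_density"
proof -
  have pd: "prob_space (density lborel pareto_density)"
  proof
    have "emeasure (density lborel pareto_density) (space (density lborel pareto_density)) = (\<integral>\<^sup>+u. ennreal (pareto_density u) * indicator {1<..} u \<partial>lborel)"
      by (subst emeasure_density) (auto intro!: nn_integral_cong simp: pareto_density_def indicator_def)
    then show "emeasure (density lborel pareto_density) (space (density lborel pareto_density)) = 1"
      by (simp add: nn_integral_pareto_density)
  qed
  interpret D: prob_space "density lborel pareto_density" by (rule pd)
  have m: "measure (density lborel pareto_density) {x<..} = measure (\<mu> (Inl z)) {x<..}" for x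
  proof (cases "1 \<le> x")
    case True
    have "emeasure (density lborel pareto_density) {x<..} = ennreal (x powr (- \<alpha>))"
      using nn_integral_pareto_density[OF True] by (simp add: emeasure_density)
    then show ?thesis using pareto[OF True, of z] by (simp add: D.emeasure_eq_measure)
  next
    case False
    have "emeasure (density lborel pareto_density) {1<..} = 1"
      using nn_integral_pareto_density[of 1] by (simp add: emeasure_density)
    then have "1 \<le> measure (density lborel pareto_density) {x<..}"
      using D.finite_measure_mono[of "{1<..}" "{x<..}"] False by (simp add: D.emeasure_eq_measure)
    moreover have "1 \<le> measure (\<mu> (Inl z)) {x<..}"
      using \<mu>.finite_measure_mono[of "{1<..}" "{x<..}" "Inl z"] pareto[of 1 z] False by simp
    ultimately show ?thesis using D.prob_le_1[of "{x<..}"] \<mu>.prob_le_1[of "Inl z" "{x<..}"] by linarith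
  qed
  show ?thesis
  proof (rule cdf_unique)
    show "real_distribution (\<mu> (Inl z))" by (intro real_distribution.intro real_distribution_axioms.intro prob) simp
    show "real_distribution (density lborel pareto_density)" by (intro real_distribution.intro real_distribution_axioms.intro pd) simp
    have "{..x} = UNIV - {x<..}" for x :: real by auto
    then show "cdf (\<mu> (Inl z)) = cdf (density lborel pareto_density)"
      using \<mu>.prob_compl[of "{_<..}" "Inl z"] D.prob_compl[of "{_<..}"] m
      by (auto simp: cdf_def fun_eq_iff)
  qed
qed

text \<open>\<open>Y < u - k * ln u\<close> first gives \<open>u > Y\<close> and then, through
  \<open>ln u \<ge> ln Y\<close>, \<open>u > Y + k * ln Y\<close>. The linear growth in
  \<open>k\<close> makes the sum over sites converge.\<close>

lemma pareto_log_tail: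
  assumes Y: "1 \<le> Y" and k: "0 \<le> k" and [measurable]: "A \<in> sets borel" and A: "\<And>u. u \<in> A \<Longrightarrow> 1 < u \<Longrightarrow> Y < u - k * ln u"
  shows "measure (\<mu> (Inl z)) A \<le> (Y + k * ln Y) powr (- \<alpha>)"
proof -
  have sub: "u \<in> {Y + k * ln Y<..}" if "u \<in> A" "1 < u" for u
  proof -
    have "Y < u - k * ln u" by (rule A[OF that])
    moreover have "0 \<le> k * ln u" using that k by simp
    ultimately have "Y < u" by simp
    then have "k * ln Y \<le> k * ln u" using Y k by (intro mult_left_mono) auto
    then show ?thesis using \<open>Y < u - k * ln u\<close> by simp
  qed
  have "measure (\<mu> (Inl z)) A \<le> measure (\<mu> (Inl z)) {Y + k * ln Y<..}"
    by (rule \<mu>.finite_measure_mono_AE) (use AE_pareto[of z] in \<open>auto elim!: eventually_mono simp: sub[simplified]\<close>)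
  also have "\<dots> = (Y + k * ln Y) powr (- \<alpha>)"
    using Y k by (intro pareto) (auto intro: order_trans[of 1 Y] simp: add_increasing2)
  finally show ?thesis .
qed

end

section \<open>Characteristic function of the accumulated asymmetry\<close>

text \<open>\<open>- ln (1 - v)\<close> truncated at \<open>1 - \<kappa>\<close>; the truncation is inactive on regular environments.\<close>
definition log_gap :: "real \<Rightarrow> real \<Rightarrow> real" where
  "log_gap \<kappa> v = - ln (1 - min v (1 - \<kappa>))"

lemma log_gap_measurable [measurable]: "log_gap \<kappa> \<in> borel_measurable borel"
  unfolding log_gap_def by measurable

text \<open>\<open>log_gap\<close> is linear in the truncated value up to a quadratic error, which
  gives the limits, and at most a multiple of it, which gives the domination.\<close>

lemma log_gap_bounds:
  assumes \<kappa>: "0 < \<kappa>" "\<kappa> < 1" and v: "0 \<le> v"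
  defines "m \<equiv> min v (1 - \<kappa>)"
  shows "0 \<le> m" "m \<le> 1" "m \<le> v" "m \<le> log_gap \<kappa> v" "log_gap \<kappa> v \<le> m + m\<^sup>2 / \<kappa>" "log_gap \<kappa> v \<le> m / \<kappa>"
proof -
  show m: "0 \<le> m" "m \<le> 1" "m \<le> v" using \<kappa> v by (auto simp: m_def)
  have m1: "\<kappa> \<le> 1 - m" using \<kappa> by (auto simp: m_def)
  have L: "log_gap \<kappa> v = - ln (1 - m)" by (simp add: log_gap_def m_def)
  have "ln (1 - m) \<le> (1 - m) - 1" using m1 \<kappa> by (intro ln_le_minus_one) auto
  then show "m \<le> log_gap \<kappa> v" unfolding L by simp
  have "- ln (1 - m) = ln (1 / (1 - m))" using m1 \<kappa> by (simp add: ln_div)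
  also have "\<dots> \<le> 1 / (1 - m) - 1" using m1 \<kappa> by (intro ln_le_minus_one) auto
  also have "\<dots> = m / (1 - m)" using m1 \<kappa> by (simp add: field_simps)
  finally have 1: "log_gap \<kappa> v \<le> m / (1 - m)" unfolding L .
  also have "\<dots> \<le> m / \<kappa>" using m m1 \<kappa> by (intro divide_left_mono mult_pos_pos) auto
  finally show "log_gap \<kappa> v \<le> m / \<kappa>" .
  have "m / (1 - m) = m + m\<^sup>2 / (1 - m)" using m1 \<kappa> by (simp add: field_simps power2_eq_square)
  also have "\<dots> \<le> m + m\<^sup>2 / \<kappa>" using m m1 \<kappa> by (intro add_left_mono divide_left_mono mult_pos_pos) auto
  finally show "log_gap \<kappa> v \<le> m + m\<^sup>2 / \<kappa>" using 1 by simp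
qed

lemma sin_minus_self_bound: "\<bar>sin x - x\<bar> \<le> \<bar>x\<bar> ^ 3 / 6" for x :: real
  using Maclaurin_sin_bound[of x 3]
  by (simp add: sin_coeff_def numeral_eq_Suc lessThan_Suc fact_Suc field_simps)

lemma one_minus_cos_bounds:
  fixes x :: real
  shows "1 - cos x \<le> x\<^sup>2 / 2" "\<bar>1 - cos x - x\<^sup>2 / 2\<bar> \<le> x ^ 4 / 24"
proof -
  obtain t where "cos x = (\<Sum>m<4. cos_coeff m * x ^ m) + cos (t + 1/2 * real (4::nat) * pi) / fact 4 * x ^ 4"
    using Maclaurin_cos_expansion[of x 4] by blast
  moreover have "(\<Sum>m<4. cos_coeff m * x ^ m) = 1 - x\<^sup>2 / 2"
  proof -
    have "{..<4} = {0, 1, 2, 3::nat}" by auto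
    then show ?thesis by (simp add: cos_coeff_def fact_numeral)
  qed
  ultimately have "1 - cos x - x\<^sup>2 / 2 = - (cos (t + 1/2 * real (4::nat) * pi) / fact 4 * x ^ 4)" by simp
  then have "\<bar>1 - cos x - x\<^sup>2 / 2\<bar> = \<bar>cos (t + 1/2 * real (4::nat) * pi)\<bar> / fact 4 * x ^ 4"
    by (simp add: abs_mult power_even_abs_numeral)
  also have "\<dots> \<le> 1 / fact 4 * x ^ 4" by (intro mult_right_mono divide_right_mono) auto
  finally show "\<bar>1 - cos x - x\<^sup>2 / 2\<bar> \<le> x ^ 4 / 24" by (simp add: fact_numeral)
  have "1 - cos x = 2 * (sin (x / 2))\<^sup>2" using cos_double_sin[of "x / 2"] by simp
  also have "(sin (x / 2))\<^sup>2 \<le> (x / 2)\<^sup>2" using abs_sin_x_le_abs_x[of "x / 2"] by (simp only: abs_le_square_iff)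
  finally show "1 - cos x \<le> x\<^sup>2 / 2" by (simp add: power2_eq_square)
qed

section \<open>Trigonometric moments of a single truncated logarithm\<close>

context pareto_env begin

abbreviation cos_loss :: "real \<Rightarrow> real \<Rightarrow> real \<Rightarrow> real" where
  "cos_loss \<kappa> \<theta> x \<equiv> \<integral>u. 1 - cos (\<theta> * log_gap \<kappa> (u / x)) \<partial>\<mu> (Inl 0)"

abbreviation sin_mean :: "real \<Rightarrow> real \<Rightarrow> real \<Rightarrow> real" where
  "sin_mean \<kappa> \<theta> x \<equiv> \<integral>u. sin (\<theta> * log_gap \<kappa> (u / x)) \<partial>\<mu> (Inl 0)"

text \<open>One minus the squared modulus of the characteristic function of
  \<open>log_gap \<kappa> (u / x)\<close>; the squared modulus belongs to the difference of two
  independent copies. For \<alpha> > 2 and large \<open>x\<close> this is \<open>\<theta>\<close>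
  squared times the Pareto variance over x^2.\<close>

definition gap_loss :: "real \<Rightarrow> real \<Rightarrow> real \<Rightarrow> real" where
  "gap_loss \<kappa> \<theta> x = 1 - (\<integral>u. cos (\<theta> * log_gap \<kappa> (u / x)) \<partial>\<mu> (Inl 0))\<^sup>2 - (sin_mean \<kappa> \<theta> x)\<^sup>2"

lemma \<mu>_eq: "\<mu> (Inl z) = \<mu> (Inl 0)"
  by (simp add: distr_pareto)

lemma bounded_integrable:
  assumes "f \<in> borel_measurable borel" "\<And>u. 1 < u \<Longrightarrow> \<bar>f u\<bar> \<le> (b::real)"
  shows "integrable (\<mu> (Inl z)) f"
  by (rule \<mu>.integrable_const_bound[where B=b]) (use assms AE_pareto[of z] in \<open>auto elim!: eventually_mono\<close>)

lemma pareto_moment: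
  assumes k: "\<kappa> < \<alpha>"
  shows "integrable (\<mu> (Inl z)) (\<lambda>u. u powr \<kappa>)" "(\<integral>u. u powr \<kappa> \<partial>\<mu> (Inl z)) = \<alpha> / (\<alpha> - \<kappa>)"
proof -
  have "(\<integral>\<^sup>+u. ennreal (u powr \<kappa>) \<partial>\<mu> (Inl z)) = (\<integral>\<^sup>+u. ennreal (\<alpha> * u powr (\<kappa> - \<alpha> - 1)) * indicator {1..} u \<partial>lborel)"
    unfolding distr_pareto
    by (subst nn_integral_density, simp, simp, intro nn_integral_cong_AE eventually_mono[OF AE_lborel_singleton[of 1]])
       (auto simp: pareto_density_def indicator_def ennreal_mult'[symmetric] powr_add[symmetric] mult.assoc algebra_simps)
  also have "\<dots> = ennreal (0 - (\<alpha> / (\<kappa> - \<alpha>) * 1 powr (\<kappa> - \<alpha>)))"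
  proof (rule nn_integral_FTC_atLeast)
    show "((\<lambda>u. \<alpha> / (\<kappa> - \<alpha>) * u powr (\<kappa> - \<alpha>)) has_real_derivative \<alpha> * u powr (\<kappa> - \<alpha> - 1)) (at u)" if "1 \<le> u" for u
      using that k by (auto intro!: derivative_eq_intros)
    show "((\<lambda>u. \<alpha> / (\<kappa> - \<alpha>) * u powr (\<kappa> - \<alpha>)) \<longlongrightarrow> 0) at_top" using k by real_asymp
  qed (use \<alpha> in auto)
  also have "0 - (\<alpha> / (\<kappa> - \<alpha>) * 1 powr (\<kappa> - \<alpha>)) = \<alpha> / (\<alpha> - \<kappa>)" using k by (simp add: field_simps)
  finally have e: "(\<integral>\<^sup>+u. ennreal (u powr \<kappa>) \<partial>\<mu> (Inl z)) = ennreal (\<alpha> / (\<alpha> - \<kappa>))" .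
  show "integrable (\<mu> (Inl z)) (\<lambda>u. u powr \<kappa>)"
    by (rule integrableI_nonneg) (auto simp: e)
  show "(\<integral>u. u powr \<kappa> \<partial>\<mu> (Inl z)) = \<alpha> / (\<alpha> - \<kappa>)"
    by (subst integral_eq_nn_integral) (use \<alpha> k in \<open>auto simp: e\<close>)
qed

lemma pareto_mean: "integrable (\<mu> (Inl z)) (\<lambda>u. u)" "(\<integral>u. u \<partial>\<mu> (Inl z)) = \<alpha> / (\<alpha> - 1)"
proof -
  have ae: "AE u in \<mu> (Inl z). u powr 1 = u" using AE_pareto[of z] by eventually_elim simp
  show "integrable (\<mu> (Inl z)) (\<lambda>u. u)"
    by (rule integrable_cong_AE[THEN iffD1, OF _ _ ae]) (use pareto_moment(1)[of 1 z] \<alpha> in auto)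
  show "(\<integral>u. u \<partial>\<mu> (Inl z)) = \<alpha> / (\<alpha> - 1)"
  proof -
    have "(\<integral>u. u powr 1 \<partial>\<mu> (Inl z)) = (\<integral>u. u \<partial>\<mu> (Inl z))" by (rule integral_cong_AE) (use ae in auto)
    then show ?thesis using pareto_moment(2)[of 1 z] \<alpha> by simp
  qed
qed

lemma pareto_second:
  assumes "2 < \<alpha>"
  shows "integrable (\<mu> (Inl z)) (\<lambda>u. u\<^sup>2)" "(\<integral>u. u\<^sup>2 \<partial>\<mu> (Inl z)) = \<alpha> / (\<alpha> - 2)"
proof -
  have ae: "AE u in \<mu> (Inl z). u powr 2 = u\<^sup>2" using AE_pareto[of z] by eventually_elim (simp add: powr_numeral)
  show "integrable (\<mu> (Inl z)) (\<lambda>u. u\<^sup>2)"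
    using pareto_moment(1)[of 2 z] assms integrable_cong_AE[OF _ _ ae] by simp
  show "(\<integral>u. u\<^sup>2 \<partial>\<mu> (Inl z)) = \<alpha> / (\<alpha> - 2)"
    using pareto_moment(2)[of 2 z] assms integral_cong_AE[OF _ _ ae] by simp
qed

text \<open>The quantity is a small difference of terms near 1; in terms of \<open>1 - cos\<close>
  each part has a limit after rescaling.\<close>

lemma gap_loss_alt:
  "gap_loss \<kappa> \<theta> x = 2 * (cos_loss \<kappa> \<theta> x) - (cos_loss \<kappa> \<theta> x)\<^sup>2
     - (sin_mean \<kappa> \<theta> x)\<^sup>2"
proof -
  have "integrable (\<mu> (Inl 0)) (\<lambda>u. cos (\<theta> * log_gap \<kappa> (u / x)))"
    by (rule bounded_integrable[where b=1]) auto
  then have "(cos_loss \<kappa> \<theta> x) = 1 - (\<integral>u. cos (\<theta> * log_gap \<kappa> (u / x)) \<partial>\<mu> (Inl 0))"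
    by (simp add: \<mu>.prob_space[simplified])
  then have c: "(\<integral>u. cos (\<theta> * log_gap \<kappa> (u / x)) \<partial>\<mu> (Inl 0)) = 1 - (cos_loss \<kappa> \<theta> x)"
    by simp
  show ?thesis unfolding gap_loss_def c by (simp add: power2_eq_square algebra_simps)
qed

lemma log_gap_abs_le:
  assumes "0 < \<kappa>" "\<kappa> < 1" "1 < u" "0 < x"
  shows "0 \<le> log_gap \<kappa> (u / x)" "x * log_gap \<kappa> (u / x) \<le> u / \<kappa>"
proof -
  have v: "0 \<le> u / x" using assms by simp
  note b = log_gap_bounds[OF assms(1,2) v]
  show "0 \<le> log_gap \<kappa> (u / x)" using b by linarith
  have "log_gap \<kappa> (u / x) \<le> (u / x) / \<kappa>" using b(6,3) assms(1) by (meson divide_right_mono less_imp_le order_trans)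
  then have "x * log_gap \<kappa> (u / x) \<le> x * ((u / x) / \<kappa>)" using assms by (intro mult_left_mono) auto
  then show "x * log_gap \<kappa> (u / x) \<le> u / \<kappa>" using assms by simp
qed

lemma log_gap_lim:
  assumes "0 < \<kappa>" "\<kappa> < 1" "1 < u"
  shows "((\<lambda>x. x * log_gap \<kappa> (u / x)) \<longlongrightarrow> u) at_top"
proof (rule Lim_transform_eventually)
  show "((\<lambda>x. x * (- ln (1 - u / x))) \<longlongrightarrow> u) at_top" by real_asymp
  have "eventually (\<lambda>x. u / x < 1 - \<kappa>) at_top" using assms by real_asymp
  then show "eventually (\<lambda>x. x * (- ln (1 - u / x)) = x * log_gap \<kappa> (u / x)) at_top"
    by eventually_elim (simp add: log_gap_def min_def)
qed

text \<open>\<open>x * log_gap \<kappa> (u / x)\<close> tends to \<open>u\<close> and is at most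
  \<open>u / \<kappa>\<close>, whose mean is finite. Dominated convergence and a cubic error for the
  sine give the first moment.\<close>

lemma sin_moment_lim:
  assumes \<kappa>: "0 < \<kappa>" "\<kappa> < 1" and x: "\<And>k. 0 < x k" "filterlim x at_top sequentially"
  shows "(\<lambda>k. x k * (sin_mean \<kappa> \<theta> (x k))) \<longlonglongrightarrow> \<theta> * (\<alpha> / (\<alpha> - 1))"
proof -
  have "(\<lambda>k. \<integral>u. x k * sin (\<theta> * log_gap \<kappa> (u / x k)) \<partial>\<mu> (Inl 0)) \<longlonglongrightarrow> (\<integral>u. \<theta> * u \<partial>\<mu> (Inl 0))"
  proof (rule integral_dominated_convergence)
    show "integrable (\<mu> (Inl 0)) (\<lambda>u. \<bar>\<theta>\<bar> * u / \<kappa>)" using pareto_mean(1)[of 0] by simp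
    show "AE u in \<mu> (Inl 0). (\<lambda>k. x k * sin (\<theta> * log_gap \<kappa> (u / x k))) \<longlonglongrightarrow> \<theta> * u"
      using AE_pareto[of 0]
    proof eventually_elim
      case (elim u)
      have l: "(\<lambda>k. x k * log_gap \<kappa> (u / x k)) \<longlonglongrightarrow> u"
        using filterlim_compose[OF log_gap_lim[OF \<kappa> elim] x(2)] .
      have inv: "(\<lambda>k. inverse (x k)) \<longlonglongrightarrow> 0" by (intro tendsto_inverse_0_at_top x)
      define L where "L k = x k * log_gap \<kappa> (u / x k)" for k
      have main: "(\<lambda>k. \<theta> * L k) \<longlonglongrightarrow> \<theta> * u" unfolding L_def by (intro tendsto_intros l)
      have "(\<lambda>k. (\<bar>\<theta> * L k\<bar> ^ 3 * (inverse (x k))\<^sup>2) / 6) \<longlonglongrightarrow> (\<bar>\<theta> * u\<bar> ^ 3 * 0\<^sup>2) / 6"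
        unfolding L_def by (intro tendsto_intros l inv) auto
      then have err: "(\<lambda>k. (\<bar>\<theta> * L k\<bar> ^ 3 * (inverse (x k))\<^sup>2) / 6) \<longlonglongrightarrow> 0" by simp
      have "(\<lambda>k. x k * sin (\<theta> * log_gap \<kappa> (u / x k)) - \<theta> * L k) \<longlonglongrightarrow> 0"
      proof (rule Lim_null_comparison[OF _ err], intro always_eventually allI)
        fix k
        define y where "y = log_gap \<kappa> (u / x k)"
        have xk: "0 < x k" using x(1)[of k] .
        have "\<bar>x k * (sin (\<theta> * y) - \<theta> * y)\<bar> \<le> x k * (\<bar>\<theta> * y\<bar> ^ 3 / 6)"
          unfolding abs_mult using sin_minus_self_bound[of "\<theta> * y"] xk by (intro mult_mono) (auto simp: abs_mult)
        also have "\<dots> = (\<bar>\<theta> * L k\<bar> ^ 3 * (inverse (x k))\<^sup>2) / 6"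
          using xk by (simp add: L_def y_def[symmetric] abs_mult power_mult_distrib field_simps power2_eq_square power3_eq_cube)
        finally show "norm (x k * sin (\<theta> * log_gap \<kappa> (u / x k)) - \<theta> * L k) \<le> (\<bar>\<theta> * L k\<bar> ^ 3 * (inverse (x k))\<^sup>2) / 6"
          by (simp add: L_def y_def[symmetric] algebra_simps)
      qed
      from tendsto_add[OF this main] show ?case by simp
    qed
    show "AE u in \<mu> (Inl 0). norm (x k * sin (\<theta> * log_gap \<kappa> (u / x k))) \<le> \<bar>\<theta>\<bar> * u / \<kappa>" for k
      using AE_pareto[of 0]
    proof eventually_elim
      case (elim u)
      have "\<bar>sin (\<theta> * log_gap \<kappa> (u / x k))\<bar> \<le> \<bar>\<theta>\<bar> * log_gap \<kappa> (u / x k)"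
        using abs_sin_x_le_abs_x[of "\<theta> * log_gap \<kappa> (u / x k)"] log_gap_abs_le[OF \<kappa> elim x(1)] by (simp add: abs_mult)
      then have "x k * \<bar>sin (\<theta> * log_gap \<kappa> (u / x k))\<bar> \<le> x k * (\<bar>\<theta>\<bar> * log_gap \<kappa> (u / x k))"
        using x(1)[of k] by (intro mult_left_mono) auto
      also have "\<dots> = \<bar>\<theta>\<bar> * (x k * log_gap \<kappa> (u / x k))" by simp
      also have "\<dots> \<le> \<bar>\<theta>\<bar> * (u / \<kappa>)" using log_gap_abs_le[OF \<kappa> elim x(1)] by (intro mult_left_mono) auto
      finally show ?case using x(1)[of k] by (simp add: abs_mult)
    qed
  qed measurable
  then show ?thesis by (simp only: integral_mult_right_zero pareto_mean)
qed

text \<open>Same argument with a multiple of u^2 as majorant, integrable exactly when \<alpha> >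
  2.\<close>

lemma cos_moment_lim_gt2:
  assumes \<kappa>: "0 < \<kappa>" "\<kappa> < 1" and x: "\<And>k. 0 < x k" "filterlim x at_top sequentially" and \<alpha>2: "2 < \<alpha>"
  shows "(\<lambda>k. (x k)\<^sup>2 * (cos_loss \<kappa> \<theta> (x k))) \<longlonglongrightarrow> \<theta>\<^sup>2 / 2 * (\<alpha> / (\<alpha> - 2))"
proof -
  have "(\<lambda>k. \<integral>u. (x k)\<^sup>2 * (1 - cos (\<theta> * log_gap \<kappa> (u / x k))) \<partial>\<mu> (Inl 0)) \<longlonglongrightarrow> (\<integral>u. \<theta>\<^sup>2 / 2 * u\<^sup>2 \<partial>\<mu> (Inl 0))"
  proof (rule integral_dominated_convergence)
    show "integrable (\<mu> (Inl 0)) (\<lambda>u. \<theta>\<^sup>2 / 2 * (u\<^sup>2 / \<kappa>\<^sup>2))" using pareto_second(1)[OF \<alpha>2, of 0] by simp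
    show "AE u in \<mu> (Inl 0). (\<lambda>k. (x k)\<^sup>2 * (1 - cos (\<theta> * log_gap \<kappa> (u / x k)))) \<longlonglongrightarrow> \<theta>\<^sup>2 / 2 * u\<^sup>2"
      using AE_pareto[of 0]
    proof eventually_elim
      case (elim u)
      have l: "(\<lambda>k. x k * log_gap \<kappa> (u / x k)) \<longlonglongrightarrow> u"
        using filterlim_compose[OF log_gap_lim[OF \<kappa> elim] x(2)] .
      have inv: "(\<lambda>k. inverse (x k)) \<longlonglongrightarrow> 0" by (intro tendsto_inverse_0_at_top x)
      define L where "L k = x k * log_gap \<kappa> (u / x k)" for k
      have main: "(\<lambda>k. \<theta>\<^sup>2 / 2 * (L k)\<^sup>2) \<longlonglongrightarrow> \<theta>\<^sup>2 / 2 * u\<^sup>2" unfolding L_def by (intro tendsto_intros l)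
      have "(\<lambda>k. (\<theta> ^ 4 * (L k) ^ 4 * (inverse (x k))\<^sup>2) / 24) \<longlonglongrightarrow> (\<theta> ^ 4 * u ^ 4 * 0\<^sup>2) / 24"
        unfolding L_def by (intro tendsto_intros l inv) auto
      then have err: "(\<lambda>k. (\<theta> ^ 4 * (L k) ^ 4 * (inverse (x k))\<^sup>2) / 24) \<longlonglongrightarrow> 0" by simp
      have "(\<lambda>k. (x k)\<^sup>2 * (1 - cos (\<theta> * log_gap \<kappa> (u / x k))) - \<theta>\<^sup>2 / 2 * (L k)\<^sup>2) \<longlonglongrightarrow> 0"
      proof (rule Lim_null_comparison[OF _ err], intro always_eventually allI)
        fix k
        define y where "y = log_gap \<kappa> (u / x k)"
        have xk: "x k \<noteq> 0" using x(1)[of k] by simp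
        have "\<bar>(x k)\<^sup>2 * (1 - cos (\<theta> * y) - (\<theta> * y)\<^sup>2 / 2)\<bar> \<le> (x k)\<^sup>2 * ((\<theta> * y) ^ 4 / 24)"
          unfolding abs_mult using one_minus_cos_bounds(2)[of "\<theta> * y"] by (intro mult_mono) auto
        also have "\<dots> = (\<theta> ^ 4 * (L k) ^ 4 * (inverse (x k))\<^sup>2) / 24"
          using xk by (simp add: L_def y_def[symmetric] power_mult_distrib field_simps power2_eq_square power4_eq_xxxx)
        finally show "norm ((x k)\<^sup>2 * (1 - cos (\<theta> * log_gap \<kappa> (u / x k))) - \<theta>\<^sup>2 / 2 * (L k)\<^sup>2) \<le> (\<theta> ^ 4 * (L k) ^ 4 * (inverse (x k))\<^sup>2) / 24"
          by (simp add: L_def y_def[symmetric] power_mult_distrib algebra_simps)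
      qed
      from tendsto_add[OF this main] show ?case by simp
    qed
    show "AE u in \<mu> (Inl 0). norm ((x k)\<^sup>2 * (1 - cos (\<theta> * log_gap \<kappa> (u / x k)))) \<le> \<theta>\<^sup>2 / 2 * (u\<^sup>2 / \<kappa>\<^sup>2)" for k
      using AE_pareto[of 0]
    proof eventually_elim
      case (elim u)
      define y where "y = log_gap \<kappa> (u / x k)"
      have "(x k)\<^sup>2 * (1 - cos (\<theta> * y)) \<le> (x k)\<^sup>2 * ((\<theta> * y)\<^sup>2 / 2)"
        using one_minus_cos_bounds(1)[of "\<theta> * y"] by (intro mult_left_mono) auto
      also have "\<dots> = \<theta>\<^sup>2 / 2 * (x k * y)\<^sup>2" by (simp add: power_mult_distrib)
      also have "\<dots> \<le> \<theta>\<^sup>2 / 2 * (u / \<kappa>)\<^sup>2"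
        using log_gap_abs_le[OF \<kappa> elim x(1), of k] x(1)[of k] by (intro mult_left_mono power_mono) (auto simp: y_def)
      finally show ?case by (simp add: y_def power_divide)
    qed
  qed measurable
  then show ?thesis by (simp only: integral_mult_right_zero pareto_second[OF \<alpha>2])
qed

lemma pareto_truncated_integral:
  assumes h: "h \<in> borel_measurable borel" "\<And>u. 1 \<le> u \<Longrightarrow> u \<le> b \<Longrightarrow> 0 \<le> h u" and b: "1 \<le> b"
    and F: "\<And>u. 1 \<le> u \<Longrightarrow> u \<le> b \<Longrightarrow> (F has_real_derivative h u * (\<alpha> * u powr (- \<alpha> - 1))) (at u)"
  shows "integrable (\<mu> (Inl z)) (\<lambda>u. h u * indicator {1..b} u)" "(\<integral>u. h u * indicator {1..b} u \<partial>\<mu> (Inl z)) = F b - F 1"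
proof -
  have [measurable]: "h \<in> borel_measurable borel" by (rule h)
  have hi: "((\<lambda>u. h u * (\<alpha> * u powr (- \<alpha> - 1))) has_integral (F b - F 1)) {1..b}"
    using F b by (intro fundamental_theorem_of_calculus)
      (auto simp: has_real_derivative_iff_has_vector_derivative[symmetric] intro: has_field_derivative_at_within)
  have nn: "0 \<le> h u * (\<alpha> * u powr (- \<alpha> - 1))" if "u \<in> {1..b}" for u
    using that h \<alpha> by (intro mult_nonneg_nonneg) auto
  have Fn: "0 \<le> F b - F 1" by (rule has_integral_nonneg[OF hi nn])
  have "(\<integral>\<^sup>+u. ennreal (h u * indicator {1..b} u) \<partial>\<mu> (Inl z)) = (\<integral>\<^sup>+u. ennreal (h u * (\<alpha> * u powr (- \<alpha> - 1))) * indicator {1..b} u \<partial>lborel)"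
    unfolding distr_pareto
    by (subst nn_integral_density, simp, simp, intro nn_integral_cong_AE eventually_mono[OF AE_lborel_singleton[of 1]])
       (use \<alpha> h(2) in \<open>auto simp: pareto_density_def indicator_def ennreal_mult mult.commute\<close>)
  also have "\<dots> = ennreal (F b - F 1)"
    by (rule nn_integral_has_integral_lebesgue'[OF nn hi])
  finally have e: "(\<integral>\<^sup>+u. ennreal (h u * indicator {1..b} u) \<partial>\<mu> (Inl z)) = ennreal (F b - F 1)" .
  have nn': "0 \<le> h u * indicator {1..b} u" for u using h by (auto simp: indicator_def)
  show "integrable (\<mu> (Inl z)) (\<lambda>u. h u * indicator {1..b} u)"
    by (rule integrableI_nonneg) (use nn' in \<open>auto simp: e\<close>)
  show "(\<integral>u. h u * indicator {1..b} u \<partial>\<mu> (Inl z)) = F b - F 1"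
    by (subst integral_eq_nn_integral) (use nn' Fn in \<open>auto simp: e\<close>)
qed

text \<open>At \<open>\<alpha> = 2\<close> the variance is infinite: the square of the truncated value has mean
  \<open>2 ln x / x\<^sup>2\<close> to leading order, its cube only \<open>O(1 / x\<^sup>2)\<close>.\<close>
lemma truncated_moments_2:
  assumes \<kappa>: "0 < \<kappa>" "\<kappa> < 1" and \<alpha>2: "\<alpha> = 2" and x: "1 \<le> (1 - \<kappa>) * x"
  defines "m \<equiv> \<lambda>u. min (u / x) (1 - \<kappa>)"
  shows "2 * ln ((1 - \<kappa>) * x) \<le> x\<^sup>2 * (\<integral>u. (m u)\<^sup>2 \<partial>\<mu> (Inl 0))"
    "x\<^sup>2 * (\<integral>u. (m u)\<^sup>2 \<partial>\<mu> (Inl 0)) \<le> 2 * ln x + 1"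
    "x\<^sup>2 * (\<integral>u. (m u) ^ 3 \<partial>\<mu> (Inl 0)) \<le> 3"
proof -
  have xp: "0 < x"
  proof (rule ccontr)
    assume "\<not> 0 < x"
    then have "(1 - \<kappa>) * x \<le> 0" using \<kappa> by (intro mult_nonneg_nonpos) auto
    then show False using x by simp
  qed
  have x1: "1 \<le> x"
  proof -
    have "(1 - \<kappa>) * x \<le> 1 * x" using xp \<kappa> by (intro mult_right_mono) auto
    then show ?thesis using x by simp
  qed
  have [measurable]: "m \<in> borel_measurable borel" unfolding m_def by measurable
  have mb: "0 \<le> m u" "m u \<le> 1" "m u \<le> u / x" if "1 < u" for u using that xp \<kappa> by (auto simp: m_def)
  have im: "integrable (\<mu> (Inl 0)) (\<lambda>u. (m u) ^ k)" for k :: nat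
    by (rule bounded_integrable[where b=1]) (use mb in \<open>auto simp: power_abs intro!: power_le_one\<close>)
  have pw: "u powr - 3 = 1 / u ^ 3" if "0 < u" for u :: real
    using that by (simp add: powr_minus powr_numeral divide_inverse)
  have sq: "integrable (\<mu> (Inl 0)) (\<lambda>u. (u / x)\<^sup>2 * indicator {1..b} u)" "(\<integral>u. (u / x)\<^sup>2 * indicator {1..b} u \<partial>\<mu> (Inl 0)) = 2 * ln b / x\<^sup>2 - 2 * ln 1 / x\<^sup>2"
    if b: "1 \<le> b" for b
  proof -
    have F: "((\<lambda>u. 2 * ln u / x\<^sup>2) has_real_derivative (u / x)\<^sup>2 * (\<alpha> * u powr (- \<alpha> - 1))) (at u)" if "1 \<le> u" for u
    proof -
      have "((\<lambda>u. 2 * ln u / x\<^sup>2) has_real_derivative 2 * (1 / u) / x\<^sup>2) (at u)"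
        using that by (intro DERIV_cdivide DERIV_cmult DERIV_ln_divide) auto
      moreover have "2 * (1 / u) / x\<^sup>2 = (u / x)\<^sup>2 * (\<alpha> * u powr (- \<alpha> - 1))"
      proof -
        have "u powr (- \<alpha> - 1) = 1 / u ^ 3" using that pw[of u] by (simp add: \<alpha>2)
        moreover have "u\<^sup>2 * 2 / (x\<^sup>2 * u ^ 3) = 2 / (u * x\<^sup>2)" using that by (simp add: power2_eq_square power3_eq_cube)
        ultimately show ?thesis by (simp add: power_divide \<alpha>2)
      qed
      ultimately show ?thesis by simp
    qed
    show "integrable (\<mu> (Inl 0)) (\<lambda>u. (u / x)\<^sup>2 * indicator {1..b} u)" "(\<integral>u. (u / x)\<^sup>2 * indicator {1..b} u \<partial>\<mu> (Inl 0)) = 2 * ln b / x\<^sup>2 - 2 * ln 1 / x\<^sup>2"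
      by (rule pareto_truncated_integral[OF _ _ b F]; simp)+
  qed
  have cb: "integrable (\<mu> (Inl 0)) (\<lambda>u. (u / x) ^ 3 * indicator {1..x} u)" "(\<integral>u. (u / x) ^ 3 * indicator {1..x} u \<partial>\<mu> (Inl 0)) = 2 * x / x ^ 3 - 2 * 1 / x ^ 3"
  proof -
    have F: "((\<lambda>u. 2 * u / x ^ 3) has_real_derivative (u / x) ^ 3 * (\<alpha> * u powr (- \<alpha> - 1))) (at u)" if "1 \<le> u" for u
    proof -
      have "((\<lambda>u. 2 * u / x ^ 3) has_real_derivative 2 * 1 / x ^ 3) (at u)"
        by (intro DERIV_cdivide DERIV_cmult DERIV_ident)
      moreover have "2 / x ^ 3 = (u / x) ^ 3 * (\<alpha> * u powr (- \<alpha> - 1))"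
        using that xp by (simp add: \<alpha>2 pw power_divide)
      ultimately show ?thesis by simp
    qed
    show "integrable (\<mu> (Inl 0)) (\<lambda>u. (u / x) ^ 3 * indicator {1..x} u)" "(\<integral>u. (u / x) ^ 3 * indicator {1..x} u \<partial>\<mu> (Inl 0)) = 2 * x / x ^ 3 - 2 * 1 / x ^ 3"
      by (rule pareto_truncated_integral[OF _ _ x1 F]; use xp in simp)+
  qed
  have tail: "integrable (\<mu> (Inl 0)) (indicator {x<..} :: real \<Rightarrow> real)" "(\<integral>u. indicator {x<..} u \<partial>\<mu> (Inl 0)) = 1 / x\<^sup>2"
    using pareto[OF x1, of 0] xp by (auto simp: \<alpha>2 powr_minus powr_numeral divide_inverse \<mu>.emeasure_eq_measure)
  \<comment> \<open>Up to \<open>x\<close> the truncation only lowers the value; above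
    \<open>x\<close> the value is at most 1 and the tail has mass 1 / x^2.\<close>
  have split: "(m u) ^ k \<le> (u / x) ^ k * indicator {1..x} u + indicator {x<..} u" if "1 < u" for u and k :: nat
  proof (cases "u \<le> x")
    case True
    then show ?thesis using that mb[OF that] by (auto intro!: power_mono)
  next
    case False
    then show ?thesis using mb[OF that] by (auto intro!: power_le_one)
  qed
  have up: "(\<integral>u. (m u) ^ k \<partial>\<mu> (Inl 0)) \<le> (\<integral>u. (u / x) ^ k * indicator {1..x} u \<partial>\<mu> (Inl 0)) + 1 / x\<^sup>2"
    if "integrable (\<mu> (Inl 0)) (\<lambda>u. (u / x) ^ k * indicator {1..x} u)" for k :: nat
  proof -
    have "(\<integral>u. (m u) ^ k \<partial>\<mu> (Inl 0)) \<le> (\<integral>u. (u / x) ^ k * indicator {1..x} u + indicator {x<..} u \<partial>\<mu> (Inl 0))"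
      using AE_pareto[of 0] split by (intro integral_mono_AE im Bochner_Integration.integrable_add that tail) (auto elim!: eventually_mono)
    also have "\<dots> = (\<integral>u. (u / x) ^ k * indicator {1..x} u \<partial>\<mu> (Inl 0)) + 1 / x\<^sup>2"
      by (subst Bochner_Integration.integral_add) (use that tail in auto)
    finally show ?thesis .
  qed
  have "x\<^sup>2 * (\<integral>u. (m u)\<^sup>2 \<partial>\<mu> (Inl 0)) \<le> x\<^sup>2 * (2 * ln x / x\<^sup>2 + 1 / x\<^sup>2)"
    using up[of 2] sq[OF x1] by (intro mult_left_mono) auto
  then show "x\<^sup>2 * (\<integral>u. (m u)\<^sup>2 \<partial>\<mu> (Inl 0)) \<le> 2 * ln x + 1" using xp by (simp add: distrib_left)
  have "x\<^sup>2 * (\<integral>u. (m u) ^ 3 \<partial>\<mu> (Inl 0)) \<le> x\<^sup>2 * (2 * x / x ^ 3 - 2 * 1 / x ^ 3 + 1 / x\<^sup>2)"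
    using up[of 3] cb by (intro mult_left_mono) auto
  also have "\<dots> \<le> x\<^sup>2 * (3 / x\<^sup>2)"
    using xp by (intro mult_left_mono) (auto simp: field_simps power2_eq_square power3_eq_cube)
  finally show "x\<^sup>2 * (\<integral>u. (m u) ^ 3 \<partial>\<mu> (Inl 0)) \<le> 3" using xp by simp
  have "x\<^sup>2 * (\<integral>u. (u / x)\<^sup>2 * indicator {1..(1 - \<kappa>) * x} u \<partial>\<mu> (Inl 0)) \<le> x\<^sup>2 * (\<integral>u. (m u)\<^sup>2 \<partial>\<mu> (Inl 0))"
  proof (intro mult_left_mono integral_mono im sq x)
    fix u
    show "(u / x)\<^sup>2 * indicator {1..(1 - \<kappa>) * x} u \<le> (m u)\<^sup>2"
      using xp by (auto simp: indicator_def m_def min_def field_simps)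
  qed simp
  then show "2 * ln ((1 - \<kappa>) * x) \<le> x\<^sup>2 * (\<integral>u. (m u)\<^sup>2 \<partial>\<mu> (Inl 0))" using sq[OF x] xp by simp
qed

text \<open>u^2 is not integrable, so dominated convergence is replaced by an explicit comparison:
  \<open>1 - cos\<close> differs from half the square of \<open>\<theta>\<close> times the truncated
  value by at most a constant times the cube of that value, and this error disappears after division
  by \<open>ln x\<close>.\<close>

lemma cos_moment_lim_2:
  assumes \<kappa>: "0 < \<kappa>" "\<kappa> < 1" and x: "\<And>k. 0 < x k" "filterlim x at_top sequentially" and \<alpha>2: "\<alpha> = 2"
  shows "(\<lambda>k. (x k)\<^sup>2 / ln (x k) * (cos_loss \<kappa> \<theta> (x k))) \<longlonglongrightarrow> \<theta>\<^sup>2"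
proof -
  define m where "m k u = min (u / x k) (1 - \<kappa>)" for k u
  \<comment> \<open>The first summand comes from replacing the square of \<open>log_gap\<close> by
    that of the truncated value, the second from the fourth-order remainder of the cosine; fourth
    powers are reduced to third ones by \<open>M \<le> 1\<close>.\<close>
  define C where "C = \<theta>\<^sup>2 / 2 * (2 / \<kappa> + 1 / \<kappa>\<^sup>2) + \<theta> ^ 4 / 24 * (1 / \<kappa> ^ 4)"
  have C: "0 \<le> C" using \<kappa> by (simp add: C_def)
  have [measurable]: "m k \<in> borel_measurable borel" for k unfolding m_def by measurable
  have im: "integrable (\<mu> (Inl 0)) (\<lambda>u. (m k u) ^ j)" for k j :: nat
  proof (rule bounded_integrable[where b=1])
    fix u :: real assume "1 < u"
    then have "0 \<le> m k u" "m k u \<le> 1" using x(1)[of k] \<kappa> by (auto simp: m_def)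
    then show "\<bar>(m k u) ^ j\<bar> \<le> 1" by (auto simp: power_abs intro!: power_le_one)
  qed measurable
  have ic: "integrable (\<mu> (Inl 0)) (\<lambda>u. 1 - cos (\<theta> * log_gap \<kappa> (u / x k)))" for k
    by (rule bounded_integrable[where b=2]) (auto simp: abs_le_iff intro: order_trans[OF _ cos_ge_minus_one] order_trans[OF cos_le_one])
  have pt: "\<bar>(1 - cos (\<theta> * log_gap \<kappa> (u / x k))) - \<theta>\<^sup>2 / 2 * (m k u)\<^sup>2\<bar> \<le> C * (m k u) ^ 3" if u: "1 < u" for u k
  proof -
    define y where "y = log_gap \<kappa> (u / x k)"
    have v: "0 \<le> u / x k" using u x(1)[of k] by simp
    note b = log_gap_bounds[OF \<kappa> v, folded m_def y_def]
    define M where "M = m k u"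
    note b = b[folded M_def]
    have M43: "M ^ 4 \<le> M ^ 3" using b(1,2) by (intro power_decreasing) auto
    have y0: "0 \<le> y" using b by linarith
    have y4: "y ^ 4 \<le> M ^ 3 / \<kappa> ^ 4"
    proof -
      have "y ^ 4 \<le> (M / \<kappa>) ^ 4" using b(6) y0 by (intro power_mono) auto
      also have "\<dots> = M ^ 4 / \<kappa> ^ 4" by (simp add: power_divide)
      also have "\<dots> \<le> M ^ 3 / \<kappa> ^ 4" using M43 \<kappa> by (intro divide_right_mono) auto
      finally show ?thesis .
    qed
    have y2: "y\<^sup>2 - M\<^sup>2 \<le> (2 / \<kappa> + 1 / \<kappa>\<^sup>2) * M ^ 3"
    proof -
      have "y\<^sup>2 \<le> (M + M\<^sup>2 / \<kappa>)\<^sup>2" using b(5) y0 by (intro power_mono) auto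
      also have "\<dots> = M\<^sup>2 + 2 / \<kappa> * M ^ 3 + M ^ 4 / \<kappa>\<^sup>2"
        using \<kappa> by (simp add: power2_eq_square power3_eq_cube power4_eq_xxxx field_simps)
      also have "M ^ 4 / \<kappa>\<^sup>2 \<le> M ^ 3 / \<kappa>\<^sup>2" using M43 \<kappa> by (intro divide_right_mono) auto
      finally show ?thesis by (simp add: algebra_simps)
    qed
    have y2': "M\<^sup>2 \<le> y\<^sup>2" using b(1,4) by (intro power_mono) auto
    have "\<bar>(1 - cos (\<theta> * y)) - (\<theta> * y)\<^sup>2 / 2\<bar> \<le> \<theta> ^ 4 / 24 * y ^ 4"
      using one_minus_cos_bounds(2)[of "\<theta> * y"] by (simp add: power_mult_distrib)
    also have "\<dots> \<le> \<theta> ^ 4 / 24 * (M ^ 3 / \<kappa> ^ 4)" using y4 by (intro mult_left_mono) auto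
    finally have 1: "\<bar>(1 - cos (\<theta> * y)) - (\<theta> * y)\<^sup>2 / 2\<bar> \<le> \<theta> ^ 4 / 24 * (1 / \<kappa> ^ 4) * M ^ 3" by simp
    have "\<theta>\<^sup>2 / 2 * (y\<^sup>2 - M\<^sup>2) \<le> \<theta>\<^sup>2 / 2 * ((2 / \<kappa> + 1 / \<kappa>\<^sup>2) * M ^ 3)" using y2 by (intro mult_left_mono) auto
    moreover have "0 \<le> \<theta>\<^sup>2 / 2 * (y\<^sup>2 - M\<^sup>2)" using y2' by simp
    ultimately have "\<bar>(\<theta> * y)\<^sup>2 / 2 - \<theta>\<^sup>2 / 2 * M\<^sup>2\<bar> \<le> \<theta>\<^sup>2 / 2 * (2 / \<kappa> + 1 / \<kappa>\<^sup>2) * M ^ 3"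
      by (simp add: power_mult_distrib algebra_simps)
    with 1 have "\<bar>(1 - cos (\<theta> * y)) - \<theta>\<^sup>2 / 2 * M\<^sup>2\<bar> \<le> C * M ^ 3"
      unfolding C_def distrib_right by linarith
    then show ?thesis by (simp add: y_def M_def)
  qed
  have close: "\<bar>(cos_loss \<kappa> \<theta> (x k)) - \<theta>\<^sup>2 / 2 * (\<integral>u. (m k u)\<^sup>2 \<partial>\<mu> (Inl 0))\<bar> \<le> C * (\<integral>u. (m k u) ^ 3 \<partial>\<mu> (Inl 0))" for k
  proof -
    have "\<bar>\<integral>u. (1 - cos (\<theta> * log_gap \<kappa> (u / x k))) - \<theta>\<^sup>2 / 2 * (m k u)\<^sup>2 \<partial>\<mu> (Inl 0)\<bar> \<le> (\<integral>u. C * (m k u) ^ 3 \<partial>\<mu> (Inl 0))"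
      using AE_pareto[of 0] pt im ic
      by (intro order_trans[OF integral_abs_bound integral_mono_AE]) (auto elim!: eventually_mono)
    then show ?thesis using im[of k 2] im[of k 3] ic[of k] by simp
  qed
  define J where "J k = (x k)\<^sup>2 * (\<integral>u. (m k u)\<^sup>2 \<partial>\<mu> (Inl 0))" for k
  have evx: "eventually (\<lambda>k. 1 \<le> (1 - \<kappa>) * x k) sequentially" "eventually (\<lambda>k. 1 < ln (x k)) sequentially"
  proof -
    have "eventually (\<lambda>x. 1 \<le> (1 - \<kappa>) * x) at_top" using \<kappa> by real_asymp
    then show "eventually (\<lambda>k. 1 \<le> (1 - \<kappa>) * x k) sequentially" using x(2) by (rule eventually_compose_filterlim)
    have "eventually (\<lambda>x::real. 1 < ln x) at_top" by real_asymp
    then show "eventually (\<lambda>k. 1 < ln (x k)) sequentially" using x(2) by (rule eventually_compose_filterlim)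
  qed
  have J: "(\<lambda>k. J k / ln (x k)) \<longlonglongrightarrow> 2"
  proof (rule tendsto_sandwich)
    have "((\<lambda>x. 2 * ln ((1 - \<kappa>) * x) / ln x) \<longlongrightarrow> 2) at_top" using \<kappa> by real_asymp
    from filterlim_compose[OF this x(2)] show "(\<lambda>k. 2 * ln ((1 - \<kappa>) * x k) / ln (x k)) \<longlonglongrightarrow> 2" .
    have "((\<lambda>x::real. (2 * ln x + 1) / ln x) \<longlongrightarrow> 2) at_top" by real_asymp
    from filterlim_compose[OF this x(2)] show "(\<lambda>k. (2 * ln (x k) + 1) / ln (x k)) \<longlonglongrightarrow> 2" .
    show "eventually (\<lambda>k. 2 * ln ((1 - \<kappa>) * x k) / ln (x k) \<le> J k / ln (x k)) sequentially"
      using evx by eventually_elim (use truncated_moments_2(1)[OF \<kappa> \<alpha>2] in \<open>auto simp: J_def m_def intro!: divide_right_mono\<close>)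
    show "eventually (\<lambda>k. J k / ln (x k) \<le> (2 * ln (x k) + 1) / ln (x k)) sequentially"
      using evx by eventually_elim (use truncated_moments_2(2)[OF \<kappa> \<alpha>2] in \<open>auto simp: J_def m_def intro!: divide_right_mono\<close>)
  qed
  have err: "(\<lambda>k. (x k)\<^sup>2 / ln (x k) * (cos_loss \<kappa> \<theta> (x k)) - \<theta>\<^sup>2 / 2 * (J k / ln (x k))) \<longlonglongrightarrow> 0"
  proof (rule Lim_null_comparison)
    have "((\<lambda>x. 3 * C / ln x) \<longlongrightarrow> 0) at_top" by real_asymp
    from filterlim_compose[OF this x(2)] show "(\<lambda>k. 3 * C / ln (x k)) \<longlonglongrightarrow> 0" .
    show "eventually (\<lambda>k. norm ((x k)\<^sup>2 / ln (x k) * (cos_loss \<kappa> \<theta> (x k)) - \<theta>\<^sup>2 / 2 * (J k / ln (x k))) \<le> 3 * C / ln (x k)) sequentially"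
      using evx
    proof eventually_elim
      case (elim k)
      define c where "c = (cos_loss \<kappa> \<theta> (x k))"
      define j2 where "j2 = (\<integral>u. (m k u)\<^sup>2 \<partial>\<mu> (Inl 0))"
      define j3 where "j3 = (\<integral>u. (m k u) ^ 3 \<partial>\<mu> (Inl 0))"
      have "(x k)\<^sup>2 / ln (x k) * c - \<theta>\<^sup>2 / 2 * (J k / ln (x k)) = (x k)\<^sup>2 / ln (x k) * (c - \<theta>\<^sup>2 / 2 * j2)"
        by (simp add: J_def j2_def algebra_simps)
      moreover have "\<bar>(x k)\<^sup>2 / ln (x k) * (c - \<theta>\<^sup>2 / 2 * j2)\<bar> = (x k)\<^sup>2 / ln (x k) * \<bar>c - \<theta>\<^sup>2 / 2 * j2\<bar>"
        using elim by (simp add: abs_mult)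
      moreover have "(x k)\<^sup>2 / ln (x k) * \<bar>c - \<theta>\<^sup>2 / 2 * j2\<bar> \<le> (x k)\<^sup>2 / ln (x k) * (C * j3)"
        using close[of k] elim by (intro mult_left_mono) (auto simp: c_def j2_def j3_def)
      moreover have "(x k)\<^sup>2 / ln (x k) * (C * j3) = C / ln (x k) * ((x k)\<^sup>2 * j3)" by simp
      moreover have "C / ln (x k) * ((x k)\<^sup>2 * j3) \<le> C / ln (x k) * 3"
        using truncated_moments_2(3)[OF \<kappa> \<alpha>2 elim(1)] elim C by (intro mult_left_mono) (auto simp: j3_def m_def)
      ultimately show ?case by (simp add: c_def mult.commute)
    qed
  qed
  have "(\<lambda>k. \<theta>\<^sup>2 / 2 * (J k / ln (x k))) \<longlonglongrightarrow> \<theta>\<^sup>2 / 2 * 2" by (intro tendsto_intros J)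
  from tendsto_add[OF err this] show ?thesis by simp
qed

text \<open>The cosine part yields the second moment and the sine part the squared mean. Their
  difference is the variance, so \<open>sigma \<alpha>\<close> is the standard deviation of the
  Pareto law.\<close>

lemma gap_loss_lim_gt2:
  assumes \<kappa>: "0 < \<kappa>" "\<kappa> < 1" and x: "\<And>k. 0 < x k" "filterlim x at_top sequentially" and \<alpha>2: "2 < \<alpha>"
  shows "(\<lambda>k. (x k)\<^sup>2 * gap_loss \<kappa> \<theta> (x k)) \<longlonglongrightarrow> \<theta>\<^sup>2 * (sigma \<alpha>)\<^sup>2"
proof -
  define A where "A k = (cos_loss \<kappa> \<theta> (x k))" for k
  define S where "S k = (sin_mean \<kappa> \<theta> (x k))" for k
  have A: "(\<lambda>k. (x k)\<^sup>2 * A k) \<longlonglongrightarrow> \<theta>\<^sup>2 / 2 * (\<alpha> / (\<alpha> - 2))"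
    unfolding A_def by (rule cos_moment_lim_gt2[OF \<kappa> x \<alpha>2])
  have S: "(\<lambda>k. x k * S k) \<longlonglongrightarrow> \<theta> * (\<alpha> / (\<alpha> - 1))"
    unfolding S_def by (rule sin_moment_lim[OF \<kappa> x])
  have inv: "(\<lambda>k. inverse (x k)) \<longlonglongrightarrow> 0" by (intro tendsto_inverse_0_at_top x)
  have "(\<lambda>k. 2 * ((x k)\<^sup>2 * A k) - ((x k)\<^sup>2 * A k)\<^sup>2 * (inverse (x k))\<^sup>2 - (x k * S k)\<^sup>2)
      \<longlonglongrightarrow> 2 * (\<theta>\<^sup>2 / 2 * (\<alpha> / (\<alpha> - 2))) - (\<theta>\<^sup>2 / 2 * (\<alpha> / (\<alpha> - 2)))\<^sup>2 * 0\<^sup>2 - (\<theta> * (\<alpha> / (\<alpha> - 1)))\<^sup>2"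
    by (intro tendsto_intros A S inv)
  also have "(\<lambda>k. 2 * ((x k)\<^sup>2 * A k) - ((x k)\<^sup>2 * A k)\<^sup>2 * (inverse (x k))\<^sup>2 - (x k * S k)\<^sup>2) = (\<lambda>k. (x k)\<^sup>2 * gap_loss \<kappa> \<theta> (x k))"
  proof
    fix k
    have "x k \<noteq> 0" using x(1)[of k] by simp
    then have "((x k)\<^sup>2 * A k)\<^sup>2 * (inverse (x k))\<^sup>2 = (x k)\<^sup>2 * (A k)\<^sup>2"
      by (simp add: power_mult_distrib power_inverse field_simps power2_eq_square)
    then show "2 * ((x k)\<^sup>2 * A k) - ((x k)\<^sup>2 * A k)\<^sup>2 * (inverse (x k))\<^sup>2 - (x k * S k)\<^sup>2 = (x k)\<^sup>2 * gap_loss \<kappa> \<theta> (x k)"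
      unfolding gap_loss_alt A_def[symmetric] S_def[symmetric] right_diff_distrib power_mult_distrib[of "x k" "S k"]
      by (simp only: mult.left_commute)
  qed
  also have "2 * (\<theta>\<^sup>2 / 2 * (\<alpha> / (\<alpha> - 2))) - (\<theta>\<^sup>2 / 2 * (\<alpha> / (\<alpha> - 2)))\<^sup>2 * 0\<^sup>2 - (\<theta> * (\<alpha> / (\<alpha> - 1)))\<^sup>2 = \<theta>\<^sup>2 * (\<alpha> / (\<alpha> - 2) - (\<alpha> / (\<alpha> - 1))\<^sup>2)"
  proof -
    have "2 * (\<theta>\<^sup>2 / 2 * c) - (\<theta>\<^sup>2 / 2 * c)\<^sup>2 * 0\<^sup>2 - (\<theta> * e)\<^sup>2 = \<theta>\<^sup>2 * (c - e\<^sup>2)" for c e :: real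
      by (simp add: power_mult_distrib right_diff_distrib)
    then show ?thesis .
  qed
  also have "\<alpha> / (\<alpha> - 2) - (\<alpha> / (\<alpha> - 1))\<^sup>2 = (sigma \<alpha>)\<^sup>2"
  proof -
    have "(sigma \<alpha>)\<^sup>2 = \<alpha> / ((\<alpha> - 2) * (\<alpha> - 1)\<^sup>2)" using \<alpha>2 by (simp add: sigma_def)
    moreover have "\<alpha> / (\<alpha> - 2) - (\<alpha> / (\<alpha> - 1))\<^sup>2 = \<alpha> / ((\<alpha> - 2) * (\<alpha> - 1)\<^sup>2)"
    proof -
      have nz: "\<alpha> - 2 \<noteq> 0" "(\<alpha> - 1)\<^sup>2 \<noteq> 0" using \<alpha>2 by auto
      have "\<alpha> / (\<alpha> - 2) - (\<alpha> / (\<alpha> - 1))\<^sup>2 = (\<alpha> * (\<alpha> - 1)\<^sup>2 - \<alpha>\<^sup>2 * (\<alpha> - 2)) / ((\<alpha> - 2) * (\<alpha> - 1)\<^sup>2)"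
        using nz by (simp add: power_divide diff_frac_eq)
      also have "\<alpha> * (\<alpha> - 1)\<^sup>2 - \<alpha>\<^sup>2 * (\<alpha> - 2) = \<alpha>" by (simp add: power2_eq_square algebra_simps)
      finally show ?thesis .
    qed
    ultimately show ?thesis by simp
  qed
  finally show ?thesis .
qed

text \<open>The truncated second moment grows like \<open>2 * ln x\<close>, so the squared mean
  disappears after division by \<open>ln x\<close> and nothing is subtracted.\<close>

lemma gap_loss_lim_2:
  assumes \<kappa>: "0 < \<kappa>" "\<kappa> < 1" and x: "\<And>k. 0 < x k" "filterlim x at_top sequentially" and \<alpha>2: "\<alpha> = 2"
  shows "(\<lambda>k. (x k)\<^sup>2 / ln (x k) * gap_loss \<kappa> \<theta> (x k)) \<longlonglongrightarrow> 2 * \<theta>\<^sup>2"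
proof -
  define A where "A k = (cos_loss \<kappa> \<theta> (x k))" for k
  define S where "S k = (sin_mean \<kappa> \<theta> (x k))" for k
  have A: "(\<lambda>k. (x k)\<^sup>2 / ln (x k) * A k) \<longlonglongrightarrow> \<theta>\<^sup>2"
    unfolding A_def by (rule cos_moment_lim_2[OF \<kappa> x \<alpha>2])
  have S: "(\<lambda>k. x k * S k) \<longlonglongrightarrow> \<theta> * (\<alpha> / (\<alpha> - 1))"
    unfolding S_def by (rule sin_moment_lim[OF \<kappa> x])
  have l1: "(\<lambda>k. ln (x k) / (x k)\<^sup>2) \<longlonglongrightarrow> 0"
  proof -
    have "((\<lambda>x::real. ln x / x\<^sup>2) \<longlongrightarrow> 0) at_top" by real_asymp
    from filterlim_compose[OF this x(2)] show ?thesis .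
  qed
  have l2: "(\<lambda>k. 1 / ln (x k)) \<longlonglongrightarrow> 0"
  proof -
    have "((\<lambda>x::real. 1 / ln x) \<longlongrightarrow> 0) at_top" by real_asymp
    from filterlim_compose[OF this x(2)] show ?thesis .
  qed
  have "(\<lambda>k. 2 * ((x k)\<^sup>2 / ln (x k) * A k) - ((x k)\<^sup>2 / ln (x k) * A k)\<^sup>2 * (ln (x k) / (x k)\<^sup>2) - (x k * S k)\<^sup>2 * (1 / ln (x k)))
      \<longlonglongrightarrow> 2 * \<theta>\<^sup>2 - (\<theta>\<^sup>2)\<^sup>2 * 0 - (\<theta> * (\<alpha> / (\<alpha> - 1)))\<^sup>2 * 0"
    by (intro tendsto_intros A S l1 l2)
  then have L: "(\<lambda>k. 2 * ((x k)\<^sup>2 / ln (x k) * A k) - ((x k)\<^sup>2 / ln (x k) * A k)\<^sup>2 * (ln (x k) / (x k)\<^sup>2) - (x k * S k)\<^sup>2 * (1 / ln (x k)))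
      \<longlonglongrightarrow> 2 * \<theta>\<^sup>2" by simp
  show ?thesis
  proof (rule Lim_transform_eventually[OF L])
    have "eventually (\<lambda>x::real. 0 < ln x) at_top" by real_asymp
    then have "eventually (\<lambda>k. 0 < ln (x k)) sequentially" using x(2) by (rule eventually_compose_filterlim)
    then show "eventually (\<lambda>k. 2 * ((x k)\<^sup>2 / ln (x k) * A k) - ((x k)\<^sup>2 / ln (x k) * A k)\<^sup>2 * (ln (x k) / (x k)\<^sup>2) - (x k * S k)\<^sup>2 * (1 / ln (x k))
      = (x k)\<^sup>2 / ln (x k) * gap_loss \<kappa> \<theta> (x k)) sequentially"
    proof eventually_elim
      case (elim k)
      have x0: "x k \<noteq> 0" using x(1)[of k] by simp
      define l where "l = ln (x k)"
      have "((x k)\<^sup>2 / l * A k)\<^sup>2 * (l / (x k)\<^sup>2) = (x k)\<^sup>2 / l * (A k)\<^sup>2"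
        using elim x0 by (simp add: l_def power2_eq_square)
      then show ?case
        unfolding gap_loss_alt A_def[symmetric] S_def[symmetric] l_def[symmetric]
        by (simp add: power_mult_distrib right_diff_distrib)
    qed
  qed
qed


text \<open>The contribution \<open>ln (x - \<xi> (- k)) - ln (x - \<xi> k)\<close> of a mirrored
  pair, expressed by \<open>log_gap\<close> so that it makes sense in every environment, including
  those with values above \<open>x\<close>.\<close>

definition mirror_gap :: "real \<Rightarrow> real \<Rightarrow> nat \<Rightarrow> (int + nat \<Rightarrow> real) \<Rightarrow> real" where
  "mirror_gap \<kappa> x k v = (if v (Inr k) = 1 then 0 else log_gap \<kappa> (v (Inl (int k)) / x) - log_gap \<kappa> (v (Inl (- int k)) / x))"

definition mirror_sum :: "real \<Rightarrow> real \<Rightarrow> nat \<Rightarrow> (int + nat \<Rightarrow> real) \<Rightarrow> real" where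
  "mirror_sum \<kappa> x N v = (\<Sum>k\<in>{1..<N}. mirror_gap \<kappa> x k v)"

lemma mirror_gap_measurable [measurable]: "1 \<le> k \<Longrightarrow> mirror_gap \<kappa> x k \<in> borel_measurable P"
  unfolding mirror_gap_def[abs_def] by measurable

lemma mirror_sum_measurable [measurable]: "mirror_sum \<kappa> x N \<in> borel_measurable P"
  unfolding mirror_sum_def[abs_def] by (intro borel_measurable_sum) auto

lemma iexp_integrable: "f \<in> borel_measurable P \<Longrightarrow> integrable P (\<lambda>v. iexp (f v))"
  by (rule P.integrable_const_bound[where B=1]) (auto intro: measurable_compose)

lemma integral_coord:
  fixes f :: "real \<Rightarrow> complex"
  assumes "i \<in> I" and [measurable]: "f \<in> borel_measurable borel"
  shows "(\<integral>v. f (v i) \<partial>P) = (\<integral>u. f u \<partial>\<mu> i)"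
  using assms by (subst distr_coord_borel[OF assms(1), symmetric], subst integral_distr) auto

definition gap_char :: "real \<Rightarrow> real \<Rightarrow> real \<Rightarrow> complex" where
  "gap_char \<kappa> \<theta> x = (\<integral>u. iexp (\<theta> * log_gap \<kappa> (u / x)) \<partial>\<mu> (Inl 0))"

lemma gap_char_norm: "(cmod (gap_char \<kappa> \<theta> x))\<^sup>2 = 1 - gap_loss \<kappa> \<theta> x" "0 \<le> gap_loss \<kappa> \<theta> x"
proof -
  have i: "integrable (\<mu> (Inl 0)) (\<lambda>u. iexp (\<theta> * log_gap \<kappa> (u / x)))"
    by (rule \<mu>.integrable_const_bound[where B=1]) auto
  have "Re (gap_char \<kappa> \<theta> x) = (\<integral>u. Re (iexp (\<theta> * log_gap \<kappa> (u / x))) \<partial>\<mu> (Inl 0))"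
    unfolding gap_char_def by (rule integral_Re[OF i, symmetric])
  moreover have "Im (gap_char \<kappa> \<theta> x) = (\<integral>u. Im (iexp (\<theta> * log_gap \<kappa> (u / x))) \<partial>\<mu> (Inl 0))"
    unfolding gap_char_def by (rule integral_Im[OF i, symmetric])
  ultimately show 1: "(cmod (gap_char \<kappa> \<theta> x))\<^sup>2 = 1 - gap_loss \<kappa> \<theta> x"
    by (simp add: cmod_power2 gap_loss_def Re_exp Im_exp)
  have "cmod (gap_char \<kappa> \<theta> x) \<le> (\<integral>u. norm (iexp (\<theta> * log_gap \<kappa> (u / x))) \<partial>\<mu> (Inl 0))"
    unfolding gap_char_def by (rule integral_norm_bound)
  also have "\<dots> = 1" using \<mu>.prob_space[of "Inl 0"] by (simp del: of_real_mult)
  finally have "(cmod (gap_char \<kappa> \<theta> x))\<^sup>2 \<le> 1" by (simp add: power_le_one)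
  then show "0 \<le> gap_loss \<kappa> \<theta> x" unfolding 1 by simp
qed

text \<open>\<open>p + q |\<phi>|\<^sup>2\<close>: given a failed coin, the term is a difference of two independent copies.\<close>
lemma char_mirror_gap:
  assumes k: "1 \<le> k"
  shows "char (distr P borel (mirror_gap \<kappa> x k)) \<theta> = of_real (1 - (1 - p k) * gap_loss \<kappa> \<theta> x)"
proof -
  define X where "X i v = (case i of Inr (_::nat) \<Rightarrow> of_bool (v \<noteq> 1) |
      Inl z \<Rightarrow> if 0 < (z::int) then iexp (\<theta> * log_gap \<kappa> (v / x)) else iexp (- \<theta> * log_gap \<kappa> (v / x)))" for i v
  have Xm [measurable]: "X i \<in> borel_measurable borel" for i by (cases i) (auto simp: X_def[abs_def])
  define J :: "(int + nat) set" where "J = {Inr k, Inl (int k), Inl (- int k)}"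
  have "P.indep_vars (\<lambda>_. borel) (\<lambda>i v. v i) J"
    by (rule P.indep_vars_subset[OF indep_coord]) (use k in \<open>auto simp: J_def\<close>)
  then have ind: "P.indep_vars (\<lambda>_. borel) (\<lambda>i v. X i (v i)) J"
    by (rule P.indep_vars_compose2) measurable
  have norm_X: "norm (X i v) \<le> 1" for i v by (cases i) (auto simp: X_def)
  have int: "integrable P (\<lambda>v. X i (v i))" if "i \<in> J" for i
    by (rule P.integrable_const_bound[where B=1]) (use that k norm_X in \<open>auto simp: J_def\<close>)
  have prod: "(\<integral>v. (\<Prod>i\<in>J. X i (v i)) \<partial>P) = (\<Prod>i\<in>J. \<integral>v. X i (v i) \<partial>P)"
    by (rule P.indep_vars_lebesgue_integral[OF _ ind]) (auto simp: J_def int[unfolded J_def])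
  have pint: "integrable P (\<lambda>v. (\<Prod>i\<in>J. X i (v i)))"
    by (rule P.indep_vars_integrable[OF _ ind]) (auto simp: J_def int[unfolded J_def])
  have J_prod: "(\<Prod>i\<in>J. f i) = f (Inr k) * f (Inl (int k)) * f (Inl (- int k))" for f :: "int + nat \<Rightarrow> complex"
    using k by (simp add: J_def)
  have coin: "(\<integral>v. of_bool (v (Inr k) \<noteq> 1) \<partial>P) = (of_real (1 - p k) :: complex)"
  proof -
    have "(\<integral>v. of_bool (v (Inr k) \<noteq> 1) \<partial>P) = (\<integral>u. complex_of_real (indicator (- {1}) u) \<partial>\<mu> (Inr k))"
      by (subst integral_coord[where i="Inr k" and f="\<lambda>u. of_bool (u \<noteq> 1)"]) (use k in \<open>auto simp: indicator_def simp del: integral_complex_of_real intro!: Bochner_Integration.integral_cong\<close>)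
    also have "\<dots> = of_real (measure (\<mu> (Inr k)) (- {1}))"
      unfolding integral_complex_of_real by simp
    also have "measure (\<mu> (Inr k)) (- {1}) = 1 - p k"
      using \<mu>.prob_compl[of "{1}" "Inr k"] coin1[OF k] by (simp add: Compl_eq_Diff_UNIV)
    finally show ?thesis .
  qed
  have cn: "(\<integral>u. iexp (- \<theta> * log_gap \<kappa> (u / x)) \<partial>\<mu> (Inl 0)) = cnj (gap_char \<kappa> \<theta> x)"
  proof -
    have e: "iexp (- \<theta> * log_gap \<kappa> (u / x)) = cnj (iexp (\<theta> * log_gap \<kappa> (u / x)))" for u by (simp add: exp_cnj)
    have "integrable (\<mu> (Inl 0)) (\<lambda>u. iexp (\<theta> * log_gap \<kappa> (u / x)))"
      by (rule \<mu>.integrable_const_bound[where B=1]) auto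
    then show ?thesis unfolding gap_char_def e by (rule integral_bounded_linear[OF bounded_linear_cnj])
  qed
  have X1: "(\<integral>v. X (Inr k) (v (Inr k)) \<partial>P) = of_real (1 - p k)" using coin by (simp add: X_def)
  have X2: "(\<integral>v. X (Inl (int k)) (v (Inl (int k))) \<partial>P) = gap_char \<kappa> \<theta> x"
    using k by (subst integral_coord) (auto simp: X_def[abs_def] gap_char_def \<mu>_eq[of "int k"])
  have X3: "(\<integral>v. X (Inl (- int k)) (v (Inl (- int k))) \<partial>P) = cnj (gap_char \<kappa> \<theta> x)"
    using k by (subst integral_coord) (auto simp: X_def[abs_def] cn[symmetric] \<mu>_eq[of "- int k"])
  have "char (distr P borel (mirror_gap \<kappa> x k)) \<theta> = (\<integral>v. iexp (\<theta> * mirror_gap \<kappa> x k v) \<partial>P)"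
    unfolding char_def using k by (subst integral_distr) auto
  also have "\<dots> = (\<integral>v. (1 - X (Inr k) (v (Inr k))) + (\<Prod>i\<in>J. X i (v i)) \<partial>P)"
    unfolding J_prod
    by (intro Bochner_Integration.integral_cong) (use k in \<open>auto simp: X_def mirror_gap_def exp_add[symmetric] algebra_simps\<close>)
  also have "\<dots> = (1 - (\<integral>v. X (Inr k) (v (Inr k)) \<partial>P)) + (\<Prod>i\<in>J. \<integral>v. X i (v i) \<partial>P)"
    using int[of "Inr k"] pint by (simp add: J_def[THEN eqset_imp_iff] P.prob_space prod)
  also have "\<dots> = of_real (p k) + of_real (1 - p k) * (gap_char \<kappa> \<theta> x * cnj (gap_char \<kappa> \<theta> x))"
    unfolding J_prod X1 X2 X3 by simp
  also have "gap_char \<kappa> \<theta> x * cnj (gap_char \<kappa> \<theta> x) = of_real (1 - gap_loss \<kappa> \<theta> x)"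
    unfolding complex_norm_square[symmetric] gap_char_norm(1) of_real_power[symmetric] ..
  finally show ?thesis by (simp add: algebra_simps)
qed

text \<open>Distinct \<open>k\<close> use disjoint triples of coordinates, one coin and two values,
  so the terms are independent.\<close>

lemma char_mirror_sum:
  "char (distr P borel (mirror_sum \<kappa> x N)) \<theta> = of_real (\<Prod>k\<in>{1..<N}. 1 - (1 - p k) * gap_loss \<kappa> \<theta> x)"
proof -
  define K where "K k = {Inr k, Inl (int k), Inl (- int k)}" for k :: nat
  define f where "f k v = (if v (Inr k) = 1 then 0 else log_gap \<kappa> (v (Inl (int k)) / x) - log_gap \<kappa> (v (Inl (- int k)) / x))"
    for k :: nat and v :: "int + nat \<Rightarrow> real"
  have "P.indep_vars (\<lambda>j. PiM (K j) (\<lambda>_. borel)) (\<lambda>j v. restrict (\<lambda>i. v i) (K j)) {1..<N}"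
    by (rule P.indep_vars_restrict[OF indep_coord]) (auto simp: K_def disjoint_family_on_def)
  then have "P.indep_vars (\<lambda>_. borel) (\<lambda>k v. f k (restrict (\<lambda>i. v i) (K k))) {1..<N}"
  proof (rule P.indep_vars_compose2)
    fix k
    have [measurable]: "i \<in> K k \<Longrightarrow> (\<lambda>v. v i) \<in> borel_measurable (PiM (K k) (\<lambda>_. borel))" for i
      by (rule measurable_component_singleton)
    have [simp]: "Inr k \<in> K k" "Inl (int k) \<in> K k" "Inl (- int k) \<in> K k" by (auto simp: K_def)
    show "f k \<in> borel_measurable (PiM (K k) (\<lambda>_. borel))" unfolding f_def[abs_def] by measurable
  qed
  moreover have "(\<lambda>k v. f k (restrict (\<lambda>i. v i) (K k))) = mirror_gap \<kappa> x"
    by (auto simp: fun_eq_iff f_def K_def mirror_gap_def)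
  ultimately have ind: "P.indep_vars (\<lambda>_. borel) (mirror_gap \<kappa> x) {1..<N}" by simp
  have "char (distr P borel (mirror_sum \<kappa> x N)) \<theta> = (\<Prod>k\<in>{1..<N}. char (distr P borel (mirror_gap \<kappa> x k)) \<theta>)"
    unfolding mirror_sum_def[abs_def] by (rule P.char_distr_sum[OF ind])
  then show ?thesis by (simp add: char_mirror_gap)
qed

text \<open>The characteristic function is real because the two sides are exchangeable; hence the
  sine has mean 0.\<close>

lemma cos_mirror_sum:
  "(\<integral>v. cos (\<theta> * mirror_sum \<kappa> x N v) \<partial>P) = (\<Prod>k\<in>{1..<N}. 1 - (1 - p k) * gap_loss \<kappa> \<theta> x)" (is ?c)
  "(\<integral>v. sin (\<theta> * mirror_sum \<kappa> x N v) \<partial>P) = 0" (is ?s)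
proof -
  have i: "integrable P (\<lambda>v. iexp (\<theta> * mirror_sum \<kappa> x N v))" by (rule iexp_integrable) measurable
  have c: "(\<integral>v. iexp (\<theta> * mirror_sum \<kappa> x N v) \<partial>P) = of_real (\<Prod>k\<in>{1..<N}. 1 - (1 - p k) * gap_loss \<kappa> \<theta> x)"
    unfolding char_mirror_sum[symmetric] char_def by (subst integral_distr) auto
  have "Re (iexp u) = cos u" "Im (iexp u) = sin u" for u by (simp_all add: Re_exp Im_exp)
  then show ?c ?s using integral_Re[OF i] integral_Im[OF i] unfolding c Re_complex_of_real Im_complex_of_real by (simp_all only:)
qed

end

text \<open>In both bounds the probabilities \<open>q k\<close> enter only through their sum; this
  is how \<open>eta\<close> alone governs the limit.\<close>

lemma prod_one_minus_bounds:
  fixes q :: "nat \<Rightarrow> real"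
  assumes "\<And>k. 0 \<le> q k" "\<And>k. q k \<le> 1" "0 \<le> w" "w \<le> 1 / 2"
  shows "exp (- ((1 + 2 * w) * (w * (\<Sum>k\<in>A. q k)))) \<le> (\<Prod>k\<in>A. 1 - q k * w)"
    "(\<Prod>k\<in>A. 1 - q k * w) \<le> exp (- (w * (\<Sum>k\<in>A. q k)))"
proof -
  have b: "exp (- ((1 + 2 * w) * (q k * w))) \<le> 1 - q k * w" "1 - q k * w \<le> exp (- (q k * w))" "0 \<le> 1 - q k * w" for k
  proof -
    have "q k * w \<le> 1 * w" using assms by (intro mult_right_mono) auto
    then show "exp (- ((1 + 2 * w) * (q k * w))) \<le> 1 - q k * w" "0 \<le> 1 - q k * w"
      using assms by (auto intro!: one_minus_ge_exp)
    show "1 - q k * w \<le> exp (- (q k * w))" using exp_ge_add_one_self[of "- (q k * w)"] by simp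
  qed
  show "exp (- ((1 + 2 * w) * (w * (\<Sum>k\<in>A. q k)))) \<le> (\<Prod>k\<in>A. 1 - q k * w)"
  proof (cases "finite A")
    case True
    have "exp (- ((1 + 2 * w) * (w * (\<Sum>k\<in>A. q k)))) = (\<Prod>k\<in>A. exp (- ((1 + 2 * w) * (q k * w))))"
      using True by (simp add: exp_sum[symmetric] sum_negf sum_distrib_left mult_ac)
    also have "\<dots> \<le> (\<Prod>k\<in>A. 1 - q k * w)" by (intro prod_mono) (use b in auto)
    finally show ?thesis .
  qed simp
  show "(\<Prod>k\<in>A. 1 - q k * w) \<le> exp (- (w * (\<Sum>k\<in>A. q k)))"
  proof (cases "finite A")
    case True
    have "(\<Prod>k\<in>A. 1 - q k * w) \<le> (\<Prod>k\<in>A. exp (- (q k * w)))" by (intro prod_mono) (use b in auto)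
    also have "\<dots> = exp (- (w * (\<Sum>k\<in>A. q k)))"
      using True by (simp add: exp_sum[symmetric] sum_negf sum_distrib_left mult_ac)
    finally show ?thesis .
  qed simp
qed

section \<open>Asymptotics of the height and space scales\<close>

lemma scale_at_top:
  assumes "2 \<le> \<alpha>"
  shows "filterlim (scale_a \<alpha>) at_top at_top" "filterlim (scale_r \<alpha>) at_top at_top"
proof -
  have g: "0 < 1 / (\<alpha> - 1)" using assms by simp
  show a: "filterlim (scale_a \<alpha>) at_top at_top" unfolding scale_a_def using g by real_asymp
  have "filterlim (\<lambda>t::real. t / ln t) at_top at_top" by real_asymp
  from filterlim_at_top_mult_at_top[OF this a] show "filterlim (scale_r \<alpha>) at_top at_top" by (simp add: scale_r_def[abs_def])
qed

lemma scale_r_eq_powr: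
  assumes "2 \<le> \<alpha>" "1 < t"
  shows "scale_r \<alpha> t = scale_a \<alpha> t powr \<alpha>" "0 < scale_a \<alpha> t" "0 < scale_r \<alpha> t"
proof -
  have t: "0 < t" "0 < ln t" using assms by simp_all
  then have T: "0 < t / ln t" by simp
  have "scale_r \<alpha> t = (t / ln t) powr (1 + 1 / (\<alpha> - 1))"
    unfolding scale_r_def scale_a_def by (rule powr_mult_base) (use T in simp)
  also have "1 + 1 / (\<alpha> - 1) = 1 / (\<alpha> - 1) * \<alpha>" using assms by (simp add: field_simps)
  finally show "scale_r \<alpha> t = scale_a \<alpha> t powr \<alpha>" by (simp add: scale_a_def powr_powr)
  show a: "0 < scale_a \<alpha> t" using t by (simp add: scale_a_def)
  show "0 < scale_r \<alpha> t" unfolding scale_r_def using T a by (rule mult_pos_pos)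
qed

text \<open>The shift \<open>j\<close> covers both the peak itself and its predecessor, the last
  index of the asymmetry sum and hence the argument of \<open>eta\<close>.\<close>

lemma site_over_scale:
  fixes s :: real and j :: nat
  assumes "filterlim r at_top F" "0 < s"
  shows "((\<lambda>t. real (nat \<lfloor>r t * s\<rfloor> - j) / r t) \<longlongrightarrow> s) F"
proof -
  have "((\<lambda>r. real (nat \<lfloor>r * s\<rfloor> - j) / r) \<longlongrightarrow> s) at_top"
  proof (rule tendsto_sandwich)
    show "((\<lambda>r. (r * s - (real j + 1)) / r) \<longlongrightarrow> s) at_top" by real_asymp
    show "((\<lambda>r. r * s / r) \<longlongrightarrow> s) at_top" by real_asymp
    show "eventually (\<lambda>r. (r * s - (real j + 1)) / r \<le> real (nat \<lfloor>r * s\<rfloor> - j) / r) at_top"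
      using eventually_gt_at_top[of 0] by eventually_elim (intro divide_right_mono, linarith+)
    show "eventually (\<lambda>r. real (nat \<lfloor>r * s\<rfloor> - j) / r \<le> r * s / r) at_top"
      using eventually_gt_at_top[of 0]
    proof eventually_elim
      case (elim r)
      have "0 \<le> r * s" using elim assms by simp
      then have "real (nat \<lfloor>r * s\<rfloor> - j) \<le> r * s" by linarith
      then show ?case using elim by (intro divide_right_mono) auto
    qed
  qed
  from filterlim_compose[OF this assms(1)] show ?thesis .
qed

lemma site_at_top:
  assumes "filterlim r at_top F" "0 < (s :: real)"
  shows "filterlim (\<lambda>t. nat \<lfloor>r t * s\<rfloor> - j) at_top F"
proof -
  have "filterlim (\<lambda>r. nat \<lfloor>r * s\<rfloor> - j) at_top at_top"
  proof (subst filterlim_at_top, intro allI)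
    fix n :: nat
    have "eventually (\<lambda>r::real. real (n + j) + 1 \<le> r * s) at_top" using assms(2) by real_asymp
    then show "eventually (\<lambda>r. n \<le> nat \<lfloor>r * s\<rfloor> - j) at_top" by eventually_elim linarith
  qed
  from filterlim_compose[OF this assms(1)] show ?thesis .
qed

lemma kappa_scale_gt2:
  assumes \<alpha>: "2 < \<alpha>" and s: "0 < s" and y: "0 < y"
  shows "((\<lambda>t. kappa \<alpha> (peak_site \<alpha> s t - 1) / (scale_a \<alpha> t * y)\<^sup>2) \<longlongrightarrow> s powr (2 / \<alpha>) / y\<^sup>2) at_top"
proof (rule Lim_transform_eventually)
  have r: "filterlim (scale_r \<alpha>) at_top at_top" using \<alpha> by (intro scale_at_top) auto
  show "((\<lambda>t. (real (peak_site \<alpha> s t - 1) / scale_r \<alpha> t) powr (2 / \<alpha>) / y\<^sup>2) \<longlongrightarrow> s powr (2 / \<alpha>) / y\<^sup>2) at_top"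
    using s y by (intro tendsto_intros site_over_scale r) auto
  show "eventually (\<lambda>t. (real (peak_site \<alpha> s t - 1) / scale_r \<alpha> t) powr (2 / \<alpha>) / y\<^sup>2
      = kappa \<alpha> (peak_site \<alpha> s t - 1) / (scale_a \<alpha> t * y)\<^sup>2) at_top"
    using eventually_gt_at_top[of 1]
  proof eventually_elim
    case (elim t)
    note sc = scale_r_eq_powr[OF less_imp_le[OF \<alpha>] elim]
    have "scale_r \<alpha> t powr (2 / \<alpha>) = (scale_a \<alpha> t)\<^sup>2"
      using sc(2) \<alpha> unfolding sc(1) by (simp add: powr_powr powr_numeral)
    then show ?case using \<alpha> sc(3) by (simp add: kappa_def powr_divide power_mult_distrib)
  qed
qed

text \<open>Here \<open>scale_r\<close> is the square of \<open>scale_a\<close>, so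
  \<open>ln N\<close> is asymptotic to \<open>2 * ln (scale_a 2 t)\<close>. The resulting 1/2
  cancels the 2 in the limit of \<open>gap_loss\<close> and produces the value
  \<open>sigma 2 = 1\<close>.\<close>

lemma kappa_scale_2:
  assumes s: "0 < s" and y: "0 < y"
  shows "((\<lambda>t. kappa 2 (peak_site 2 s t - 1) * ln (scale_a 2 t * y) / (scale_a 2 t * y)\<^sup>2) \<longlongrightarrow> s / (2 * y\<^sup>2)) at_top"
proof (rule Lim_transform_eventually)
  have r: "filterlim (scale_r 2) at_top at_top" and a: "filterlim (scale_a 2) at_top at_top" by (intro scale_at_top; simp)+
  define m where "m t = real (peak_site 2 s t - 1) / scale_r 2 t" for t
  have m: "(m \<longlongrightarrow> s) at_top" unfolding m_def by (intro site_over_scale r s)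
  have la: "((\<lambda>t. inverse (ln (scale_a 2 t))) \<longlongrightarrow> 0) at_top"
    by (intro tendsto_inverse_0_at_top filterlim_compose[OF ln_at_top a])
  have "((\<lambda>t. m t * (1 + ln y * inverse (ln (scale_a 2 t))) / ((2 + ln (m t) * inverse (ln (scale_a 2 t))) * y\<^sup>2))
      \<longlongrightarrow> s * (1 + ln y * 0) / ((2 + ln s * 0) * y\<^sup>2)) at_top"
    using s y by (intro tendsto_intros la m) auto
  then show "((\<lambda>t. m t * (1 + ln y * inverse (ln (scale_a 2 t))) / ((2 + ln (m t) * inverse (ln (scale_a 2 t))) * y\<^sup>2))
      \<longlongrightarrow> s / (2 * y\<^sup>2)) at_top" by simp
  have "eventually (\<lambda>t. 1 < scale_a 2 t) at_top" using a unfolding filterlim_at_top_dense by simp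
  moreover have "eventually (\<lambda>t. 0 < m t) at_top" using m s by (rule order_tendstoD)
  ultimately show "eventually (\<lambda>t. m t * (1 + ln y * inverse (ln (scale_a 2 t))) / ((2 + ln (m t) * inverse (ln (scale_a 2 t))) * y\<^sup>2)
      = kappa 2 (peak_site 2 s t - 1) * ln (scale_a 2 t * y) / (scale_a 2 t * y)\<^sup>2) at_top"
    using eventually_gt_at_top[of 1]
  proof eventually_elim
    case (elim t)
    define a where "a = scale_a 2 t"
    have sc: "scale_r 2 t = a\<^sup>2" "1 < a" using scale_r_eq_powr[of 2 t] elim by (auto simp: a_def powr_numeral)
    have N: "real (peak_site 2 s t - 1) = m t * a\<^sup>2" using sc by (simp add: m_def)
    have l: "ln a \<noteq> 0" using sc by simp
    have e1: "ln (a * y) = ln a * (1 + ln y * inverse (ln a))" using sc y l by (simp add: ln_mult distrib_left)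
    have e2: "ln (m t * a\<^sup>2) = ln a * (2 + ln (m t) * inverse (ln a))"
      using sc elim l by (simp add: ln_mult ln_realpow distrib_left)
    have "kappa 2 (peak_site 2 s t - 1) * ln (a * y) / (a * y)\<^sup>2
       = m t * a\<^sup>2 / (ln a * (2 + ln (m t) * inverse (ln a))) * (ln a * (1 + ln y * inverse (ln a))) / (a * y)\<^sup>2"
      unfolding kappa_def N e1 e2 by simp
    also have "\<dots> = m t * (1 + ln y * inverse (ln a)) / ((2 + ln (m t) * inverse (ln a)) * y\<^sup>2)"
      unfolding power_mult_distrib
    proof -
      have *: "m * A / (l * e) * (l * b) / (A * Y) = m * b / (e * Y)" if "A \<noteq> 0" "l \<noteq> 0" for m A l e b Y :: real
        using that by simp
      show "m t * a\<^sup>2 / (ln a * (2 + ln (m t) * inverse (ln a))) * (ln a * (1 + ln y * inverse (ln a))) / (a\<^sup>2 * y\<^sup>2)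
        = m t * (1 + ln y * inverse (ln a)) / ((2 + ln (m t) * inverse (ln a)) * y\<^sup>2)"
        by (rule *) (use l sc in auto)
    qed
    finally show ?case unfolding a_def by simp
  qed
qed

context pareto_env begin

text \<open>Scaled so that \<open>exp (- (\<beta> * gap_exponent \<theta> b))\<close> is the
  characteristic function of a centred normal law with standard deviation
  \<open>sqrt (2 * \<beta>) * sigma \<alpha> * b\<close>.\<close>

definition gap_exponent :: "real \<Rightarrow> real \<Rightarrow> real" where
  "gap_exponent \<theta> b = (sigma \<alpha>)\<^sup>2 * \<theta>\<^sup>2 * b\<^sup>2"

lemma mirror_sum_exponent_lim:
  assumes \<kappa>: "0 < \<kappa>" "\<kappa> < 1" and s: "0 < s" and y: "0 < y" and \<tau>: "filterlim \<tau> at_top sequentially"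
  shows "(\<lambda>k. gap_loss \<kappa> \<theta> (scale_a \<alpha> (\<tau> k) * y) * eta p (peak_site \<alpha> s (\<tau> k) - 1)) \<longlonglongrightarrow> \<beta> * gap_exponent \<theta> (s powr (1 / \<alpha>) / y)"
    "(\<lambda>k. gap_loss \<kappa> \<theta> (scale_a \<alpha> (\<tau> k) * y)) \<longlonglongrightarrow> 0"
proof -
  \<comment> \<open>The value 1 for small \<open>\<tau> k\<close> keeps \<open>x k\<close> positive
    for every \<open>k\<close>, as the moment lemmas demand; the limit only sees large
    \<open>k\<close>.\<close>
  define x where "x k = (if 1 < \<tau> k then scale_a \<alpha> (\<tau> k) * y else 1)" for k
  define N where "N k = peak_site \<alpha> s (\<tau> k) - 1" for k
  have \<tau>1: "eventually (\<lambda>k. 1 < \<tau> k) sequentially" using \<tau> unfolding filterlim_at_top_dense by simp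
  have xe: "eventually (\<lambda>k. x k = scale_a \<alpha> (\<tau> k) * y) sequentially"
    using \<tau>1 by eventually_elim (simp add: x_def)
  have x0: "0 < x k" for k using scale_r_eq_powr[OF \<alpha>, of "\<tau> k"] y by (simp add: x_def)
  have "filterlim (\<lambda>k. scale_a \<alpha> (\<tau> k) * y) at_top sequentially"
    by (rule filterlim_at_top_mult_tendsto_pos[OF tendsto_const y filterlim_compose[OF scale_at_top(1)[OF \<alpha>] \<tau>]])
  then have xt: "filterlim x at_top sequentially" using filterlim_cong[OF refl refl xe] by simp
  have Nt: "filterlim N at_top sequentially"
    unfolding N_def by (rule site_at_top[OF filterlim_compose[OF scale_at_top(2)[OF \<alpha>] \<tau>] s])
  have kpos: "eventually (\<lambda>n. 0 < kappa \<alpha> n) at_top"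
    using eventually_gt_at_top[of 1] by eventually_elim (auto simp: kappa_def)
  have "eventually (\<lambda>n. eta p n \<noteq> 0 \<or> \<beta> * kappa \<alpha> n \<noteq> 0) at_top" using kpos by eventually_elim (use \<beta> in auto)
  from asymp_equivD_strong[OF eta_asymp this] have "((\<lambda>n. eta p n / (\<beta> * kappa \<alpha> n)) \<longlongrightarrow> 1) at_top" .
  from tendsto_mult[OF tendsto_const[of \<beta>] this] have "((\<lambda>n. \<beta> * (eta p n / (\<beta> * kappa \<alpha> n))) \<longlongrightarrow> \<beta>) at_top" by simp
  then have "((\<lambda>n. eta p n / kappa \<alpha> n) \<longlongrightarrow> \<beta>) at_top" using \<beta> by simp
  from filterlim_compose[OF this Nt] have e: "(\<lambda>k. eta p (N k) / kappa \<alpha> (N k)) \<longlonglongrightarrow> \<beta>" .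
  have kN: "eventually (\<lambda>k. 0 < kappa \<alpha> (N k)) sequentially" using kpos Nt by (rule eventually_compose_filterlim)
  define g where "g k = gap_loss \<kappa> \<theta> (x k)" for k
  have g_eq: "eventually (\<lambda>k. g k = gap_loss \<kappa> \<theta> (scale_a \<alpha> (\<tau> k) * y)) sequentially"
    using xe by eventually_elim (simp add: g_def)
  have inv: "(\<lambda>k. inverse (x k)) \<longlonglongrightarrow> 0" by (intro tendsto_inverse_0_at_top xt)
  have main: "(\<lambda>k. g k * kappa \<alpha> (N k)) \<longlonglongrightarrow> gap_exponent \<theta> (s powr (1 / \<alpha>) / y) \<and> g \<longlonglongrightarrow> 0"
  proof (cases "2 < \<alpha>")
    case True
    have G: "(\<lambda>k. (x k)\<^sup>2 * g k) \<longlonglongrightarrow> \<theta>\<^sup>2 * (sigma \<alpha>)\<^sup>2"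
      unfolding g_def by (rule gap_loss_lim_gt2[OF \<kappa> x0 xt True])
    have K: "(\<lambda>k. kappa \<alpha> (N k) / (x k)\<^sup>2) \<longlonglongrightarrow> s powr (2 / \<alpha>) / y\<^sup>2"
      by (rule Lim_transform_eventually[OF filterlim_compose[OF kappa_scale_gt2[OF True s y] \<tau>]])
         (use xe in eventually_elim, simp add: N_def)
    have "(\<lambda>k. ((x k)\<^sup>2 * g k) * (kappa \<alpha> (N k) / (x k)\<^sup>2)) \<longlonglongrightarrow> \<theta>\<^sup>2 * (sigma \<alpha>)\<^sup>2 * (s powr (2 / \<alpha>) / y\<^sup>2)"
      by (intro tendsto_intros G K)
    moreover have "((x k)\<^sup>2 * g k) * (kappa \<alpha> (N k) / (x k)\<^sup>2) = g k * kappa \<alpha> (N k)" for k using x0[of k] by simp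
    moreover have "\<theta>\<^sup>2 * (sigma \<alpha>)\<^sup>2 * (s powr (2 / \<alpha>) / y\<^sup>2) = gap_exponent \<theta> (s powr (1 / \<alpha>) / y)"
      by (simp add: gap_exponent_def power_divide power2_eq_square[of "s powr (1/\<alpha>)"] powr_add[symmetric])
    moreover have "(\<lambda>k. ((x k)\<^sup>2 * g k) * (inverse (x k))\<^sup>2) \<longlonglongrightarrow> \<theta>\<^sup>2 * (sigma \<alpha>)\<^sup>2 * 0\<^sup>2"
      by (intro tendsto_intros G inv)
    moreover have "((x k)\<^sup>2 * g k) * (inverse (x k))\<^sup>2 = g k" for k
      using x0[of k] by (simp add: power_inverse)
    ultimately show ?thesis by simp
  next
    case False
    then have \<alpha>2: "\<alpha> = 2" using \<alpha> by simp
    have G: "(\<lambda>k. (x k)\<^sup>2 / ln (x k) * g k) \<longlonglongrightarrow> 2 * \<theta>\<^sup>2"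
      unfolding g_def by (rule gap_loss_lim_2[OF \<kappa> x0 xt \<alpha>2])
    have K: "(\<lambda>k. kappa \<alpha> (N k) * ln (x k) / (x k)\<^sup>2) \<longlonglongrightarrow> s / (2 * y\<^sup>2)"
      by (rule Lim_transform_eventually[OF filterlim_compose[OF kappa_scale_2[OF s y] \<tau>]])
         (use xe in eventually_elim, simp add: N_def \<alpha>2)
    have "((\<lambda>x::real. ln x / x\<^sup>2) \<longlongrightarrow> 0) at_top" by real_asymp
    from filterlim_compose[OF this xt] have inv2: "(\<lambda>k. ln (x k) / (x k)\<^sup>2) \<longlonglongrightarrow> 0" .
    have "eventually (\<lambda>x::real. 0 < ln x) at_top" by real_asymp
    from eventually_compose_filterlim[OF this xt] have lp: "eventually (\<lambda>k. 0 < ln (x k)) sequentially" .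
    have "(\<lambda>k. ((x k)\<^sup>2 / ln (x k) * g k) * (kappa \<alpha> (N k) * ln (x k) / (x k)\<^sup>2)) \<longlonglongrightarrow> 2 * \<theta>\<^sup>2 * (s / (2 * y\<^sup>2))"
      by (intro tendsto_intros G K)
    moreover have "2 * \<theta>\<^sup>2 * (s / (2 * y\<^sup>2)) = gap_exponent \<theta> (s powr (1 / \<alpha>) / y)"
      unfolding gap_exponent_def using s by (simp add: sigma_def \<alpha>2 power_divide powr_half_sqrt)
    ultimately have 1: "(\<lambda>k. ((x k)\<^sup>2 / ln (x k) * g k) * (kappa \<alpha> (N k) * ln (x k) / (x k)\<^sup>2)) \<longlonglongrightarrow> gap_exponent \<theta> (s powr (1 / \<alpha>) / y)" by simp
    have "(\<lambda>k. ((x k)\<^sup>2 / ln (x k) * g k) * (ln (x k) / (x k)\<^sup>2)) \<longlonglongrightarrow> 2 * \<theta>\<^sup>2 * 0"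
      by (intro tendsto_intros G inv2)
    then have 2: "(\<lambda>k. ((x k)\<^sup>2 / ln (x k) * g k) * (ln (x k) / (x k)\<^sup>2)) \<longlonglongrightarrow> 0" by simp
    have "g \<longlonglongrightarrow> 0" by (rule Lim_transform_eventually[OF 2]) (use lp in eventually_elim, use x0 in \<open>simp add: less_imp_neq[THEN not_sym]\<close>)
    moreover have "(\<lambda>k. g k * kappa \<alpha> (N k)) \<longlonglongrightarrow> gap_exponent \<theta> (s powr (1 / \<alpha>) / y)"
      by (rule Lim_transform_eventually[OF 1]) (use lp in eventually_elim, use x0 in \<open>simp add: less_imp_neq[THEN not_sym]\<close>)
    ultimately show ?thesis by simp
  qed
  have "(\<lambda>k. g k * kappa \<alpha> (N k) * (eta p (N k) / kappa \<alpha> (N k))) \<longlonglongrightarrow> gap_exponent \<theta> (s powr (1 / \<alpha>) / y) * \<beta>"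
    using main by (intro tendsto_intros e) auto
  then show "(\<lambda>k. gap_loss \<kappa> \<theta> (scale_a \<alpha> (\<tau> k) * y) * eta p (peak_site \<alpha> s (\<tau> k) - 1)) \<longlonglongrightarrow> \<beta> * gap_exponent \<theta> (s powr (1 / \<alpha>) / y)"
    unfolding mult.commute[of \<beta>]
  proof (rule Lim_transform_eventually)
    show "eventually (\<lambda>k. g k * kappa \<alpha> (N k) * (eta p (N k) / kappa \<alpha> (N k)) = gap_loss \<kappa> \<theta> (scale_a \<alpha> (\<tau> k) * y) * eta p (peak_site \<alpha> s (\<tau> k) - 1)) sequentially"
      using g_eq kN by eventually_elim (simp add: N_def)
  qed
  show "(\<lambda>k. gap_loss \<kappa> \<theta> (scale_a \<alpha> (\<tau> k) * y)) \<longlonglongrightarrow> 0"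
    using main g_eq by (auto intro: Lim_transform_eventually)
qed

lemma cos_mirror_sum_lim:
  assumes \<kappa>: "0 < \<kappa>" "\<kappa> < 1" and s: "0 < s" and y: "0 < y" and \<tau>: "filterlim \<tau> at_top sequentially"
  shows "(\<lambda>k. \<integral>v. cos (\<theta> * mirror_sum \<kappa> (scale_a \<alpha> (\<tau> k) * y) (peak_site \<alpha> s (\<tau> k)) v) \<partial>P) \<longlonglongrightarrow> exp (- (\<beta> * gap_exponent \<theta> (s powr (1 / \<alpha>) / y)))"
proof -
  define N where "N k = peak_site \<alpha> s (\<tau> k)" for k
  define w where "w k = gap_loss \<kappa> \<theta> (scale_a \<alpha> (\<tau> k) * y)" for k
  note lims = mirror_sum_exponent_lim[OF assms, of \<theta>, folded N_def w_def]
  have w0: "0 \<le> w k" for k unfolding w_def by (rule gap_char_norm)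
  have w2: "eventually (\<lambda>k. w k \<le> 1 / 2) sequentially"
  proof -
    have "eventually (\<lambda>k. w k < 1 / 2) sequentially" by (rule order_tendstoD(2)[OF lims(2)]) simp
    then show ?thesis by eventually_elim simp
  qed
  have eta: "eta p (N k - 1) = (\<Sum>j\<in>{1..<N k}. 1 - p j)" for k
    unfolding eta_def by (intro sum.cong) auto
  have pr: "0 \<le> 1 - p j" "1 - p j \<le> 1" for j using p_range[of j] by auto
  show ?thesis unfolding cos_mirror_sum N_def[symmetric] w_def[symmetric]
  proof (rule tendsto_sandwich)
    have "(\<lambda>k. exp (- ((1 + 2 * w k) * (w k * eta p (N k - 1))))) \<longlonglongrightarrow> exp (- ((1 + 2 * 0) * (\<beta> * gap_exponent \<theta> (s powr (1 / \<alpha>) / y))))"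
      by (intro tendsto_intros lims)
    then show "(\<lambda>k. exp (- ((1 + 2 * w k) * (w k * eta p (N k - 1))))) \<longlonglongrightarrow> exp (- (\<beta> * gap_exponent \<theta> (s powr (1 / \<alpha>) / y)))" by simp
    show "(\<lambda>k. exp (- (w k * eta p (N k - 1)))) \<longlonglongrightarrow> exp (- (\<beta> * gap_exponent \<theta> (s powr (1 / \<alpha>) / y)))"
      by (intro tendsto_intros lims)
    show "eventually (\<lambda>k. exp (- ((1 + 2 * w k) * (w k * eta p (N k - 1)))) \<le> (\<Prod>j\<in>{1..<N k}. 1 - (1 - p j) * w k)) sequentially"
      using w2 by eventually_elim (unfold eta, rule prod_one_minus_bounds(1)[OF pr w0])
    show "eventually (\<lambda>k. (\<Prod>j\<in>{1..<N k}. 1 - (1 - p j) * w k) \<le> exp (- (w k * eta p (N k - 1)))) sequentially"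
      using w2 by eventually_elim (unfold eta, rule prod_one_minus_bounds(2)[OF pr w0])
  qed
qed

end

section \<open>Regular environments are typical\<close>

text \<open>For a peak at scaled position \<open>s\<close> and height \<open>y\<close>, with
  \<open>c = y - \<delta>\<close>, this is a lower bound for \<open>1 / t\<close> times the
  threshold of a rival. Rounding the site down only raises the threshold.\<close>

definition level :: "real \<Rightarrow> real \<Rightarrow> real \<Rightarrow> real \<Rightarrow> real \<Rightarrow> real" where
  "level \<alpha> s y c t = scale_a \<alpha> t * c - scale_r \<alpha> t * s / t * ln (scale_a \<alpha> t * y)"

text \<open>Bound for the expected number of sites above level \<open>Y\<close>: the sum of tails
  along the sites with slope \<open>ln Y / t\<close>.\<close>

definition tail_total :: "real \<Rightarrow> real \<Rightarrow> real \<Rightarrow> real" where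
  "tail_total \<alpha> t Y = Y powr (- \<alpha>) + Y powr (1 - \<alpha>) / (ln Y / t * (\<alpha> - 1))"

text \<open>\<open>ln (scale_a \<alpha> t) / ln t\<close> tends to
  \<open>1 / (\<alpha> - 1)\<close>, which turns the logarithmic cost of the distance into
  \<open>s / (\<alpha> - 1)\<close> in units of \<open>scale_a\<close>. In \<open>tail_total\<close>
  a single site is negligible, and the integral term converges since
  \<open>scale_a \<alpha> t powr (1 - \<alpha>) = ln t / t\<close>.\<close>

lemma level_lim:
  fixes \<alpha> s y c :: real
  assumes \<alpha>: "2 \<le> \<alpha>" and s: "0 < s" and y: "0 < y" and c: "s / (\<alpha> - 1) < c"
  shows "((\<lambda>t. level \<alpha> s y c t / scale_a \<alpha> t) \<longlongrightarrow> c - s / (\<alpha> - 1)) at_top"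
    "filterlim (level \<alpha> s y c) at_top at_top"
    "((\<lambda>t. tail_total \<alpha> t (level \<alpha> s y c t)) \<longlongrightarrow> (c - s / (\<alpha> - 1)) powr (1 - \<alpha>)) at_top"
proof -
  define \<gamma> where "\<gamma> = 1 / (\<alpha> - 1)"
  have \<gamma>: "0 < \<gamma>" "\<gamma> * (\<alpha> - 1) = 1" "\<gamma> \<noteq> 0" using \<alpha> by (simp_all add: \<gamma>_def)
  define a where "a = scale_a \<alpha>"
  define Y where "Y = level \<alpha> s y c"
  define h0 where "h0 = c - s / (\<alpha> - 1)"
  have h0: "0 < h0" using c by (simp add: h0_def)
  have a_eq: "a t = (t / ln t) powr \<gamma>" for t by (simp add: a_def scale_a_def \<gamma>_def)
  have at: "filterlim a at_top at_top" unfolding a_def by (rule scale_at_top[OF \<alpha>])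
  have la: "((\<lambda>t. ln (a t) / ln t) \<longlongrightarrow> \<gamma>) at_top" unfolding a_eq using \<gamma>(1) by real_asymp
  have l1: "((\<lambda>t::real. 1 / ln t) \<longlongrightarrow> 0) at_top" by real_asymp
  have gt: "eventually (\<lambda>t::real. 3 < t) at_top" by (rule eventually_gt_at_top)
  have e: "Y t / a t = c - s * (ln (a t) / ln t + ln y * (1 / ln t))" if "3 < t" for t
  proof -
    have t: "0 < ln t" "0 < t" using that by auto
    have p: "0 < a t" using t by (simp add: a_eq)
    have "Y t = a t * c - a t / ln t * s * (ln (a t) + ln y)"
      unfolding Y_def level_def scale_r_def a_def[symmetric] using p t y by (simp add: ln_mult)
    then have "Y t / a t = c - 1 / ln t * s * (ln (a t) + ln y)" using p by (simp add: diff_divide_distrib)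
    then show ?thesis by (simp add: distrib_left add_divide_distrib mult.commute)
  qed
  have "((\<lambda>t. c - s * (ln (a t) / ln t + ln y * (1 / ln t))) \<longlongrightarrow> c - s * (\<gamma> + ln y * 0)) at_top"
    by (intro tendsto_intros la l1)
  then have "((\<lambda>t. Y t / a t) \<longlongrightarrow> c - s * (\<gamma> + ln y * 0)) at_top"
    by (rule Lim_transform_eventually) (use gt in eventually_elim, simp only: e)
  then have h: "((\<lambda>t. Y t / a t) \<longlongrightarrow> h0) at_top" by (simp add: h0_def \<gamma>_def)
  then show "((\<lambda>t. level \<alpha> s y c t / scale_a \<alpha> t) \<longlongrightarrow> c - s / (\<alpha> - 1)) at_top" by (simp add: Y_def a_def h0_def)
  have ap: "eventually (\<lambda>t. 1 < a t) at_top" using at unfolding filterlim_at_top_dense by simp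
  have "filterlim (\<lambda>t. Y t / a t * a t) at_top at_top" by (rule filterlim_tendsto_pos_mult_at_top[OF h h0 at])
  moreover have ev: "eventually (\<lambda>t. Y t / a t * a t = Y t) at_top" using ap by eventually_elim simp
  ultimately have Yt: "filterlim Y at_top at_top" using filterlim_cong[OF refl refl ev] by simp
  then show "filterlim (level \<alpha> s y c) at_top at_top" by (simp add: Y_def)
  define H where "H t = Y t / a t" for t
  have H: "(H \<longlongrightarrow> h0) at_top" using h by (simp add: H_def[abs_def])
  have Hp: "eventually (\<lambda>t. 0 < H t) at_top" using H h0 by (rule order_tendstoD)
  have "((\<lambda>t. inverse (Y t) powr \<alpha>) \<longlongrightarrow> 0 powr \<alpha>) at_top"
    by (intro tendsto_powr' tendsto_inverse_0_at_top Yt tendsto_const) (use \<alpha> Yt in \<open>auto simp: filterlim_at_top elim!: allE[of _ 0] eventually_mono\<close>)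
  then have z: "((\<lambda>t. Y t powr (- \<alpha>)) \<longlongrightarrow> 0) at_top" using \<alpha> by (simp add: powr_minus inverse_powr)
  have "((\<lambda>t. Y t powr (- \<alpha>) + H t powr (1 - \<alpha>) / ((ln (a t) / ln t + ln (H t) * (1 / ln t)) * (\<alpha> - 1)))
     \<longlongrightarrow> 0 + h0 powr (1 - \<alpha>) / ((\<gamma> + ln h0 * 0) * (\<alpha> - 1))) at_top"
    using h0 \<gamma> by (intro tendsto_intros H la l1 z) auto
  then have main: "((\<lambda>t. Y t powr (- \<alpha>) + H t powr (1 - \<alpha>) / ((ln (a t) / ln t + ln (H t) * (1 / ln t)) * (\<alpha> - 1)))
     \<longlongrightarrow> h0 powr (1 - \<alpha>)) at_top" using \<gamma> by simp
  have "((\<lambda>t. tail_total \<alpha> t (Y t)) \<longlongrightarrow> h0 powr (1 - \<alpha>)) at_top"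
  proof (rule Lim_transform_eventually[OF main])
    show "eventually (\<lambda>t. Y t powr (- \<alpha>) + H t powr (1 - \<alpha>) / ((ln (a t) / ln t + ln (H t) * (1 / ln t)) * (\<alpha> - 1)) = tail_total \<alpha> t (Y t)) at_top"
      using gt ap Hp
    proof eventually_elim
      case (elim t)
      have t: "0 < ln t" "0 < t" using elim by auto
      have Y: "Y t = a t * H t" using elim by (simp add: H_def)
      have "a t powr (1 - \<alpha>) = (t / ln t) powr (- (\<gamma> * (\<alpha> - 1)))" by (simp add: a_eq powr_powr algebra_simps)
      also have "\<dots> = ln t / t" using t by (simp add: \<gamma>(2) powr_minus)
      finally have A: "a t powr (1 - \<alpha>) = ln t / t" .
      have "Y t powr (1 - \<alpha>) = ln t / t * H t powr (1 - \<alpha>)" unfolding Y using elim by (subst powr_mult) (auto simp: A)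
      moreover have "ln (Y t) = ln t * (ln (a t) / ln t + ln (H t) * (1 / ln t))" unfolding Y using elim t by (simp add: ln_mult distrib_left)
      moreover have "l / t * h / (l * e / t * d) = h / (e * d)" if "l \<noteq> 0" "t \<noteq> 0" for l t h e d :: real using that by simp
      ultimately show ?case using t unfolding tail_total_def by simp
    qed
  qed
  then show "((\<lambda>t. tail_total \<alpha> t (level \<alpha> s y c t)) \<longlongrightarrow> (c - s / (\<alpha> - 1)) powr (1 - \<alpha>)) at_top"
    by (simp add: Y_def h0_def)
qed

lemma (in prob_space) prob_UN_le:
  fixes B :: "nat \<Rightarrow> 'a set"
  assumes B: "\<And>z. B z \<in> events" and S: "\<And>M. (\<Sum>z<M. prob (B z)) \<le> S"
  shows "prob (\<Union>z. B z) \<le> S"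
proof -
  have "summable (\<lambda>z. prob (B z))" by (rule bounded_imp_summable[where B=S]) (use S in \<open>auto simp only: lessThan_Suc_atMost[symmetric] measure_nonneg\<close>)
  then show ?thesis
    using finite_measure_subadditive_countably[of B] B suminf_le_const[of "\<lambda>z. prob (B z)" S] S by fastforce
qed

context pareto_env begin

definition exceed :: "real \<Rightarrow> real \<Rightarrow> nat \<Rightarrow> real set" where
  "exceed t L z = {u. L < t * u - real z * ln u}"

lemma exceed_sets [measurable]: "exceed t L z \<in> sets borel"
  unfolding exceed_def by measurable

lemma exceed_prob:
  assumes "0 < t" "1 \<le> Y" "t * Y \<le> L"
  shows "measure (\<mu> (Inl w)) (exceed t L z) \<le> (Y + ln Y / t * real z) powr (- \<alpha>)"
proof -
  have "measure (\<mu> (Inl w)) (exceed t L z) \<le> (Y + real z / t * ln Y) powr (- \<alpha>)"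
  proof (rule pareto_log_tail)
    fix u assume "u \<in> exceed t L z"
    then have "t * Y < t * (u - real z / t * ln u)" using assms by (simp add: exceed_def right_diff_distrib)
    then show "Y < u - real z / t * ln u" using assms by simp
  qed (use assms in auto)
  then show ?thesis by (simp add: mult.commute)
qed

lemma tail_total_sum:
  assumes "0 < t" "1 < Y"
  shows "(\<Sum>z<M. (Y + ln Y / t * real z) powr (- \<alpha>)) \<le> tail_total \<alpha> t Y"
  unfolding tail_total_def using assms \<alpha> by (intro sum_powr_affine_le) auto

lemma prob_coord2:
  assumes "i \<in> I" "j \<in> I" "i \<noteq> j" and [measurable]: "A \<in> sets borel" "B \<in> sets borel"
  shows "P.prob {v\<in>space P. v i \<in> A \<and> v j \<in> B} = measure (\<mu> i) A * measure (\<mu> j) B"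
proof -
  define C where "C k = (if k = i then A else B)" for k
  have "P.prob (\<Inter>k\<in>{i, j}. (\<lambda>v. v k) -` C k \<inter> space P) = (\<Prod>k\<in>{i, j}. P.prob ((\<lambda>v. v k) -` C k \<inter> space P))"
    by (rule P.indep_varsD[OF indep_coord]) (use assms in \<open>auto simp: C_def\<close>)
  moreover have "(\<Inter>k\<in>{i, j}. (\<lambda>v. v k) -` C k \<inter> space P) = {v\<in>space P. v i \<in> A \<and> v j \<in> B}"
    using assms by (auto simp: C_def)
  moreover have "P.prob ((\<lambda>v. v k) -` D \<inter> space P) = measure (\<mu> k) D" if "k \<in> I" "D \<in> sets borel" for k D
    using prob_coord[OF that] by (simp add: vimage_def Int_def conj_commute)
  ultimately show ?thesis using assms by (simp add: C_def)
qed

lemma prob_coin_fail: "1 \<le> n \<Longrightarrow> measure (\<mu> (Inr n)) (- {1}) = 1 - p n"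
  using \<mu>.prob_compl[of "{1}" "Inr n"] coin1 by (simp add: Compl_eq_Diff_UNIV)

lemma AE_sites: "AE v in P. \<forall>z. 1 < v (Inl z)"
  unfolding AE_all_countable
proof
  fix z
  have "P.prob {v\<in>space P. v (Inl z) \<in> {1<..}} = 1" using prob_coord[of "Inl z" "{1<..}"] pareto[of 1 z] by simp
  then have "AE v in P. v \<in> {v\<in>space P. v (Inl z) \<in> {1<..}}" by (intro P.prob_eq_1[THEN iffD1]) measurable
  then show "AE v in P. 1 < v (Inl z)" by eventually_elim simp
qed

text \<open>The four ways in which an environment conditioned to peak at \<open>N\<close> can fail to be regular.\<close>

definition bad_coin :: "nat \<Rightarrow> nat \<Rightarrow> (int + nat \<Rightarrow> real) set" where
  "bad_coin N d = {v\<in>space P. \<exists>n\<in>{N - d..N - d + 2 * d}. v (Inr n) \<noteq> 1}"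

text \<open>Restricted to failed coins. Rivals at the origin or at successful coins do not become
  rare; they shape the limit law and are handled by the site events.\<close>

definition bad_rival :: "real \<Rightarrow> real \<Rightarrow> (int + nat \<Rightarrow> real) set" where
  "bad_rival t L = {v\<in>space P. \<exists>z\<ge>1. v (Inr z) \<noteq> 1 \<and> (v (Inl (int z)) \<in> exceed t L z \<or> v (Inl (- int z)) \<in> exceed t L z)}"

definition bad_far :: "real \<Rightarrow> real \<Rightarrow> (int + nat \<Rightarrow> real) set" where
  "bad_far E R = {v\<in>space P. \<exists>z. E * max \<bar>real_of_int z\<bar> R < v (Inl z)}"

definition bad_sum :: "nat \<Rightarrow> real \<Rightarrow> (int + nat \<Rightarrow> real) set" where
  "bad_sum N K = {v\<in>space P. K < (\<Sum>k\<in>{1..<N}. if v (Inr k) = 1 then 0 else \<bar>v (Inl (int k)) - v (Inl (- int k))\<bar>)}"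

lemma bad_coin_prob:
  assumes "d < N"
  shows "bad_coin N d \<in> P.events" "P.prob (bad_coin N d) \<le> (\<Sum>j\<in>{..2 * d}. 1 - p (N - d + j))"
proof -
  define B where "B j = {v\<in>space P. v (Inr (N - d + j)) \<in> - {1}}" for j
  have B: "B j \<in> P.events" "P.prob (B j) = 1 - p (N - d + j)" for j
  proof -
    have "1 \<le> N - d + j" using assms by simp
    then have [measurable]: "Inr (N - d + j) \<in> I" by (rule I_mem(2))
    show "B j \<in> P.events" unfolding B_def by measurable
    have "P.prob (B j) = measure (\<mu> (Inr (N - d + j))) (- {1})"
      unfolding B_def by (rule prob_coord) measurable
    then show "P.prob (B j) = 1 - p (N - d + j)" using prob_coin_fail \<open>1 \<le> N - d + j\<close> by simp
  qed
  have e: "bad_coin N d = (\<Union>j\<in>{..2 * d}. B j)"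
  proof -
    have "n \<in> {N - d..N - d + 2 * d} \<longleftrightarrow> (\<exists>j\<in>{..2 * d}. n = N - d + j)" for n
      by (auto intro!: bexI[of _ "n - (N - d)"])
    then show ?thesis by (auto simp: bad_coin_def B_def)
  qed
  show "bad_coin N d \<in> P.events" unfolding e using B by auto
  show "P.prob (bad_coin N d) \<le> (\<Sum>j\<in>{..2 * d}. 1 - p (N - d + j))"
    unfolding e B(2)[symmetric] using B by (intro P.finite_measure_subadditive_finite) auto
qed

text \<open>Thinning by \<open>q\<close>: the finitely many sites below \<open>m\<close> each have a
  small tail probability, and beyond \<open>m\<close> the factor \<open>e\<close> multiplies a
  bounded total.\<close>

lemma bad_rival_prob:
  assumes t: "0 < t" and Y: "1 < Y" "t * Y \<le> L" and q: "\<And>z. m \<le> z \<Longrightarrow> 1 - p z \<le> e" and e: "0 \<le> e"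
  shows "bad_rival t L \<in> P.events" "P.prob (bad_rival t L) \<le> 2 * (real m * Y powr (- \<alpha>) + e * tail_total \<alpha> t Y)"
proof -
  define f where "f z = (Y + ln Y / t * real z) powr (- \<alpha>)" for z :: nat
  define B where "B z = {v\<in>space P. 1 \<le> z \<and> v (Inr z) \<in> - {1} \<and> v (Inl (int z)) \<in> exceed t L z}" for z :: nat
  define B' where "B' z = {v\<in>space P. 1 \<le> z \<and> v (Inr z) \<in> - {1} \<and> v (Inl (- int z)) \<in> exceed t L z}" for z :: nat
  have f: "0 \<le> f z" "f z \<le> Y powr (- \<alpha>)" for z
  proof -
    have "0 \<le> ln Y / t * real z" using t Y by simp
    then show "0 \<le> f z" "f z \<le> Y powr (- \<alpha>)" unfolding f_def using Y \<alpha> by (auto intro!: powr_mono2')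
  qed
  have ev: "B z \<in> P.events" "B' z \<in> P.events" for z
    unfolding B_def B'_def by (cases z; measurable)+
  have pr: "P.prob (B z) \<le> (1 - p z) * f z \<and> P.prob (B' z) \<le> (1 - p z) * f z" for z
  proof (cases "1 \<le> z")
    case True
    have "B z = {v\<in>space P. v (Inr z) \<in> - {1} \<and> v (Inl (int z)) \<in> exceed t L z}"
      "B' z = {v\<in>space P. v (Inr z) \<in> - {1} \<and> v (Inl (- int z)) \<in> exceed t L z}" using True by (auto simp: B_def B'_def)
    then have "P.prob (B z) = (1 - p z) * measure (\<mu> (Inl (int z))) (exceed t L z)"
      "P.prob (B' z) = (1 - p z) * measure (\<mu> (Inl (- int z))) (exceed t L z)"
      using True prob_coord2[of "Inr z" "Inl (int z)" "- {1}" "exceed t L z"] prob_coord2[of "Inr z" "Inl (- int z)" "- {1}" "exceed t L z"]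
      by (simp_all only: prob_coin_fail) simp_all
    then show ?thesis using exceed_prob[OF t _ Y(2)] Y(1) p_range unfolding f_def by (auto intro!: mult_left_mono)
  next
    case False
    then have "B z = {}" "B' z = {}" by (auto simp: B_def B'_def)
    then show ?thesis using p_range f by simp
  qed
  have qf: "(1 - p z) * f z \<le> (if z < m then Y powr (- \<alpha>) else 0) + e * f z" for z
  proof (cases "z < m")
    case True
    have "(1 - p z) * f z \<le> 1 * Y powr (- \<alpha>)" using f p_range by (intro mult_mono) auto
    moreover have "0 \<le> e * f z" using e f by simp
    ultimately show ?thesis using True by simp
  next
    case False
    then show ?thesis using q[of z] f by (auto intro!: mult_right_mono)
  qed
  have one: "(\<Sum>z<M. (1 - p z) * f z) \<le> real m * Y powr (- \<alpha>) + e * tail_total \<alpha> t Y" for M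
  proof -
    have "(\<Sum>z<M. (1 - p z) * f z) \<le> (\<Sum>z<M. (if z < m then Y powr (- \<alpha>) else 0) + e * f z)" by (intro sum_mono qf)
    also have "\<dots> = (\<Sum>z<M. if z < m then Y powr (- \<alpha>) else 0) + e * (\<Sum>z<M. f z)" by (simp add: sum.distrib sum_distrib_left)
    also have "(\<Sum>z<M. if z < m then Y powr (- \<alpha>) else 0) = real (card {z. z < M \<and> z < m}) * Y powr (- \<alpha>)"
      by (simp add: sum.If_cases lessThan_def Int_def)
    also have "\<dots> \<le> real m * Y powr (- \<alpha>)"
      using card_mono[of "{..<m}" "{z. z < M \<and> z < m}"] by (intro mult_right_mono) auto
    also have "e * (\<Sum>z<M. f z) \<le> e * tail_total \<alpha> t Y"
      unfolding f_def by (intro mult_left_mono tail_total_sum t Y(1) e)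
    finally show ?thesis by simp
  qed
  have eq: "bad_rival t L = (\<Union>z. B z \<union> B' z)" by (auto simp: bad_rival_def B_def B'_def)
  show "bad_rival t L \<in> P.events" unfolding eq using ev by auto
  show "P.prob (bad_rival t L) \<le> 2 * (real m * Y powr (- \<alpha>) + e * tail_total \<alpha> t Y)"
    unfolding eq
  proof (rule P.prob_UN_le)
    fix M
    have "(\<Sum>z<M. P.prob (B z \<union> B' z)) \<le> (\<Sum>z<M. 2 * ((1 - p z) * f z))"
    proof (rule sum_mono)
      fix z
      show "P.prob (B z \<union> B' z) \<le> 2 * ((1 - p z) * f z)"
        using measure_Un_le[OF ev(1)[of z] ev(2)[of z]] pr[of z] by simp
    qed
    then show "(\<Sum>z<M. P.prob (B z \<union> B' z)) \<le> 2 * (real m * Y powr (- \<alpha>) + e * tail_total \<alpha> t Y)"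
      using one[of M] by (simp add: sum_distrib_left[symmetric])
  qed (use ev in auto)
qed

text \<open>The maximum of \<open>\<bar>z\<bar>\<close> and \<open>R\<close> is at least their
  average, which makes the threshold affine in the distance and the tails summable.\<close>

lemma bad_far_prob:
  assumes E: "0 < E" and R: "0 < R" "2 \<le> E * R"
  shows "bad_far E R \<in> P.events" "P.prob (bad_far E R) \<le> 2 * ((E * R / 2) powr (- \<alpha>) + (E * R / 2) powr (1 - \<alpha>) / (E / 2 * (\<alpha> - 1)))"
proof -
  define c where "c z = E * max \<bar>real_of_int z\<bar> R" for z
  define B where "B z = {v\<in>space P. v (Inl (int z)) \<in> {c (int z)<..}}" for z :: nat
  define B' where "B' z = {v\<in>space P. v (Inl (- int z)) \<in> {c (- int z)<..}}" for z :: nat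
  have cg: "E * R / 2 + E / 2 * real z \<le> c (int z)" "c (- int z) = c (int z)" "1 \<le> E * R / 2 + E / 2 * real z" for z
  proof -
    have "E * ((real z + R) / 2) \<le> E * max (real z) R" using E by (intro mult_left_mono) auto
    then show "E * R / 2 + E / 2 * real z \<le> c (int z)" by (simp add: c_def algebra_simps add_divide_distrib)
    show "1 \<le> E * R / 2 + E / 2 * real z" using R E by (simp add: add_increasing2)
  qed (simp add: c_def)
  have ev: "B z \<in> P.events" "B' z \<in> P.events" for z unfolding B_def B'_def by measurable
  have pr: "P.prob (B z) \<le> (E * R / 2 + E / 2 * real z) powr (- \<alpha>)" "P.prob (B' z) \<le> (E * R / 2 + E / 2 * real z) powr (- \<alpha>)" for z
  proof -
    have "P.prob (B z) = c (int z) powr (- \<alpha>)" "P.prob (B' z) = c (int z) powr (- \<alpha>)"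
      unfolding B_def B'_def using cg[of z] by (subst prob_coord; simp add: pareto)+
    moreover have "c (int z) powr (- \<alpha>) \<le> (E * R / 2 + E / 2 * real z) powr (- \<alpha>)"
      using cg(1,3)[of z] \<alpha> by (intro powr_mono2') auto
    ultimately show "P.prob (B z) \<le> (E * R / 2 + E / 2 * real z) powr (- \<alpha>)" "P.prob (B' z) \<le> (E * R / 2 + E / 2 * real z) powr (- \<alpha>)" by simp_all
  qed
  have eq: "bad_far E R = (\<Union>z. B z \<union> B' z)"
  proof -
    have "(\<exists>z. Q z) \<longleftrightarrow> (\<exists>n. Q (int n) \<or> Q (- int n))" for Q by (metis int_cases2)
    then show ?thesis by (auto simp: bad_far_def B_def B'_def c_def)
  qed
  show "bad_far E R \<in> P.events" unfolding eq using ev by auto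
  show "P.prob (bad_far E R) \<le> 2 * ((E * R / 2) powr (- \<alpha>) + (E * R / 2) powr (1 - \<alpha>) / (E / 2 * (\<alpha> - 1)))"
    unfolding eq
  proof (rule P.prob_UN_le)
    fix M
    have "(\<Sum>z<M. P.prob (B z \<union> B' z)) \<le> (\<Sum>z<M. 2 * (E * R / 2 + E / 2 * real z) powr (- \<alpha>))"
    proof (rule sum_mono)
      fix z
      show "P.prob (B z \<union> B' z) \<le> 2 * (E * R / 2 + E / 2 * real z) powr (- \<alpha>)"
        using measure_Un_le[OF ev(1)[of z] ev(2)[of z]] pr[of z] by simp
    qed
    also have "\<dots> \<le> 2 * ((E * R / 2) powr (- \<alpha>) + (E * R / 2) powr (1 - \<alpha>) / (E / 2 * (\<alpha> - 1)))"
      unfolding sum_distrib_left[symmetric] using E R \<alpha> by (intro mult_left_mono sum_powr_affine_le) auto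
    finally show "(\<Sum>z<M. P.prob (B z \<union> B' z)) \<le> 2 * ((E * R / 2) powr (- \<alpha>) + (E * R / 2) powr (1 - \<alpha>) / (E / 2 * (\<alpha> - 1)))" .
  qed (use ev in auto)
qed

text \<open>Markov's inequality. A failed coin is independent of the two values, so each term has
  mean at most \<open>1 - p k\<close> times twice the Pareto mean.\<close>

lemma bad_sum_prob:
  assumes K: "0 < K"
  shows "bad_sum N K \<in> P.events" "P.prob (bad_sum N K) \<le> eta p (N - 1) * (2 * \<alpha> / (\<alpha> - 1)) / K"
proof -
  define g where "g k v = (if v (Inr k) = 1 then 0 else \<bar>v (Inl (int k)) - v (Inl (- int k))\<bar>)" for k :: nat and v :: "int + nat \<Rightarrow> real"
  have [measurable]: "1 \<le> k \<Longrightarrow> g k \<in> borel_measurable P" for k unfolding g_def[abs_def] by measurable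
  define G where "G v = (\<Sum>k\<in>{1..<N}. g k v)" for v
  have Gm [measurable]: "G \<in> borel_measurable P" unfolding G_def[abs_def] by (intro borel_measurable_sum) auto
  have eq: "bad_sum N K = {v\<in>space P. K < G v}" by (simp add: bad_sum_def G_def g_def)
  show "bad_sum N K \<in> P.events" unfolding eq by measurable
  have m0: "0 \<le> \<alpha> / (\<alpha> - 1)" using \<alpha> by simp
  have cond: "(\<integral>\<^sup>+v. ennreal (of_bool (v (Inr k) \<noteq> 1) * \<bar>v (Inl z)\<bar>) \<partial>P) \<le> ennreal ((1 - p k) * (\<alpha> / (\<alpha> - 1)))" if k: "1 \<le> k" for k z
  proof -
    have "(\<integral>\<^sup>+v. ennreal (of_bool (v (Inr k) \<noteq> 1) * \<bar>v (Inl z)\<bar>) \<partial>P) = (\<integral>\<^sup>+u. \<integral>\<^sup>+v. ennreal (of_bool (v (Inr k) \<noteq> 1) * \<bar>u\<bar>) \<partial>P \<partial>\<mu> (Inl z))"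
      using k by (subst resample(1)[of "Inl z"]) auto
    also have "\<dots> = (\<integral>\<^sup>+u. ennreal \<bar>u\<bar> * ennreal (1 - p k) \<partial>\<mu> (Inl z))"
    proof (rule nn_integral_cong)
      fix u
      have "(\<integral>\<^sup>+v. ennreal (of_bool (v (Inr k) \<noteq> 1) * \<bar>u\<bar>) \<partial>P) = (\<integral>\<^sup>+v. ennreal \<bar>u\<bar> * indicator {v\<in>space P. v (Inr k) \<in> - {1}} v \<partial>P)"
        by (intro nn_integral_cong) (auto simp: indicator_def)
      also have "\<dots> = ennreal \<bar>u\<bar> * emeasure P {v\<in>space P. v (Inr k) \<in> - {1}}"
        using k by (intro nn_integral_cmult_indicator) measurable
      also have "emeasure P {v\<in>space P. v (Inr k) \<in> - {1}} = ennreal (1 - p k)"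
        unfolding P.emeasure_eq_measure using k by (subst prob_coord) (auto simp: prob_coin_fail)
      finally show "(\<integral>\<^sup>+v. ennreal (of_bool (v (Inr k) \<noteq> 1) * \<bar>u\<bar>) \<partial>P) = ennreal \<bar>u\<bar> * ennreal (1 - p k)" .
    qed
    also have "\<dots> = (\<integral>\<^sup>+u. ennreal \<bar>u\<bar> \<partial>\<mu> (Inl z)) * ennreal (1 - p k)" by (rule nn_integral_multc) measurable
    also have "(\<integral>\<^sup>+u. ennreal \<bar>u\<bar> \<partial>\<mu> (Inl z)) = (\<integral>\<^sup>+u. ennreal u \<partial>\<mu> (Inl z))"
      using AE_pareto[of z] by (intro nn_integral_cong_AE) (auto elim!: eventually_mono)
    also have "\<dots> = ennreal (\<alpha> / (\<alpha> - 1))"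
      using pareto_mean[of z] AE_pareto[of z] by (subst nn_integral_eq_integral) (auto elim!: eventually_mono)
    finally show ?thesis using m0 p_range[of k] by (simp add: ennreal_mult[symmetric] mult.commute)
  qed
  have gi: "(\<integral>\<^sup>+v. ennreal (g k v) \<partial>P) \<le> ennreal ((1 - p k) * (2 * \<alpha> / (\<alpha> - 1)))" if k: "1 \<le> k" for k
  proof -
    have "(\<integral>\<^sup>+v. ennreal (g k v) \<partial>P) \<le> (\<integral>\<^sup>+v. ennreal (of_bool (v (Inr k) \<noteq> 1) * \<bar>v (Inl (int k))\<bar>) + ennreal (of_bool (v (Inr k) \<noteq> 1) * \<bar>v (Inl (- int k))\<bar>) \<partial>P)"
      by (intro nn_integral_mono) (auto simp: g_def ennreal_plus[symmetric] simp del: ennreal_plus intro!: ennreal_leI)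
    also have "\<dots> = (\<integral>\<^sup>+v. ennreal (of_bool (v (Inr k) \<noteq> 1) * \<bar>v (Inl (int k))\<bar>) \<partial>P) + (\<integral>\<^sup>+v. ennreal (of_bool (v (Inr k) \<noteq> 1) * \<bar>v (Inl (- int k))\<bar>) \<partial>P)"
      using k by (intro nn_integral_add) measurable
    also have "\<dots> \<le> ennreal ((1 - p k) * (\<alpha> / (\<alpha> - 1))) + ennreal ((1 - p k) * (\<alpha> / (\<alpha> - 1)))"
      by (intro add_mono cond k)
    also have "\<dots> = ennreal ((1 - p k) * (2 * \<alpha> / (\<alpha> - 1)))"
    proof -
      have "0 \<le> (1 - p k) * (\<alpha> / (\<alpha> - 1))" using p_range[of k] by (intro mult_nonneg_nonneg m0) simp
      moreover have "(1 - p k) * (2 * \<alpha> / (\<alpha> - 1)) = (1 - p k) * (\<alpha> / (\<alpha> - 1)) + (1 - p k) * (\<alpha> / (\<alpha> - 1))" by simp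
      ultimately show ?thesis by (simp only: ennreal_plus)
    qed
    finally show ?thesis .
  qed
  have Gi: "(\<integral>\<^sup>+v. ennreal (G v) \<partial>P) \<le> ennreal (eta p (N - 1) * (2 * \<alpha> / (\<alpha> - 1)))"
  proof -
    have "(\<integral>\<^sup>+v. ennreal (G v) \<partial>P) = (\<Sum>k\<in>{1..<N}. \<integral>\<^sup>+v. ennreal (g k v) \<partial>P)"
      unfolding G_def by (subst sum_ennreal[symmetric], simp add: g_def, subst nn_integral_sum) auto
    also have "\<dots> \<le> (\<Sum>k\<in>{1..<N}. ennreal ((1 - p k) * (2 * \<alpha> / (\<alpha> - 1))))" by (intro sum_mono gi) auto
    also have "\<dots> = ennreal (\<Sum>k\<in>{1..<N}. (1 - p k) * (2 * \<alpha> / (\<alpha> - 1)))"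
      using p_range \<alpha> by (intro sum_ennreal) auto
    also have "(\<Sum>k\<in>{1..<N}. (1 - p k) * (2 * \<alpha> / (\<alpha> - 1))) = eta p (N - 1) * (2 * \<alpha> / (\<alpha> - 1))"
      unfolding eta_def sum_distrib_right by (intro sum.cong) auto
    finally show ?thesis .
  qed
  have e0: "0 \<le> eta p (N - 1) * (2 * \<alpha> / (\<alpha> - 1))" using p_range \<alpha> by (intro mult_nonneg_nonneg) (auto simp: eta_def intro!: sum_nonneg)
  have "ennreal K * emeasure P (bad_sum N K) = (\<integral>\<^sup>+v. ennreal K * indicator (bad_sum N K) v \<partial>P)"
    using \<open>bad_sum N K \<in> P.events\<close> by (rule nn_integral_cmult_indicator[symmetric])
  also have "\<dots> \<le> (\<integral>\<^sup>+v. ennreal (G v) \<partial>P)"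
    by (intro nn_integral_mono) (auto simp: eq indicator_def intro!: ennreal_leI)
  finally have "ennreal (K * P.prob (bad_sum N K)) \<le> ennreal (eta p (N - 1) * (2 * \<alpha> / (\<alpha> - 1)))"
    using Gi K by (simp add: P.emeasure_eq_measure ennreal_mult)
  then have "P.prob (bad_sum N K) * K \<le> eta p (N - 1) * (2 * \<alpha> / (\<alpha> - 1))"
    unfolding mult.commute[of _ K] using e0 by (simp add: ennreal_le_iff)
  then show "P.prob (bad_sum N K) \<le> eta p (N - 1) * (2 * \<alpha> / (\<alpha> - 1)) / K" unfolding pos_le_divide_eq[OF K] .
qed

end

section \<open>Regular environments from good coordinates\<close>

definition potv :: "(int + nat \<Rightarrow> real) \<Rightarrow> int \<Rightarrow> real" where
  "potv v z = (if 0 \<le> z then v (Inl z) else if v (Inr (nat (- z))) = 1 then v (Inl (- z)) else v (Inl z))"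

context pareto_env begin

definition bad_env :: "real \<Rightarrow> nat \<Rightarrow> nat \<Rightarrow> real \<Rightarrow> real \<Rightarrow> real \<Rightarrow> real \<Rightarrow> (int + nat \<Rightarrow> real) set" where
  "bad_env t N d L E R K = bad_coin N d \<union> bad_rival t L \<union> bad_far E R \<union> bad_sum N K"

text \<open>Every site other than the peak is in one of two classes: at the origin or a successful
  coin its value is bounded by \<open>rival\<close>, at a failed coin by the absence of
  \<open>bad_rival\<close>. The height at \<open>N\<close> is overwritten, so its compatibility with
  the growth bound is a separate hypothesis on \<open>x\<close>.\<close>

lemma regular_potv:
  assumes v: "v \<in> space P" "\<And>z. 1 < v (Inl z)" "v \<notin> bad_env t N d (t * x - N * ln x - D) E R K"
    and rival: "\<And>z. z \<noteq> N \<Longrightarrow> z = 0 \<or> v (Inr z) = 1 \<Longrightarrow> v (Inl (int z)) \<notin> exceed t (t * x - N * ln x - D) z"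
    and x: "1 \<le> x" "x \<le> E * max (real N) R" and N: "d < N"
  shows "regular_env t x N d D E R K (potv (v(Inl (int N) := x)))"
proof -
  define \<xi> where "\<xi> = potv (v(Inl (int N) := x))"
  note bad = v(3)[unfolded bad_env_def Un_iff de_Morgan_disj]
  have coin: "v (Inr n) = 1" if "N - d \<le> n" "n \<le> N + d" for n
    using bad v(1) that N by (auto simp: bad_coin_def)
  have cN: "v (Inr N) = 1" by (rule coin) auto
  have pos: "\<xi> (int n) = (if n = N then x else v (Inl (int n)))" for n by (auto simp: \<xi>_def potv_def)
  have neg: "\<xi> (- int n) = (if v (Inr n) = 1 then \<xi> (int n) else v (Inl (- int n)))" if "1 \<le> n" for n
    using that by (auto simp: \<xi>_def potv_def)
  have dup: "\<xi> (int n) = \<xi> (- int n)" if "v (Inr n) = 1" for n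
    using neg[of n] that by (cases n) auto
  have far: "v (Inl z) \<le> E * max \<bar>real_of_int z\<bar> R" for z
    using bad v(1) by (auto simp: bad_far_def not_less)
  have caseI: "Q z" if "\<And>n. Q (int n)" "\<And>n. 1 \<le> n \<Longrightarrow> Q (- int n)" for Q and z :: int
    using that(1)[of "nat z"] that(2)[of "nat (- z)"] by (cases "0 \<le> z") auto
  have L: "t * u - n * ln u \<le> t * x - N * ln x - D" if "u \<notin> exceed t (t * x - N * ln x - D) n" for u and n :: nat
    using that by (simp add: exceed_def not_less)
  have riv: "v (Inl (int n)) \<notin> exceed t (t * x - N * ln x - D) n \<and> v (Inl (- int n)) \<notin> exceed t (t * x - N * ln x - D) n"
    if "1 \<le> n" "v (Inr n) \<noteq> 1" for n
    using bad v(1) that unfolding bad_rival_def by blast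
  have gp: "t * \<xi> (int n) - n * ln (\<xi> (int n)) \<le> t * x - N * ln x - D" if "n \<noteq> N" for n
  proof (cases "n = 0 \<or> v (Inr n) = 1")
    case True
    then show ?thesis using L[OF rival[OF that True]] that by (simp add: pos)
  next
    case False
    then show ?thesis using that L[of "v (Inl (int n))" n] riv[of n] by (auto simp: pos Suc_le_eq)
  qed
  have gn: "t * \<xi> (- int n) - n * ln (\<xi> (- int n)) \<le> t * x - N * ln x - D" if "n \<noteq> N" "1 \<le> n" for n
  proof (cases "v (Inr n) = 1")
    case True
    then show ?thesis using gp[OF that(1)] dup by simp
  next
    case False
    then show ?thesis using that L[of "v (Inl (- int n))" n] riv[of n] by (auto simp: neg)
  qed
  have gap: "\<forall>z. \<bar>z\<bar> \<noteq> int N \<longrightarrow> t * \<xi> z - \<bar>z\<bar> * ln (\<xi> z) \<le> t * x - N * ln x - D"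
  proof
    fix z
    show "\<bar>z\<bar> \<noteq> int N \<longrightarrow> t * \<xi> z - \<bar>z\<bar> * ln (\<xi> z) \<le> t * x - N * ln x - D"
      by (rule caseI) (use gp gn in auto)
  qed
  have fp: "\<xi> (int n) \<le> E * max (real n) R" "1 \<le> \<xi> (int n)" for n
    using far[of "int n"] x v(2)[of "int n"] by (auto simp: pos)
  have fn: "\<xi> (- int n) \<le> E * max (real n) R" "1 \<le> \<xi> (- int n)" if "1 \<le> n" for n
    using far[of "- int n"] fp[of n] v(2)[of "- int n"] that by (auto simp: neg)
  have all: "\<forall>z. \<xi> z \<le> E * max \<bar>z\<bar> R" "\<forall>z. 1 \<le> \<xi> z"
  proof -
    show "\<forall>z. \<xi> z \<le> E * max \<bar>z\<bar> R"
    proof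
      fix z show "\<xi> z \<le> E * max \<bar>z\<bar> R" by (rule caseI) (use fp fn in auto)
    qed
    show "\<forall>z. 1 \<le> \<xi> z"
    proof
      fix z show "1 \<le> \<xi> z" by (rule caseI) (use fp fn in auto)
    qed
  qed
  have win: "\<xi> (int N - j) = \<xi> (- (int N - j)) \<and> \<xi> (int N + j) = \<xi> (- (int N + j))" if "1 \<le> j" "j \<le> int d" for j
  proof -
    have "int N - j = int (N - nat j)" "int N + j = int (N + nat j)" using that N by auto
    moreover have "v (Inr (N - nat j)) = 1" "v (Inr (N + nat j)) = 1" using that N by (auto intro!: coin)
    ultimately show ?thesis using dup[of "N - nat j"] dup[of "N + nat j"] by metis
  qed
  have "(\<Sum>k<N. \<bar>\<xi> (int k) - \<xi> (- int k)\<bar>) = (\<Sum>k\<in>{1..<N}. \<bar>\<xi> (int k) - \<xi> (- int k)\<bar>)"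
  proof (rule sum.mono_neutral_right)
    show "\<forall>i\<in>{..<N} - {1..<N}. \<bar>\<xi> (int i) - \<xi> (- int i)\<bar> = 0"
    proof
      fix i assume "i \<in> {..<N} - {1..<N}"
      then have "i = 0" by auto
      then show "\<bar>\<xi> (int i) - \<xi> (- int i)\<bar> = 0" by simp
    qed
  qed auto
  also have "\<dots> = (\<Sum>k\<in>{1..<N}. if v (Inr k) = 1 then 0 else \<bar>v (Inl (int k)) - v (Inl (- int k))\<bar>)"
    by (intro sum.cong) (auto simp: neg pos)
  also have "\<dots> \<le> K" using bad v(1) by (simp add: bad_sum_def not_less)
  finally have "(\<Sum>k<N. \<bar>\<xi> (int k) - \<xi> (- int k)\<bar>) \<le> K" .
  moreover have "\<xi> (int N) = x" "\<xi> (- int N) = x" using dup[OF cN] pos[of N] by simp_all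
  moreover have "\<forall>j. 1 \<le> j \<longrightarrow> j \<le> int d \<longrightarrow> \<xi> (int N - j) = \<xi> (- (int N - j)) \<and> \<xi> (int N + j) = \<xi> (- (int N + j))"
    by (intro allI impI win)
  ultimately show ?thesis
    unfolding regular_env_def \<xi>_def[symmetric] using all gap unfolding of_int_abs by (intro conjI)
qed

text \<open>Values below the peak are at most \<open>x * (1 - \<kappa>)\<close>, so the truncation
  in \<open>log_gap\<close> is inactive; the term at the origin cancels.\<close>

lemma mirror_sum_potv:
  fixes x \<kappa> :: real and N :: nat
  defines "\<xi> \<equiv> \<lambda>v. potv (v(Inl (int N) := x))"
  assumes x: "0 < x" "0 < \<kappa>" and le: "\<And>z. \<bar>z\<bar> < int N \<Longrightarrow> \<xi> v z \<le> x * (1 - \<kappa>)"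
  shows "(\<Sum>k<N. ln (x - \<xi> v (- int k)) - ln (x - \<xi> v (int k))) = mirror_sum \<kappa> x N v"
proof -
  have lg: "ln (x - u) = ln x - log_gap \<kappa> (u / x)" if "u \<le> x * (1 - \<kappa>)" for u
  proof -
    have 1: "u / x \<le> 1 - \<kappa>" using that x by (simp add: pos_divide_le_eq mult.commute)
    have "x - u = x * (1 - u / x)" using x by (simp add: right_diff_distrib)
    moreover have "0 < 1 - u / x" using 1 x by linarith
    ultimately have "ln (x - u) = ln x + ln (1 - u / x)" using ln_mult_pos[OF x(1), of "1 - u / x"] by (simp only:)
    then show ?thesis using 1 by (simp add: log_gap_def min_def)
  qed
  have "(\<Sum>k<N. ln (x - \<xi> v (- int k)) - ln (x - \<xi> v (int k))) = (\<Sum>k\<in>{1..<N}. ln (x - \<xi> v (- int k)) - ln (x - \<xi> v (int k)))"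
  proof (rule sum.mono_neutral_right)
    show "\<forall>k\<in>{..<N} - {1..<N}. ln (x - \<xi> v (- int k)) - ln (x - \<xi> v (int k)) = 0"
    proof
      fix k assume "k \<in> {..<N} - {1..<N}"
      then have "k = 0" by auto
      then show "ln (x - \<xi> v (- int k)) - ln (x - \<xi> v (int k)) = 0" by simp
    qed
  qed auto
  also have "\<dots> = mirror_sum \<kappa> x N v"
    unfolding mirror_sum_def
  proof (rule sum.cong)
    fix k assume k: "k \<in> {1..<N}"
    have "ln (x - \<xi> v (- int k)) - ln (x - \<xi> v (int k)) = log_gap \<kappa> (\<xi> v (int k) / x) - log_gap \<kappa> (\<xi> v (- int k) / x)"
      using k le by (subst (1 2) lg) auto
    also have "\<dots> = mirror_gap \<kappa> x k v" using k by (auto simp: mirror_gap_def \<xi>_def potv_def)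
    finally show "ln (x - \<xi> v (- int k)) - ln (x - \<xi> v (int k)) = mirror_gap \<kappa> x k v" .
  qed simp
  finally show ?thesis .
qed

section \<open>The bad events become negligible\<close>

lemma site_le: "0 \<le> u \<Longrightarrow> real (nat \<lfloor>u\<rfloor>) \<le> u" by linarith

lemma bad_coin_lim:
  assumes s: "0 < s"
  shows "((\<lambda>t. P.prob (bad_coin (peak_site \<alpha> s t) d)) \<longlongrightarrow> 0) at_top"
proof (rule tendsto_sandwich[where f="\<lambda>_. 0"])
  define N where "N t = peak_site \<alpha> s t" for t
  have Nt: "filterlim (\<lambda>t. N t - d) at_top at_top" "filterlim (\<lambda>t. N t - 0) at_top at_top"
    unfolding N_def by (intro site_at_top scale_at_top \<alpha> s)+
  have "((\<lambda>t. \<Sum>j\<in>{..2 * d}. 1 - p (N t - d + j)) \<longlongrightarrow> (\<Sum>j\<in>{..2 * d}. 1 - 1)) at_top"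
  proof (intro tendsto_sum tendsto_diff tendsto_const)
    fix j
    have "filterlim (\<lambda>t. N t - d + j) at_top at_top"
      by (rule filterlim_at_top_mono[OF Nt(1)]) auto
    from filterlim_compose[OF p_lim this] show "((\<lambda>t. p (N t - d + j)) \<longlongrightarrow> 1) at_top" .
  qed
  then show "((\<lambda>t. \<Sum>j\<in>{..2 * d}. 1 - p (N t - d + j)) \<longlongrightarrow> 0) at_top" by simp
  have "eventually (\<lambda>t. Suc d \<le> N t) at_top" using Nt(2) unfolding filterlim_at_top by simp
  then show "eventually (\<lambda>t. P.prob (bad_coin (peak_site \<alpha> s t) d) \<le> (\<Sum>j\<in>{..2 * d}. 1 - p (N t - d + j))) at_top"
    by eventually_elim (unfold N_def, rule bad_coin_prob, simp)
qed auto

text \<open>The limit \<open>h\<close> of the tail total is finite, so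
  \<open>e = \<epsilon> / (4 * (h + 1))\<close> leaves at most half of \<open>\<epsilon>\<close> for
  the far sites, where \<open>q \<le> e\<close>. The sites below the cutoff \<open>m\<close> are
  fixed in number, while the level tends to infinity.\<close>

lemma bad_rival_lim:
  fixes s y \<delta> :: real
  assumes s: "0 < s" and y: "0 < y" "s / (\<alpha> - 1) < y - \<delta>"
  defines "L \<equiv> \<lambda>t. t * (scale_a \<alpha> t * y) - real (peak_site \<alpha> s t) * ln (scale_a \<alpha> t * y) - \<delta> * scale_a \<alpha> t * t"
  shows "eventually (\<lambda>t. 1 < level \<alpha> s y (y - \<delta>) t \<and> t * level \<alpha> s y (y - \<delta>) t \<le> L t) at_top"
    "((\<lambda>t. P.prob (bad_rival t (L t))) \<longlongrightarrow> 0) at_top"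
proof -
  define Y where "Y = level \<alpha> s y (y - \<delta>)"
  define h where "h = (y - \<delta> - s / (\<alpha> - 1)) powr (1 - \<alpha>)"
  note lv = level_lim[OF \<alpha> s y, folded Y_def h_def]
  have h: "0 \<le> h" by (simp add: h_def)
  have Y1: "eventually (\<lambda>t. 1 < Y t) at_top" using lv(2) unfolding filterlim_at_top_dense by simp
  have "filterlim (\<lambda>t. scale_a \<alpha> t * y) at_top at_top"
    by (rule filterlim_at_top_mult_tendsto_pos[OF tendsto_const y(1) scale_at_top(1)[OF \<alpha>]])
  then have x1: "eventually (\<lambda>t. 1 < scale_a \<alpha> t * y) at_top" unfolding filterlim_at_top_dense by simp
  have YL: "eventually (\<lambda>t. t * Y t \<le> L t) at_top"
    using x1 eventually_gt_at_top[of 1]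
  proof eventually_elim
    case (elim t)
    have "0 \<le> scale_r \<alpha> t * s" using scale_r_eq_powr(3)[OF \<alpha> elim(2)] s by simp
    then have "real (peak_site \<alpha> s t) * ln (scale_a \<alpha> t * y) \<le> scale_r \<alpha> t * s * ln (scale_a \<alpha> t * y)"
      using elim by (intro mult_right_mono site_le) auto
    moreover have "t * Y t = t * (scale_a \<alpha> t * y) - scale_r \<alpha> t * s * ln (scale_a \<alpha> t * y) - \<delta> * scale_a \<alpha> t * t"
      unfolding Y_def level_def using elim by (simp add: right_diff_distrib)
    ultimately show ?case by (simp add: L_def)
  qed
  show ev: "eventually (\<lambda>t. 1 < level \<alpha> s y (y - \<delta>) t \<and> t * level \<alpha> s y (y - \<delta>) t \<le> L t) at_top"
    using Y1 YL unfolding Y_def by eventually_elim simp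
  show "((\<lambda>t. P.prob (bad_rival t (L t))) \<longlongrightarrow> 0) at_top"
  proof (rule order_tendstoI)
    fix \<epsilon> :: real assume \<epsilon>: "0 < \<epsilon>"
    define e where "e = \<epsilon> / (4 * (h + 1))"
    have e: "0 < e" using \<epsilon> h by (simp add: e_def)
    have "(\<lambda>n. 1 - p n) \<longlonglongrightarrow> 1 - 1" by (intro tendsto_intros p_lim)
    then have "eventually (\<lambda>n. 1 - p n < e) sequentially" using e by (intro order_tendstoD(2)) auto
    then obtain m where m: "\<And>n. m \<le> n \<Longrightarrow> 1 - p n \<le> e" unfolding eventually_sequentially using less_imp_le by blast
    have Yi: "((\<lambda>t. Y t powr (- \<alpha>)) \<longlongrightarrow> 0) at_top"
    proof -
      have "((\<lambda>u::real. u powr (- \<alpha>)) \<longlongrightarrow> 0) at_top" using \<alpha> by real_asymp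
      from filterlim_compose[OF this lv(2)] show ?thesis .
    qed
    have "((\<lambda>t. 2 * (real m * Y t powr (- \<alpha>) + e * tail_total \<alpha> t (Y t))) \<longlongrightarrow> 2 * (real m * 0 + e * h)) at_top"
      by (intro tendsto_intros Yi lv(3))
    moreover have "2 * (real m * 0 + e * h) < \<epsilon>"
    proof -
      have "2 * (e * h) \<le> 2 * (e * (h + 1))" using e by (intro mult_left_mono) auto
      also have "\<dots> = \<epsilon> / 2"
      proof -
        have "2 * (\<epsilon> / (4 * H) * H) = \<epsilon> / 2" if "0 < H" for H using that by simp
        from this[of "h + 1"] show ?thesis unfolding e_def using h by linarith
      qed
      finally show ?thesis using \<epsilon> by simp
    qed
    ultimately have "eventually (\<lambda>t. 2 * (real m * Y t powr (- \<alpha>) + e * tail_total \<alpha> t (Y t)) < \<epsilon>) at_top"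
      by (rule order_tendstoD(2))
    then show "eventually (\<lambda>t. P.prob (bad_rival t (L t)) < \<epsilon>) at_top"
      using Y1 YL eventually_gt_at_top[of 0]
    proof eventually_elim
      case (elim t)
      have "P.prob (bad_rival t (L t)) \<le> 2 * (real m * Y t powr (- \<alpha>) + e * tail_total \<alpha> t (Y t))"
        by (rule bad_rival_prob(2)[OF elim(4,2,3)]) (use m e in auto)
      then show ?case using elim(1) by simp
    qed
  next
    fix u :: real assume "u < 0"
    then have "u < P.prob (bad_rival t (L t))" for t by (rule less_le_trans) simp
    then show "eventually (\<lambda>t. u < P.prob (bad_rival t (L t))) at_top" by simp
  qed
qed

text \<open>\<open>W\<close>, half the threshold within \<open>R\<close>, is of order
  \<open>sqrt (ln t) * scale_a \<alpha> t\<close>. The mean number of offending sites is then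
  dominated by a multiple of \<open>ln t powr ((1 - \<alpha>) / 2)\<close>: the factor
  \<open>sqrt (ln t)\<close> in \<open>R\<close> makes it vanish.\<close>

lemma bad_far_lim:
  "((\<lambda>t. P.prob (bad_far (1 / (\<alpha> - 1) / 4 * ln t / t) (sqrt (ln t) * scale_r \<alpha> t))) \<longlongrightarrow> 0) at_top"
proof (rule tendsto_sandwich[where f="\<lambda>_. 0"])
  define \<gamma> where "\<gamma> = 1 / (\<alpha> - 1)"
  have \<gamma>: "0 < \<gamma>" "\<gamma> * (\<alpha> - 1) = 1" using \<alpha> by (simp_all add: \<gamma>_def)
  define W where "W t = \<gamma> / 8 * sqrt (ln t) * scale_a \<alpha> t" for t
  define B where "B t = 2 * (W t powr (- \<alpha>) + 8 * (\<gamma> / 8) powr (1 - \<alpha>) * ln t powr ((1 - \<alpha>) / 2))" for t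
  have Wt: "filterlim W at_top at_top" unfolding W_def scale_a_def \<gamma>_def[symmetric] using \<gamma>(1) by real_asymp
  have "((\<lambda>u::real. u powr (- \<alpha>)) \<longlongrightarrow> 0) at_top" using \<alpha> by real_asymp
  from filterlim_compose[OF this Wt] have W0: "((\<lambda>t. W t powr (- \<alpha>)) \<longlongrightarrow> 0) at_top" .
  have l0: "((\<lambda>t. ln t powr ((1 - \<alpha>) / 2)) \<longlongrightarrow> 0) at_top" using \<alpha> by real_asymp
  have "(B \<longlongrightarrow> 2 * (0 + 8 * (\<gamma> / 8) powr (1 - \<alpha>) * 0)) at_top" unfolding B_def by (intro tendsto_intros W0 l0)
  then show "(B \<longlongrightarrow> 0) at_top" by simp
  have "eventually (\<lambda>t. 1 < W t) at_top" using Wt unfolding filterlim_at_top_dense by simp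
  then show "eventually (\<lambda>t. P.prob (bad_far (1 / (\<alpha> - 1) / 4 * ln t / t) (sqrt (ln t) * scale_r \<alpha> t)) \<le> B t) at_top"
    using eventually_gt_at_top[of 3]
  proof eventually_elim
    case (elim t)
    define E where "E = \<gamma> / 4 * ln t / t"
    define R where "R = sqrt (ln t) * scale_r \<alpha> t"
    have t: "0 < ln t" "1 < t" "0 < t" using elim by auto
    have E: "0 < E" using t \<gamma> by (simp add: E_def)
    have R: "0 < R" using scale_r_eq_powr(3)[OF \<alpha> t(2)] t by (simp add: R_def)
    have ER: "E * R / 2 = W t" using t by (simp add: E_def R_def W_def scale_r_def)
    have a1: "scale_a \<alpha> t powr (1 - \<alpha>) = ln t / t"
    proof -
      have "scale_a \<alpha> t powr (1 - \<alpha>) = (t / ln t) powr (- (\<gamma> * (\<alpha> - 1)))"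
        unfolding scale_a_def \<gamma>_def[symmetric] powr_powr by (simp add: algebra_simps)
      also have "\<dots> = ln t / t" using t by (simp add: \<gamma>(2) powr_minus)
      finally show ?thesis .
    qed
    have "W t powr (1 - \<alpha>) = (\<gamma> / 8) powr (1 - \<alpha>) * ln t powr ((1 - \<alpha>) / 2) * (ln t / t)"
    proof -
      have "W t powr (1 - \<alpha>) = (\<gamma> / 8) powr (1 - \<alpha>) * sqrt (ln t) powr (1 - \<alpha>) * scale_a \<alpha> t powr (1 - \<alpha>)"
        unfolding W_def using \<gamma> t scale_r_eq_powr(2)[OF \<alpha> t(2)] by (simp only: powr_mult)
      also have "sqrt (ln t) powr (1 - \<alpha>) = ln t powr ((1 - \<alpha>) / 2)"
        using t by (simp add: powr_half_sqrt[symmetric] powr_powr)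
      finally show ?thesis by (simp add: a1)
    qed
    moreover have "E / 2 * (\<alpha> - 1) = ln t / t / 8"
    proof -
      have "E / 2 * (\<alpha> - 1) = \<gamma> * (\<alpha> - 1) * (ln t / t / 8)" by (simp add: E_def mult.commute mult.left_commute)
      then show ?thesis unfolding \<gamma>(2) by simp
    qed
    moreover have "c * l / (l / 8) = 8 * c" if "l \<noteq> 0" for c l :: real using that by simp
    ultimately have "W t powr (1 - \<alpha>) / (E / 2 * (\<alpha> - 1)) = 8 * ((\<gamma> / 8) powr (1 - \<alpha>) * ln t powr ((1 - \<alpha>) / 2))" using t by simp
    then have "2 * ((E * R / 2) powr (- \<alpha>) + (E * R / 2) powr (1 - \<alpha>) / (E / 2 * (\<alpha> - 1))) = B t" by (simp add: B_def ER)
    moreover have "2 \<le> E * R" using ER elim by simp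
    ultimately show ?case using bad_far_prob(2)[OF E R] by (simp add: E_def R_def \<gamma>_def)
  qed
qed auto

text \<open>\<open>eta p (N - 1)\<close> is at most of order a^2 with
  \<open>a = scale_a \<alpha> t\<close>, also for \<alpha> = 2, so Markov's bound is of order
  \<open>1 / sqrt a\<close>.\<close>

lemma bad_sum_lim:
  assumes s: "0 < s"
  shows "((\<lambda>t. P.prob (bad_sum (peak_site \<alpha> s t) ((scale_a \<alpha> t)\<^sup>2 * sqrt (scale_a \<alpha> t)))) \<longlongrightarrow> 0) at_top"
proof (rule tendsto_sandwich[where f="\<lambda>_. 0"])
  define N where "N t = peak_site \<alpha> s t" for t
  define c where "c = 2 * \<beta> * s powr (2 / \<alpha>) * (2 * \<alpha> / (\<alpha> - 1))"
  have at: "filterlim (scale_a \<alpha>) at_top at_top" by (rule scale_at_top[OF \<alpha>])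
  have "((\<lambda>a::real. c / sqrt a) \<longlongrightarrow> 0) at_top" by real_asymp
  from filterlim_compose[OF this at] show "((\<lambda>t. c / sqrt (scale_a \<alpha> t)) \<longlongrightarrow> 0) at_top" .
  have Nt: "filterlim (\<lambda>t. N t - 1) at_top at_top" unfolding N_def by (intro site_at_top scale_at_top \<alpha> s)
  have kpos: "eventually (\<lambda>n. 0 < kappa \<alpha> n) at_top"
    using eventually_gt_at_top[of 1] by eventually_elim (auto simp: kappa_def)
  have "eventually (\<lambda>n. eta p n \<noteq> 0 \<or> \<beta> * kappa \<alpha> n \<noteq> 0) at_top" using kpos by eventually_elim (use \<beta> in auto)
  from asymp_equivD_strong[OF eta_asymp this] have "((\<lambda>n. eta p n / (\<beta> * kappa \<alpha> n)) \<longlongrightarrow> 1) at_top" .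
  then have "eventually (\<lambda>n. eta p n / (\<beta> * kappa \<alpha> n) < 2) at_top" by (rule order_tendstoD) simp
  then have "eventually (\<lambda>n. eta p n \<le> 2 * \<beta> * real n powr (2 / \<alpha>)) at_top"
    using kpos eventually_ge_at_top[of 3]
  proof eventually_elim
    case (elim n)
    have "kappa \<alpha> n \<le> real n powr (2 / \<alpha>)"
    proof (cases "2 < \<alpha>")
      case False
      then have a2: "\<alpha> = 2" using \<alpha> by simp
      have "exp 1 \<le> (3::real)" by (rule exp_le)
      then have "1 \<le> ln (real n)" using elim by (simp add: ln_ge_iff)
      then have "real n / ln (real n) \<le> real n / 1" by (intro divide_left_mono) auto
      then show ?thesis using elim by (simp add: kappa_def a2)
    qed (simp add: kappa_def)
    moreover have "eta p n \<le> 2 * (\<beta> * kappa \<alpha> n)" using elim \<beta> by (simp add: pos_divide_less_eq)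
    ultimately show ?case using \<beta> by (auto intro: order_trans mult_left_mono)
  qed
  then have "eventually (\<lambda>t. eta p (N t - 1) \<le> 2 * \<beta> * real (N t - 1) powr (2 / \<alpha>)) at_top" using Nt by (rule eventually_compose_filterlim)
  moreover have "eventually (\<lambda>t. 1 < scale_a \<alpha> t) at_top" using at unfolding filterlim_at_top_dense by simp
  ultimately show "eventually (\<lambda>t. P.prob (bad_sum (peak_site \<alpha> s t) ((scale_a \<alpha> t)\<^sup>2 * sqrt (scale_a \<alpha> t))) \<le> c / sqrt (scale_a \<alpha> t)) at_top"
    using eventually_gt_at_top[of 1]
  proof eventually_elim
    case (elim t)
    define a where "a = scale_a \<alpha> t"
    note sc = scale_r_eq_powr[OF \<alpha> elim(3), folded a_def]
    have K: "0 < a\<^sup>2 * sqrt a" using sc by simp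
    have c0: "0 \<le> 2 * \<alpha> / (\<alpha> - 1)" using \<alpha> by simp
    have "real (N t - 1) powr (2 / \<alpha>) \<le> (scale_r \<alpha> t * s) powr (2 / \<alpha>)"
    proof (rule powr_mono2)
      have "0 \<le> scale_r \<alpha> t * s" using sc s by simp
      then show "real (N t - 1) \<le> scale_r \<alpha> t * s" using site_le[of "scale_r \<alpha> t * s"] of_nat_mono[OF diff_le_self[of "N t" 1], where 'a=real] unfolding N_def by linarith
    qed (use \<alpha> in auto)
    also have "\<dots> = s powr (2 / \<alpha>) * a\<^sup>2"
      using sc s \<alpha> by (simp add: powr_mult powr_powr powr_numeral)
    finally have "eta p (N t - 1) \<le> 2 * \<beta> * (s powr (2 / \<alpha>) * a\<^sup>2)" using elim(1) \<beta> by (auto intro: order_trans mult_left_mono)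
    then have "eta p (N t - 1) * (2 * \<alpha> / (\<alpha> - 1)) / (a\<^sup>2 * sqrt a) \<le> 2 * \<beta> * (s powr (2 / \<alpha>) * a\<^sup>2) * (2 * \<alpha> / (\<alpha> - 1)) / (a\<^sup>2 * sqrt a)"
      using K c0 by (intro divide_right_mono mult_right_mono) auto
    also have "\<dots> = c / sqrt a" using sc by (simp add: c_def)
    finally show ?case using bad_sum_prob(2)[OF K, of "N t"] by (simp add: N_def a_def)
  qed
qed auto

end

section \<open>Measurability of the solution in the environment\<close>

lemma pathw_Suc_nn_integral:
  assumes "0 \<le> t"
  shows "pathw UNIV c z (Suc k) t x = exp (c x * t) *
    enn2real (\<integral>\<^sup>+s. ennreal (exp (- c x * s) * (pathw UNIV c z k s (x + 1) + pathw UNIV c z k s (x - 1))) * indicator {0..t} s \<partial>lborel)"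
proof -
  let ?g = "\<lambda>s. exp (- c x * s) * (pathw UNIV c z k s (x + 1) + pathw UNIV c z k s (x - 1))"
  have "?g integrable_on {0..t}"
    by (intro integrable_continuous_interval continuous_intros continuous_on_subset[OF pathw_cont]) auto
  then have hi: "(?g has_integral integral {0..t} ?g) {0..t}" by (rule integrable_integral)
  have nn: "0 \<le> ?g s" if "s \<in> {0..t}" for s using that by simp
  have "(\<integral>\<^sup>+s. ennreal (?g s) * indicator {0..t} s \<partial>lborel) = ennreal (integral {0..t} ?g)"
    by (rule nn_integral_has_integral_lebesgue'[OF nn hi])
  moreover have "0 \<le> integral {0..t} ?g" by (rule has_integral_nonneg[OF hi nn])
  ultimately show ?thesis by simp
qed

text \<open>The recursion integrates over time, so measurability is proved jointly in environment
  and time; \<open>max 0\<close> extends the functions to all real times. As nonnegative Lebesgue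
  integrals, the parameter integrals are measurable.\<close>

lemma pathw_joint_measurable:
  assumes [measurable]: "\<And>y. (\<lambda>v. c v y) \<in> borel_measurable M"
  shows "(\<lambda>w. pathw UNIV (c (fst w)) z k (max 0 (snd w)) x) \<in> borel_measurable (M \<Otimes>\<^sub>M borel)"
proof (induction k arbitrary: x)
  case 0
  then show ?case by simp
next
  case (Suc k)
  define Q where "Q x w = pathw UNIV (c (fst w)) z k (max 0 (snd w)) x" for x and w :: "'a \<times> real"
  have [measurable]: "Q x \<in> borel_measurable (M \<Otimes>\<^sub>M borel)" for x
    unfolding Q_def[abs_def] by (rule Suc)
  have e: "pathw UNIV (c (fst w)) z (Suc k) (max 0 (snd w)) x = exp (c (fst w) x * max 0 (snd w)) *
      enn2real (\<integral>\<^sup>+s. ennreal (exp (- c (fst w) x * s) * (Q (x + 1) (fst w, s) + Q (x - 1) (fst w, s))) * indicator {r. 0 \<le> r \<and> r \<le> max 0 (snd w)} s \<partial>lborel)" for w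
  proof -
    have "(\<integral>\<^sup>+s. ennreal (exp (- c (fst w) x * s) * (pathw UNIV (c (fst w)) z k s (x + 1) + pathw UNIV (c (fst w)) z k s (x - 1))) * indicator {0..max 0 (snd w)} s \<partial>lborel)
      = (\<integral>\<^sup>+s. ennreal (exp (- c (fst w) x * s) * (Q (x + 1) (fst w, s) + Q (x - 1) (fst w, s))) * indicator {r. 0 \<le> r \<and> r \<le> max 0 (snd w)} s \<partial>lborel)"
    proof (rule nn_integral_cong)
      fix s
      show "ennreal (exp (- c (fst w) x * s) * (pathw UNIV (c (fst w)) z k s (x + 1) + pathw UNIV (c (fst w)) z k s (x - 1))) * indicator {0..max 0 (snd w)} s
        = ennreal (exp (- c (fst w) x * s) * (Q (x + 1) (fst w, s) + Q (x - 1) (fst w, s))) * indicator {r. 0 \<le> r \<and> r \<le> max 0 (snd w)} s"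
        by (cases "0 \<le> s") (simp_all add: Q_def max_absorb2 indicator_def)
    qed
    then show ?thesis by (subst pathw_Suc_nn_integral) simp_all
  qed
  show ?case unfolding e by measurable
qed

lemma pam_u_measurable:
  assumes "\<And>y. (\<lambda>v. \<xi> v y) \<in> borel_measurable M" "0 \<le> t"
  shows "(\<lambda>v. pam_u (\<xi> v) t z) \<in> borel_measurable M"
proof -
  have [measurable]: "(\<lambda>v. \<xi> v y) \<in> borel_measurable M" for y by (rule assms)
  have [measurable]: "(\<lambda>v. pathw UNIV (\<lambda>y. \<xi> v y - 2) z k t 0) \<in> borel_measurable M" for k
    using measurable_compose[OF measurable_Pair2'[of t borel M] pathw_joint_measurable[where c="\<lambda>v y. \<xi> v y - 2" and M=M and z=z and k=k and x=0]] assms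
    by (simp add: max_absorb2)
  show ?thesis unfolding pam_u_eq[OF assms(2)] by measurable
qed

text \<open>Strict maximality is required over all sites and not just over mirrored ones, so at most
  one site wins and the event involves no choice of a maximiser. Positivity of both solutions is
  included to give the logarithm of their ratio a meaning.\<close>

definition wins :: "(int \<Rightarrow> real) \<Rightarrow> real \<Rightarrow> nat \<Rightarrow> bool" where
  "wins \<xi> t n \<longleftrightarrow> \<xi> (int n) = \<xi> (- int n) \<and> (\<forall>m. m \<noteq> n \<longrightarrow> Psi \<xi> t m < Psi \<xi> t n) \<and>
     0 < pam_u \<xi> t (int n) \<and> 0 < pam_u \<xi> t (- int n)"

definition log_ratio :: "(int \<Rightarrow> real) \<Rightarrow> real \<Rightarrow> nat \<Rightarrow> real" where
  "log_ratio \<xi> t n = ln (pam_u \<xi> t (int n) / pam_u \<xi> t (- int n))"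

lemma wins_measurable:
  assumes "\<And>y. (\<lambda>v. \<xi> v y) \<in> borel_measurable M" "0 \<le> t"
  shows "Measurable.pred M (\<lambda>v. wins (\<xi> v) t n)"
proof -
  have [measurable]: "(\<lambda>v. \<xi> v y) \<in> borel_measurable M" "(\<lambda>v. pam_u (\<xi> v) t y) \<in> borel_measurable M" for y
    using assms by (auto intro: pam_u_measurable)
  show ?thesis unfolding wins_def Psi_def by measurable
qed

lemma log_ratio_measurable:
  assumes "\<And>y. (\<lambda>v. \<xi> v y) \<in> borel_measurable M" "0 \<le> t"
  shows "(\<lambda>v. log_ratio (\<xi> v) t n) \<in> borel_measurable M"
proof -
  have [measurable]: "(\<lambda>v. pam_u (\<xi> v) t y) \<in> borel_measurable M" for y
    using assms by (auto intro: pam_u_measurable)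
  show ?thesis unfolding log_ratio_def by measurable
qed

lemma regular_env_wins:
  assumes reg: "regular_env t x N d D E R K \<xi>" and t: "0 < t" "0 < D"
    and pos: "0 < pam_u \<xi> t (int N)" "0 < pam_u \<xi> t (- int N)"
  shows "wins \<xi> t N"
proof -
  have x: "\<xi> (int N) = x" "\<xi> (- int N) = x" and gap: "\<bar>z\<bar> \<noteq> int N \<Longrightarrow> t * \<xi> z - \<bar>z\<bar> * ln (\<xi> z) \<le> t * x - N * ln x - D" for z
    using reg by (auto simp: regular_env_def)
  have "Psi \<xi> t m < Psi \<xi> t N" if "m \<noteq> N" for m
  proof -
    have "t * \<xi> (int m) - m * ln (\<xi> (int m)) < t * x - N * ln x" using gap[of "int m"] that t by simp
    moreover have "Psi \<xi> t m = (t * \<xi> (int m) - m * ln (\<xi> (int m))) / t" "Psi \<xi> t N = (t * x - N * ln x) / t"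
      using t x by (simp_all add: Psi_def diff_divide_distrib)
    ultimately show ?thesis using t by (simp add: divide_strict_right_mono)
  qed
  then show ?thesis using x pos by (simp add: wins_def)
qed

section \<open>Lower bound for a peak at a fixed scaled site and height\<close>

context pareto_env begin

lemma potv_measurable [measurable]: "(\<lambda>v. potv v z) \<in> borel_measurable P"
proof (cases "0 \<le> z")
  case False
  then have "Inr (nat (- z)) \<in> I" by (intro I_mem(2)) simp
  then have [measurable]: "(\<lambda>v. v (Inr (nat (- z)))) \<in> borel_measurable P" by measurable
  show ?thesis unfolding potv_def using False by simp
qed (simp add: potv_def)


text \<open>Values at the origin or at successful coins do not enter the asymmetry; this is the
  invariance that \<open>site_events_lower_bound\<close> demands of its integrand.\<close>

lemma mirror_sum_update:
  assumes "z = 0 \<or> v (Inr z) = 1"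
  shows "mirror_sum \<kappa> x N (v(Inl (int z) := u)) = mirror_sum \<kappa> x N v"
  unfolding mirror_sum_def
proof (rule sum.cong)
  fix k assume "k \<in> {1..<N}"
  then show "mirror_gap \<kappa> x k (v(Inl (int z) := u)) = mirror_gap \<kappa> x k v"
    using assms by (cases "k = z") (auto simp: mirror_gap_def)
qed simp

definition peak_integrand :: "(real \<Rightarrow> real) \<Rightarrow> real \<Rightarrow> nat \<Rightarrow> (int + nat \<Rightarrow> real) \<Rightarrow> ennreal" where
  "peak_integrand F t n v = ennreal (F (log_ratio (potv v) t n)) * indicator {v. wins (potv v) t n} v"

lemma peak_integrand_measurable [measurable]:
  assumes [measurable]: "F \<in> borel_measurable borel" and t: "0 \<le> t"
  shows "peak_integrand F t n \<in> borel_measurable P"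
proof -
  have [measurable]: "(\<lambda>v. log_ratio (potv v) t n) \<in> borel_measurable P" "Measurable.pred P (\<lambda>v. wins (potv v) t n)"
    using t by (auto intro: log_ratio_measurable wins_measurable)
  show ?thesis unfolding peak_integrand_def[abs_def] by measurable
qed

text \<open>The event \<open>W\<close>, no rival at the origin or at a successful coin other than at
  \<open>N\<close>, is inserted at the cost of a product of site probabilities. On \<open>W\<close>
  and off the bad events the environment is regular, \<open>N\<close> wins, and
  \<open>log_ratio\<close> is within \<open>\<epsilon>\<close> of \<open>mirror_sum\<close>, which
  costs \<open>\<Lambda> * \<epsilon>\<close> in \<open>F\<close>. The bad events cost at most
  \<open>C\<close> times their probability.\<close>

lemma peak_lower_bound:
  fixes t x A y Y E R K \<kappa> \<delta> \<epsilon> C \<Lambda> :: real and N d :: nat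
  defines "L \<equiv> t * x - N * ln x - \<delta> * A * t"
  assumes t: "0 < t" and x: "1 \<le> x" "x \<le> E * max (real N) R" and N: "d < N" and \<delta>: "0 < \<delta> * A * t"
    and Y: "1 < Y" "t * Y \<le> L" "Y powr (- \<alpha>) \<le> 1 / 2" and K: "0 < K" and E: "0 < E" "0 < R" "2 \<le> E * R"
    and \<kappa>: "0 < \<kappa>" "x * (1 - \<kappa>) = A * (y - \<delta> / 2)" "x = A * y"
    and F [measurable]: "F \<in> borel_measurable borel" and F_bd: "\<And>u. 0 \<le> F u" "\<And>u. F u \<le> C" and F_lip: "\<And>u w. \<bar>F u - F w\<bar> \<le> \<Lambda> * \<bar>u - w\<bar>" and \<Lambda>: "0 \<le> \<Lambda>" "0 \<le> \<epsilon>"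
    and ratio: "\<And>\<xi>. regular_env t x N d (\<delta> * A * t) E R K \<xi> \<Longrightarrow>
      0 < pam_u \<xi> t (int N) \<and> 0 < pam_u \<xi> t (- int N) \<and>
      \<bar>ln (pam_u \<xi> t (int N) / pam_u \<xi> t (- int N)) - (\<Sum>k<N. ln (x - \<xi> (- int k)) - ln (x - \<xi> (int k)))\<bar> \<le> \<epsilon> \<and>
      (\<forall>z. \<bar>z\<bar> < int N \<longrightarrow> \<xi> z \<le> A * (y - \<delta> / 2))"
  shows "ennreal (exp (- ((1 + 2 * Y powr (- \<alpha>)) * tail_total \<alpha> t Y)) * (\<integral>v. F (mirror_sum \<kappa> x N v) \<partial>P))
    \<le> (\<integral>\<^sup>+v. peak_integrand F t N (v(Inl (int N) := x)) \<partial>P) + ennreal (\<Lambda> * \<epsilon> + C * P.prob (bad_env t N d L E R K))"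
proof -
  define q where "q = exp (- ((1 + 2 * Y powr (- \<alpha>)) * tail_total \<alpha> t Y))"
  define G where "G v = F (mirror_sum \<kappa> x N v)" for v
  have [measurable]: "G \<in> borel_measurable P" unfolding G_def[abs_def] by measurable
  have C: "0 \<le> C" using F_bd[of 0] by simp
  have iG: "integrable P G"
    by (rule P.integrable_const_bound[where B=C]) (use F_bd in \<open>auto simp: G_def\<close>)
  have G_nn: "(\<integral>\<^sup>+v. ennreal (G v) \<partial>P) = ennreal (\<integral>v. G v \<partial>P)"
    by (rule nn_integral_eq_integral[OF iG]) (use F_bd in \<open>auto simp: G_def\<close>)
  have bad_ev: "bad_env t N d L E R K \<in> P.events"
    unfolding bad_env_def using bad_coin_prob(1)[OF N] bad_rival_prob(1)[OF t Y(1,2), of 0 1] bad_far_prob(1)[OF E] bad_sum_prob(1)[OF K] p_range by auto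
  define W where "W = {v. \<forall>z\<in>- {N}. z = 0 \<or> v (Inr z) = 1 \<longrightarrow> v (Inl (int z)) \<notin> exceed t L z}"
  have "ennreal (q * (\<integral>v. G v \<partial>P)) = ennreal q * (\<integral>\<^sup>+v. ennreal (G v) \<partial>P)"
    unfolding G_nn by (simp add: ennreal_mult' q_def)
  also have "\<dots> \<le> (\<integral>\<^sup>+v. ennreal (G v) * indicator W v \<partial>P)"
    unfolding W_def
  proof (rule site_events_lower_bound_all)
    show "ennreal (G (v(Inl (int z) := u))) = ennreal (G v)" if "z \<in> - {N}" "z = 0 \<or> v (Inr z) = 1" for v z u
      using mirror_sum_update[of z v \<kappa> x N u] that by (simp add: G_def)
    show "(\<integral>\<^sup>+v. ennreal (G v) \<partial>P) < \<infinity>" unfolding G_nn by simp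
    fix M :: nat
    define f where "f z = measure (\<mu> (Inl (int z))) (exceed t L z)" for z
    define \<rho> where "\<rho> = Y powr (- \<alpha>)"
    have f1: "f z \<le> (Y + ln Y / t * real z) powr (- \<alpha>)" for z
      unfolding f_def using Y by (intro exceed_prob t) auto
    have f: "0 \<le> f z" "f z \<le> \<rho>" for z
    proof -
      have "(Y + ln Y / t * real z) powr (- \<alpha>) \<le> Y powr (- \<alpha>)" using Y t \<alpha> by (intro powr_mono2') auto
      then show "f z \<le> \<rho>" using f1[of z] by (simp add: \<rho>_def)
    qed (simp add: f_def)
    have fs: "(\<Sum>z\<in>- {N} \<inter> {..<M}. f z) \<le> tail_total \<alpha> t Y"
    proof -
      have "(\<Sum>z\<in>- {N} \<inter> {..<M}. f z) \<le> (\<Sum>z<M. f z)" by (intro sum_mono2) (auto simp: f)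
      also have "\<dots> \<le> (\<Sum>z<M. (Y + ln Y / t * real z) powr (- \<alpha>))" by (intro sum_mono f1)
      also have "\<dots> \<le> tail_total \<alpha> t Y" by (rule tail_total_sum[OF t Y(1)])
      finally show ?thesis .
    qed
    have "q \<le> exp (- ((1 + 2 * \<rho>) * (\<Sum>z\<in>- {N} \<inter> {..<M}. f z)))"
      unfolding q_def \<rho>_def[symmetric] using fs by (auto intro!: mult_left_mono simp: \<rho>_def)
    also have "\<dots> = (\<Prod>z\<in>- {N} \<inter> {..<M}. exp (- ((1 + 2 * \<rho>) * f z)))"
      by (simp add: exp_sum[symmetric] sum_negf sum_distrib_left)
    also have "\<dots> \<le> (\<Prod>z\<in>- {N} \<inter> {..<M}. 1 - f z)"
      using f Y(3) by (intro prod_mono conjI one_minus_ge_exp) (auto simp: \<rho>_def)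
    finally show "q \<le> (\<Prod>z\<in>- {N} \<inter> {..<M}. 1 - measure (\<mu> (Inl (int z))) (exceed t L z))" by (simp add: f_def)
  qed measurable
  also have "\<dots> \<le> (\<integral>\<^sup>+v. peak_integrand F t N (v(Inl (int N) := x)) + (ennreal (\<Lambda> * \<epsilon>) + ennreal C * indicator (bad_env t N d L E R K) v) \<partial>P)"
  proof (rule nn_integral_mono_AE)
    show "AE v in P. ennreal (G v) * indicator W v \<le> peak_integrand F t N (v(Inl (int N) := x)) + (ennreal (\<Lambda> * \<epsilon>) + ennreal C * indicator (bad_env t N d L E R K) v)"
      using AE_sites AE_space
    proof eventually_elim
      case (elim v)
      show ?case
      proof (cases "v \<in> W \<and> v \<notin> bad_env t N d L E R K")
        case True
        define \<xi> where "\<xi> = potv (v(Inl (int N) := x))"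
        have reg: "regular_env t x N d (\<delta> * A * t) E R K \<xi>"
          unfolding \<xi>_def
          by (rule regular_potv) (use True elim x N in \<open>auto simp: W_def L_def\<close>)
        note r = ratio[OF reg]
        have w: "wins \<xi> t N" using regular_env_wins[OF reg t \<delta>] r by simp
        have "(\<Sum>k<N. ln (x - \<xi> (- int k)) - ln (x - \<xi> (int k))) = mirror_sum \<kappa> x N v"
          unfolding \<xi>_def by (rule mirror_sum_potv; (unfold \<kappa>(2))?; use x(1) \<kappa>(1) r in \<open>simp add: \<xi>_def\<close>)
        then have "\<bar>log_ratio \<xi> t N - mirror_sum \<kappa> x N v\<bar> \<le> \<epsilon>" using r by (simp add: log_ratio_def)
        then have "\<Lambda> * \<bar>log_ratio \<xi> t N - mirror_sum \<kappa> x N v\<bar> \<le> \<Lambda> * \<epsilon>" using \<Lambda> by (intro mult_left_mono)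
        then have "G v \<le> F (log_ratio \<xi> t N) + \<Lambda> * \<epsilon>" using F_lip[of "log_ratio \<xi> t N" "mirror_sum \<kappa> x N v"] by (simp add: G_def abs_le_iff)
        then have "ennreal (G v) \<le> ennreal (F (log_ratio \<xi> t N)) + ennreal (\<Lambda> * \<epsilon>)"
          using F_bd \<Lambda> by (subst ennreal_plus[symmetric]) (auto intro: ennreal_leI simp del: ennreal_plus)
        then show ?thesis using True w by (simp add: peak_integrand_def \<xi>_def[symmetric])
      next
        case False
        have "ennreal (G v) \<le> ennreal C" using F_bd by (auto simp: G_def intro: ennreal_leI)
        show ?thesis
        proof (cases "v \<in> W")
          case True
          then have "v \<in> bad_env t N d L E R K" using False by simp
          then show ?thesis using True \<open>ennreal (G v) \<le> ennreal C\<close> by (simp add: add_increasing)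
        qed simp
      qed
    qed
  qed
  also have "\<dots> = (\<integral>\<^sup>+v. peak_integrand F t N (v(Inl (int N) := x)) \<partial>P) + (ennreal (\<Lambda> * \<epsilon>) + ennreal C * emeasure P (bad_env t N d L E R K))"
  proof -
    have [measurable]: "(\<lambda>v. peak_integrand F t N (v(Inl (int N) := x))) \<in> borel_measurable P"
      by (rule measurable_compose[OF _ peak_integrand_measurable]) (measurable, use t in simp)
    show ?thesis using bad_ev
      by (subst nn_integral_add, simp, simp, subst nn_integral_add, simp, simp, subst nn_integral_cmult_indicator)
         (auto simp: P.emeasure_space_1)
  qed
  also have "ennreal (\<Lambda> * \<epsilon>) + ennreal C * emeasure P (bad_env t N d L E R K) = ennreal (\<Lambda> * \<epsilon> + C * P.prob (bad_env t N d L E R K))"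
    using C \<Lambda> by (simp add: P.emeasure_eq_measure ennreal_mult ennreal_plus)
  finally show ?thesis unfolding q_def G_def .
qed

text \<open>Given a number below the claimed limit, the margin \<open>\<delta>\<close> is taken so
  small that the exponent loses little, then \<open>\<epsilon>\<close> so small that
  \<open>F\<close> does. The truncation \<open>\<kappa> = \<delta> / (2 * y)\<close> matches the gap
  that regular environments have at this \<open>\<delta>\<close>, so the limit of \<open>F\<close>
  is assumed for every \<open>\<kappa>\<close>.\<close>

theorem peak_liminf:
  fixes s y C \<Lambda> l :: real and F :: "real \<Rightarrow> real" and \<tau> :: "nat \<Rightarrow> real"
  defines "x \<equiv> \<lambda>t. scale_a \<alpha> t * y" and "N \<equiv> \<lambda>t. peak_site \<alpha> s t"
  assumes s: "0 < s" and y: "s / (\<alpha> - 1) < y" and \<tau>: "filterlim \<tau> at_top sequentially"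
    and F [measurable]: "F \<in> borel_measurable borel" and F_bd: "\<And>u. 0 \<le> F u" "\<And>u. F u \<le> C"
    and F_lip: "\<And>u w. \<bar>F u - F w\<bar> \<le> \<Lambda> * \<bar>u - w\<bar>"
    and F_lim: "\<And>\<kappa>. 0 < \<kappa> \<Longrightarrow> \<kappa> < 1 \<Longrightarrow> (\<lambda>k. \<integral>v. F (mirror_sum \<kappa> (x (\<tau> k)) (N (\<tau> k)) v) \<partial>P) \<longlonglongrightarrow> l"
  shows "ennreal (l * exp (- ((y - s / (\<alpha> - 1)) powr (1 - \<alpha>))))
    \<le> liminf (\<lambda>k. \<integral>\<^sup>+v. peak_integrand F (\<tau> k) (N (\<tau> k)) (v(Inl (int (N (\<tau> k))) := x (\<tau> k))) \<partial>P)"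
proof -
  define \<psi> where "\<psi> = y - s / (\<alpha> - 1)"
  have \<psi>: "0 < \<psi>" using y by (simp add: \<psi>_def)
  have s\<alpha>: "0 < s / (\<alpha> - 1)" using s \<alpha> by simp
  then have y0: "0 < y" using y by linarith
  define \<Lambda>' where "\<Lambda>' = \<bar>\<Lambda>\<bar>"
  have F_lip': "\<bar>F u - F w\<bar> \<le> \<Lambda>' * \<bar>u - w\<bar>" for u w
  proof -
    have "\<Lambda> * \<bar>u - w\<bar> \<le> \<bar>\<Lambda>\<bar> * \<bar>u - w\<bar>" by (intro mult_right_mono) auto
    then show ?thesis using F_lip[of u w] by (simp add: \<Lambda>'_def)
  qed
  define H where "H k = (\<integral>\<^sup>+v. peak_integrand F (\<tau> k) (N (\<tau> k)) (v(Inl (int (N (\<tau> k))) := x (\<tau> k))) \<partial>P)" for k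
  have main: "eventually (\<lambda>k. ennreal c < H k) sequentially" if c0: "0 \<le> c" and c: "c < l * exp (- (\<psi> powr (1 - \<alpha>)))" for c
  proof -
    have "((\<lambda>\<delta>. l * exp (- ((\<psi> - \<delta>) powr (1 - \<alpha>)))) \<longlongrightarrow> l * exp (- ((\<psi> - 0) powr (1 - \<alpha>)))) (at_right 0)"
      using \<psi> by (intro tendsto_intros) auto
    then have "eventually (\<lambda>\<delta>. c < l * exp (- ((\<psi> - \<delta>) powr (1 - \<alpha>)))) (at_right 0)"
      using c by (intro order_tendstoD(1)) auto
    moreover have "eventually (\<lambda>\<delta>. \<delta> \<in> {0<..<\<psi>}) (at_right 0)" by (rule eventually_at_rightI[OF _ \<psi>])
    ultimately have "eventually (\<lambda>\<delta>. c < l * exp (- ((\<psi> - \<delta>) powr (1 - \<alpha>))) \<and> \<delta> \<in> {0<..<\<psi>}) (at_right 0)" by (rule eventually_conj)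
    from eventually_happens'[OF _ this] obtain \<delta> where
      \<delta>: "c < l * exp (- ((\<psi> - \<delta>) powr (1 - \<alpha>)))" "0 < \<delta>" "\<delta> < \<psi>" by auto
    define e0 where "e0 = l * exp (- ((\<psi> - \<delta>) powr (1 - \<alpha>)))"
    \<comment> \<open>At most half of the slack \<open>e0 - c\<close> is spent on the Lipschitz
      error; the summand 1 covers \<open>\<Lambda>' = 0\<close>.\<close>
    define \<epsilon> where "\<epsilon> = (e0 - c) / (2 * (\<Lambda>' + 1))"
    have \<Lambda>': "0 \<le> \<Lambda>'" by (simp add: \<Lambda>'_def)
    have \<epsilon>: "0 < \<epsilon>" using \<delta>(1) \<Lambda>' by (simp add: \<epsilon>_def e0_def)
    have e0: "c < e0 - \<Lambda>' * \<epsilon>"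
    proof -
      have "\<Lambda>' * \<epsilon> \<le> (\<Lambda>' + 1) * \<epsilon>" using \<epsilon> by (intro mult_right_mono) auto
      also have "\<dots> = (e0 - c) / 2"
      proof -
        have "B * (w / (2 * B)) = w / 2" if "0 < B" for B w :: real using that by simp
        from this[of "\<Lambda>' + 1" "e0 - c"] show ?thesis unfolding \<epsilon>_def using \<Lambda>' by linarith
      qed
      finally show ?thesis using \<delta>(1) by (simp add: e0_def)
    qed
    have \<delta>y: "\<delta> < y" using \<delta>(3) s\<alpha> unfolding \<psi>_def by linarith
    define \<kappa> where "\<kappa> = \<delta> / (2 * y)"
    have \<kappa>: "0 < \<kappa>" "\<kappa> < 1" using \<delta> \<delta>y y0 by (simp_all add: \<kappa>_def)
    define d where "d = nat \<lceil>\<alpha>\<rceil>"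
    define E where "E t = 1 / (\<alpha> - 1) / 4 * ln t / t" for t
    define R where "R t = sqrt (ln t) * scale_r \<alpha> t" for t
    define K where "K t = (scale_a \<alpha> t)\<^sup>2 * sqrt (scale_a \<alpha> t)" for t
    define L where "L t = t * x t - N t * ln (x t) - \<delta> * scale_a \<alpha> t * t" for t
    define Y where "Y = level \<alpha> s y (y - \<delta>)"
    have yc: "s / (\<alpha> - 1) < y - \<delta>" using \<delta> by (simp add: \<psi>_def)
    note lv = level_lim[OF \<alpha> s y0 yc, folded Y_def]
    have Nt: "filterlim (\<lambda>t. N t - 0) at_top at_top" unfolding N_def by (intro site_at_top scale_at_top \<alpha> s)
    have e1: "eventually (\<lambda>t. Suc d \<le> N t) at_top" using Nt unfolding filterlim_at_top by simp
    have e2: "eventually (\<lambda>t. 1 < Y t \<and> t * Y t \<le> L t) at_top"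
      unfolding Y_def L_def x_def N_def by (rule bad_rival_lim(1)[OF s y0 yc])
    have "filterlim x at_top at_top" unfolding x_def
      by (rule filterlim_at_top_mult_tendsto_pos[OF tendsto_const y0 scale_at_top(1)[OF \<alpha>]])
    then have x2: "eventually (\<lambda>t. 2 < x t) at_top" unfolding filterlim_at_top_dense by simp
    have "0 < 1 / (\<alpha> - 1) / 4" using \<alpha> by simp
    then have "eventually (\<lambda>t. y \<le> 1 / (\<alpha> - 1) / 4 * sqrt (ln t)) at_top" using y0 by real_asymp
    then have e4: "eventually (\<lambda>t. 2 < x t \<and> x t \<le> E t * R t \<and> 0 < E t \<and> 0 < R t \<and> 0 < K t) at_top"
      using x2 eventually_gt_at_top[of 1]
    proof eventually_elim
      case (elim t)
      have t: "0 < t" "0 < ln t" using elim(3) by auto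
      note sc = scale_r_eq_powr[OF \<alpha> elim(3)]
      have "x t \<le> 1 / (\<alpha> - 1) / 4 * sqrt (ln t) * scale_a \<alpha> t"
        unfolding x_def mult.commute[of "scale_a \<alpha> t"] using elim(1) sc by (intro mult_right_mono) auto
      also have "\<dots> = E t * R t" using t by (simp add: E_def R_def scale_r_def)
      finally show ?case using elim(2) sc t \<alpha> by (simp add: E_def R_def K_def)
    qed
    define b where "b t = P.prob (bad_env t (N t) d (L t) (E t) (R t) (K t))" for t
    have b: "(b \<longlongrightarrow> 0) at_top"
    proof (rule tendsto_sandwich[where f="\<lambda>_. 0"])
      have "((\<lambda>t. P.prob (bad_coin (N t) d) + P.prob (bad_rival t (L t)) + P.prob (bad_far (E t) (R t)) + P.prob (bad_sum (N t) (K t))) \<longlongrightarrow> 0 + 0 + 0 + 0) at_top"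
        unfolding N_def x_def L_def E_def R_def K_def
        by (intro tendsto_add bad_coin_lim[OF s] bad_rival_lim(2)[OF s y0 yc] bad_far_lim bad_sum_lim[OF s])
      then show "((\<lambda>t. P.prob (bad_coin (N t) d) + P.prob (bad_rival t (L t)) + P.prob (bad_far (E t) (R t)) + P.prob (bad_sum (N t) (K t))) \<longlongrightarrow> 0) at_top" by simp
      show "eventually (\<lambda>t. b t \<le> P.prob (bad_coin (N t) d) + P.prob (bad_rival t (L t)) + P.prob (bad_far (E t) (R t)) + P.prob (bad_sum (N t) (K t))) at_top"
        using e1 e2 e4 eventually_gt_at_top[of 0]
      proof eventually_elim
        case (elim t)
        have "2 \<le> E t * R t" using elim(3) by simp
        then have "bad_coin (N t) d \<in> P.events" "bad_rival t (L t) \<in> P.events" "bad_far (E t) (R t) \<in> P.events" "bad_sum (N t) (K t) \<in> P.events"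
          using bad_coin_prob(1) bad_rival_prob(1)[of t "Y t" "L t" 0 1] bad_far_prob(1) bad_sum_prob(1) elim p_range by auto
        then show ?case unfolding b_def bad_env_def
          by (intro order_trans[OF measure_Un_le] add_mono order_refl) auto
      qed
    qed (auto simp: b_def)
    have ev: "eventually (\<lambda>t. ennreal (exp (- ((1 + 2 * Y t powr (- \<alpha>)) * tail_total \<alpha> t (Y t))) * (\<integral>v. F (mirror_sum \<kappa> (x t) (N t) v) \<partial>P))
      \<le> (\<integral>\<^sup>+v. peak_integrand F t (N t) (v(Inl (int (N t)) := x t)) \<partial>P) + ennreal (\<Lambda>' * \<epsilon> + C * b t)) at_top"
    proof -
      have "((\<lambda>u::real. u powr (- \<alpha>)) \<longlongrightarrow> 0) at_top" using \<alpha> by real_asymp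
      from filterlim_compose[OF this lv(2)] have "((\<lambda>t. Y t powr (- \<alpha>)) \<longlongrightarrow> 0) at_top" .
      then have e3: "eventually (\<lambda>t. Y t powr (- \<alpha>) < 1 / 2) at_top" by (rule order_tendstoD(2)) simp
      show ?thesis
        using e1 e2 e3 e4 pam_ratio_asymptotic[OF \<alpha> s \<delta>(2) \<delta>y \<epsilon>] eventually_gt_at_top[of 1]
      proof eventually_elim
        case (elim t)
        have t: "0 < t" using elim(6) by simp
        note sc = scale_r_eq_powr[OF \<alpha> elim(6)]
        show ?case
          unfolding b_def L_def
        proof (rule peak_lower_bound[where y=y and \<delta>=\<delta> and A="scale_a \<alpha> t"])
          show "x t \<le> E t * max (real (N t)) (R t)" using elim(4) by (auto intro: order_trans mult_left_mono)
          show "2 \<le> E t * R t" using elim(4) by simp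
          show "0 < \<delta> * scale_a \<alpha> t * t" using \<delta> sc t by simp
          show "t * Y t \<le> t * x t - N t * ln (x t) - \<delta> * scale_a \<alpha> t * t" using elim(2) by (simp add: L_def)
          show "x t * (1 - \<kappa>) = scale_a \<alpha> t * (y - \<delta> / 2)" using y0 by (simp add: x_def \<kappa>_def right_diff_distrib)
          show "0 < pam_u \<xi> t (int (N t)) \<and> 0 < pam_u \<xi> t (- int (N t)) \<and>
              \<bar>ln (pam_u \<xi> t (int (N t)) / pam_u \<xi> t (- int (N t))) - (\<Sum>k<N t. ln (x t - \<xi> (- int k)) - ln (x t - \<xi> (int k)))\<bar> \<le> \<epsilon> \<and>
              (\<forall>z. \<bar>z\<bar> < int (N t) \<longrightarrow> \<xi> z \<le> scale_a \<alpha> t * (y - \<delta> / 2))"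
            if "regular_env t (x t) (N t) d (\<delta> * scale_a \<alpha> t * t) (E t) (R t) (K t) \<xi>" for \<xi>
            using elim(5)[rule_format, of \<xi>] that unfolding x_def N_def E_def R_def K_def d_def by blast
        qed (use elim t F_bd F_lip' \<Lambda>' \<epsilon> \<kappa> in \<open>auto simp: x_def\<close>)
      qed
    qed
    define m where "m k = exp (- ((1 + 2 * Y (\<tau> k) powr (- \<alpha>)) * tail_total \<alpha> (\<tau> k) (Y (\<tau> k)))) * (\<integral>v. F (mirror_sum \<kappa> (x (\<tau> k)) (N (\<tau> k)) v) \<partial>P)" for k
    have "((\<lambda>u::real. u powr (- \<alpha>)) \<longlongrightarrow> 0) at_top" using \<alpha> by real_asymp
    from filterlim_compose[OF this filterlim_compose[OF lv(2) \<tau>]] have Y0: "(\<lambda>k. Y (\<tau> k) powr (- \<alpha>)) \<longlonglongrightarrow> 0" .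
    have "m \<longlonglongrightarrow> exp (- ((1 + 2 * 0) * (y - \<delta> - s / (\<alpha> - 1)) powr (1 - \<alpha>))) * l"
      unfolding m_def by (intro tendsto_intros Y0 filterlim_compose[OF lv(3) \<tau>] F_lim \<kappa>)
    then have m: "m \<longlonglongrightarrow> e0" by (simp add: e0_def \<psi>_def mult.commute algebra_simps)
    have "(\<lambda>k. m k - (\<Lambda>' * \<epsilon> + C * b (\<tau> k))) \<longlonglongrightarrow> e0 - (\<Lambda>' * \<epsilon> + C * 0)"
      by (intro tendsto_intros m filterlim_compose[OF b \<tau>])
    then have "eventually (\<lambda>k. c < m k - (\<Lambda>' * \<epsilon> + C * b (\<tau> k))) sequentially"
      using e0 by (intro order_tendstoD(1)) auto
    moreover have "eventually (\<lambda>k. ennreal (m k) \<le> H k + ennreal (\<Lambda>' * \<epsilon> + C * b (\<tau> k))) sequentially"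
      unfolding m_def H_def using eventually_compose_filterlim[OF ev \<tau>] .
    ultimately show ?thesis
    proof eventually_elim
      case (elim k)
      define e where "e = \<Lambda>' * \<epsilon> + C * b (\<tau> k)"
      have e: "0 \<le> e" unfolding e_def b_def using \<Lambda>' \<epsilon> order_trans[OF F_bd(1) F_bd(2)] by (intro add_nonneg_nonneg mult_nonneg_nonneg) auto
      show ?case
      proof (rule ccontr)
        assume "\<not> ennreal c < H k"
        then have "ennreal (m k) \<le> ennreal c + ennreal e"
          using elim(2) unfolding e_def[symmetric] not_less by (meson add_right_mono order_trans)
        also have "\<dots> = ennreal (c + e)" using c0 e by simp
        finally have "m k \<le> c + e" using c0 e by (subst (asm) ennreal_le_iff) auto
        then show False using elim(1) by (simp add: e_def)
      qed
    qed
  qed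
  show ?thesis
    unfolding H_def[symmetric] le_Liminf_iff
  proof (intro allI impI)
    fix u assume u: "u < ennreal (l * exp (- ((y - s / (\<alpha> - 1)) powr (1 - \<alpha>))))"
    then obtain c where c: "u = ennreal c" "0 \<le> c" by (cases u) auto
    then have "c < l * exp (- ((y - s / (\<alpha> - 1)) powr (1 - \<alpha>)))" using u by (simp add: ennreal_less_iff)
    then show "eventually (\<lambda>k. u < H k) sequentially" unfolding c(1) using c(2) main by (simp add: \<psi>_def)
  qed
qed

end

section \<open>The law of the peak\<close>

text \<open>Written as a Lebesgue integral, the sum over sites can be rescaled by a real
  factor.\<close>

lemma nn_integral_floor:
  fixes h :: "nat \<Rightarrow> ennreal"
  shows "(\<integral>\<^sup>+u. h (nat \<lfloor>u\<rfloor>) * indicator {0..} (u :: real) \<partial>lborel) = (\<Sum>n. h n)"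
proof -
  have e: "h (nat \<lfloor>u\<rfloor>) * indicator {0..} u = (\<Sum>n. h n * indicator {real n..<real n + 1} u)" for u :: real
  proof (cases "0 \<le> u")
    case True
    have i: "indicator {real n..<real n + 1} u = (if n = nat \<lfloor>u\<rfloor> then 1 else 0 :: ennreal)" for n
      using True by (auto simp: indicator_def) linarith+
    have "(\<Sum>n. h n * indicator {real n..<real n + 1} u) = (\<Sum>n\<in>{nat \<lfloor>u\<rfloor>}. h n * indicator {real n..<real n + 1} u)"
      by (rule suminf_finite) (auto simp: i)
    then show ?thesis using True by (simp add: i)
  next
    case False
    then have "indicator {real n..<real n + 1} u = (0 :: ennreal)" for n by (auto simp: indicator_def)
    then show ?thesis using False by simp
  qed
  have "(\<integral>\<^sup>+u. h (nat \<lfloor>u\<rfloor>) * indicator {0..} (u :: real) \<partial>lborel) = (\<integral>\<^sup>+u. (\<Sum>n. h n * indicator {real n..<real n + 1} u) \<partial>lborel)"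
    by (rule nn_integral_cong) (rule e)
  also have "\<dots> = (\<Sum>n. \<integral>\<^sup>+u. h n * indicator {real n..<real n + 1} u \<partial>lborel)"
    by (rule nn_integral_suminf) measurable
  also have "\<dots> = (\<Sum>n. h n)" by (simp add: nn_integral_cmult_indicator)
  finally show ?thesis .
qed

lemma liminf_ennreal_mult:
  fixes c :: "nat \<Rightarrow> real" and h :: "nat \<Rightarrow> ennreal"
  assumes c: "c \<longlonglongrightarrow> c0" "0 \<le> c0" and h: "ennreal l \<le> liminf h"
  shows "ennreal (c0 * l) \<le> liminf (\<lambda>k. ennreal (c k) * h k)"
  unfolding le_Liminf_iff
proof (intro allI impI)
  fix u assume u: "u < ennreal (c0 * l)"
  then obtain w where w: "u = ennreal w" "0 \<le> w" by (cases u) auto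
  have w1: "w < c0 * l" using u w by (simp add: ennreal_less_iff)
  have c0: "0 < c0" using c(2) w w1 by (cases "c0 = 0") auto
  define d where "d = (w / c0 + l) / 2"
  have wl: "w / c0 < l" using w1 c0 by (simp add: pos_divide_less_eq mult.commute)
  have w0: "0 \<le> w / c0" using w c0 by simp
  have "W < (W + l) / 2 \<and> (W + l) / 2 < l \<and> 0 < (W + l) / 2" if "W < l" "0 \<le> W" for W using that by simp
  from this[OF wl w0] have d: "w / c0 < d" "d < l" "0 < d" unfolding d_def by simp_all
  have "w < c0 * d" using d(1) c0 by (simp add: pos_divide_less_eq mult.commute)
  moreover have "(\<lambda>k. c k * d) \<longlonglongrightarrow> c0 * d" by (intro tendsto_intros c)
  ultimately have "eventually (\<lambda>k. w < c k * d) sequentially" by (intro order_tendstoD(1))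
  moreover have "eventually (\<lambda>k. ennreal d < h k) sequentially"
  proof -
    have "ennreal d < ennreal l" using d by (simp add: ennreal_less_iff)
    then show ?thesis using h unfolding le_Liminf_iff by blast
  qed
  ultimately show "eventually (\<lambda>k. u < ennreal (c k) * h k) sequentially"
  proof eventually_elim
    case (elim k)
    have "u < ennreal (c k * d)" unfolding w(1) using elim(1) w(2) by (simp add: ennreal_less_iff)
    also have "\<dots> = ennreal (c k) * ennreal d" using d by (simp add: ennreal_mult'')
    also have "\<dots> \<le> ennreal (c k) * h k" using elim(2) by (intro mult_left_mono) auto
    finally show ?case .
  qed
qed

context pareto_env begin

definition peak_mean :: "(real \<Rightarrow> real) \<Rightarrow> real \<Rightarrow> nat \<Rightarrow> real \<Rightarrow> ennreal" where
  "peak_mean F t n x = (\<integral>\<^sup>+v. peak_integrand F t n (v(Inl (int n) := x)) \<partial>P)"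

text \<open>The winning events of different sites are disjoint, so this is one expectation: of
  \<open>g\<close> at the scaled peak times \<open>F\<close> at the log ratio, on the event that
  some site wins.\<close>

definition peak_mass :: "(real \<Rightarrow> real) \<Rightarrow> (real \<Rightarrow> real) \<Rightarrow> real \<Rightarrow> ennreal" where
  "peak_mass g F t = (\<Sum>n. \<integral>\<^sup>+v. ennreal (g (real n powr (1 / \<alpha>) / v (Inl (int n)))) * peak_integrand F t n v \<partial>P)"

definition scaled_mass :: "(real \<Rightarrow> real) \<Rightarrow> (real \<Rightarrow> real) \<Rightarrow> real \<Rightarrow> real \<Rightarrow> real \<Rightarrow> ennreal" where
  "scaled_mass g F t s y = ennreal (of_bool (0 \<le> s \<and> 1 < scale_a \<alpha> t * y) * (\<alpha> * y powr (- \<alpha> - 1) *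
     g (real (peak_site \<alpha> s t) powr (1 / \<alpha>) / (scale_a \<alpha> t * y)))) * peak_mean F t (peak_site \<alpha> s t) (scale_a \<alpha> t * y)"

lemma peak_mean_measurable [measurable]:
  assumes [measurable]: "F \<in> borel_measurable borel" and t: "0 \<le> t"
  shows "peak_mean F t n \<in> borel_measurable borel"
proof -
  have [measurable]: "peak_integrand F t n \<in> borel_measurable P" by (intro peak_integrand_measurable assms)
  show ?thesis unfolding peak_mean_def[abs_def] by measurable
qed

text \<open>The value at \<open>n\<close> is resampled and integrated against its density, then site
  and height are rescaled. The factor
  \<open>r * a * \<alpha> * (a * y) powr (- \<alpha> - 1)\<close> no longer depends on
  \<open>t\<close> because \<open>r = a powr \<alpha>\<close>.\<close>

lemma peak_mass_eq:
  assumes [measurable]: "g \<in> borel_measurable borel" "F \<in> borel_measurable borel" and g: "\<And>b. 0 \<le> g b" and t: "1 < t"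
  shows "peak_mass g F t = (\<integral>\<^sup>+s. \<integral>\<^sup>+y. scaled_mass g F t s y \<partial>lborel \<partial>lborel)"
proof -
  let ?h = "\<lambda>n. \<integral>\<^sup>+v. ennreal (g (real n powr (1 / \<alpha>) / v (Inl (int n)))) * peak_integrand F t n v \<partial>P"
  define a where "a = scale_a \<alpha> t"
  define r where "r = scale_r \<alpha> t"
  note sc = scale_r_eq_powr[OF \<alpha> t, folded a_def r_def]
  have [measurable]: "peak_integrand F t n \<in> borel_measurable P" "peak_mean F t n \<in> borel_measurable borel" for n
    using t by (auto intro: peak_integrand_measurable peak_mean_measurable)
  define G where "G n x = ennreal (g (real n powr (1 / \<alpha>) / x)) * peak_mean F t n x" for n x
  have [measurable]: "G n \<in> borel_measurable borel" for n unfolding G_def[abs_def] by measurable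
  define H where "H n = (\<integral>\<^sup>+y. ennreal (of_bool (1 < a * y) * (\<alpha> * y powr (- \<alpha> - 1))) * G n (a * y) \<partial>lborel)" for n
  have ra: "ennreal r * ?h n = H n" for n
  proof -
    have "?h n
      = (\<integral>\<^sup>+x. \<integral>\<^sup>+v. ennreal (g (real n powr (1 / \<alpha>) / x)) * peak_integrand F t n (v(Inl (int n) := x)) \<partial>P \<partial>\<mu> (Inl (int n)))"
      by (subst resample(1)[of "Inl (int n)"]) auto
    also have "\<dots> = (\<integral>\<^sup>+x. G n x \<partial>\<mu> (Inl (int n)))"
      unfolding G_def peak_mean_def by (intro nn_integral_cong nn_integral_cmult) measurable
    also have "\<dots> = (\<integral>\<^sup>+x. ennreal (pareto_density x) * G n x \<partial>lborel)"
      unfolding distr_pareto by (rule nn_integral_density) measurable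
    also have "\<dots> = ennreal \<bar>a\<bar> * (\<integral>\<^sup>+y. ennreal (pareto_density (0 + a * y)) * G n (0 + a * y) \<partial>lborel)"
      by (rule nn_integral_real_affine) (use sc in auto)
    also have "\<dots> = (\<integral>\<^sup>+y. ennreal a * (ennreal (pareto_density (a * y)) * G n (a * y)) \<partial>lborel)"
      using sc by (subst nn_integral_cmult) auto
    finally have "ennreal r * ?h n
      = (\<integral>\<^sup>+y. ennreal r * (ennreal a * (ennreal (pareto_density (a * y)) * G n (a * y))) \<partial>lborel)"
      by (simp add: nn_integral_cmult)
    also have "\<dots> = H n"
      unfolding H_def
    proof (intro nn_integral_cong)
      fix y
      have "r * (a * pareto_density (a * y)) = of_bool (1 < a * y) * (\<alpha> * y powr (- \<alpha> - 1))"
      proof (cases "1 < a * y")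
        case True
        then have y: "0 < y" using sc by (metis less_trans zero_less_mult_pos zero_less_one)
        have "r * (a * (\<alpha> * (a * y) powr (- \<alpha> - 1))) = (a powr \<alpha> * a powr 1 * a powr (- \<alpha> - 1)) * (\<alpha> * y powr (- \<alpha> - 1))"
          using sc y by (simp add: powr_mult)
        also have "a powr \<alpha> * a powr 1 * a powr (- \<alpha> - 1) = 1" using sc by (simp only: powr_add[symmetric]) simp
        finally show ?thesis using True by (simp add: pareto_density_def)
      qed (simp add: pareto_density_def)
      moreover have "ennreal r * (ennreal a * (ennreal (pareto_density (a * y)) * G n (a * y))) = ennreal (r * (a * pareto_density (a * y))) * G n (a * y)"
        using sc by (simp add: ennreal_mult mult.assoc)
      ultimately show "ennreal r * (ennreal a * (ennreal (pareto_density (a * y)) * G n (a * y)))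
        = ennreal (of_bool (1 < a * y) * (\<alpha> * y powr (- \<alpha> - 1))) * G n (a * y)" by simp
    qed
    finally show ?thesis .
  qed
  have "peak_mass g F t = (\<integral>\<^sup>+u. ?h (nat \<lfloor>u\<rfloor>) * indicator {0..} (u :: real) \<partial>lborel)"
    unfolding peak_mass_def by (rule nn_integral_floor[symmetric])
  also have "\<dots> = ennreal \<bar>r\<bar> * (\<integral>\<^sup>+s. ?h (nat \<lfloor>0 + r * s\<rfloor>) * indicator {0..} (0 + r * s) \<partial>lborel)"
    by (rule nn_integral_real_affine) (use sc in auto)
  also have "\<dots> = (\<integral>\<^sup>+s. ennreal r * (?h (nat \<lfloor>r * s\<rfloor>) * indicator {0..} (r * s)) \<partial>lborel)"
    using sc by (subst nn_integral_cmult) auto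
  also have "\<dots> = (\<integral>\<^sup>+s. H (nat \<lfloor>r * s\<rfloor>) * indicator {0..} s \<partial>lborel)"
  proof (intro nn_integral_cong)
    fix s
    have "indicator {0..} (r * s) = (indicator {0..} s :: ennreal)" using sc by (auto simp: indicator_def zero_le_mult_iff)
    then show "ennreal r * (?h (nat \<lfloor>r * s\<rfloor>) * indicator {0..} (r * s))
      = H (nat \<lfloor>r * s\<rfloor>) * indicator {0..} s" unfolding ra[symmetric] by (simp add: mult.assoc)
  qed
  also have "\<dots> = (\<integral>\<^sup>+s. \<integral>\<^sup>+y. scaled_mass g F t s y \<partial>lborel \<partial>lborel)"
  proof (intro nn_integral_cong)
    fix s
    have "H (nat \<lfloor>r * s\<rfloor>) * indicator {0..} s = (\<integral>\<^sup>+y. ennreal (of_bool (1 < a * y) * (\<alpha> * y powr (- \<alpha> - 1))) * G (nat \<lfloor>r * s\<rfloor>) (a * y) * indicator {0..} s \<partial>lborel)"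
      unfolding H_def by (rule nn_integral_multc[symmetric]) measurable
    also have "\<dots> = (\<integral>\<^sup>+y. scaled_mass g F t s y \<partial>lborel)"
      unfolding scaled_mass_def a_def[symmetric] r_def[symmetric] G_def
      using \<alpha> g by (intro nn_integral_cong) (auto simp: indicator_def ennreal_mult mult_ac)
    finally show "H (nat \<lfloor>r * s\<rfloor>) * indicator {0..} s = (\<integral>\<^sup>+y. scaled_mass g F t s y \<partial>lborel)" .
  qed
  finally show ?thesis .
qed

text \<open>With the peak at \<open>r s\<close> of height \<open>a y\<close>, the value of \<open>\<Psi>\<close> there is \<open>a\<close> times \<open>y - s / (\<alpha> - 1)\<close>,
  and no other site exceeds it with probability \<open>exp (- (y - s / (\<alpha> - 1)) powr (1 - \<alpha>))\<close>.\<close>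
definition peak_density :: "real \<Rightarrow> real \<Rightarrow> real" where
  "peak_density s y = of_bool (0 < s \<and> s / (\<alpha> - 1) < y) * (\<alpha> * y powr (- \<alpha> - 1) * exp (- ((y - s / (\<alpha> - 1)) powr (1 - \<alpha>))))"

lemma peak_density_nonneg [simp]: "0 \<le> peak_density s y" using \<alpha> by (simp add: peak_density_def)

lemma peak_density_measurable [measurable]: "(\<lambda>(s, y). peak_density s y) \<in> borel_measurable (borel \<Otimes>\<^sub>M borel)"
  unfolding peak_density_def by measurable

definition peak_law :: "real measure" where
  "peak_law = distr (density (lborel \<Otimes>\<^sub>M lborel) (\<lambda>(s, y). peak_density s y)) borel (\<lambda>(s, y). s powr (1 / \<alpha>) / y)"

lemma sets_peak_law [simp, measurable_cong]: "sets peak_law = sets borel" by (simp add: peak_law_def)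

lemma nn_integral_peak_law:
  assumes [measurable]: "G \<in> borel_measurable borel"
  shows "(\<integral>\<^sup>+b. G b \<partial>peak_law) = (\<integral>\<^sup>+s. \<integral>\<^sup>+y. ennreal (peak_density s y) * G (s powr (1 / \<alpha>) / y) \<partial>lborel \<partial>lborel)"
proof -
  have "(\<integral>\<^sup>+b. G b \<partial>peak_law) = (\<integral>\<^sup>+w. G (case w of (s, y) \<Rightarrow> s powr (1 / \<alpha>) / y) \<partial>density (lborel \<Otimes>\<^sub>M lborel) (\<lambda>(s, y). peak_density s y))"
    unfolding peak_law_def by (rule nn_integral_distr) measurable
  also have "\<dots> = (\<integral>\<^sup>+w. ennreal (case w of (s, y) \<Rightarrow> peak_density s y) * G (case w of (s, y) \<Rightarrow> s powr (1 / \<alpha>) / y) \<partial>(lborel \<Otimes>\<^sub>M lborel))"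
    by (subst nn_integral_density) (auto simp: split_beta')
  also have "\<dots> = (\<integral>\<^sup>+s. \<integral>\<^sup>+y. ennreal (peak_density s y) * G (s powr (1 / \<alpha>) / y) \<partial>lborel \<partial>lborel)"
    by (subst lborel.nn_integral_fst[symmetric]) (auto simp: split_beta')
  finally show ?thesis .
qed

text \<open>In the variable \<open>w = y - s / (\<alpha> - 1)\<close> the integral over
  \<open>s\<close> is elementary and leaves \<open>(\<alpha> - 1) * w powr (- \<alpha>) * exp (- (w
  powr (1 - \<alpha>)))\<close>, the density of a Frechet law.\<close>

lemma prob_space_peak_law: "prob_space peak_law"
proof
  define \<gamma> where "\<gamma> = 1 / (\<alpha> - 1)"
  have \<gamma>: "0 < \<gamma>" "\<gamma> * (\<alpha> - 1) = 1" using \<alpha> by (simp_all add: \<gamma>_def)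
  define D where "D s w = ennreal (of_bool (0 < s \<and> 0 < w) * (\<alpha> * (w + \<gamma> * s) powr (- \<alpha> - 1) * exp (- (w powr (1 - \<alpha>)))))" for s w
  have Dm [measurable]: "case_prod D \<in> borel_measurable (borel \<Otimes>\<^sub>M borel)" unfolding D_def by measurable
  have "emeasure peak_law (space peak_law) = (\<integral>\<^sup>+b. 1 \<partial>peak_law)" by simp
  also have "\<dots> = (\<integral>\<^sup>+s. \<integral>\<^sup>+y. ennreal (peak_density s y) \<partial>lborel \<partial>lborel)"
    by (subst nn_integral_peak_law) auto
  also have "\<dots> = (\<integral>\<^sup>+s. \<integral>\<^sup>+w. D s w \<partial>lborel \<partial>lborel)"
  proof (rule nn_integral_cong)
    fix s
    have "(\<integral>\<^sup>+y. ennreal (peak_density s y) \<partial>lborel) = ennreal \<bar>1\<bar> * (\<integral>\<^sup>+w. ennreal (peak_density s (\<gamma> * s + 1 * w)) \<partial>lborel)"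
      by (rule nn_integral_real_affine) auto
    then show "(\<integral>\<^sup>+y. ennreal (peak_density s y) \<partial>lborel) = (\<integral>\<^sup>+w. D s w \<partial>lborel)"
      by (simp add: peak_density_def D_def \<gamma>_def add.commute)
  qed
  also have "\<dots> = (\<integral>\<^sup>+w. \<integral>\<^sup>+s. D s w \<partial>lborel \<partial>lborel)"
    by (rule lborel_pair.Fubini') measurable
  also have "\<dots> = (\<integral>\<^sup>+w. ennreal (of_bool (0 < w) * ((\<alpha> - 1) * w powr (- \<alpha>) * exp (- (w powr (1 - \<alpha>))))) \<partial>lborel)"
  proof (intro nn_integral_cong)
    fix w
    show "(\<integral>\<^sup>+s. D s w \<partial>lborel) = ennreal (of_bool (0 < w) * ((\<alpha> - 1) * w powr (- \<alpha>) * exp (- (w powr (1 - \<alpha>)))))"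
    proof (cases "0 < w")
      case True
      have "(\<integral>\<^sup>+s. D s w \<partial>lborel) = (\<integral>\<^sup>+s. ennreal (\<alpha> * (w + \<gamma> * s) powr (- \<alpha> - 1) * exp (- (w powr (1 - \<alpha>)))) * indicator {0..} s \<partial>lborel)"
        using True by (intro nn_integral_cong_AE eventually_mono[OF AE_lborel_singleton[of 0]]) (auto simp: D_def indicator_def)
      also have "\<dots> = ennreal (0 - (- (\<alpha> - 1) * (w + \<gamma> * 0) powr (- \<alpha>) * exp (- (w powr (1 - \<alpha>)))))"
      proof (rule nn_integral_FTC_atLeast)
        show "((\<lambda>s. - (\<alpha> - 1) * (w + \<gamma> * s) powr (- \<alpha>) * exp (- (w powr (1 - \<alpha>)))) has_real_derivative
            \<alpha> * (w + \<gamma> * s) powr (- \<alpha> - 1) * exp (- (w powr (1 - \<alpha>)))) (at s)" if s: "0 \<le> s" for s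
        proof -
          have p: "0 < w + \<gamma> * s" using True s \<gamma> by (simp add: add_pos_nonneg)
          have "((\<lambda>s. - (\<alpha> - 1) * (w + \<gamma> * s) powr (- \<alpha>) * exp (- (w powr (1 - \<alpha>)))) has_real_derivative
            - (\<alpha> - 1) * (- \<alpha> * (w + \<gamma> * s) powr (- \<alpha> - 1) * \<gamma>) * exp (- (w powr (1 - \<alpha>)))) (at s)"
            using p by (auto intro!: derivative_eq_intros)
          moreover have "- (\<alpha> - 1) * (- \<alpha> * W * \<gamma>) * e = \<alpha> * W * e" for W e
          proof -
            have "- (\<alpha> - 1) * (- \<alpha> * W * \<gamma>) * e = (\<gamma> * (\<alpha> - 1)) * (\<alpha> * W * e)" by (simp add: algebra_simps)
            then show ?thesis unfolding \<gamma>(2) by simp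
          qed
          ultimately show ?thesis by simp
        qed
        show "((\<lambda>s. - (\<alpha> - 1) * (w + \<gamma> * s) powr (- \<alpha>) * exp (- (w powr (1 - \<alpha>)))) \<longlongrightarrow> 0) at_top"
          using \<gamma>(1) \<alpha> True by real_asymp
      qed (use \<alpha> in auto)
      finally show ?thesis using True by (simp add: algebra_simps)
    qed (simp add: D_def)
  qed
  also have "\<dots> = (\<integral>\<^sup>+w. ennreal (of_bool (0 < w) * ((\<alpha> - 1) * w powr (- \<alpha>) * exp (- (w powr (1 - \<alpha>))))) * indicator {0..} w \<partial>lborel)"
    by (intro nn_integral_cong) (auto simp: indicator_def)
  also have "\<dots> = ennreal (1 - (\<lambda>w. if 0 < w then exp (- (w powr (1 - \<alpha>))) else 0) (0 :: real))"
  \<comment> \<open>\<open>0 powr (1 - \<alpha>)\<close> is 0 by convention, so the antiderivative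
    needs the explicit value 0 at the origin; extended in this way it has derivative 0
    there.\<close>
  proof (rule nn_integral_FTC_atLeast[where F="\<lambda>w. if 0 < w then exp (- (w powr (1 - \<alpha>))) else 0"])
    define F where "F w = (if 0 < w then exp (- (w powr (1 - \<alpha>))) else 0)" for w :: real
    have "(F has_real_derivative of_bool (0 < w) * ((\<alpha> - 1) * w powr (- \<alpha>) * exp (- (w powr (1 - \<alpha>))))) (at w)" if "0 \<le> w" for w
    proof (cases "w = 0")
      case True
      have "((\<lambda>h. (F (0 + h) - F 0) / h) \<longlongrightarrow> 0) (at 0)"
      proof (rule filterlim_split_at)
        show "((\<lambda>h. (F (0 + h) - F 0) / h) \<longlongrightarrow> 0) (at_left 0)"
          by (rule tendsto_eventually) (auto simp: F_def eventually_at_filter)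
        have "((\<lambda>h. exp (- (h powr (1 - \<alpha>))) / h) \<longlongrightarrow> 0) (at_right 0)" using \<alpha> by real_asymp
        then show "((\<lambda>h. (F (0 + h) - F 0) / h) \<longlongrightarrow> 0) (at_right 0)"
          by (rule Lim_transform_eventually) (auto simp: F_def eventually_at_filter)
      qed
      then show ?thesis unfolding DERIV_def True by simp
    next
      case False
      then have w: "0 < w" using that by simp
      have "((\<lambda>w. exp (- (w powr (1 - \<alpha>)))) has_real_derivative (\<alpha> - 1) * w powr (- \<alpha>) * exp (- (w powr (1 - \<alpha>)))) (at w)"
        using w by (auto intro!: derivative_eq_intros simp: algebra_simps)
      then have "(F has_real_derivative (\<alpha> - 1) * w powr (- \<alpha>) * exp (- (w powr (1 - \<alpha>)))) (at w)"
        by (rule DERIV_cong_ev[THEN iffD1, rotated -1, OF _ refl _ refl])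
           (use w eventually_nhds_in_open[of "{0<..}" w] in \<open>auto simp: F_def elim!: eventually_mono\<close>)
      then show ?thesis using w by simp
    qed
    then show "((\<lambda>w. if 0 < w then exp (- (w powr (1 - \<alpha>))) else 0) has_real_derivative of_bool (0 < w) * ((\<alpha> - 1) * w powr (- \<alpha>) * exp (- (w powr (1 - \<alpha>))))) (at w)" if "0 \<le> w" for w
      using that by (simp add: F_def[abs_def])
    have "((\<lambda>w::real. exp (- (w powr (1 - \<alpha>)))) \<longlongrightarrow> 1) at_top" using \<alpha> by real_asymp
    then show "((\<lambda>w::real. if 0 < w then exp (- (w powr (1 - \<alpha>))) else 0) \<longlongrightarrow> 1) at_top"
      by (rule Lim_transform_eventually) (use eventually_gt_at_top[of "0::real"] in \<open>auto elim!: eventually_mono\<close>)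
  qed (use \<alpha> in auto)
  finally show "emeasure peak_law (space peak_law) = 1" by simp
qed

lemma AE_peak_law_pos: "AE b in peak_law. 0 < b"
proof -
  have z: "ennreal (peak_density s y) * indicator {..0} (s powr (1 / \<alpha>) / y) = 0" for s y
  proof (cases "0 < s \<and> s / (\<alpha> - 1) < y")
    case True
    then have "0 < s / (\<alpha> - 1)" using \<alpha> by simp
    then have "0 < y" using True by linarith
    then show ?thesis using True by (simp add: indicator_def not_le)
  next
    case False
    then have "peak_density s y = 0" by (auto simp: peak_density_def)
    then show ?thesis by simp
  qed
  have "(\<integral>\<^sup>+b. indicator {..0} b \<partial>peak_law) = (\<integral>\<^sup>+s. \<integral>\<^sup>+y. ennreal (peak_density s y) * indicator {..0} (s powr (1 / \<alpha>) / y) \<partial>lborel \<partial>lborel)"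
    by (rule nn_integral_peak_law) measurable
  also have "\<dots> = 0" unfolding z by simp
  finally have "emeasure peak_law {..0} = 0" by simp
  then have "AE b in peak_law. b \<notin> {..0}" by (intro AE_not_in) (simp add: null_sets_def)
  then show ?thesis by eventually_elim simp
qed

text \<open>For fixed \<open>(s, y)\<close> the argument of \<open>g\<close> converges since
  rounding to sites disappears in the scale, and \<open>peak_liminf\<close> bounds the remaining
  factor. Where \<open>s / (\<alpha> - 1) < y\<close> fails, the density is 0 and the pointwise
  bound is trivial.\<close>

theorem peak_mass_liminf:
  fixes C \<Lambda> :: real and F g l :: "real \<Rightarrow> real" and \<tau> :: "nat \<Rightarrow> real"
  assumes \<tau>: "filterlim \<tau> at_top sequentially" and \<tau>1: "\<And>k. 1 < \<tau> k"
    and g: "continuous_on UNIV g" "\<And>b. 0 \<le> g b"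
    and F [measurable]: "F \<in> borel_measurable borel" and F_bd: "\<And>u. 0 \<le> F u" "\<And>u. F u \<le> C"
    and F_lip: "\<And>u w. \<bar>F u - F w\<bar> \<le> \<Lambda> * \<bar>u - w\<bar>"
    and l [measurable]: "l \<in> borel_measurable borel"
    and F_lim: "\<And>\<kappa> s y. 0 < \<kappa> \<Longrightarrow> \<kappa> < 1 \<Longrightarrow> 0 < s \<Longrightarrow> 0 < y \<Longrightarrow>
      (\<lambda>k. \<integral>v. F (mirror_sum \<kappa> (scale_a \<alpha> (\<tau> k) * y) (peak_site \<alpha> s (\<tau> k)) v) \<partial>P) \<longlonglongrightarrow> l (s powr (1 / \<alpha>) / y)"
  shows "(\<integral>\<^sup>+b. ennreal (g b * l b) \<partial>peak_law) \<le> liminf (\<lambda>k. peak_mass g F (\<tau> k))"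
proof -
  have [measurable]: "g \<in> borel_measurable borel" using g(1) by (rule borel_measurable_continuous_onI)
  have \<tau>0: "0 \<le> \<tau> k" for k using \<tau>1[of k] by simp
  have [measurable]: "peak_mean F (\<tau> k) n \<in> borel_measurable borel" for k n
    by (intro peak_mean_measurable F \<tau>0)
  have [measurable]: "(\<lambda>(s, y). scaled_mass g F (\<tau> k) s y) \<in> borel_measurable (borel \<Otimes>\<^sub>M borel)" for k
  proof -
    have "(\<lambda>w. peak_mean F (\<tau> k) (nat \<lfloor>scale_r \<alpha> (\<tau> k) * fst w\<rfloor>) (scale_a \<alpha> (\<tau> k) * snd w)) \<in> borel_measurable (borel \<Otimes>\<^sub>M borel)"
      by (rule measurable_compose_countable[where f="\<lambda>n w. peak_mean F (\<tau> k) n (scale_a \<alpha> (\<tau> k) * snd w)"]) measurable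
    then show ?thesis unfolding scaled_mass_def split_beta' by measurable
  qed
  have pt: "ennreal (peak_density s y) * ennreal (g (s powr (1 / \<alpha>) / y) * l (s powr (1 / \<alpha>) / y)) \<le> liminf (\<lambda>k. scaled_mass g F (\<tau> k) s y)" for s y
  proof (cases "0 < s \<and> s / (\<alpha> - 1) < y")
    case True
    then have s: "0 < s" and sy: "s / (\<alpha> - 1) < y" by auto
    have "0 < s / (\<alpha> - 1)" using s \<alpha> by simp
    then have y: "0 < y" using sy by linarith
    define b where "b k = real (peak_site \<alpha> s (\<tau> k)) powr (1 / \<alpha>) / (scale_a \<alpha> (\<tau> k) * y)" for k
    have b: "b \<longlonglongrightarrow> s powr (1 / \<alpha>) / y"
    proof -
      have "(\<lambda>k. (real (peak_site \<alpha> s (\<tau> k)) / scale_r \<alpha> (\<tau> k)) powr (1 / \<alpha>) / y) \<longlonglongrightarrow> s powr (1 / \<alpha>) / y"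
        using s y by (intro tendsto_intros site_over_scale[where j=0, unfolded diff_zero, OF filterlim_compose[OF scale_at_top(2)[OF \<alpha>] \<tau>] s]) auto
      moreover have "(real (peak_site \<alpha> s (\<tau> k)) / scale_r \<alpha> (\<tau> k)) powr (1 / \<alpha>) / y = b k" for k
      proof -
        note sc = scale_r_eq_powr[OF \<alpha> \<tau>1[of k]]
        have "scale_r \<alpha> (\<tau> k) powr (1 / \<alpha>) = scale_a \<alpha> (\<tau> k)" using sc \<alpha> by (simp add: powr_powr)
        then show ?thesis using sc by (simp add: powr_divide b_def)
      qed
      ultimately show ?thesis by simp
    qed
    have "(\<lambda>k. g (b k)) \<longlonglongrightarrow> g (s powr (1 / \<alpha>) / y)"
      using g(1) b by (metis continuous_on_eq_continuous_at isCont_tendsto_compose open_UNIV UNIV_I)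
    then have 1: "(\<lambda>k. \<alpha> * y powr (- \<alpha> - 1) * g (b k)) \<longlonglongrightarrow> \<alpha> * y powr (- \<alpha> - 1) * g (s powr (1 / \<alpha>) / y)" by (intro tendsto_intros)
    have "ennreal (l (s powr (1 / \<alpha>) / y) * exp (- ((y - s / (\<alpha> - 1)) powr (1 - \<alpha>))))
      \<le> liminf (\<lambda>k. peak_mean F (\<tau> k) (peak_site \<alpha> s (\<tau> k)) (scale_a \<alpha> (\<tau> k) * y))"
      unfolding peak_mean_def
      by (rule peak_liminf[OF s sy \<tau> F F_bd F_lip]) (use F_lim s y in auto)
    from liminf_ennreal_mult[OF 1 _ this]
    have 2: "ennreal (\<alpha> * y powr (- \<alpha> - 1) * g (s powr (1 / \<alpha>) / y) * (l (s powr (1 / \<alpha>) / y) * exp (- ((y - s / (\<alpha> - 1)) powr (1 - \<alpha>)))))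
      \<le> liminf (\<lambda>k. ennreal (\<alpha> * y powr (- \<alpha> - 1) * g (b k)) * peak_mean F (\<tau> k) (peak_site \<alpha> s (\<tau> k)) (scale_a \<alpha> (\<tau> k) * y))"
      using \<alpha> g(2) by simp
    also have "\<dots> = liminf (\<lambda>k. scaled_mass g F (\<tau> k) s y)"
    proof (rule Liminf_eq)
      have "filterlim (\<lambda>k. scale_a \<alpha> (\<tau> k) * y) at_top sequentially"
        by (rule filterlim_at_top_mult_tendsto_pos[OF tendsto_const y filterlim_compose[OF scale_at_top(1)[OF \<alpha>] \<tau>]])
      then have "eventually (\<lambda>k. 1 < scale_a \<alpha> (\<tau> k) * y) sequentially" unfolding filterlim_at_top_dense by simp
      then show "eventually (\<lambda>k. ennreal (\<alpha> * y powr (- \<alpha> - 1) * g (b k)) * peak_mean F (\<tau> k) (peak_site \<alpha> s (\<tau> k)) (scale_a \<alpha> (\<tau> k) * y)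
        = scaled_mass g F (\<tau> k) s y) sequentially"
        by eventually_elim (use s in \<open>simp add: scaled_mass_def b_def\<close>)
    qed
    also have "ennreal (\<alpha> * y powr (- \<alpha> - 1) * g (s powr (1 / \<alpha>) / y) * (l (s powr (1 / \<alpha>) / y) * exp (- ((y - s / (\<alpha> - 1)) powr (1 - \<alpha>)))))
      = ennreal (peak_density s y) * ennreal (g (s powr (1 / \<alpha>) / y) * l (s powr (1 / \<alpha>) / y))"
      unfolding peak_density_def using True \<alpha> by (subst ennreal_mult'[symmetric]) (auto simp: mult_ac)
    finally show ?thesis .
  next
    case False
    then have "peak_density s y = 0" by (auto simp: peak_density_def)
    then show ?thesis by simp
  qed
  have "(\<integral>\<^sup>+b. ennreal (g b * l b) \<partial>peak_law) = (\<integral>\<^sup>+s. \<integral>\<^sup>+y. ennreal (peak_density s y) * ennreal (g (s powr (1 / \<alpha>) / y) * l (s powr (1 / \<alpha>) / y)) \<partial>lborel \<partial>lborel)"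
    by (rule nn_integral_peak_law) measurable
  also have "\<dots> \<le> (\<integral>\<^sup>+s. \<integral>\<^sup>+y. liminf (\<lambda>k. scaled_mass g F (\<tau> k) s y) \<partial>lborel \<partial>lborel)"
    by (intro nn_integral_mono pt)
  also have "\<dots> \<le> (\<integral>\<^sup>+s. liminf (\<lambda>k. \<integral>\<^sup>+y. scaled_mass g F (\<tau> k) s y \<partial>lborel) \<partial>lborel)"
    by (intro nn_integral_mono nn_integral_liminf) measurable
  also have "\<dots> \<le> liminf (\<lambda>k. \<integral>\<^sup>+s. \<integral>\<^sup>+y. scaled_mass g F (\<tau> k) s y \<partial>lborel \<partial>lborel)"
    by (intro nn_integral_liminf) measurable
  also have "\<dots> = liminf (\<lambda>k. peak_mass g F (\<tau> k))"
    using peak_mass_eq[OF _ F g(2) \<tau>1] by simp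
  finally show ?thesis .
qed

end

section \<open>Weak limits\<close>

text \<open>Limits along sequences suffice, and the sequences may be kept above 1, where the
  logarithm and the scales are positive.\<close>

lemma tendsto_at_top_sequences_gt_1:
  fixes f :: "real \<Rightarrow> real"
  assumes *: "\<And>\<tau>. filterlim \<tau> at_top sequentially \<Longrightarrow> (\<And>k. 1 < \<tau> k) \<Longrightarrow> (\<lambda>k. f (\<tau> k)) \<longlonglongrightarrow> l"
  shows "(f \<longlongrightarrow> l) at_top"
proof (rule tendsto_at_topI_sequentially)
  fix \<tau> :: "nat \<Rightarrow> real" assume \<tau>: "filterlim \<tau> at_top sequentially"
  have "eventually (\<lambda>k. 2 \<le> \<tau> k) sequentially" using \<tau> unfolding filterlim_at_top by simp
  then have ev: "eventually (\<lambda>k. max 2 (\<tau> k) = \<tau> k) sequentially" by eventually_elim simp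
  have "(\<lambda>k. f (max 2 (\<tau> k))) \<longlonglongrightarrow> l"
    by (rule *) (use \<tau> filterlim_cong[OF refl refl ev] in auto)
  then show "(\<lambda>k. f (\<tau> k)) \<longlonglongrightarrow> l"
    by (rule Lim_transform_eventually) (use ev in eventually_elim, simp)
qed

text \<open>A lower bound for \<open>c - h k\<close> is an upper bound for \<open>h k\<close> in
  disguise, so two liminf inequalities make a limit.\<close>

lemma (in prob_space) liminf_squeeze:
  fixes h :: "nat \<Rightarrow> 'a \<Rightarrow> real"
  assumes [measurable]: "\<And>k. h k \<in> borel_measurable M" and h: "\<And>k \<omega>. 0 \<le> h k \<omega>" "\<And>k \<omega>. h k \<omega> \<le> c" and u: "0 \<le> u" "u \<le> c"
    and lo: "ennreal u \<le> liminf (\<lambda>k. \<integral>\<^sup>+\<omega>. ennreal (h k \<omega>) \<partial>M)"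
    and hi: "ennreal (c - u) \<le> liminf (\<lambda>k. \<integral>\<^sup>+\<omega>. ennreal (c - h k \<omega>) \<partial>M)"
  shows "(\<lambda>k. expectation (h k)) \<longlonglongrightarrow> u"
proof -
  have ih: "integrable M (h k)" for k by (rule integrable_const_bound[where B=c]) (use h in auto)
  have e1: "(\<integral>\<^sup>+\<omega>. ennreal (h k \<omega>) \<partial>M) = ennreal (expectation (h k))" for k
    by (rule nn_integral_eq_integral[OF ih]) (use h in auto)
  have e2: "(\<integral>\<^sup>+\<omega>. ennreal (c - h k \<omega>) \<partial>M) = ennreal (c - expectation (h k))" for k
    using h ih[of k] by (subst nn_integral_eq_integral) (auto simp: prob_space)
  have E: "0 \<le> expectation (h k)" "0 \<le> c - expectation (h k)" for k
  proof -
    show "0 \<le> expectation (h k)" using h by simp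
    have "expectation (h k) \<le> expectation (\<lambda>_. c)" by (intro integral_mono ih) (use h in auto)
    then show "0 \<le> c - expectation (h k)" by (simp add: prob_space)
  qed
  have ev: "eventually (\<lambda>k. w < X k) sequentially" if "ennreal z \<le> liminf (\<lambda>k. ennreal (X k))" "w < z" "\<And>k. 0 \<le> X k" "0 \<le> z" for w z :: real and X
  proof (cases "0 \<le> w")
    case True
    have "ennreal w < ennreal z" using that True by (simp add: ennreal_less_iff)
    then have "eventually (\<lambda>k. ennreal w < ennreal (X k)) sequentially" using that(1) unfolding le_Liminf_iff by blast
    then show ?thesis by eventually_elim (use that True in \<open>simp add: ennreal_less_iff\<close>)
  next
    case False
    then have "w < X k" for k using that(3)[of k] by linarith
    then show ?thesis by simp
  qed
  show ?thesis
  proof (rule order_tendstoI)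
    fix w assume "w < u"
    then show "eventually (\<lambda>k. w < expectation (h k)) sequentially" using ev[OF lo[unfolded e1]] E u by auto
  next
    fix w assume "u < w"
    then have cw: "c - w < c - u" by simp
    have "eventually (\<lambda>k. c - w < c - expectation (h k)) sequentially"
      by (rule ev[OF hi[unfolded e2] cw]) (use E u in auto)
    then show "eventually (\<lambda>k. expectation (h k) < w) sequentially" by eventually_elim simp
  qed
qed

lemma cos_sin_lipschitz:
  fixes a b :: real
  shows "\<bar>cos a - cos b\<bar> \<le> \<bar>a - b\<bar>" "\<bar>sin a - sin b\<bar> \<le> \<bar>a - b\<bar>"
proof -
  have s: "\<bar>2 * x * sin ((b - a) / 2)\<bar> \<le> \<bar>a - b\<bar>" "\<bar>2 * sin ((a - b) / 2) * x\<bar> \<le> \<bar>a - b\<bar>" if "\<bar>x\<bar> \<le> 1" for x :: real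
  proof -
    have *: "\<bar>x\<bar> * \<bar>sin w\<bar> \<le> 1 * \<bar>w\<bar>" for w using that abs_sin_x_le_abs_x by (intro mult_mono) auto
    show "\<bar>2 * x * sin ((b - a) / 2)\<bar> \<le> \<bar>a - b\<bar>" using *[of "(b - a) / 2"] by (simp add: abs_mult)
    show "\<bar>2 * sin ((a - b) / 2) * x\<bar> \<le> \<bar>a - b\<bar>" using *[of "(a - b) / 2"] by (simp add: abs_mult mult_ac)
  qed
  show "\<bar>cos a - cos b\<bar> \<le> \<bar>a - b\<bar>" unfolding cos_diff_cos by (rule s) simp
  show "\<bar>sin a - sin b\<bar> \<le> \<bar>a - b\<bar>" unfolding sin_diff_sin by (rule s) simp
qed

section \<open>Transfer to the given probability space and convergence in law\<close>

locale env_coupling = pareto_env \<alpha> \<beta> p \<mu> + M: prob_space M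
  for \<alpha> \<beta> :: real and p :: "nat \<Rightarrow> real" and \<mu> :: "int + nat \<Rightarrow> real measure" and M :: "'a measure" +
  fixes V :: "'a \<Rightarrow> int + nat \<Rightarrow> real" and Z :: "real \<Rightarrow> 'a \<Rightarrow> nat"
  assumes V [measurable]: "V \<in> measurable M P" and distr_V: "distr M P V = P"
    and Z_meas: "\<And>t. 0 < t \<Longrightarrow> Z t \<in> measurable M (count_space UNIV)"
    and Z_wins: "\<And>t. 0 < t \<Longrightarrow> AE \<omega> in M. \<forall>n. wins (potv (V \<omega>)) t n \<longrightarrow> Z t \<omega> = n"
begin

definition pot :: "'a \<Rightarrow> int \<Rightarrow> real" where "pot \<omega> = potv (V \<omega>)"
definition scaled_peak :: "real \<Rightarrow> 'a \<Rightarrow> real" where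
  "scaled_peak t \<omega> = real (Z t \<omega>) powr (1 / \<alpha>) / pot \<omega> (int (Z t \<omega>))"
definition ratio :: "real \<Rightarrow> 'a \<Rightarrow> real" where
  "ratio t \<omega> = pam_u (pot \<omega>) t (int (Z t \<omega>)) / pam_u (pot \<omega>) t (- int (Z t \<omega>))"
definition positive :: "real \<Rightarrow> 'a \<Rightarrow> bool" where
  "positive t \<omega> \<longleftrightarrow> 0 < pam_u (pot \<omega>) t (int (Z t \<omega>)) \<and> 0 < pam_u (pot \<omega>) t (- int (Z t \<omega>))"

lemma pot_measurable [measurable]: "(\<lambda>\<omega>. pot \<omega> z) \<in> borel_measurable M"
  unfolding pot_def by (rule measurable_compose[OF V potv_measurable])

lemma peak_measurable:
  assumes "0 < t"
  shows "scaled_peak t \<in> borel_measurable M" "ratio t \<in> borel_measurable M" "Measurable.pred M (positive t)"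
proof -
  have [measurable]: "Z t \<in> measurable M (count_space UNIV)" by (rule Z_meas[OF assms])
  have u: "(\<lambda>\<omega>. pam_u (pot \<omega>) t z) \<in> borel_measurable M" for z
    by (rule pam_u_measurable) (use assms in auto)
  have [measurable]: "(\<lambda>\<omega>. pam_u (pot \<omega>) t (int (Z t \<omega>))) \<in> borel_measurable M" "(\<lambda>\<omega>. pam_u (pot \<omega>) t (- int (Z t \<omega>))) \<in> borel_measurable M"
    "(\<lambda>\<omega>. pot \<omega> (int (Z t \<omega>))) \<in> borel_measurable M"
    by (rule measurable_compose_countable[OF u] measurable_compose_countable[OF pot_measurable]; measurable)+
  show "scaled_peak t \<in> borel_measurable M" unfolding scaled_peak_def[abs_def] by measurable
  show "ratio t \<in> borel_measurable M" unfolding ratio_def[abs_def] by measurable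
  show "Measurable.pred M (positive t)" unfolding positive_def[abs_def] by measurable
qed

abbreviation observed :: "(real \<Rightarrow> real) \<Rightarrow> (real \<Rightarrow> real) \<Rightarrow> real \<Rightarrow> ennreal" where
  "observed g F t \<equiv> \<integral>\<^sup>+\<omega>. ennreal (g (scaled_peak t \<omega>) * F (ln (ratio t \<omega>))) * indicator {\<omega>. positive t \<omega>} \<omega> \<partial>M"

text \<open>Only \<open>n = Z t \<omega>\<close> can win, so the series collapses to one term.
  Environments without a winner contribute 0 on the left and something nonnegative on the
  right.\<close>

lemma peak_mass_le:
  assumes [measurable]: "g \<in> borel_measurable borel" "F \<in> borel_measurable borel" and nn: "\<And>b. 0 \<le> g b" "\<And>u. 0 \<le> F u" and t: "0 < t"
  shows "peak_mass g F t \<le> observed g F t"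
proof -
  define H where "H n v = ennreal (g (real n powr (1 / \<alpha>) / v (Inl (int n)))) * peak_integrand F t n v" for n v
  have [measurable]: "peak_integrand F t n \<in> borel_measurable P" for n using t by (intro peak_integrand_measurable) auto
  have Hm [measurable]: "H n \<in> borel_measurable P" for n unfolding H_def[abs_def] by measurable
  have "peak_mass g F t = (\<Sum>n. \<integral>\<^sup>+v. H n v \<partial>distr M P V)"
    unfolding peak_mass_def H_def distr_V ..
  also have "\<dots> = (\<Sum>n. \<integral>\<^sup>+\<omega>. H n (V \<omega>) \<partial>M)" by (subst nn_integral_distr) auto
  also have "\<dots> = (\<integral>\<^sup>+\<omega>. (\<Sum>n. H n (V \<omega>)) \<partial>M)" by (rule nn_integral_suminf[symmetric]) measurable
  also have "\<dots> \<le> observed g F t"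
  proof (rule nn_integral_mono_AE)
    show "AE \<omega> in M. (\<Sum>n. H n (V \<omega>)) \<le> ennreal (g (scaled_peak t \<omega>) * F (ln (ratio t \<omega>))) * indicator {\<omega>. positive t \<omega>} \<omega>"
      using Z_wins[OF t]
    proof eventually_elim
      case (elim \<omega>)
      have "H n (V \<omega>) = 0" if "n \<noteq> Z t \<omega>" for n
      proof -
        have "\<not> wins (potv (V \<omega>)) t n" using elim that by auto
        then show ?thesis by (simp add: H_def peak_integrand_def)
      qed
      then have "(\<Sum>n. H n (V \<omega>)) = H (Z t \<omega>) (V \<omega>)" using suminf_finite[of "{Z t \<omega>}" "\<lambda>n. H n (V \<omega>)"] by simp
      also have "\<dots> \<le> ennreal (g (scaled_peak t \<omega>) * F (ln (ratio t \<omega>))) * indicator {\<omega>. positive t \<omega>} \<omega>"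
      proof (cases "wins (potv (V \<omega>)) t (Z t \<omega>)")
        case True
        then have "positive t \<omega>" by (simp add: wins_def positive_def pot_def)
        then show ?thesis using True nn
          by (simp add: H_def peak_integrand_def scaled_peak_def ratio_def pot_def potv_def log_ratio_def ennreal_mult)
      qed (simp add: H_def peak_integrand_def)
      finally show ?case .
    qed
  qed
  finally show ?thesis .
qed

lemma peak_liminf_M:
  fixes F g l :: "real \<Rightarrow> real" and C \<Lambda> :: real
  assumes \<tau>: "filterlim \<tau> at_top sequentially" "\<And>k. 1 < \<tau> k"
    and g: "continuous_on UNIV g" "\<And>b. 0 \<le> g b"
    and F [measurable]: "F \<in> borel_measurable borel" and F_bd: "\<And>u. 0 \<le> F u" "\<And>u. F u \<le> C"
    and F_lip: "\<And>u w. \<bar>F u - F w\<bar> \<le> \<Lambda> * \<bar>u - w\<bar>"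
    and l [measurable]: "l \<in> borel_measurable borel"
    and F_lim: "\<And>\<kappa> s y. 0 < \<kappa> \<Longrightarrow> \<kappa> < 1 \<Longrightarrow> 0 < s \<Longrightarrow> 0 < y \<Longrightarrow>
      (\<lambda>k. \<integral>v. F (mirror_sum \<kappa> (scale_a \<alpha> (\<tau> k) * y) (peak_site \<alpha> s (\<tau> k)) v) \<partial>P) \<longlonglongrightarrow> l (s powr (1 / \<alpha>) / y)"
    and gl: "\<And>b. 0 \<le> g b * l b" "\<And>b. g b * l b \<le> K"
  shows "ennreal (\<integral>b. g b * l b \<partial>peak_law) \<le> liminf (\<lambda>k. observed g F (\<tau> k))"
proof -
  interpret B: prob_space peak_law by (rule prob_space_peak_law)
  have [measurable]: "g \<in> borel_measurable borel" using g(1) by (rule borel_measurable_continuous_onI)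
  have "integrable peak_law (\<lambda>b. g b * l b)"
    by (rule B.integrable_const_bound[where B=K]) (use gl in auto)
  then have "ennreal (\<integral>b. g b * l b \<partial>peak_law) = (\<integral>\<^sup>+b. ennreal (g b * l b) \<partial>peak_law)"
    using gl by (subst nn_integral_eq_integral) auto
  also have "\<dots> \<le> liminf (\<lambda>k. peak_mass g F (\<tau> k))"
    by (rule peak_mass_liminf[OF \<tau> g F F_bd F_lip l F_lim])
  also have "\<dots> \<le> liminf (\<lambda>k. observed g F (\<tau> k))"
  proof (rule Liminf_mono, rule always_eventually, rule allI)
    fix k
    have "0 < \<tau> k" using \<tau>(2)[of k] by simp
    then show "peak_mass g F (\<tau> k) \<le> observed g F (\<tau> k)"
      using g F_bd by (intro peak_mass_le) auto
  qed
  finally show ?thesis .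
qed

lemma liminf_mono_indicator:
  assumes "ennreal u \<le> liminf (\<lambda>k. \<integral>\<^sup>+\<omega>. ennreal (f k \<omega>) * indicator (A k) \<omega> \<partial>M)"
  shows "ennreal u \<le> liminf (\<lambda>k. \<integral>\<^sup>+\<omega>. ennreal (f k \<omega>) \<partial>M)"
  using assms
  by (rule order_trans) (intro Liminf_mono always_eventually allI nn_integral_mono, auto simp: indicator_def)

text \<open>With \<open>F = 1\<close> the ratio drops out. The bound is used for the nonnegative
  functions \<open>f + C\<close> and \<open>C - f\<close>.\<close>

lemma scaled_peak_lim:
  fixes f :: "real \<Rightarrow> real"
  assumes \<tau>: "filterlim \<tau> at_top sequentially" "\<And>k. 1 < \<tau> k"
    and f: "continuous_on UNIV f" "\<And>x. \<bar>f x\<bar> \<le> C"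
  shows "(\<lambda>k. \<integral>\<omega>. f (scaled_peak (\<tau> k) \<omega>) \<partial>M) \<longlonglongrightarrow> (\<integral>b. f b \<partial>peak_law)"
proof -
  interpret B: prob_space peak_law by (rule prob_space_peak_law)
  have [measurable]: "f \<in> borel_measurable borel" using f(1) by (rule borel_measurable_continuous_onI)
  have [measurable]: "scaled_peak (\<tau> k) \<in> borel_measurable M" for k using peak_measurable(1)[of "\<tau> k"] \<tau>(2)[of k] by simp
  have f2: "- C \<le> f x" "f x \<le> C" for x using f(2)[of x] by (auto simp: abs_le_iff)
  have if': "integrable peak_law f" by (rule B.integrable_const_bound[where B=C]) (use f in auto)
  have ifM: "integrable M (\<lambda>\<omega>. f (scaled_peak (\<tau> k) \<omega>))" for k by (rule M.integrable_const_bound[where B=C]) (use f in auto)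
  have one: "ennreal (\<integral>b. g b \<partial>peak_law) \<le> liminf (\<lambda>k. \<integral>\<^sup>+\<omega>. ennreal (g (scaled_peak (\<tau> k) \<omega>)) \<partial>M)"
    if g: "continuous_on UNIV g" "\<And>x. 0 \<le> g x" "\<And>x. g x \<le> 2 * C" for g
  proof -
    have "ennreal (\<integral>b. g b * (\<lambda>_. 1) b \<partial>peak_law) \<le> liminf (\<lambda>k. observed g (\<lambda>_. 1) (\<tau> k))"
      by (rule peak_liminf_M[OF \<tau> g(1,2), where C=1 and \<Lambda>=0 and K="2 * C"]) (use g in \<open>auto simp: P.prob_space\<close>)
    then show ?thesis using liminf_mono_indicator by simp
  qed
  have "(\<lambda>k. \<integral>\<omega>. f (scaled_peak (\<tau> k) \<omega>) + C \<partial>M) \<longlonglongrightarrow> (\<integral>b. f b + C \<partial>peak_law)"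
  proof (rule M.liminf_squeeze[where c="2 * C"])
    have i: "(\<integral>b. f b + C \<partial>peak_law) = (\<integral>b. f b \<partial>peak_law) + C" using if' by (simp add: B.prob_space)
    have "(\<integral>b. f b \<partial>peak_law) \<le> (\<integral>b. C \<partial>peak_law)" "(\<integral>b. - C \<partial>peak_law) \<le> (\<integral>b. f b \<partial>peak_law)"
      by (intro integral_mono if'; use f2 in simp)+
    then show "0 \<le> (\<integral>b. f b + C \<partial>peak_law)" "(\<integral>b. f b + C \<partial>peak_law) \<le> 2 * C" unfolding i by (simp_all add: B.prob_space)
    show "ennreal (\<integral>b. f b + C \<partial>peak_law) \<le> liminf (\<lambda>k. \<integral>\<^sup>+\<omega>. ennreal (f (scaled_peak (\<tau> k) \<omega>) + C) \<partial>M)"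
    proof (rule one)
      show "0 \<le> f x + C" "f x + C \<le> 2 * C" for x using f2[of x] by linarith+
    qed (auto intro!: continuous_intros f(1))
    have "ennreal (\<integral>b. C - f b \<partial>peak_law) \<le> liminf (\<lambda>k. \<integral>\<^sup>+\<omega>. ennreal (C - f (scaled_peak (\<tau> k) \<omega>)) \<partial>M)"
    proof (rule one)
      show "0 \<le> C - f x" "C - f x \<le> 2 * C" for x using f2[of x] by linarith+
    qed (auto intro!: continuous_intros f(1))
    moreover have "(\<integral>b. C - f b \<partial>peak_law) = 2 * C - (\<integral>b. f b + C \<partial>peak_law)" unfolding i using if' by (simp add: B.prob_space)
    moreover have "2 * C - (x + C) = C - x" for x by simp
    ultimately show "ennreal (2 * C - (\<integral>b. f b + C \<partial>peak_law)) \<le> liminf (\<lambda>k. \<integral>\<^sup>+\<omega>. ennreal (2 * C - (f (scaled_peak (\<tau> k) \<omega>) + C)) \<partial>M)" by (simp only:)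
  next
    fix k \<omega>
    show "0 \<le> f (scaled_peak (\<tau> k) \<omega>) + C" "f (scaled_peak (\<tau> k) \<omega>) + C \<le> 2 * C" using f2[of "scaled_peak (\<tau> k) \<omega>"] by auto
  qed measurable
  then have "(\<lambda>k. (\<integral>\<omega>. f (scaled_peak (\<tau> k) \<omega>) \<partial>M) + C) \<longlonglongrightarrow> (\<integral>b. f b \<partial>peak_law) + C"
    using ifM if' by (simp add: M.prob_space B.prob_space)
  from tendsto_diff[OF this tendsto_const[of C]] show ?thesis by simp
qed

text \<open>With \<open>g = F = 1\<close> the lower bound is the full mass 1. Positivity also
  excludes the default value 0 of an infinite expectation.\<close>

lemma positive_lim:
  assumes \<tau>: "filterlim \<tau> at_top sequentially" "\<And>k. 1 < \<tau> k"
  shows "(\<lambda>k. M.prob {\<omega>\<in>space M. \<not> positive (\<tau> k) \<omega>}) \<longlonglongrightarrow> 0"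
proof -
  interpret B: prob_space peak_law by (rule prob_space_peak_law)
  have [measurable]: "Measurable.pred M (positive (\<tau> k))" for k using peak_measurable(3)[of "\<tau> k"] \<tau>(2)[of k] by simp
  have "ennreal (\<integral>b. (\<lambda>_. 1) b * (\<lambda>_. 1) b \<partial>peak_law) \<le> liminf (\<lambda>k. observed (\<lambda>_. 1) (\<lambda>_. 1) (\<tau> k))"
    by (rule peak_liminf_M[OF \<tau>, where C=1 and \<Lambda>=0 and K=1]) (auto simp: P.prob_space)
  moreover have "(indicator {\<omega>. positive (\<tau> k) \<omega>} \<omega> :: ennreal) = ennreal (of_bool (positive (\<tau> k) \<omega>))" for k \<omega> by (simp add: indicator_def)
  ultimately have lo: "ennreal 1 \<le> liminf (\<lambda>k. \<integral>\<^sup>+\<omega>. ennreal (of_bool (positive (\<tau> k) \<omega>)) \<partial>M)"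
    by (simp add: B.prob_space)
  have "(\<lambda>k. \<integral>\<omega>. (of_bool (positive (\<tau> k) \<omega>) :: real) \<partial>M) \<longlonglongrightarrow> 1"
    by (rule M.liminf_squeeze[where c=1]) (use lo in auto)
  moreover have "M.prob {\<omega>\<in>space M. \<not> positive (\<tau> k) \<omega>} = 1 - (\<integral>\<omega>. (of_bool (positive (\<tau> k) \<omega>) :: real) \<partial>M)" for k
  proof -
    have "(\<integral>\<omega>. (of_bool (positive (\<tau> k) \<omega>) :: real) \<partial>M) = (\<integral>\<omega>. indicator {\<omega>\<in>space M. positive (\<tau> k) \<omega>} \<omega> \<partial>M :: real)"
      by (intro Bochner_Integration.integral_cong) (auto simp: indicator_def)
    then show ?thesis using M.prob_neg[of "positive (\<tau> k)"] by simp
  qed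
  ultimately show ?thesis using tendsto_diff[OF tendsto_const[of 1]] by fastforce
qed

definition limit_char :: "real \<Rightarrow> real" where
  "limit_char \<theta> = (\<integral>b. exp (- (\<beta> * gap_exponent \<theta> b)) \<partial>peak_law)"

text \<open>The lower bound is applied to \<open>1 + h\<close> and \<open>1 - h\<close>, both
  nonnegative, bounded and Lipschitz. \<open>l b\<close> is the limiting mean of \<open>h\<close>
  given that the scaled peak is near \<open>b\<close>.\<close>

lemma trig_lim:
  fixes h :: "real \<Rightarrow> real"
  assumes \<tau>: "filterlim \<tau> at_top sequentially" "\<And>k. 1 < \<tau> k"
    and h [measurable]: "h \<in> borel_measurable borel" and h_bd: "\<And>u. \<bar>h u\<bar> \<le> 1" and h_lip: "\<And>u w. \<bar>h u - h w\<bar> \<le> \<Lambda> * \<bar>u - w\<bar>"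
    and l [measurable]: "l \<in> borel_measurable borel" and l_bd: "\<And>b. \<bar>l b\<bar> \<le> 1"
    and h_lim: "\<And>\<kappa> s y. 0 < \<kappa> \<Longrightarrow> \<kappa> < 1 \<Longrightarrow> 0 < s \<Longrightarrow> 0 < y \<Longrightarrow>
      (\<lambda>k. \<integral>v. h (mirror_sum \<kappa> (scale_a \<alpha> (\<tau> k) * y) (peak_site \<alpha> s (\<tau> k)) v) \<partial>P) \<longlonglongrightarrow> l (s powr (1 / \<alpha>) / y)"
  shows "(\<lambda>k. \<integral>\<omega>. h (ln (ratio (\<tau> k) \<omega>)) \<partial>M) \<longlonglongrightarrow> (\<integral>b. l b \<partial>peak_law)"
proof -
  interpret B: prob_space peak_law by (rule prob_space_peak_law)
  have [measurable]: "ratio (\<tau> k) \<in> borel_measurable M" for k using peak_measurable(2)[of "\<tau> k"] \<tau>(2)[of k] by simp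
  have hb: "- 1 \<le> h u" "h u \<le> 1" for u using h_bd[of u] by (auto simp: abs_le_iff)
  have lb: "- 1 \<le> l u" "l u \<le> 1" for u using l_bd[of u] by (auto simp: abs_le_iff)
  have il: "integrable peak_law l" by (rule B.integrable_const_bound[where B=1]) (use l_bd in auto)
  have ih: "integrable M (\<lambda>\<omega>. h (ln (ratio (\<tau> k) \<omega>)))" for k by (rule M.integrable_const_bound[where B=1]) (use h_bd in auto)
  have ihP: "integrable P (\<lambda>v. h (mirror_sum \<kappa> x N v))" for \<kappa> x N by (rule P.integrable_const_bound[where B=1]) (use h_bd in auto)
  have one: "ennreal (\<integral>b. 1 * (1 + c * l b) \<partial>peak_law) \<le> liminf (\<lambda>k. \<integral>\<^sup>+\<omega>. ennreal (1 + c * h (ln (ratio (\<tau> k) \<omega>))) \<partial>M)"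
    if c: "c = 1 \<or> c = - 1" for c :: real
  proof -
    have "ennreal (\<integral>b. (\<lambda>_. 1) b * (1 + c * l b) \<partial>peak_law) \<le> liminf (\<lambda>k. observed (\<lambda>_. 1) (\<lambda>u. 1 + c * h u) (\<tau> k))"
    proof (rule peak_liminf_M[OF \<tau>, where C=2 and \<Lambda>="\<Lambda>" and K=2 and F="\<lambda>u. 1 + c * h u" and l="\<lambda>b. 1 + c * l b"])
      show "\<bar>1 + c * h u - (1 + c * h w)\<bar> \<le> \<Lambda> * \<bar>u - w\<bar>" for u w using c h_lip[of u w] by (auto simp: abs_minus_commute)
      fix \<kappa> s y :: real assume a: "0 < \<kappa>" "\<kappa> < 1" "0 < s" "0 < y"
      have "(\<lambda>k. 1 + c * (\<integral>v. h (mirror_sum \<kappa> (scale_a \<alpha> (\<tau> k) * y) (peak_site \<alpha> s (\<tau> k)) v) \<partial>P)) \<longlonglongrightarrow> 1 + c * l (s powr (1 / \<alpha>) / y)"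
        by (intro tendsto_intros h_lim a)
      then show "(\<lambda>k. \<integral>v. 1 + c * h (mirror_sum \<kappa> (scale_a \<alpha> (\<tau> k) * y) (peak_site \<alpha> s (\<tau> k)) v) \<partial>P) \<longlonglongrightarrow> 1 + c * l (s powr (1 / \<alpha>) / y)"
        using ihP by (simp add: P.prob_space)
    next
      fix u
      show "0 \<le> 1 + c * h u" "1 + c * h u \<le> 2" using c hb[of u] by auto
    next
      fix b
      show "0 \<le> 1 * (1 + c * l b)" "1 * (1 + c * l b) \<le> 2" using c lb[of b] by auto
    qed (auto intro!: continuous_intros)
    then show ?thesis using liminf_mono_indicator by simp
  qed
  have "(\<lambda>k. \<integral>\<omega>. 1 + h (ln (ratio (\<tau> k) \<omega>)) \<partial>M) \<longlonglongrightarrow> (\<integral>b. 1 + l b \<partial>peak_law)"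
  proof (rule M.liminf_squeeze[where c=2])
    have i: "(\<integral>b. 1 + l b \<partial>peak_law) = 1 + (\<integral>b. l b \<partial>peak_law)" using il by (simp add: B.prob_space)
    have "(\<integral>b. l b \<partial>peak_law) \<le> (\<integral>b. 1 \<partial>peak_law)" "(\<integral>b. - 1 \<partial>peak_law) \<le> (\<integral>b. l b \<partial>peak_law)"
      by (intro integral_mono il; use lb in simp)+
    then show "0 \<le> (\<integral>b. 1 + l b \<partial>peak_law)" "(\<integral>b. 1 + l b \<partial>peak_law) \<le> 2" unfolding i by (simp_all add: B.prob_space)
    show "ennreal (\<integral>b. 1 + l b \<partial>peak_law) \<le> liminf (\<lambda>k. \<integral>\<^sup>+\<omega>. ennreal (1 + h (ln (ratio (\<tau> k) \<omega>))) \<partial>M)"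
      using one[of 1] by simp
    have "(\<integral>b. 1 * (1 + - 1 * l b) \<partial>peak_law) = 2 - (\<integral>b. 1 + l b \<partial>peak_law)" unfolding i using il by (simp add: B.prob_space)
    moreover have "2 - (1 + x) = 1 + - 1 * x" for x :: real by simp
    ultimately show "ennreal (2 - (\<integral>b. 1 + l b \<partial>peak_law)) \<le> liminf (\<lambda>k. \<integral>\<^sup>+\<omega>. ennreal (2 - (1 + h (ln (ratio (\<tau> k) \<omega>)))) \<partial>M)"
      using one[OF disjI2[OF refl]] by (simp only:)
  next
    fix k \<omega>
    show "0 \<le> 1 + h (ln (ratio (\<tau> k) \<omega>))" "1 + h (ln (ratio (\<tau> k) \<omega>)) \<le> 2" using hb[of "ln (ratio (\<tau> k) \<omega>)"] by auto
  qed measurable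
  then have "(\<lambda>k. 1 + (\<integral>\<omega>. h (ln (ratio (\<tau> k) \<omega>)) \<partial>M)) \<longlonglongrightarrow> 1 + (\<integral>b. l b \<partial>peak_law)"
    using ih il by (simp add: M.prob_space B.prob_space)
  from tendsto_diff[OF this tendsto_const[of 1]] show ?thesis by simp
qed

text \<open>Real and imaginary parts are treated separately, as \<open>trig_lim\<close> is about
  real functions; the sine has limit 0 since the asymmetry has a symmetric law.\<close>

lemma char_log_ratio_lim:
  assumes \<tau>: "filterlim \<tau> at_top sequentially" "\<And>k. 1 < \<tau> k"
  shows "(\<lambda>k. char (distr M borel (\<lambda>\<omega>. ln (ratio (\<tau> k) \<omega>))) \<theta>) \<longlonglongrightarrow> complex_of_real (limit_char \<theta>)"
proof -
  interpret B: prob_space peak_law by (rule prob_space_peak_law)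
  have [measurable]: "ratio (\<tau> k) \<in> borel_measurable M" for k using peak_measurable(2)[of "\<tau> k"] \<tau>(2)[of k] by simp
  have lip: "\<bar>cos (\<theta> * u) - cos (\<theta> * w)\<bar> \<le> \<bar>\<theta>\<bar> * \<bar>u - w\<bar>" "\<bar>sin (\<theta> * u) - sin (\<theta> * w)\<bar> \<le> \<bar>\<theta>\<bar> * \<bar>u - w\<bar>" for u w
    using cos_sin_lipschitz[of "\<theta> * u" "\<theta> * w"] by (simp_all add: right_diff_distrib[symmetric] abs_mult)
  have c: "(\<lambda>k. \<integral>\<omega>. cos (\<theta> * ln (ratio (\<tau> k) \<omega>)) \<partial>M) \<longlonglongrightarrow> limit_char \<theta>"
    unfolding limit_char_def
  proof (rule trig_lim[OF \<tau>, where h="\<lambda>u. cos (\<theta> * u)"])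
    show "\<bar>exp (- (\<beta> * gap_exponent \<theta> b))\<bar> \<le> 1" for b using \<beta> by (simp add: gap_exponent_def)
    show "(\<lambda>b. exp (- (\<beta> * gap_exponent \<theta> b))) \<in> borel_measurable borel" unfolding gap_exponent_def by measurable
    show "(\<lambda>k. \<integral>v. cos (\<theta> * mirror_sum \<kappa> (scale_a \<alpha> (\<tau> k) * y) (peak_site \<alpha> s (\<tau> k)) v) \<partial>P) \<longlonglongrightarrow> exp (- (\<beta> * gap_exponent \<theta> (s powr (1 / \<alpha>) / y)))"
      if "0 < \<kappa>" "\<kappa> < 1" "0 < s" "0 < y" for \<kappa> s y
      by (rule cos_mirror_sum_lim[OF that \<tau>(1)])
  qed (use lip in auto)
  have "(\<lambda>k. \<integral>\<omega>. sin (\<theta> * ln (ratio (\<tau> k) \<omega>)) \<partial>M) \<longlonglongrightarrow> (\<integral>b. 0 \<partial>peak_law)"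
    by (rule trig_lim[OF \<tau>, where h="\<lambda>u. sin (\<theta> * u)" and \<Lambda>="\<bar>\<theta>\<bar>"]) (use lip in \<open>auto simp: cos_mirror_sum\<close>)
  then have s: "(\<lambda>k. \<integral>\<omega>. sin (\<theta> * ln (ratio (\<tau> k) \<omega>)) \<partial>M) \<longlonglongrightarrow> 0" by simp
  have e: "char (distr M borel (\<lambda>\<omega>. ln (ratio (\<tau> k) \<omega>))) \<theta> = Complex (\<integral>\<omega>. cos (\<theta> * ln (ratio (\<tau> k) \<omega>)) \<partial>M) (\<integral>\<omega>. sin (\<theta> * ln (ratio (\<tau> k) \<omega>)) \<partial>M)" for k
  proof -
    have i: "integrable M (\<lambda>\<omega>. iexp (\<theta> * ln (ratio (\<tau> k) \<omega>)))"
      by (rule M.integrable_const_bound[where B=1]) auto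
    have ce: "char (distr M borel (\<lambda>\<omega>. ln (ratio (\<tau> k) \<omega>))) \<theta> = (\<integral>\<omega>. iexp (\<theta> * ln (ratio (\<tau> k) \<omega>)) \<partial>M)"
      unfolding char_def by (subst integral_distr) auto
    have "Re (iexp u) = cos u" "Im (iexp u) = sin u" for u by (simp_all add: Re_exp Im_exp)
    then show ?thesis unfolding ce using integral_Re[OF i] integral_Im[OF i] by (intro complex_eqI) (simp_all only: complex.sel)
  qed
  show ?thesis
    unfolding tendsto_complex_iff e using c s by simp
qed

abbreviation joint_law :: "(real \<times> real) measure" where
  "joint_law \<equiv> peak_law \<Otimes>\<^sub>M density lborel std_normal_density"

definition ln_limit_law :: "real measure" where
  "ln_limit_law = distr joint_law borel (\<lambda>(b, n). sqrt (2 * \<beta>) * sigma \<alpha> * b * n)"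

lemma ln_limit_law_measurable [measurable]:
  "(\<lambda>(b, n). sqrt (2 * \<beta>) * sigma \<alpha> * b * n) \<in> borel_measurable joint_law"
proof -
  have "sets joint_law = sets (borel \<Otimes>\<^sub>M borel :: (real \<times> real) measure)"
    by (intro sets_pair_measure_cong) auto
  moreover have "(\<lambda>(b, n). sqrt (2 * \<beta>) * sigma \<alpha> * b * n) \<in> borel_measurable (borel \<Otimes>\<^sub>M borel)" by measurable
  ultimately show ?thesis using measurable_cong_sets by blast
qed

lemma real_distribution_ln_limit_law: "real_distribution ln_limit_law"
proof -
  interpret B: prob_space peak_law by (rule prob_space_peak_law)
  interpret N: prob_space "density lborel std_normal_density" by (rule prob_space_normal_density) simp
  interpret Q: pair_prob_space peak_law "density lborel std_normal_density" ..
  show ?thesis unfolding ln_limit_law_def by (rule Q.real_distribution_distr[OF ln_limit_law_measurable])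
qed

text \<open>Given \<open>b\<close> the law is centred normal with standard deviation
  \<open>sqrt (2 * \<beta>) * sigma \<alpha> * b\<close>; Fubini leaves the integral over
  \<open>b\<close> of its characteristic function.\<close>

lemma char_ln_limit_law: "char ln_limit_law \<theta> = complex_of_real (limit_char \<theta>)"
proof -
  interpret B: prob_space peak_law by (rule prob_space_peak_law)
  interpret N: prob_space "density lborel std_normal_density" by (rule prob_space_normal_density) simp
  interpret Q: pair_prob_space peak_law "density lborel std_normal_density" ..
  define c where "c = sqrt (2 * \<beta>) * sigma \<alpha>"
  have m: "(\<lambda>(b, n). c * b * n) \<in> borel_measurable joint_law"
    unfolding c_def by (rule ln_limit_law_measurable)
  have "char ln_limit_law \<theta> = (\<integral>w. iexp (\<theta> * (case w of (b, n) \<Rightarrow> c * b * n)) \<partial>joint_law)"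
    unfolding char_def ln_limit_law_def c_def by (rule integral_distr[OF ln_limit_law_measurable]) measurable
  also have "\<dots> = (\<integral>b. \<integral>n. iexp (\<theta> * (case (b, n) of (b, n) \<Rightarrow> c * b * n)) \<partial>density lborel std_normal_density \<partial>peak_law)"
  proof (rule Q.integral_fst'[symmetric])
    show "integrable joint_law (\<lambda>w. iexp (\<theta> * (case w of (b, n) \<Rightarrow> c * b * n)))"
      by (rule Q.integrable_const_bound[where B=1]) (use m in auto)
  qed
  also have "\<dots> = (\<integral>b. char (density lborel std_normal_density) (\<theta> * c * b) \<partial>peak_law)"
    by (simp add: char_def mult_ac)
  also have "\<dots> = (\<integral>b. complex_of_real (exp (- (\<beta> * gap_exponent \<theta> b))) \<partial>peak_law)"
  proof (rule Bochner_Integration.integral_cong)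
    fix b
    have "(\<theta> * c * b)\<^sup>2 / 2 = \<beta> * gap_exponent \<theta> b"
      using \<beta> by (simp add: c_def gap_exponent_def power_mult_distrib)
    then show "char (density lborel std_normal_density) (\<theta> * c * b) = complex_of_real (exp (- (\<beta> * gap_exponent \<theta> b)))"
      by (simp add: char_std_normal_distribution)
  qed simp
  also have "\<dots> = complex_of_real (limit_char \<theta>)" unfolding limit_char_def by (rule integral_complex_of_real)
  finally show ?thesis .
qed

text \<open>Levy's continuity theorem applies to the logarithm of the ratio. Exponentiating returns
  the ratio only where it is positive, and the exceptional event has vanishing probability.\<close>

lemma ratio_lim:
  fixes f :: "real \<Rightarrow> real"
  assumes \<tau>: "filterlim \<tau> at_top sequentially" "\<And>k. 1 < \<tau> k"
    and f: "continuous_on UNIV f" "\<And>x. \<bar>f x\<bar> \<le> C"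
  shows "(\<lambda>k. \<integral>\<omega>. f (ratio (\<tau> k) \<omega>) \<partial>M) \<longlonglongrightarrow> (\<integral>x. f (exp x) \<partial>ln_limit_law)"
proof -
  have fm [measurable]: "f \<in> borel_measurable borel" using f(1) by (rule borel_measurable_continuous_onI)
  have [measurable]: "ratio (\<tau> k) \<in> borel_measurable M" for k using peak_measurable(2)[of "\<tau> k"] \<tau>(2)[of k] by simp
  have [measurable]: "Measurable.pred M (positive (\<tau> k))" for k using peak_measurable(3)[of "\<tau> k"] \<tau>(2)[of k] by simp
  have C: "0 \<le> C" using f(2)[of 0] by linarith
  have rd: "real_distribution (distr M borel (\<lambda>\<omega>. ln (ratio (\<tau> k) \<omega>)))" for k
    by (rule M.real_distribution_distr) measurable
  have wc: "weak_conv_m (\<lambda>k. distr M borel (\<lambda>\<omega>. ln (ratio (\<tau> k) \<omega>))) ln_limit_law"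
    by (rule levy_continuity[OF rd real_distribution_ln_limit_law]) (simp only: char_ln_limit_law char_log_ratio_lim[OF \<tau>])
  have cont: "isCont (\<lambda>x. f (exp x)) x" for x
    using f(1) by (intro isCont_o2[OF isCont_exp]) (simp add: continuous_on_eq_continuous_at)
  have "(\<lambda>k. \<integral>x. f (exp x) \<partial>distr M borel (\<lambda>\<omega>. ln (ratio (\<tau> k) \<omega>))) \<longlonglongrightarrow> (\<integral>x. f (exp x) \<partial>ln_limit_law)"
    by (rule weak_conv_imp_integral_bdd_continuous_conv[OF rd real_distribution_ln_limit_law wc cont, where B=C]) (use f in auto)
  moreover have "(\<integral>x. f (exp x) \<partial>distr M borel (\<lambda>\<omega>. ln (ratio (\<tau> k) \<omega>))) = (\<integral>\<omega>. f (exp (ln (ratio (\<tau> k) \<omega>))) \<partial>M)" for k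
    by (rule integral_distr) measurable
  ultimately have main: "(\<lambda>k. \<integral>\<omega>. f (exp (ln (ratio (\<tau> k) \<omega>))) \<partial>M) \<longlonglongrightarrow> (\<integral>x. f (exp x) \<partial>ln_limit_law)" by simp
  have "(\<lambda>k. (\<integral>\<omega>. f (ratio (\<tau> k) \<omega>) \<partial>M) - (\<integral>\<omega>. f (exp (ln (ratio (\<tau> k) \<omega>))) \<partial>M)) \<longlonglongrightarrow> 0"
  proof (rule Lim_null_comparison)
    have "(\<lambda>k. 2 * C * M.prob {\<omega>\<in>space M. \<not> positive (\<tau> k) \<omega>}) \<longlonglongrightarrow> 2 * C * 0" by (intro tendsto_intros positive_lim \<tau>)
    then show "(\<lambda>k. 2 * C * M.prob {\<omega>\<in>space M. \<not> positive (\<tau> k) \<omega>}) \<longlonglongrightarrow> 0" by simp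
    show "eventually (\<lambda>k. norm ((\<integral>\<omega>. f (ratio (\<tau> k) \<omega>) \<partial>M) - (\<integral>\<omega>. f (exp (ln (ratio (\<tau> k) \<omega>))) \<partial>M)) \<le> 2 * C * M.prob {\<omega>\<in>space M. \<not> positive (\<tau> k) \<omega>}) sequentially"
    proof (intro always_eventually allI)
      fix k
      have i: "integrable M (\<lambda>\<omega>. f (ratio (\<tau> k) \<omega>))" "integrable M (\<lambda>\<omega>. f (exp (ln (ratio (\<tau> k) \<omega>))))"
        by (rule M.integrable_const_bound[where B=C]; use f in auto)+
      have "\<bar>\<integral>\<omega>. f (ratio (\<tau> k) \<omega>) - f (exp (ln (ratio (\<tau> k) \<omega>))) \<partial>M\<bar> \<le> (\<integral>\<omega>. \<bar>f (ratio (\<tau> k) \<omega>) - f (exp (ln (ratio (\<tau> k) \<omega>)))\<bar> \<partial>M)"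
        by (rule integral_abs_bound)
      also have "\<dots> \<le> (\<integral>\<omega>. 2 * C * indicator {\<omega>\<in>space M. \<not> positive (\<tau> k) \<omega>} \<omega> \<partial>M)"
      proof (rule integral_mono)
        fix \<omega> assume \<omega>: "\<omega> \<in> space M"
        show "\<bar>f (ratio (\<tau> k) \<omega>) - f (exp (ln (ratio (\<tau> k) \<omega>)))\<bar> \<le> 2 * C * indicator {\<omega>\<in>space M. \<not> positive (\<tau> k) \<omega>} \<omega>"
        proof (cases "positive (\<tau> k) \<omega>")
          case True
          then have "0 < ratio (\<tau> k) \<omega>" by (simp add: positive_def ratio_def)
          then show ?thesis using C by simp
        next
          case False
          then show ?thesis using f(2)[of "ratio (\<tau> k) \<omega>"] f(2)[of "exp (ln (ratio (\<tau> k) \<omega>))"] \<omega> by (simp only: abs_le_iff) simp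
        qed
      qed (use i in \<open>auto intro!: integrable_mult_right M.integrable_const_bound[where B=1]\<close>)
      also have "\<dots> = 2 * C * M.prob {\<omega>\<in>space M. \<not> positive (\<tau> k) \<omega>}" by simp
      finally show "norm ((\<integral>\<omega>. f (ratio (\<tau> k) \<omega>) \<partial>M) - (\<integral>\<omega>. f (exp (ln (ratio (\<tau> k) \<omega>))) \<partial>M)) \<le> 2 * C * M.prob {\<omega>\<in>space M. \<not> positive (\<tau> k) \<omega>}"
        using i by simp
    qed
  qed
  from tendsto_add[OF this main] show ?thesis by simp
qed

lemma weak_limits:
  "weak_conv_at_top (\<lambda>t. distr M borel (scaled_peak t)) peak_law"
  "weak_conv_at_top (\<lambda>t. distr M borel (ratio t))
     (distr joint_law borel (\<lambda>(b, n). exp (sqrt (2 * \<beta>) * sigma \<alpha> * b * n)))"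
proof -
  have bd: "\<exists>C. \<forall>x. \<bar>f x\<bar> \<le> C" if "bounded (range f)" for f :: "real \<Rightarrow> real"
    using that by (auto simp: bounded_iff)
  show "weak_conv_at_top (\<lambda>t. distr M borel (scaled_peak t)) peak_law"
    unfolding weak_conv_at_top_def
  proof (intro allI impI)
    fix f :: "real \<Rightarrow> real" assume f: "continuous_on UNIV f \<and> bounded (range f)"
    then obtain C where C: "\<And>x. \<bar>f x\<bar> \<le> C" using bd by blast
    show "((\<lambda>t. \<integral>x. f x \<partial>distr M borel (scaled_peak t)) \<longlongrightarrow> (\<integral>x. f x \<partial>peak_law)) at_top"
    proof (rule tendsto_at_top_sequences_gt_1)
      fix \<tau> :: "nat \<Rightarrow> real" assume \<tau>: "filterlim \<tau> at_top sequentially" "\<And>k. 1 < \<tau> k"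
      have "(\<integral>x. f x \<partial>distr M borel (scaled_peak (\<tau> k))) = (\<integral>\<omega>. f (scaled_peak (\<tau> k) \<omega>) \<partial>M)" for k
        using f \<tau>(2)[of k] by (intro integral_distr peak_measurable borel_measurable_continuous_onI) auto
      then show "(\<lambda>k. \<integral>x. f x \<partial>distr M borel (scaled_peak (\<tau> k))) \<longlonglongrightarrow> (\<integral>x. f x \<partial>peak_law)"
        using scaled_peak_lim[OF \<tau> conjunct1[OF f] C] by simp
    qed
  qed
  show "weak_conv_at_top (\<lambda>t. distr M borel (ratio t))
     (distr joint_law borel (\<lambda>(b, n). exp (sqrt (2 * \<beta>) * sigma \<alpha> * b * n)))"
    unfolding weak_conv_at_top_def
  proof (intro allI impI)
    fix f :: "real \<Rightarrow> real" assume f: "continuous_on UNIV f \<and> bounded (range f)"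
    then obtain C where C: "\<And>x. \<bar>f x\<bar> \<le> C" using bd by blast
    have fm [measurable]: "f \<in> borel_measurable borel" using f by (intro borel_measurable_continuous_onI) auto
    have lim: "(\<integral>x. f x \<partial>distr joint_law borel (\<lambda>(b, n). exp (sqrt (2 * \<beta>) * sigma \<alpha> * b * n)))
      = (\<integral>x. f (exp x) \<partial>ln_limit_law)"
    proof -
      have "distr joint_law borel (\<lambda>(b, n). exp (sqrt (2 * \<beta>) * sigma \<alpha> * b * n)) = distr ln_limit_law borel exp"
        unfolding ln_limit_law_def by (subst distr_distr) (auto intro!: distr_cong)
      then show ?thesis by (simp add: integral_distr ln_limit_law_def)
    qed
    show "((\<lambda>t. \<integral>x. f x \<partial>distr M borel (ratio t)) \<longlongrightarrow>
      (\<integral>x. f x \<partial>distr joint_law borel (\<lambda>(b, n). exp (sqrt (2 * \<beta>) * sigma \<alpha> * b * n)))) at_top"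
      unfolding lim
    proof (rule tendsto_at_top_sequences_gt_1)
      fix \<tau> :: "nat \<Rightarrow> real" assume \<tau>: "filterlim \<tau> at_top sequentially" "\<And>k. 1 < \<tau> k"
      have "(\<integral>x. f x \<partial>distr M borel (ratio (\<tau> k))) = (\<integral>\<omega>. f (ratio (\<tau> k) \<omega>) \<partial>M)" for k
        using \<tau>(2)[of k] by (intro integral_distr peak_measurable fm) auto
      then show "(\<lambda>k. \<integral>x. f x \<partial>distr M borel (ratio (\<tau> k))) \<longlonglongrightarrow> (\<integral>x. f (exp x) \<partial>ln_limit_law)"
        using ratio_lim[OF \<tau> conjunct1[OF f] C] by simp
    qed
  qed
qed

end

section \<open>Identification of the model with the product space\<close>

theorem theorem1p4:
  fixes M :: "'a measure"
    and \<alpha> \<beta> :: real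
    and p :: "nat \<Rightarrow> real"
    and xi0 :: "int \<Rightarrow> 'a \<Rightarrow> real"
    and coin :: "nat \<Rightarrow> 'a \<Rightarrow> bool"
    and Z :: "real \<Rightarrow> 'a \<Rightarrow> nat"
  assumes "prob_space M"
    and alpha: "\<alpha> \<ge> 2"
    and p_range: "\<forall>n. 0 \<le> p n \<and> p n \<le> 1"
    and p_mono: "\<exists>N. mono_on {N..} p"
    and p_lim: "p \<longlonglongrightarrow> 1"
    and indep: "prob_space.indep_vars M (\<lambda>_. borel)
        (\<lambda>i \<omega>. case i of Inl z \<Rightarrow> xi0 z \<omega> | Inr n \<Rightarrow> of_bool (coin n \<omega>))
        (range Inl \<union> Inr ` {1..})"
    and pareto: "\<forall>z x. x \<ge> 1 \<longrightarrow> measure M {\<omega> \<in> space M. xi0 z \<omega> > x} = x powr (- \<alpha>)"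
    and coin_prob: "\<forall>n\<ge>1. measure M {\<omega> \<in> space M. coin n \<omega>} = p n"
    and Z_meas: "\<forall>t>0. Z t \<in> M \<rightarrow>\<^sub>M count_space UNIV"
    and Z_max: "\<forall>t>0. AE \<omega> in M.
        Z t \<omega> \<in> Dset (potential xi0 coin \<omega>) \<and>
        (\<forall>z\<in>Dset (potential xi0 coin \<omega>).
           Psi (potential xi0 coin \<omega>) t z \<le> Psi (potential xi0 coin \<omega>) t (Z t \<omega>))"
    and beta: "\<beta> > 0"
    and eta_asymp: "(\<lambda>n. eta p n) \<sim>[at_top] (\<lambda>n. \<beta> * kappa \<alpha> n)"
  shows "\<exists>\<mu>B :: real measure. prob_space \<mu>B \<and> sets \<mu>B = sets borel \<and>
    (AE b in \<mu>B. 0 < b) \<and>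
    weak_conv_at_top
      (\<lambda>t. distr M borel (\<lambda>\<omega>. real (Z t \<omega>) powr (1 / \<alpha>) / potential xi0 coin \<omega> (int (Z t \<omega>))))
      \<mu>B \<and>
    weak_conv_at_top
      (\<lambda>t. distr M borel (\<lambda>\<omega>. pam_u (potential xi0 coin \<omega>) t (int (Z t \<omega>))
                              / pam_u (potential xi0 coin \<omega>) t (- int (Z t \<omega>))))
      (distr (\<mu>B \<Otimes>\<^sub>M density lborel std_normal_density) borel
         (\<lambda>(b, n). exp (sqrt (2 * \<beta>) * sigma \<alpha> * b * n)))"
proof -
  interpret M: prob_space M by fact
  define J :: "(int + nat) set" where "J = range Inl \<union> Inr ` {1..}"
  define X where "X i \<omega> = (case i of Inl z \<Rightarrow> xi0 z \<omega> | Inr n \<Rightarrow> of_bool (coin n \<omega>))" for i \<omega>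
  \<comment> \<open>The one index outside \<open>J\<close>, \<open>Inr 0\<close>, gets the point
    mass at 0, so that every \<open>\<mu> i\<close> is a probability measure.\<close>
  define \<mu> where "\<mu> i = distr M borel (if i \<in> J then X i else (\<lambda>_. 0))" for i
  \<comment> \<open>The restriction makes \<open>V \<omega>\<close> extensional, as points of the
    product space are.\<close>
  define V where "V \<omega> = (\<lambda>i\<in>J. X i \<omega>)" for \<omega>
  have ind: "M.indep_vars (\<lambda>_. borel) X J" using indep unfolding X_def[abs_def] J_def .
  have X [measurable]: "X i \<in> borel_measurable M" if "i \<in> J" for i using ind that by (auto simp: M.indep_vars_def)
  have J: "Inl z \<in> J" "1 \<le> n \<Longrightarrow> Inr n \<in> J" for z n by (auto simp: J_def)
  have \<mu>J: "\<mu> i = distr M borel (X i)" if "i \<in> J" for i using that by (simp add: \<mu>_def)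
  have pe: "pareto_env \<alpha> \<beta> p \<mu>"
  proof (rule pareto_env.intro)
    show "prob_space (\<mu> i)" for i unfolding \<mu>_def by (rule M.prob_space_distr) auto
    show "measure (\<mu> (Inl z)) {x<..} = x powr (- \<alpha>)" if "1 \<le> x" for z x
    proof -
      have "measure (\<mu> (Inl z)) {x<..} = M.prob (X (Inl z) -` {x<..} \<inter> space M)"
        unfolding \<mu>J[OF J(1)] by (rule measure_distr[OF X[OF J(1)]]) simp
      also have "X (Inl z) -` {x<..} \<inter> space M = {\<omega> \<in> space M. xi0 z \<omega> > x}" by (auto simp: X_def)
      finally show ?thesis using pareto that by simp
    qed
    show "measure (\<mu> (Inr n)) {1} = p n" if "1 \<le> n" for n
    proof -
      have "measure (\<mu> (Inr n)) {1} = M.prob (X (Inr n) -` {1} \<inter> space M)"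
        unfolding \<mu>J[OF J(2)[OF that]] by (rule measure_distr[OF X[OF J(2)[OF that]]]) simp
      also have "X (Inr n) -` {1} \<inter> space M = {\<omega> \<in> space M. coin n \<omega>}" by (auto simp: X_def)
      finally show ?thesis using coin_prob that by simp
    qed
  qed (use alpha p_range p_lim eta_asymp beta in \<open>auto simp: \<mu>_def\<close>)
  interpret pareto_env \<alpha> \<beta> p \<mu> by (rule pe)
  have IJ: "I = J" by (simp add: I_def J_def)
  have pot_eq: "potv (V \<omega>) = potential xi0 coin \<omega>" for \<omega>
  proof
    fix z
    have "1 \<le> nat (- z)" if "\<not> 0 \<le> z" using that by simp
    then show "potv (V \<omega>) z = potential xi0 coin \<omega> z"
      using J by (auto simp: potv_def potential_def V_def X_def)
  qed
  have V: "V \<in> measurable M P"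
  proof -
    have "V \<in> measurable M (PiM J (\<lambda>_. borel))" unfolding V_def[abs_def] by (intro measurable_restrict X)
    then show ?thesis using measurable_cong_sets[OF refl sets_P] unfolding IJ by blast
  qed
  \<comment> \<open>Independence of the values and coins is the statement that their joint law is
    the product measure.\<close>
  have "distr M P V = distr M (PiM J (\<lambda>_. borel)) V" by (rule distr_cong) (auto simp: sets_P IJ)
  also have "\<dots> = PiM J (\<lambda>i. distr M borel (X i))"
    unfolding V_def[abs_def] using ind by (subst (asm) M.indep_vars_iff_distr_eq_PiM') (auto simp: J_def intro: X[unfolded J_def])
  also have "\<dots> = P" unfolding P_def IJ by (intro PiM_cong) (auto simp: \<mu>J)
  finally have dV: "distr M P V = P" .
  interpret env_coupling \<alpha> \<beta> p \<mu> M V Z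
  proof (intro env_coupling.intro env_coupling_axioms.intro pe)
    show "AE \<omega> in M. \<forall>n. wins (potv (V \<omega>)) t n \<longrightarrow> Z t \<omega> = n" if "0 < t" for t
      using Z_max[rule_format, OF that]
    proof eventually_elim
      case (elim \<omega>)
      show ?case
      proof (intro allI impI)
        fix n assume w: "wins (potv (V \<omega>)) t n"
        \<comment> \<open>A winner is a mirrored site, so the maximality of
          \<open>Z t \<omega>\<close> applies to it; its own strict maximality over all sites then
          leaves \<open>Z t \<omega> = n\<close>.\<close>
        then have "Psi (potential xi0 coin \<omega>) t n \<le> Psi (potential xi0 coin \<omega>) t (Z t \<omega>)"
          using elim by (auto simp: wins_def Dset_def pot_eq)
        then show "Z t \<omega> = n" using w by (auto simp: wins_def pot_eq not_less[symmetric])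
      qed
    qed
  qed (use V dV Z_meas M.prob_space_axioms in auto)
  have pe: "pot \<omega> = potential xi0 coin \<omega>" for \<omega> by (simp add: pot_def pot_eq)
  have e: "scaled_peak = (\<lambda>t \<omega>. real (Z t \<omega>) powr (1 / \<alpha>) / potential xi0 coin \<omega> (int (Z t \<omega>)))"
    "ratio = (\<lambda>t \<omega>. pam_u (potential xi0 coin \<omega>) t (int (Z t \<omega>)) / pam_u (potential xi0 coin \<omega>) t (- int (Z t \<omega>)))"
    unfolding fun_eq_iff scaled_peak_def ratio_def pe by simp_all
  show ?thesis
    by (intro exI[of _ peak_law] conjI prob_space_peak_law sets_peak_law AE_peak_law_pos weak_limits[unfolded e])
qed

end
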